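(* Assume the standing setting of the context. Let $1\le m\le n$, let $\gamma$ be a contraction of $\{1,\dots,n\}$ with $m$ components, $\sigma$ an ordering of its components, $F:\mathcal{D}_\varepsilon^n\to\mathbb{R}$ $\mathscr{C}^1$ in each time variable, and $\mathtt{L}:\{1,\dots,m\}\to\{\triangledown,\diamond,\mathtt{nil}\}$ a labeling with $\mathtt{L}(i)=\mathtt{nil}$ whenever $|\gamma_i|$ is odd. Let $\Gamma(\gamma)=\Gamma_1(\gamma)\cup\mathtt{L}^{-1}(\diamond)$. Then for every $p\ge2$ and $T\in[0,1]$ there exist constants $\kappa_{\gamma,i}(\mathbf{p})>0$ (not depending on $\varepsilon,T,F$) and $C$ depending on $p$ (not on $\varepsilon,T,F$) such that $$\mathbb{E}_p\Big[\sup_{t\in[0,T]}\big|(\mathcal{I}^{\varepsilon,\mathtt{L}}_{\gamma,\sigma}F)_t\big|\Big]\le C\!\!\sum_{\substack{\mathbf{p}\in\mathscr{P}_m:\ \mathbf{p}^{-1}(1)\cap\Gamma(\gamma)=\emptyset,\\ \mathtt{L}^{-1}(\triangledown)\subset\mathbf{p}^{-1}(1)}}\!\!\varepsilon^{\alpha_\gamma(\mathbf{p})}\|F^{\gamma,\sigma}\|_{L^{\mathbf{p}}_\varepsilon}^{\beta_{\gamma,p}(\mathbf{p})}\Bigg(\prod_{\substack{i\in\mathbf{p}^{-1}(\infty)\setminus\Gamma_1(\gamma):\\ i\ge2}}\varepsilon^{-\kappa_{\gamma,i}(\mathbf{p})}\|F^{\gamma,\sigma}\|_{\mathscr{C}^1_{s_i}(L^\infty_\varepsilon)}^{\beta^{(i)}_{\gamma,p}(\mathbf{p})}\Bigg)^{1/p},$$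 where $\alpha_\gamma(\mathbf{p})=(d+\mathbf{k})\big(\sum_{i=1}^m|\gamma_i|-2|\mathbf{p}^{-1}(1)|-|\mathbf{p}^{-1}(2)|\big)$, $\beta_{\gamma,p}(\mathbf{p})=\big(\frac{p-1}{p}\big)^{\#\{i\in\mathbf{p}^{-1}(\infty)\setminus\Gamma_1(\gamma):\,i\ge2\}}$ and $\beta^{(i)}_{\gamma,p}(\mathbf{p})=\big(\frac{p-1}{p}\big)^{\#\{j\in\mathbf{p}^{-1}(\infty)\setminus\Gamma_1(\gamma):\,j\ge i+1\}}$.
   Context: Standing setting. Fix $d\in\mathbb{N}$, $\varepsilon\in(0,1]$ with $\varepsilon^{-1}\in\mathbb{N}$; $\Lambda_\varepsilon=(\varepsilon\mathbb{Z}/\mathbb{Z})^d$, $\mathcal{D}_\varepsilon=[0,\infty)\times\Lambda_\varepsilon$, $\mathcal{D}_{\varepsilon,t}=[0,t)\times\Lambda_\varepsilon$. On a filtered probability space with the usual conditions, $(\mathbb{M}_\varepsilon(t,x))_{t\ge0}$, $x\in\Lambda_\varepsilon$, are càdlàg square-integrable martingales, $\Delta_t\mathbb{M}_\varepsilon(x)=\mathbb{M}_\varepsilon(t,x)-\mathbb{M}_\varepsilon(t-,x)$, with non-random constants independent of $\varepsilon,s,t,x$: (A1) $\langle\mathbb{M}_\varepsilon(x),\mathbb{M}_\varepsilon(y)\rangle=0$ for $x\ne y$, $\langle\mathbb{M}_\varepsilon(x)\rangle_t=\varepsilon^{-d}\int_0^t\mathcal{C}_\varepsilon(s,x)ds$,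 $\mathcal{C}_\varepsilon$ progressively measurable, $|\mathcal{C}_\varepsilon|\le C$ a.s.; (A2) for every $T>0$, a.s. no two distinct $\mathbb{M}_\varepsilon(x),\mathbb{M}_\varepsilon(y)$ jump simultaneously in $[0,T]$; (A3) there are $\mathbf{k}>-d/2$, $c>0$ with a.s. $|\Delta_t\mathbb{M}_\varepsilon(x)|=c\varepsilon^{\mathbf{k}}$ whenever nonzero; (A4) $\mathbb{M}_\varepsilon(t,x)=\sum_{0\le s\le t}\Delta_s\mathbb{M}_\varepsilon(x)-\varepsilon^{-\mathbf{k}-d}\int_0^t\mathtt{C}_\varepsilon(s,x)ds$, $\mathtt{C}_\varepsilon$ progressively measurable, $|\mathtt{C}_\varepsilon|\le C$ a.s. $\mathbb{E}_pX=\mathbb{E}[|X|^p]^{1/p}$. Let $\overline{\mathbb{M}}_\varepsilon(t,x)=\varepsilon^{-\mathbf{k}}([\mathbb{M}_\varepsilon(x)]_t-\langle\mathbb{M}_\varepsilon(x)\rangle_t)$ ($[\cdot]$ the quadratic variation). Integrals. $\int F\,d\mathbf{M}_\varepsilon=\sum_x\varepsilon^d\int_0^\infty F(s,x)d\mathbb{M}_\varepsilon(s,x)$, similarly $\int F\,d\overline{\mathbf{M}}_\varepsilon$ with $\overline{\mathbb{M}}_\varepsilon$; $\int_{\mathcal{D}_{\varepsilon,t}}H(z)\,dz=\sum_x\varepsilon^d\int_0^tH(s,x)ds$; $\mathbf{M}^{(1)}_\varepsilon=\mathbf{M}_\varepsilon$ and, for $j\ge2$, $\int F\,d\mathbf{M}^{(j)}_\varepsilon=\sum_x\varepsilon^{jd}\sum_{s\ge0}F(s,x)(\Delta_s\mathbb{M}_\varepsilon(x))^j$;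 $\mathbf{M}_\varepsilon^{\otimes n}$ is the product measure. A contraction $\gamma$ is an equivalence relation on $\{1,\dots,n\}$ with classes (components); an ordering $\sigma$ is a bijection from $\{1,\dots,m\}$ to the components, and $\gamma_j:=\sigma(j)$. $\mathcal{D}_\gamma$: points of $\mathcal{D}_\varepsilon^n$ with $z_i=z_j$ iff $i,j$ in the same component, minus points having two coordinates with equal times and different spatial positions; $\mathcal{D}_{\gamma,\sigma}$: those $((s_1,x_1),\dots,(s_n,x_n))\in\mathcal{D}_\gamma$ with $s_i<s_j$ whenever the component of $i$ precedes that of $j$. $(\mathcal{I}^\varepsilon_{\gamma,\sigma}F)_t=\int_{\mathcal{D}_{\gamma,\sigma}\cap\mathcal{D}^n_{\varepsilon,t}}F\,d\mathbf{M}_\varepsilon^{\otimes n}$. $F^{\gamma,\sigma}(z_1,\dots,z_m)=F(\bar z)$ with $\bar z_i=z_j$ for $i\in\gamma_j$, $z_j=(s_j,x_j)$. $\Gamma_1(\gamma)=\{i:|\gamma_i|=1\}$. Labelled integrals. For $m=1$ (so $|\gamma_1|=n$): $(\mathcal{I}^{\varepsilon,\mathtt{L}}_{\gamma,\sigma}F)_t$ equals $\varepsilon^{(d+\mathbf{k})(n-2)}\int_{\mathcal{D}_{\varepsilon,t}}F^{\gamma,\sigma}(z)\mathcal{C}_\varepsilon(z)dz$ if $\mathtt{L}(1)=\triangledown$, $\varepsilon^{(d+\mathbf{k})(n-1)}\int_{\mathcal{D}_{\varepsilon,t}}F^{\gamma,\sigma}\,d\overline{\mathbf{M}}_\varepsilon$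 if $\mathtt{L}(1)=\diamond$, and $(\mathcal{I}^\varepsilon_{\gamma,\sigma}F)_t$ if $\mathtt{L}(1)=\mathtt{nil}$. For $m\ge2$, let $\bar\gamma$ be $\gamma$ with $\gamma_m$ removed, $\bar\sigma$ and $\bar{\mathtt{L}}$ the restrictions to $\{1,\dots,m-1\}$, and $F^{(z_m)}$ the function obtained from $F$ by setting all variables with index in $\gamma_m$ equal to $z_m$; with $J(z_m)=(\mathcal{I}^{\varepsilon,\bar{\mathtt{L}}}_{\bar\gamma,\bar\sigma}F^{(z_m)})_{s_m-}$, set $(\mathcal{I}^{\varepsilon,\mathtt{L}}_{\gamma,\sigma}F)_t$ equal to $\varepsilon^{(d+\mathbf{k})(|\gamma_m|-2)}\int_{\mathcal{D}_{\varepsilon,t}}J(z_m)\mathcal{C}_\varepsilon(z_m)dz_m$ if $\mathtt{L}(m)=\triangledown$, $\varepsilon^{(d+\mathbf{k})(|\gamma_m|-1)}\int_{\mathcal{D}_{\varepsilon,t}}J(z_m)\,d\overline{\mathbf{M}}_\varepsilon(z_m)$ if $\mathtt{L}(m)=\diamond$, and $\int_{\mathcal{D}_{\varepsilon,t}}J(z_m)\,d\mathbf{M}^{(|\gamma_m|)}_\varepsilon(z_m)$ if $\mathtt{L}(m)=\mathtt{nil}$. $\mathtt{L}^{-1}(a)=\{i:\mathtt{L}(i)=a\}$. Norms. For $H$ on $[0,T]\times\Lambda_\varepsilon$, $\|H\|_{L^q_\varepsilon}=(\varepsilon^d\sum_x\int_0^T|H|^q)^{1/q}$ ($q=1,2$),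 $\|H\|_{L^\infty_\varepsilon}=\sup_{[0,T]\times\Lambda_\varepsilon}|H|$. $\mathscr{P}_m$: functions $\mathbf{p}:\{1,\dots,m\}\to\{1,2,\infty\}$. For $m=1$, $\|H\|_{L^{\mathbf{p}}_\varepsilon}=\|H\|_{L^{\mathbf{p}(1)}_\varepsilon}$; for $m\ge2$, $\|H\|_{L^{\mathbf{p}}_\varepsilon}=\|z_m\mapsto\|H(\cdot,z_m)\mathbb{1}_{s_m>s_{m-1}}\|_{L^{\mathbf{p}|_{\{1,\dots,m-1\}}}_\varepsilon}\|_{L^{\mathbf{p}(m)}_\varepsilon}$. $\|H\|_{\mathscr{C}^1_{s_i}(L^\infty_\varepsilon)}=\sup|H|+\sup|\partial_{s_i}H|$, suprema over all arguments with times in $[0,T]$. *)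

theory Defs
  imports "HOL-Probability.Probability"
begin

definition eps :: "nat \<Rightarrow> real" where
  "eps N = 1 / real N"

(* sites of Lambda_eps = (eps Z / Z)^d, encoded x = (x_0,...,x_{d-1}) with 0 <= x_i < N,
   meaning the point eps*x; coordinates >= d are 0 *)
type_synonym site = "nat \<Rightarrow> nat"
type_synonym point = "real \<times> site"     (* z = (s, x) in D_eps = [0,oo) x Lambda_eps *)
type_synonym tuple = "nat \<Rightarrow> point"   (* (z_1, ..., z_n), indices 1..n are relevant *)

definition Lam :: "nat \<Rightarrow> nat \<Rightarrow> site set" where
  "Lam N d = {x. (\<forall>i<d. x i < N) \<and> (\<forall>i\<ge>d. x i = 0)}"

definition base0 :: point where "base0 = (0, (\<lambda>_. 0))"

(* ---------- jumps of a path (convention X_{0-} = X_0) ---------- *)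

definition jump :: "(real \<Rightarrow> real) \<Rightarrow> real \<Rightarrow> real" where
  "jump f s = (if s \<le> 0 then 0 else f s - Lim (at_left s) f)"

definition jumps_in :: "(real \<Rightarrow> real) \<Rightarrow> real set \<Rightarrow> real set" where
  "jumps_in f A = {s \<in> A. jump f s \<noteq> 0}"

definition cadlag :: "(real \<Rightarrow> real) \<Rightarrow> bool" where
  "cadlag f \<longleftrightarrow> (\<forall>t\<ge>0. continuous (at t within {t..}) f \<and>
                         (t > 0 \<longrightarrow> (\<exists>l. (f \<longlongrightarrow> l) (at_left t))))"

definition usual_filtration :: "'a measure \<Rightarrow> (real \<Rightarrow> 'a measure) \<Rightarrow> bool" where
  "usual_filtration P Fl \<longleftrightarrow>
     filtration (space P) Fl \<and> (\<forall>t. subalgebra P (Fl t)) \<and>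
     (\<forall>t\<ge>0. sets (Fl t) = (\<Inter>u\<in>{t<..}. sets (Fl u))) \<and>
     (\<forall>A Z. Z \<in> null_sets P \<and> A \<subseteq> Z \<longrightarrow> A \<in> sets (Fl 0))"

definition adapted :: "(real \<Rightarrow> 'a measure) \<Rightarrow> (real \<Rightarrow> 'a \<Rightarrow> real) \<Rightarrow> bool" where
  "adapted Fl X \<longleftrightarrow> (\<forall>t\<ge>0. X t \<in> borel_measurable (Fl t))"

definition prog_measurable :: "(real \<Rightarrow> 'a measure) \<Rightarrow> (real \<Rightarrow> 'a \<Rightarrow> real) \<Rightarrow> bool" where
  "prog_measurable Fl X \<longleftrightarrow>
     (\<forall>t\<ge>0. (\<lambda>(s, \<omega>). X s \<omega>) \<in> borel_measurable (restrict_space borel {0..t} \<Otimes>\<^sub>M Fl t))"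

definition martingale :: "'a measure \<Rightarrow> (real \<Rightarrow> 'a measure) \<Rightarrow> (real \<Rightarrow> 'a \<Rightarrow> real) \<Rightarrow> bool" where
  "martingale P Fl X \<longleftrightarrow> adapted Fl X \<and> (\<forall>t\<ge>0. integrable P (X t)) \<and>
     (\<forall>s t A. 0 \<le> s \<and> s \<le> t \<and> A \<in> sets (Fl s) \<longrightarrow>
        set_lebesgue_integral P A (X t) = set_lebesgue_integral P A (X s))"

definition sq_int_cadlag_martingale ::
  "'a measure \<Rightarrow> (real \<Rightarrow> 'a measure) \<Rightarrow> (real \<Rightarrow> 'a \<Rightarrow> real) \<Rightarrow> bool" where
  "sq_int_cadlag_martingale P Fl X \<longleftrightarrow> martingale P Fl X \<and>
     (\<forall>t\<ge>0. integrable P (\<lambda>\<omega>. (X t \<omega>)\<^sup>2)) \<and> (\<forall>\<omega>\<in>space P. cadlag (\<lambda>t. X t \<omega>))"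

(* Standing assumptions (A1)-(A4), with constants d, k, c, Cb (Cb = the bound "C").
   M x t w = M_eps(t,x)(w); Cc = calligraphic C_eps, Ctt = typewriter C_eps.
   (A1): <M(x),M(y)> = 0 for x ~= y is expressed as: M(x) M(y) is a martingale;
         <M(x)>_t = eps^{-d} int_0^t Cc is expressed as: M(x)^2 - eps^{-d} int_0^t Cc
         is a martingale (the continuous adapted process eps^{-d} int Cc is predictable,
         so this is the defining property of the predictable quadratic variation). *)
definition model :: "nat \<Rightarrow> real \<Rightarrow> real \<Rightarrow> real \<Rightarrow> nat \<Rightarrow> 'a measure \<Rightarrow> (real \<Rightarrow> 'a measure)
    \<Rightarrow> (site \<Rightarrow> real \<Rightarrow> 'a \<Rightarrow> real) \<Rightarrow> (real \<Rightarrow> site \<Rightarrow> 'a \<Rightarrow> real)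
    \<Rightarrow> (real \<Rightarrow> site \<Rightarrow> 'a \<Rightarrow> real) \<Rightarrow> bool" where
  "model d k c Cb N P Fl M Cc Ctt \<longleftrightarrow>
     prob_space P \<and> usual_filtration P Fl \<and>
     (\<forall>x\<in>Lam N d. sq_int_cadlag_martingale P Fl (M x)) \<and>
     \<comment> \<open>(A1)\<close>
     (\<forall>x\<in>Lam N d. \<forall>y\<in>Lam N d. x \<noteq> y \<longrightarrow>
         martingale P Fl (\<lambda>t \<omega>. M x t \<omega> * M y t \<omega>)) \<and>
     (\<forall>x\<in>Lam N d. prog_measurable Fl (\<lambda>s. Cc s x) \<and>
         (AE \<omega> in P. \<forall>s\<ge>0. \<bar>Cc s x \<omega>\<bar> \<le> Cb) \<and>
         martingale P Fl (\<lambda>t \<omega>. (M x t \<omega>)\<^sup>2 -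
            eps N powr (- real d) * (LBINT s:{0..t}. Cc s x \<omega>))) \<and>
     \<comment> \<open>(A2)\<close>
     (\<forall>T. AE \<omega> in P. \<forall>s\<in>{0..T}. \<forall>x\<in>Lam N d. \<forall>y\<in>Lam N d.
         x \<noteq> y \<longrightarrow> \<not> (jump (\<lambda>t. M x t \<omega>) s \<noteq> 0 \<and> jump (\<lambda>t. M y t \<omega>) s \<noteq> 0)) \<and>
     \<comment> \<open>(A3)\<close>
     (\<forall>x\<in>Lam N d. AE \<omega> in P. \<forall>t\<ge>0.
         jump (\<lambda>t. M x t \<omega>) t \<noteq> 0 \<longrightarrow> \<bar>jump (\<lambda>t. M x t \<omega>) t\<bar> = c * eps N powr k) \<and>
     \<comment> \<open>(A4)\<close>
     (\<forall>x\<in>Lam N d. prog_measurable Fl (\<lambda>s. Ctt s x) \<and>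
         (AE \<omega> in P. \<forall>s\<ge>0. \<bar>Ctt s x \<omega>\<bar> \<le> Cb) \<and>
         (AE \<omega> in P. \<forall>t\<ge>0. M x t \<omega> =
            (\<Sum>s\<in>jumps_in (\<lambda>r. M x r \<omega>) {0..t}. jump (\<lambda>r. M x r \<omega>) s)
            - eps N powr (- k - real d) * (LBINT s:{0..t}. Ctt s x \<omega>)))"

(* ---------- pathwise integrals (for a fixed sample point) ----------
   Mw x = path of M_eps(.,x); Cw = path of Cc; Ctw = path of Ctt.
   All integrals over D_{eps,t} = [0,t) x Lambda_eps. *)

definition intM :: "nat \<Rightarrow> nat \<Rightarrow> real \<Rightarrow> (site \<Rightarrow> real \<Rightarrow> real) \<Rightarrow> (real \<Rightarrow> site \<Rightarrow> real)
    \<Rightarrow> (point \<Rightarrow> real) \<Rightarrow> real \<Rightarrow> real" where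
  "intM N d k Mw Ctw H t = (\<Sum>x\<in>Lam N d. eps N ^ d *
      ((\<Sum>s\<in>jumps_in (Mw x) {0..<t}. H (s, x) * jump (Mw x) s)
       - eps N powr (- k - real d) * (LBINT s:{0..<t}. H (s, x) * Ctw s x)))"

definition intMj :: "nat \<Rightarrow> nat \<Rightarrow> nat \<Rightarrow> (site \<Rightarrow> real \<Rightarrow> real) \<Rightarrow> (point \<Rightarrow> real) \<Rightarrow> real \<Rightarrow> real" where
  "intMj N d j Mw H t = (\<Sum>x\<in>Lam N d. eps N ^ (j * d) *
      (\<Sum>s\<in>jumps_in (Mw x) {0..<t}. H (s, x) * (jump (Mw x) s) ^ j))"

(* int H d Mbar, Mbar = eps^{-k}([M] - <M>), [M]_t = sum_{s<=t} (Delta_s M)^2 (pure jump,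
   finite variation), <M>_t = eps^{-d} int_0^t Cc *)
definition intMbar :: "nat \<Rightarrow> nat \<Rightarrow> real \<Rightarrow> (site \<Rightarrow> real \<Rightarrow> real) \<Rightarrow> (real \<Rightarrow> site \<Rightarrow> real)
    \<Rightarrow> (point \<Rightarrow> real) \<Rightarrow> real \<Rightarrow> real" where
  "intMbar N d k Mw Cw H t = (\<Sum>x\<in>Lam N d. eps N ^ d * eps N powr (- k) *
      ((\<Sum>s\<in>jumps_in (Mw x) {0..<t}. H (s, x) * (jump (Mw x) s)\<^sup>2)
       - eps N powr (- real d) * (LBINT s:{0..<t}. H (s, x) * Cw s x)))"

definition intdz :: "nat \<Rightarrow> nat \<Rightarrow> (real \<Rightarrow> site \<Rightarrow> real) \<Rightarrow> (point \<Rightarrow> real) \<Rightarrow> real \<Rightarrow> real" where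
  "intdz N d Cw H t = (\<Sum>x\<in>Lam N d. eps N ^ d * (LBINT s:{0..<t}. H (s, x) * Cw s x))"

datatype label = Nabla | Diamond | NilL

(* integral of H against the measure attached to a component of size j with label l *)
definition lint :: "nat \<Rightarrow> nat \<Rightarrow> real \<Rightarrow> (site \<Rightarrow> real \<Rightarrow> real) \<Rightarrow> (real \<Rightarrow> site \<Rightarrow> real)
    \<Rightarrow> (real \<Rightarrow> site \<Rightarrow> real) \<Rightarrow> label \<Rightarrow> nat \<Rightarrow> (point \<Rightarrow> real) \<Rightarrow> real \<Rightarrow> real" where
  "lint N d k Mw Cw Ctw l j H t = (case l of
       Nabla \<Rightarrow> eps N powr ((real d + k) * (real j - 2)) * intdz N d Cw H t
     | Diamond \<Rightarrow> eps N powr ((real d + k) * (real j - 1)) * intMbar N d k Mw Cw H t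
     | NilL \<Rightarrow> (if j = 1 then intM N d k Mw Ctw H t else intMj N d j Mw H t))"

(* The labelled iterated integral (I^{eps,L}_{gamma,sigma} F)_t, written in terms of
   G = F^{gamma,sigma} (a function of z_1..z_m); sg j = gamma_j = sigma(j).
   For m = 1 and label nil, (I_{gamma,sigma}F)_t is the integral of F over the diagonal of
   M^{(x)n}, i.e. int F^{gamma,sigma} dM^{(n)}. For m >= 2, J(z_m) is the left limit at s_m. *)
fun Ilab :: "nat \<Rightarrow> nat \<Rightarrow> real \<Rightarrow> (site \<Rightarrow> real \<Rightarrow> real) \<Rightarrow> (real \<Rightarrow> site \<Rightarrow> real)
    \<Rightarrow> (real \<Rightarrow> site \<Rightarrow> real) \<Rightarrow> (nat \<Rightarrow> nat set) \<Rightarrow> (nat \<Rightarrow> label) \<Rightarrow> nat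
    \<Rightarrow> (tuple \<Rightarrow> real) \<Rightarrow> real \<Rightarrow> real" where
  "Ilab N d k Mw Cw Ctw sg L 0 G t = 0"
| "Ilab N d k Mw Cw Ctw sg L (Suc 0) G t =
     lint N d k Mw Cw Ctw (L 1) (card (sg 1)) (\<lambda>z. G (\<lambda>i. if i = 1 then z else base0)) t"
| "Ilab N d k Mw Cw Ctw sg L (Suc (Suc m)) G t =
     lint N d k Mw Cw Ctw (L (Suc (Suc m))) (card (sg (Suc (Suc m))))
       (\<lambda>z. Lim (at_left (fst z))
              (\<lambda>r. Ilab N d k Mw Cw Ctw sg L (Suc m) (\<lambda>w. G (w(Suc (Suc m) := z))) r)) t"

definition Fgs :: "nat \<Rightarrow> nat \<Rightarrow> (nat \<Rightarrow> nat set) \<Rightarrow> (tuple \<Rightarrow> real) \<Rightarrow> tuple \<Rightarrow> real" where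
  "Fgs n m sg F z = F (\<lambda>i. if i \<in> {1..n} then z (THE j. j \<in> {1..m} \<and> i \<in> sg j) else base0)"

definition timevec :: "nat \<Rightarrow> tuple \<Rightarrow> (nat \<Rightarrow> real) \<Rightarrow> tuple" where
  "timevec n z t = (\<lambda>i. if i \<in> {1..n} then (t i, snd (z i)) else z i)"

definition C1_time :: "nat \<Rightarrow> (tuple \<Rightarrow> real) \<Rightarrow> bool" where
  "C1_time n F \<longleftrightarrow> (\<forall>z.
     continuous_on {t. \<forall>i\<in>{1..n}. 0 \<le> t i} (\<lambda>t. F (timevec n z t)) \<and>
     (\<forall>i\<in>{1..n}. \<exists>D. (\<forall>t\<in>{t. \<forall>i\<in>{1..n}. 0 \<le> t i}.
          ((\<lambda>s. F (timevec n z (t(i := s)))) has_real_derivative D t) (at (t i) within {0..}))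
        \<and> continuous_on {t. \<forall>i\<in>{1..n}. 0 \<le> t i} D))"

datatype expo = E1 | E2 | EInf

definition lqnorm :: "nat \<Rightarrow> nat \<Rightarrow> real \<Rightarrow> expo \<Rightarrow> (point \<Rightarrow> real) \<Rightarrow> real" where
  "lqnorm N d T q f = (case q of
       E1 \<Rightarrow> eps N ^ d * (\<Sum>x\<in>Lam N d. LBINT s:{0..T}. \<bar>f (s, x)\<bar>)
     | E2 \<Rightarrow> sqrt (eps N ^ d * (\<Sum>x\<in>Lam N d. LBINT s:{0..T}. (f (s, x))\<^sup>2))
     | EInf \<Rightarrow> Sup {\<bar>f (s, x)\<bar> | s x. s \<in> {0..T} \<and> x \<in> Lam N d})"

fun mnorm :: "nat \<Rightarrow> nat \<Rightarrow> real \<Rightarrow> (nat \<Rightarrow> expo) \<Rightarrow> nat \<Rightarrow> (tuple \<Rightarrow> real) \<Rightarrow> real" where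
  "mnorm N d T pp 0 H = 0"
| "mnorm N d T pp (Suc 0) H = lqnorm N d T (pp 1) (\<lambda>z. H (\<lambda>i. if i = 1 then z else base0))"
| "mnorm N d T pp (Suc (Suc m)) H =
     lqnorm N d T (pp (Suc (Suc m)))
       (\<lambda>z. mnorm N d T pp (Suc m)
              (\<lambda>w. H (w(Suc (Suc m) := z)) * (if fst z > fst (w (Suc m)) then 1 else 0)))"

definition c1norm :: "nat \<Rightarrow> nat \<Rightarrow> real \<Rightarrow> nat \<Rightarrow> nat \<Rightarrow> (tuple \<Rightarrow> real) \<Rightarrow> real" where
  "c1norm N d T m i H =
     Sup {\<bar>H z\<bar> | z. \<forall>j\<in>{1..m}. fst (z j) \<in> {0..T} \<and> snd (z j) \<in> Lam N d}
   + Sup {\<bar>vector_derivative (\<lambda>s. H (z(i := (s, snd (z i))))) (at (fst (z i)) within {0..})\<bar>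
          | z. \<forall>j\<in>{1..m}. fst (z j) \<in> {0..T} \<and> snd (z j) \<in> Lam N d}"

definition Ep :: "'a measure \<Rightarrow> real \<Rightarrow> ('a \<Rightarrow> real) \<Rightarrow> ennreal" where
  "Ep P p X = (let I = (\<integral>\<^sup>+ \<omega>. ennreal (\<bar>X \<omega>\<bar> powr p) \<partial>P) in
               if I = \<infinity> then \<infinity> else ennreal (enn2real I powr (1 / p)))"


definition Gamma1 :: "nat \<Rightarrow> (nat \<Rightarrow> nat set) \<Rightarrow> nat set" where
  "Gamma1 m sg = {i \<in> {1..m}. card (sg i) = 1}"

definition GammaL :: "nat \<Rightarrow> (nat \<Rightarrow> nat set) \<Rightarrow> (nat \<Rightarrow> label) \<Rightarrow> nat set" where
  "GammaL m sg L = Gamma1 m sg \<union> {i \<in> {1..m}. L i = Diamond}"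

definition Padm :: "nat \<Rightarrow> (nat \<Rightarrow> nat set) \<Rightarrow> (nat \<Rightarrow> label) \<Rightarrow> (nat \<Rightarrow> expo) set" where
  "Padm m sg L = {pp \<in> PiE {1..m} (\<lambda>_. {E1, E2, EInf}).
      {i \<in> {1..m}. pp i = E1} \<inter> GammaL m sg L = {} \<and>
      {i \<in> {1..m}. L i = Nabla} \<subseteq> {i \<in> {1..m}. pp i = E1}}"

definition alpha :: "nat \<Rightarrow> real \<Rightarrow> nat \<Rightarrow> (nat \<Rightarrow> nat set) \<Rightarrow> (nat \<Rightarrow> expo) \<Rightarrow> real" where
  "alpha d k m sg pp = (real d + k) * (real (\<Sum>i=1..m. card (sg i))
      - 2 * real (card {i \<in> {1..m}. pp i = E1}) - real (card {i \<in> {1..m}. pp i = E2}))"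

definition Iinf :: "nat \<Rightarrow> (nat \<Rightarrow> nat set) \<Rightarrow> (nat \<Rightarrow> expo) \<Rightarrow> nat \<Rightarrow> nat set" where
  "Iinf m sg pp a = {i \<in> {1..m}. pp i = EInf \<and> i \<notin> Gamma1 m sg \<and> a \<le> i}"

definition beta :: "real \<Rightarrow> nat \<Rightarrow> (nat \<Rightarrow> nat set) \<Rightarrow> (nat \<Rightarrow> expo) \<Rightarrow> real" where
  "beta p m sg pp = ((p - 1) / p) ^ card (Iinf m sg pp 2)"

definition betai :: "real \<Rightarrow> nat \<Rightarrow> (nat \<Rightarrow> nat set) \<Rightarrow> (nat \<Rightarrow> expo) \<Rightarrow> nat \<Rightarrow> real" where
  "betai p m sg pp i = ((p - 1) / p) ^ card (Iinf m sg pp (i + 1))"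

end

theory Submission
  imports Defs "HOL-Probability.Probability"
begin

text \<open>
Every labelled integral is an iteration of one-level operators of the form \<open>\<Sum> H \<xi> - \<integral> H \<zeta> + \<integral> H \<rho>\<close>: a
compensated sum over the jumps of the driving martingales (whose intensity is bounded because the quadratic
variation is) plus a bounded drift. Integrals over \<open>[0, t)\<close> are left-continuous in \<open>t\<close>, so the left limits in
the recursion are values. For one level, a chain rule along the path and Young's inequality give a Rosenthal
inequality whose three terms are the \<open>L\<^sup>1\<close>, \<open>L\<^sup>2\<close> and \<open>L\<^sup>\<infinity>\<close> norms of the integrand with the scaling
weights of the exponents 1, 2 and infinity; iterating over the levels yields the sum of mixed norms to the first
power, and a pathwise Doob inequality handles the supremum. Finally, the mixed norm is at most \<open>sup |F|\<close>, hence at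
most each \<open>C\<^sup>1\<close> norm; since \<open>\<beta> + (\<Sum> \<beta>\<^sub>i) / p = 1\<close>, part of it may be traded for those norms, with
\<open>\<kappa> = 1\<close>.
\<close>

section \<open>Pathwise integrals along left-continuous paths\<close>

text \<open>Since all jumps have absolute value \<open>a = c \<epsilon>^k\<close>, an even power of
  a jump is constant and an odd power is a constant times the jump. So every label and every
  component size is driven by one of two processes, the jumps or their squares, and (A4) and (A1)
  supply exactly these two compensators. Nothing beyond second moments is assumed. Integrability
  comes from the number \<open>N\<close> of jumps in \<open>[0,1]\<close>: (A1) bounds its
  intensity, hence \<open>N\<close> has all moments, and every process that occurs is bounded
  pathwise by a polynomial in \<open>N\<close>. In particular the moment that the Rosenthal argument
  absorbs into the left side is finite. An inner integral enters the next level only through a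
  deterministic bound of its \<open>L^p\<close> norm at each point \<open>z\<close>. The intensity
  is of order \<open>\<epsilon>^(-d-2k)\<close>; with the factor \<open>\<epsilon>^(-d)\<close> from
  summing over sites, its square root is of order \<open>\<epsilon>^(-(d+k))\<close>, which is
  precisely the step of \<open>alpha\<close> from the exponent infinity to 2. A drift costs the same
  step twice, which gives the exponent 1.\<close>

lemma set_integrable_cong_imp:
 fixes f g :: "'a => real"
 assumes "set_integrable M A f" "!!x. x \<in> A ==> f x = g x"
 shows "set_integrable M A g"
 using assms(1) set_integrable_cong[of M M A A f g] assms(2) by auto

lemma LBINT_ico: "(LBINT s:{a..<b}. f s) = (LBINT s:{a..b::real}. (f s::real))"
 unfolding set_lebesgue_integral_def
 by (rule integral_discrete_difference[where X="{b}"]) (auto simp: indicator_def)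

lemma LBINT_ioc: "(LBINT s:{a<..b}. f s) = (LBINT s:{a..b::real}. (f s::real))"
 unfolding set_lebesgue_integral_def
 by (rule integral_discrete_difference[where X="{a}"]) (auto simp: indicator_def)

lemma LBINT_split:
 assumes "set_integrable lborel {a..c} (f::real=>real)" "a <= b" "b <= c"
 shows "(LBINT s:{a..c}. f s) = (LBINT s:{a..b}. f s) + (LBINT s:{b..c}. f s)"
proof -
 have "(LBINT s:{a..b} \<union> {b<..c}. f s) = (LBINT s:{a..b}. f s) + (LBINT s:{b<..c}. f s)"
  by (rule set_integral_Un) (use assms in \<open>auto intro: set_integrable_subset\<close>)
 moreover have "{a..b} \<union> {b<..c} = {a..c}" using assms by auto
 ultimately show ?thesis by (simp add: LBINT_ioc)
qed

text \<open>Left end point of the cell \<open>{i*t/n<..(i+1)*t/n}\<close> that contains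
  \<open>s\<close>, for the uniform grid of \<open>[0,t]\<close>. Cells open on the left make
  \<open>la n t s < s\<close> strict, so left-continuity of an integrand suffices when the grid is
  refined.\<close>

definition la :: "nat => real => real => real" where
 "la n t s = t * (of_int \<lceil>real n * s / t\<rceil> - 1) / real n"

lemma la_bounds:
 assumes "0 < s" "s <= t" "n \<ge> 1"
 shows "0 <= la n t s" "la n t s < s" "s - t / real n <= la n t s"
proof -
 have t: "t > 0" using assms by simp
 define y where "y = real n * s / t"
 have y: "y > 0" "s = t * y / real n" using assms t by (auto simp: y_def)
 have c: "of_int \<lceil>y\<rceil> - 1 < y" "y <= of_int \<lceil>y\<rceil>" by linarith+
 have "\<lceil>y\<rceil> \<ge> 1" using y by simp
 then have "(of_int \<lceil>y\<rceil>::real) \<ge> 1" by linarith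
 then show "0 <= la n t s" using t unfolding la_def y_def by simp
 show "la n t s < s" unfolding la_def y_def[symmetric] y(2)
  using c(1) t assms(3) by (simp add: divide_strict_right_mono)
 have "t * y / real n - t / real n = t * (y - 1) / real n"
  by (simp add: diff_divide_distrib right_diff_distrib)
 also have "... <= t * (of_int \<lceil>y\<rceil> - 1) / real n"
  using c(2) t by (intro divide_right_mono mult_left_mono) auto
 finally show "s - t / real n <= la n t s" unfolding la_def y_def[symmetric] y(2)[symmetric] .
qed

lemma la_eq:
 assumes "t > 0" "n \<ge> 1" "real i * t / real n < s" "s <= real (Suc i) * t / real n"
 shows "la n t s = real i * t / real n"
proof -
 have "real i < real n * s / t" "real n * s / t <= real (Suc i)"
  using assms by (auto simp: field_simps)
 then have "\<lceil>real n * s / t\<rceil> = int (Suc i)" by (intro ceiling_unique) auto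
 then show ?thesis by (simp add: la_def mult.commute)
qed

lemma la_filterlim:
 assumes "0 < s" "s <= t"
 shows "filterlim (%n. la n t s) (at_left s) sequentially"
proof -
 have "(%n. la n t s) \<longlonglongrightarrow> s"
 proof (rule tendsto_sandwich)
  show "\<forall>\<^sub>F n in sequentially. s - t / real n <= la n t s"
   using la_bounds(3)[OF assms] by (intro eventually_sequentiallyI[of 1]) auto
  show "\<forall>\<^sub>F n in sequentially. la n t s <= s"
   using la_bounds(2)[OF assms] by (intro eventually_sequentiallyI[of 1]) (auto intro: less_imp_le)
  show "(%n. s - t / real n) \<longlonglongrightarrow> s"
   by real_asymp
 qed simp
 moreover have "\<forall>\<^sub>F n in sequentially. la n t s \<in> {..<s} & la n t s ~= s"
  using la_bounds(2)[OF assms] by (intro eventually_sequentiallyI[of 1]) force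
 ultimately show ?thesis by (simp add: filterlim_at)
qed

text \<open>An Ito sum: the integrand is taken at the left end of each cell, hence known before the
  increment of \<open>V\<close> occurs. Martingale identities are proved for these sums and then
  passed to the limit.\<close>

definition lsum :: "nat => real => (real => real) => (real => real) => real" where
 "lsum n t K V = (\<Sum>i<n. K (real i * t / real n) * (V (real (Suc i) * t / real n) - V (real i * t / real n)))"

text \<open>Exact and not only a limit: a step path moves in a cell by its jumps there, and
  \<open>la n t\<close> is constant on the cell.\<close>

lemma lsum_jump:
 assumes t: "t > 0" and n: "n \<ge> 1" and J: "finite J" "J \<subseteq> {0<..}"
 shows "lsum n t K (%u. \<Sum>s\<in>J Int {..u}. \<xi> s) = (\<Sum>s\<in>J Int {..t}. K (la n t s) * \<xi> s)"
proof -
 define g where "g i = real i * t / real n" for i :: nat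
 have gm: "g i < g (Suc i)" for i using t n by (simp add: g_def field_simps)
 have "(\<Sum>i<m. K (g i) * ((\<Sum>s\<in>J Int {..g (Suc i)}. \<xi> s) - (\<Sum>s\<in>J Int {..g i}. \<xi> s)))
    = (\<Sum>s\<in>J Int {..g m}. K (la n t s) * \<xi> s)" for m
 proof (induction m)
  case 0
  have "J Int {..g 0} = {}" using J by (auto simp: g_def)
  then show ?case by simp
 next
  case (Suc m)
  have eq: "J Int {..g (Suc m)} = (J Int {..g m}) \<union> (J Int {g m<..g (Suc m)})"
   using gm[of m] by auto
  have s: "(\<Sum>s\<in>J Int {..g (Suc m)}. h s) = (\<Sum>s\<in>J Int {..g m}. h s) + (\<Sum>s\<in>J Int {g m<..g (Suc m)}. h s)" for h :: "real => real"
   unfolding eq by (rule sum.union_disjoint) (use J in auto)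
  have "(\<Sum>s\<in>J Int {g m<..g (Suc m)}. K (la n t s) * \<xi> s) = (\<Sum>s\<in>J Int {g m<..g (Suc m)}. K (g m) * \<xi> s)"
   by (rule sum.cong) (use la_eq[OF t n] in \<open>auto simp: g_def\<close>)
  then show ?case using Suc by (simp add: s sum_distrib_left del: sum.lessThan_Suc add: sum.lessThan_Suc)
 qed
 from this[of n] show ?thesis using n by (simp add: lsum_def g_def)
qed

text \<open>As for jumps, \<open>K (la n t s)\<close> is constant on each cell, so the sum is the
  integral of a step function against \<open>\<theta>\<close>; integrability comes out of the same
  cell by cell induction, for arbitrary \<open>K\<close>.\<close>

lemma lsum_int:
 assumes t: "t > 0" and n: "n \<ge> 1" and f: "set_integrable lborel {0..t} \<theta>"
 shows "lsum n t K (%u. LBINT s:{0..u}. \<theta> s) = (LBINT s:{0..t}. K (la n t s) * \<theta> s)"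
  and "set_integrable lborel {0..t} (%s. K (la n t s) * \<theta> s)"
proof -
 define g where "g i = real i * t / real n" for i :: nat
 have gm: "g i < g (Suc i)" for i using t n by (simp add: g_def field_simps)
 have gn: "g n = t" using n by (simp add: g_def)
 have g0: "g 0 = 0" by (simp add: g_def)
 have gmono: "mono g" using gm by (intro incseq_SucI) (auto intro: less_imp_le)
 have ge0: "g i \<ge> 0" for i using t by (simp add: g_def)
 have *: "set_integrable lborel {0..g m} (%s. K (la n t s) * \<theta> s) \<and>
    (\<Sum>i<m. K (g i) * ((LBINT s:{0..g (Suc i)}. \<theta> s) - (LBINT s:{0..g i}. \<theta> s)))
    = (LBINT s:{0..g m}. K (la n t s) * \<theta> s)" if "m <= n" for m
  using that
 proof (induction m)
  case 0
  have "AE x in lborel. x ~= (0::real)" by (rule AE_lborel_singleton)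
  then have "(LBINT s:{0..0}. K (la n t s) * \<theta> s) = 0"
   unfolding set_lebesgue_integral_def by (intro integral_eq_zero_AE) (erule eventually_mono, auto simp: indicator_def)
  moreover have "set_integrable lborel {0..0} (%s. K (la n t s) * \<theta> s)"
  proof -
   have "integrable lborel (%_::real. 0::real) = integrable lborel (%s. indicator {0..0} s *\<^sub>R (K (la n t s) * \<theta> s))"
    by (rule integrable_discrete_difference[of "{0}"]) (auto simp: indicator_def)
   then show ?thesis by (simp add: set_integrable_def)
  qed
  ultimately show ?case by (simp add: g0)
 next
  case (Suc m)
  have gle: "g (Suc m) <= t" using monoD[OF gmono Suc.prems] gn by simp
  have i\<theta>: "set_integrable lborel {0..g (Suc m)} \<theta>" by (rule set_integrable_subset[OF f]) (use gle in auto)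
  have i2: "set_integrable lborel {g m<..g (Suc m)} \<theta>" by (rule set_integrable_subset[OF f]) (use gle ge0[of m] in auto)
  have cong: "K (la n t s) * \<theta> s = K (g m) * \<theta> s" if "s \<in> {g m<..g (Suc m)}" for s
   using la_eq[OF t n, of m s] that by (auto simp: g_def)
  have i3: "set_integrable lborel {g m<..g (Suc m)} (%s. K (la n t s) * \<theta> s)"
   by (rule set_integrable_cong_imp[OF set_integrable_mult_right[OF i2, of "K (g m)"]]) (simp only: cong)
  have e: "{0..g m} \<union> {g m<..g (Suc m)} = {0..g (Suc m)}" using gm[of m] ge0[of m] by auto
  have I: "set_integrable lborel {0..g m} (%s. K (la n t s) * \<theta> s)" using Suc by auto
  have "set_integrable lborel ({0..g m} \<union> {g m<..g (Suc m)}) (%s. K (la n t s) * \<theta> s)"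
   by (rule set_integrable_Un[OF I i3]) auto
  then have i4: "set_integrable lborel {0..g (Suc m)} (%s. K (la n t s) * \<theta> s)" by (simp add: e)
  have s1: "(LBINT s:{0..g (Suc m)}. \<theta> s) = (LBINT s:{0..g m}. \<theta> s) + (LBINT s:{g m..g (Suc m)}. \<theta> s)"
   by (rule LBINT_split[OF i\<theta>]) (use gm[of m] ge0 in \<open>auto intro: less_imp_le\<close>)
  have s2: "(LBINT s:{0..g (Suc m)}. K (la n t s) * \<theta> s) = (LBINT s:{0..g m}. K (la n t s) * \<theta> s) + (LBINT s:{g m..g (Suc m)}. K (la n t s) * \<theta> s)"
   by (rule LBINT_split[OF i4]) (use gm[of m] ge0 in \<open>auto intro: less_imp_le\<close>)
  have s3: "(LBINT s:{g m..g (Suc m)}. K (la n t s) * \<theta> s) = K (g m) * (LBINT s:{g m..g (Suc m)}. \<theta> s)"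
   unfolding LBINT_ioc[symmetric]
   by (subst set_lebesgue_integral_cong[OF _ allI[OF impI[OF cong]]]) auto
  show ?case using Suc i4 s1 s2 s3 by simp
 qed
 from *[of n] show "lsum n t K (%u. LBINT s:{0..u}. \<theta> s) = (LBINT s:{0..t}. K (la n t s) * \<theta> s)"
  and "set_integrable lborel {0..t} (%s. K (la n t s) * \<theta> s)"
  using n by (simp_all add: lsum_def g_def)
qed

text \<open>The horizon of the whole development is 1, and time 0 is never approached from the
  left.\<close>

definition lcont :: "(real => real) => bool" where
 "lcont K \<longleftrightarrow> (\<forall>s. 0 < s & s <= 1 --> (K \<longlongrightarrow> K s) (at_left s))"

lemma lcont_la:
 assumes "lcont K" "0 < s" "s <= t" "t <= 1"
 shows "(%n. K (la n t s)) \<longlonglongrightarrow> K s"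
 using filterlim_compose[OF _ la_filterlim[of s t], of K "nhds (K s)"] assms by (auto simp: lcont_def)

lemma lsum_jump_tendsto:
 assumes "lcont K" "t > 0" "t <= 1" "finite J" "J \<subseteq> {0<..}"
 shows "(%n. lsum n t K (%u. \<Sum>s\<in>J Int {..u}. \<xi> s)) \<longlonglongrightarrow> (\<Sum>s\<in>J Int {..t}. K s * \<xi> s)"
proof -
 have "(%n. \<Sum>s\<in>J Int {..t}. K (la n t s) * \<xi> s) \<longlonglongrightarrow> (\<Sum>s\<in>J Int {..t}. K s * \<xi> s)"
  using assms by (intro tendsto_intros lcont_la) auto
 then show ?thesis
  by (rule Lim_transform_eventually)
    (use assms in \<open>auto intro!: eventually_sequentiallyI[of 1] lsum_jump[symmetric]\<close>)
qed

text \<open>\<open>K\<close> is the limit of the step functions \<open>K (la n t s)\<close>, which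
  are measurable as integrands of \<open>lsum_int\<close> with density 1. Time 0 is cut off because
  \<open>la\<close> gives no control there.\<close>

lemma lcont_measurable:
 assumes "lcont K" "t <= 1" "t > 0"
 shows "(%s. K s * indicator {0<..t} s) \<in> borel_measurable borel"
proof -
 have m: "(%s. K (la n t s) * indicator {0<..t} s) \<in> borel_measurable borel" if n: "n \<ge> 1" for n
 proof -
  have i: "set_integrable lborel {0..t} (%_. 1::real)"
   by (simp add: set_integrable_def integrable_indicator_iff emeasure_lborel_Icc_eq)
  have "set_borel_measurable lborel {0..t} (%s. K (la n t s) * 1)"
   using lsum_int(2)[OF assms(3) n i, of K]
   by (auto simp: set_integrable_def set_borel_measurable_def)
  then have "(%s. (indicator {0..t} s * K (la n t s)) * indicator {0<..t} s) \<in> borel_measurable borel"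
   by (simp add: set_borel_measurable_def)
  then show ?thesis by (rule measurable_cong[THEN iffD1, rotated]) (auto simp: indicator_def)
 qed
 show ?thesis
 proof (rule borel_measurable_LIMSEQ_real)
  show "(%s. K (la (Suc n) t s) * indicator {0<..t} s) \<in> borel_measurable borel" for n by (rule m) simp
  show "(%n. K (la (Suc n) t s) * indicator {0<..t} s) \<longlonglongrightarrow> K s * indicator {0<..t} s" for s
   using LIMSEQ_Suc[OF lcont_la[OF assms(1), of s t]] assms by (cases "s \<in> {0<..t}") (auto intro: tendsto_mult)
 qed
qed

text \<open>Dominated convergence for \<open>K (la n t s) * \<theta> s\<close>. The restriction to
  \<open>{0<..t}\<close> removes the single point 0, where the step functions need not
  converge.\<close>

lemma lsum_int_tendsto:
 assumes K: "lcont K" and t: "t > 0" "t <= 1" and f: "set_integrable lborel {0..t} \<theta>"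
  and D: "!!s. 0 <= s ==> s <= t ==> \<bar>K s\<bar> <= D"
 shows "(%n. lsum n t K (%u. LBINT s:{0..u}. \<theta> s)) \<longlonglongrightarrow> (LBINT s:{0..t}. K s * \<theta> s)"
  and "set_integrable lborel {0..t} (%s. K s * \<theta> s)"
proof -
 define F where "F s = indicator {0<..t} s * (K s * \<theta> s)" for s
 define G where "G n s = indicator {0<..t} s * (K (la (Suc n) t s) * \<theta> s)" for n s
 have \<theta>m: "(%s. indicator {0..t} s * \<theta> s) \<in> borel_measurable borel" using f by (auto simp: set_integrable_def)
 have F: "F \<in> borel_measurable lborel"
 proof -
  have "(%s. (K s * indicator {0<..t} s) * (indicator {0..t} s * \<theta> s)) \<in> borel_measurable lborel"
   using lcont_measurable[OF K t(2,1)] \<theta>m by simp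
  then show ?thesis unfolding F_def by (rule measurable_cong[THEN iffD1, rotated]) (auto simp: indicator_def)
 qed
 have G: "G n \<in> borel_measurable lborel" for n
 proof -
  have "set_integrable lborel {0<..t} (%s. K (la (Suc n) t s) * \<theta> s)"
   by (rule set_integrable_subset[OF lsum_int(2)[OF t(1) _ f]]) auto
  then show ?thesis by (auto simp: set_integrable_def G_def[abs_def])
 qed
 have w: "integrable lborel (%s. D * (indicator {0..t} s * \<bar>\<theta> s\<bar>))"
  using set_integrable_abs[OF f] by (auto simp: set_integrable_def)
 have lim: "AE s in lborel. (%n. G n s) \<longlonglongrightarrow> F s"
  unfolding F_def G_def
 proof (intro AE_I2)
  fix s show "(%n. indicator {0<..t} s * (K (la (Suc n) t s) * \<theta> s)) \<longlonglongrightarrow> indicator {0<..t} s * (K s * \<theta> s)"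
   using LIMSEQ_Suc[OF lcont_la[OF K, of s t]] t by (cases "s \<in> {0<..t}") (auto intro!: tendsto_intros)
 qed
 have bd: "AE s in lborel. norm (G n s) <= D * (indicator {0..t} s * \<bar>\<theta> s\<bar>)" for n
 proof (intro AE_I2)
  fix s show "norm (G n s) <= D * (indicator {0..t} s * \<bar>\<theta> s\<bar>)"
  proof (cases "s \<in> {0<..t}")
   case True
   then have "\<bar>K (la (Suc n) t s)\<bar> <= D" using la_bounds[of s t "Suc n"] by (intro D) auto
   then show ?thesis using True by (simp add: G_def abs_mult mult_right_mono)
  next
   case False
   have "0 <= D" using D[of 0] t by linarith
   with False show ?thesis by (simp add: G_def)
  qed
 qed
 have "(%n. integral\<^sup>L lborel (G n)) \<longlonglongrightarrow> integral\<^sup>L lborel F"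
  by (rule integral_dominated_convergence[OF F G w lim bd])
 moreover have "integral\<^sup>L lborel (G n) = lsum (Suc n) t K (%u. LBINT s:{0..u}. \<theta> s)" for n
  using lsum_int(1)[OF t(1) _ f, of "Suc n" K] LBINT_ioc[of 0 t "%s. K (la (Suc n) t s) * \<theta> s"]
  by (simp add: G_def[abs_def] set_lebesgue_integral_def)
 moreover have "integral\<^sup>L lborel F = (LBINT s:{0..t}. K s * \<theta> s)"
  using LBINT_ioc[of 0 t "%s. K s * \<theta> s"] by (simp add: F_def[abs_def] set_lebesgue_integral_def)
 ultimately have "(%n. lsum (Suc n) t K (%u. LBINT s:{0..u}. \<theta> s)) \<longlonglongrightarrow> (LBINT s:{0..t}. K s * \<theta> s)" by simp
 then show "(%n. lsum n t K (%u. LBINT s:{0..u}. \<theta> s)) \<longlonglongrightarrow> (LBINT s:{0..t}. K s * \<theta> s)" by (rule LIMSEQ_imp_Suc)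
 have "integrable lborel F" by (rule integrable_dominated_convergence[OF F G w lim bd])
 moreover have "AE s in lborel. F s = indicator {0..t} s * (K s * \<theta> s)"
  using AE_lborel_singleton[of 0] by (auto elim!: eventually_mono simp: F_def indicator_def)
 moreover have "(%s. indicator {0..t} s * (K s * \<theta> s)) \<in> borel_measurable lborel"
  by (rule measurable_discrete_difference[OF F, of "{0}"]) (auto simp: F_def indicator_def)
 ultimately show "set_integrable lborel {0..t} (%s. K s * \<theta> s)"
  unfolding set_integrable_def by (auto intro: integrable_cong_AE_imp)
qed

section \<open>Chain rule for paths with bounded drift and finitely many jumps\<close>

lemma set_integrable_const_Icc: "set_integrable lborel {a..b::real} (%_. c::real)"
 using set_integrable_mult_right[of c lborel "{a..b}" "%_. 1::real"]
 by (cases "a <= b") (simp_all add: set_integrable_def integrable_indicator_iff emeasure_lborel_Icc_eq)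

text \<open>The density \<open>b\<close> is only bounded and integrable, so \<open>x\<close> is
  Lipschitz but need not be differentiable at a given point. Instead of differentiating
  \<open>x\<close>, the difference \<open>\<Psi>\<close> of the two sides is shown to have
  derivative 0 everywhere on \<open>{u..v}\<close>.\<close>

lemma chain_cont:
 fixes x0 u v :: real and b :: "real => real"
 assumes uv: "u <= v" and b: "set_integrable lborel {u..v} b" and B: "!!s. s \<in> {u..v} ==> \<bar>b s\<bar> <= B"
  and \<phi>: "!!x. (\<phi> has_real_derivative \<phi>' x) (at x)" and c: "continuous_on UNIV \<phi>'"
 defines "x \<equiv> %r. x0 + (LBINT s:{u..r}. b s)"
 shows "\<phi> (x v) - \<phi> x0 = (LBINT s:{u..v}. \<phi>' (x s) * b s)"
  and "set_integrable lborel {u..v} (%s. \<phi>' (x s) * b s)"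
proof -
 have ib: "set_integrable lborel {r..t} b" if "u <= r" "t <= v" for r t
  by (rule set_integrable_subset[OF b]) (use that in auto)
 have B0: "0 <= B" using B[of u] uv by fastforce
 have bd: "\<bar>LBINT s:{r..t}. f s\<bar> <= M * (t - r)"
  if "r <= t" "set_integrable lborel {r..t} f" "!!s. s \<in> {r..t} ==> \<bar>f s\<bar> <= M" for r t M and f :: "real => real"
 proof -
  have "\<bar>LBINT s:{r..t}. f s\<bar> <= (LBINT s:{r..t}. \<bar>f s\<bar>)"
   unfolding set_lebesgue_integral_def by (rule order.trans[OF integral_abs_bound]) (simp add: abs_mult)
  also have "... <= (LBINT s:{r..t}. M)"
   by (rule set_integral_mono[OF set_integrable_abs[OF that(2)]]) (use that(3) set_integrable_const_Icc in auto)
  also have "... = M * (t - r)" using that(1) by (simp add: set_lebesgue_integral_def)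
  finally show ?thesis .
 qed
 have xd: "x t - x r = (LBINT s:{r..t}. b s)" if "u <= r" "r <= t" "t <= v" for r t
  using LBINT_split[OF ib[of u t], of r] that by (simp add: x_def)
 have xl: "\<bar>x t - x r\<bar> <= B * \<bar>t - r\<bar>" if "r \<in> {u..v}" "t \<in> {u..v}" for r t
 proof (cases "r <= t")
  case True
  have "\<bar>LBINT s:{r..t}. b s\<bar> <= B * (t - r)" using True that by (intro bd ib B) auto
  then show ?thesis using xd[of r t] True that by simp
 next
  case False
  have "\<bar>LBINT s:{t..r}. b s\<bar> <= B * (r - t)" using False that by (intro bd ib B) auto
  then show ?thesis using xd[of t r] False that by (simp add: abs_minus_commute)
 qed
 have xc: "continuous_on {u..v} x"
 proof (rule continuous_onI)
  fix r e :: real assume r: "r \<in> {u..v}" and e: "e > 0"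
  show "\<exists>d>0. \<forall>x'\<in>{u..v}. dist x' r < d --> dist (x x') (x r) <= e"
  proof (intro exI[of _ "e / (B + 1)"] conjI ballI impI)
   fix x' assume "x' \<in> {u..v}" "dist x' r < e / (B + 1)"
   then have "\<bar>x x' - x r\<bar> <= B * \<bar>x' - r\<bar>" "\<bar>x' - r\<bar> * (B + 1) < e"
    using xl[OF r, of x'] B0 by (auto simp: dist_real_def field_simps)
   then show "dist (x x') (x r) <= e" using abs_ge_zero[of "x' - r"] unfolding dist_real_def by argo
  qed (use e B0 in auto)
 qed
 have pc: "continuous_on {u..v} (%s. \<phi>' (x s))"
  by (rule continuous_on_compose2[OF c xc]) auto
 obtain M where M: "!!s. s \<in> {u..v} ==> \<bar>\<phi>' (x s)\<bar> <= M"
 proof -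
  have "bounded ((%s. \<phi>' (x s)) ` {u..v})"
   by (rule compact_imp_bounded[OF compact_continuous_image[OF pc]]) simp
  then obtain a where "\<forall>y\<in>(%s. \<phi>' (x s)) ` {u..v}. norm y <= a" unfolding bounded_iff ..
  then show ?thesis by (intro that[of a]) auto
 qed
 have "set_integrable lborel {u..v} (%s. b s * M)" using b by simp
 moreover have meas: "set_borel_measurable lborel {u..v} (%s. \<phi>' (x s) * b s)"
 proof -
  have "(%s. (indicator {u..v} s *\<^sub>R \<phi>' (x s)) * (indicator {u..v} s *\<^sub>R b s)) \<in> borel_measurable lborel"
   using b borel_measurable_continuous_on_indicator[OF _ pc]
   by (intro borel_measurable_times) (auto simp: set_integrable_def)
  then show ?thesis unfolding set_borel_measurable_def
   by (rule measurable_cong[THEN iffD1, rotated]) (auto simp: indicator_def)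
 qed
 ultimately show I: "set_integrable lborel {u..v} (%s. \<phi>' (x s) * b s)"
 proof (rule set_integrable_bound)
  show "AE s in lborel. s \<in> {u..v} --> norm (\<phi>' (x s) * b s) <= norm (b s * M)"
  proof (intro AE_I2 impI)
   fix s assume s: "s \<in> {u..v}"
   have "\<bar>\<phi>' (x s)\<bar> * \<bar>b s\<bar> <= \<bar>M\<bar> * \<bar>b s\<bar>" using M[OF s] by (intro mult_right_mono) auto
   then show "norm (\<phi>' (x s) * b s) <= norm (b s * M)" by (simp add: abs_mult mult.commute)
  qed
 qed
 define \<Psi> where "\<Psi> t = \<phi> (x t) - (LBINT s:{u..t}. \<phi>' (x s) * b s)" for t
 have xu: "x u = x0"
 proof -
  have "(LBINT s:{u..u}. b s) = 0" using bd[of u u b B] ib[of u u] uv B[of u] by fastforce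
  then show ?thesis by (simp add: x_def)
 qed
 have iI: "set_integrable lborel {r..t} (%s. \<phi>' (x s) * b s)" if "u <= r" "t <= v" for r t
  by (rule set_integrable_subset[OF I]) (use that in auto)
 \<comment> \<open>Both increments contain the same \<open>b\<close>, weighted by
   \<open>\<phi>'\<close> at nearby values of \<open>x\<close>. The increment of
   \<open>\<Psi>\<close> is therefore of order \<open>e * (t - r)\<close> although \<open>b\<close>
   itself has no limit.\<close>
 have key: "\<bar>\<Psi> t - \<Psi> r\<bar> <= 2 * e * B * (t - r)"
  if r: "u <= r" "r <= t" "t <= v" and s0: "s0 \<in> {r..t}" and e: "!!s. s \<in> {r..t} ==> \<bar>\<phi>' (x s) - \<phi>' (x s0)\<bar> <= e" for r t s0 e
 proof -
  have "\<exists>s\<in>{r..t}. \<phi> (x t) - \<phi> (x r) = \<phi>' (x s) * (x t - x r)"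
  proof (cases "x t = x r")
   case True then show ?thesis using r by auto
  next
   case False
   obtain y where y: "y \<in> closed_segment (x r) (x t)" "\<phi> (x t) - \<phi> (x r) = \<phi>' y * (x t - x r)"
   proof (cases "x r < x t")
    case True
    then obtain z where "z > x r" "z < x t" "\<phi> (x t) - \<phi> (x r) = (x t - x r) * \<phi>' z"
     using MVT2[OF True, of \<phi> \<phi>'] \<phi> by auto
    then show ?thesis using that[of z] True by (auto simp: closed_segment_eq_real_ivl)
   next
    case F: False
    then have "x t < x r" using False by simp
    then obtain z where "z > x t" "z < x r" "\<phi> (x r) - \<phi> (x t) = (x r - x t) * \<phi>' z"
     using MVT2[of "x t" "x r" \<phi> \<phi>'] \<phi> by auto
    then show ?thesis using that[of z] \<open>x t < x r\<close> by (auto simp: closed_segment_eq_real_ivl algebra_simps)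
   qed
   \<comment> \<open>The mean value point lies between \<open>x r\<close> and \<open>x t\<close>;
     continuity of \<open>x\<close> turns it into a time.\<close>
   have "connected (x ` {r..t})"
    by (rule connected_continuous_image) (use xc r in \<open>auto intro: continuous_on_subset\<close>)
   then have "closed_segment (x r) (x t) \<subseteq> x ` {r..t}"
    using r by (intro closed_segment_subset) (auto simp: is_interval_connected_1[symmetric] is_interval_convex_1[symmetric])
   then show ?thesis using y by auto
  qed
  then obtain s1 where s1: "s1 \<in> {r..t}" "\<phi> (x t) - \<phi> (x r) = \<phi>' (x s1) * (LBINT s:{r..t}. b s)"
   using xd[of r t] r by auto
  have "\<Psi> t - \<Psi> r = \<phi>' (x s1) * (LBINT s:{r..t}. b s) - (LBINT s:{r..t}. \<phi>' (x s) * b s)"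
   using LBINT_split[OF iI[of u t], of r] s1 r by (simp add: \<Psi>_def)
  also have "... = (LBINT s:{r..t}. (\<phi>' (x s1) - \<phi>' (x s)) * b s)"
   using r ib[of r t] iI[of r t] by (simp add: left_diff_distrib set_integral_diff)
  also have "\<bar>...\<bar> <= (2 * e * B) * (t - r)"
  proof (rule bd[OF r(2)])
   show "set_integrable lborel {r..t} (%s. (\<phi>' (x s1) - \<phi>' (x s)) * b s)"
    using r ib[of r t] iI[of r t] by (simp add: left_diff_distrib set_integral_diff)
   fix s assume s: "s \<in> {r..t}"
   have "\<bar>\<phi>' (x s1) - \<phi>' (x s)\<bar> <= 2 * e" using e[OF s] e[OF s1(1)] by linarith
   moreover have "\<bar>b s\<bar> <= B" using B s r by auto
   ultimately show "\<bar>(\<phi>' (x s1) - \<phi>' (x s)) * b s\<bar> <= 2 * e * B"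
    unfolding abs_mult by (intro mult_mono) auto
  qed
  finally show ?thesis .
 qed
 have der: "(\<Psi> has_real_derivative 0) (at s within {u..v})" if s: "s \<in> {u..v}" for s
  unfolding has_field_derivative_iff
 proof (rule tendstoI)
  fix e :: real assume e: "e > 0"
  \<comment> \<open>The \<open>+ 1\<close> keeps \<open>2 * e' * B < e\<close> strict and the
    quotient defined when \<open>B = 0\<close>.\<close>
  define e' where "e' = e / (4 * B + 1)"
  have e': "e' > 0" using e B0 by (simp add: e'_def)
  obtain d where d: "d > 0" "!!s'. s' \<in> {u..v} ==> dist s' s < d ==> \<bar>\<phi>' (x s') - \<phi>' (x s)\<bar> <= e'"
   using pc s e' unfolding continuous_on_iff dist_real_def by (metis less_imp_le)
  have "dist ((\<Psi> y - \<Psi> s) / (y - s)) 0 < e" if y: "y \<in> {u..v}" "y ~= s" "dist y s < d" for y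
  proof -
   have "\<bar>\<Psi> y - \<Psi> s\<bar> <= 2 * e' * B * \<bar>y - s\<bar>"
   proof (cases "s <= y")
    case True
    have "\<bar>\<Psi> y - \<Psi> s\<bar> <= 2 * e' * B * (y - s)"
     by (rule key[of _ _ s]) (use True s y in \<open>auto intro!: d simp: dist_real_def\<close>)
    then show ?thesis using True by simp
   next
    case False
    have "\<bar>\<Psi> s - \<Psi> y\<bar> <= 2 * e' * B * (s - y)"
     by (rule key[of _ _ s]) (use False s y in \<open>auto intro!: d simp: dist_real_def\<close>)
    then show ?thesis using False by (simp add: abs_minus_commute)
   qed
   then have "\<bar>\<Psi> y - \<Psi> s\<bar> / \<bar>y - s\<bar> <= 2 * e' * B" using y(2) by (simp add: field_simps)
   moreover have "2 * e' * B < e"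
   proof -
    have "2 * e' * B < e' * (4 * B + 1)" using e' B0 by (simp add: algebra_simps add_strict_increasing)
    also have "... = e" using B0 by (simp add: e'_def)
    finally show ?thesis .
   qed
   ultimately show ?thesis by (simp add: dist_real_def abs_divide)
  qed
  then show "\<forall>\<^sub>F y in at s within {u..v}. dist ((\<Psi> y - \<Psi> s) / (y - s)) 0 < e"
   unfolding eventually_at using d(1) by blast
 qed
 have "\<exists>c. \<forall>s\<in>{u..v}. \<Psi> s = c"
  by (rule has_field_derivative_zero_constant) (use der in auto)
 then have "\<Psi> v = \<Psi> u" using uv by auto
 moreover have "(LBINT s:{u..u}. \<phi>' (x s) * b s) = 0"
  using bd[of u u "%s. \<phi>' (x s) * b s" "\<bar>\<phi>' (x u) * b u\<bar>"] iI[of u u] uv by simp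
 ultimately show "\<phi> (x v) - \<phi> x0 = (LBINT s:{u..v}. \<phi>' (x s) * b s)" by (simp add: \<Psi>_def xu)
qed

text \<open>Induction on the number of jumps before \<open>t\<close>: up to the last jump
  \<open>q\<close> the induction hypothesis applies, afterwards the path is a continuous one started
  at \<open>x q + v q\<close>. Summing over \<open>{..<r}\<close> makes \<open>x\<close>
  left-continuous, so that \<open>x s\<close> is the value before the jump at
  \<open>s\<close>.\<close>

lemma chain_jump:
 fixes b v :: "real => real"
 assumes J: "finite J" "J \<subseteq> {0<..}" and b: "set_integrable lborel {0..T} b"
  and B: "!!s. s \<in> {0..T} ==> \<bar>b s\<bar> <= B"
  and \<phi>: "!!x. (\<phi> has_real_derivative \<phi>' x) (at x)" and c: "continuous_on UNIV \<phi>'"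
 defines "x \<equiv> %r. (\<Sum>s\<in>J Int {..<r}. v s) + (LBINT s:{0..r}. b s)"
 assumes t: "0 <= t" "t <= T"
 shows "\<phi> (x t) - \<phi> 0 = (\<Sum>s\<in>J Int {..<t}. \<phi> (x s + v s) - \<phi> (x s)) + (LBINT s:{0..t}. \<phi>' (x s) * b s)
   & set_integrable lborel {0..t} (%s. \<phi>' (x s) * b s)"
 using t
proof (induction "card (J Int {..<t})" arbitrary: t rule: less_induct)
 case less
 have ib: "set_integrable lborel {r..q} b" if "0 <= r" "q <= T" for r q
  by (rule set_integrable_subset[OF b]) (use that in auto)
 show ?case
 proof (cases "J Int {..<t} = {}")
  case True
  have x: "x s = 0 + (LBINT r:{0..s}. b r)" if "s \<in> {0..t}" for s
  proof -
   have "J Int {..<s} = {}" using True that by auto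
   then show ?thesis by (simp add: x_def)
  qed
  have bt: "!!s. s \<in> {0..t} ==> \<bar>b s\<bar> <= B" using B less.prems by auto
  have i: "set_integrable lborel {0..t} (%s. \<phi>' (0 + (LBINT r:{0..s}. b r)) * b s)"
   using chain_cont(2)[of 0 t b B \<phi> \<phi>' 0, OF less.prems(1) ib[OF order.refl less.prems(2)] bt \<phi> c] by simp
  have "\<phi> (x t) - \<phi> 0 = (LBINT s:{0..t}. \<phi>' (0 + (LBINT r:{0..s}. b r)) * b s)"
   using chain_cont(1)[of 0 t b B \<phi> \<phi>' 0, OF less.prems(1) ib[OF order.refl less.prems(2)] bt \<phi> c] x[of t] less.prems by simp
  also have "... = (LBINT s:{0..t}. \<phi>' (x s) * b s)"
   by (rule set_lebesgue_integral_cong) (auto simp: x)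
  finally have "\<phi> (x t) - \<phi> 0 = (LBINT s:{0..t}. \<phi>' (x s) * b s)" .
  moreover have "set_integrable lborel {0..t} (%s. \<phi>' (x s) * b s)"
   using i by (rule set_integrable_cong_imp) (auto simp: x)
  ultimately show ?thesis using True by simp
 next
  case False
  define q where "q = Max (J Int {..<t})"
  have q: "q \<in> J" "q < t" using Max_in[OF _ False] J by (auto simp: q_def)
  have qm: "s <= q" if "s \<in> J" "s < t" for s unfolding q_def using that J by (intro Max_ge) auto
  have q0: "0 < q" using q J by auto
  have Jt: "J Int {..<t} = insert q (J Int {..<q})" using q qm by force
  have "card (J Int {..<q}) < card (J Int {..<t})" unfolding Jt using J by simp
  then have IH: "\<phi> (x q) - \<phi> 0 = (\<Sum>s\<in>J Int {..<q}. \<phi> (x s + v s) - \<phi> (x s)) + (LBINT s:{0..q}. \<phi>' (x s) * b s)"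
   "set_integrable lborel {0..q} (%s. \<phi>' (x s) * b s)"
   using less.hyps[of q] q q0 less.prems by auto
  define y where "y r = (x q + v q) + (LBINT s:{q..r}. b s)" for r
  have xy: "x r = y r" if r: "r \<in> {q<..t}" for r
  proof -
   have "J Int {..<r} = insert q (J Int {..<q})" using q qm r by force
   then have "(\<Sum>s\<in>J Int {..<r}. v s) = v q + (\<Sum>s\<in>J Int {..<q}. v s)" using J by simp
   then show ?thesis using LBINT_split[OF ib[of 0 r], of q] r q0 less.prems
    by (simp add: x_def y_def)
  qed
  have bt: "!!s. s \<in> {q..t} ==> \<bar>b s\<bar> <= B" using B less.prems q0 by auto
  note cc = chain_cont[of q t b B \<phi> \<phi>' "x q + v q", OF less_imp_le[OF q(2)] ib[OF less_imp_le[OF q0] less.prems(2)] bt \<phi> c, folded y_def]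
  have i2: "set_integrable lborel {q<..t} (%s. \<phi>' (x s) * b s)"
  proof -
   have "set_integrable lborel {q<..t} (%s. \<phi>' (y s) * b s)" by (rule set_integrable_subset[OF cc(2)]) auto
   then show ?thesis by (rule set_integrable_cong_imp) (auto simp: xy)
  qed
  have e2: "(LBINT s:{q<..t}. \<phi>' (x s) * b s) = (LBINT s:{q..t}. \<phi>' (y s) * b s)"
   unfolding LBINT_ioc[symmetric] by (rule set_lebesgue_integral_cong) (auto simp: xy)
  have un: "{0..q} \<union> {q<..t} = {0..t}" using q q0 by auto
  have dj: "{0..q} Int {q<..t} = {}" by auto
  have i3: "set_integrable lborel {0..t} (%s. \<phi>' (x s) * b s)"
   using set_integrable_Un[OF IH(2) i2] un by simp
  have e3: "(LBINT s:{0..t}. \<phi>' (x s) * b s) = (LBINT s:{0..q}. \<phi>' (x s) * b s) + (LBINT s:{q<..t}. \<phi>' (x s) * b s)"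
   using set_integral_Un[OF dj IH(2) i2] unfolding un .
  have "(\<Sum>s\<in>J Int {..<t}. \<phi> (x s + v s) - \<phi> (x s)) = (\<phi> (x q + v q) - \<phi> (x q)) + (\<Sum>s\<in>J Int {..<q}. \<phi> (x s + v s) - \<phi> (x s))"
   unfolding Jt using J by simp
  then show ?thesis using i3 e3 e2 cc(1) IH(1) xy[of t] q by simp
 qed
qed

section \<open>Jump processes with bounded compensator\<close>

text \<open>The hypothesis \<open>orth\<close> says that the conditional expectation of
  \<open>Y\<close> given \<open>F\<close> vanishes; \<open>Z\<close> is pulled out of it and may be
  unbounded as long as \<open>Z * Y\<close> is integrable.\<close>

lemma mart_orth:
 fixes Y Z :: "'a => real"
 assumes "prob_space P" and sub: "subalgebra P F" and Y: "integrable P Y"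
  and orth: "!!A. A \<in> sets F ==> (\<integral>om. indicator A om * Y om \<partial>P) = 0"
  and Z: "Z \<in> borel_measurable F" and ZY: "integrable P (%om. Z om * Y om)"
 shows "(\<integral>om. Z om * Y om \<partial>P) = 0"
proof -
 interpret prob_space P by fact
 interpret finite_measure_subalgebra P F by unfold_locales (fact sub)
 have "AE om in P. real_cond_exp P F Y om = 0"
  by (rule real_cond_exp_charact) (use Y orth in \<open>auto simp: set_lebesgue_integral_def\<close>)
 then have "(\<integral>om. Z om * real_cond_exp P F Y om \<partial>P) = 0"
  by (intro integral_eq_zero_AE) auto
 then show ?thesis using real_cond_exp_intg(2)[OF ZY Z] Y by auto
qed

text \<open>Induction from indicators over simple functions to monotone limits; in
  \<open>ennreal\<close> no integrability of \<open>Z\<close> has to be tracked.\<close>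

lemma nn_integral_subalgebra_bound:
 fixes Z W :: "'a => ennreal"
 assumes sub: "subalgebra P F" and W: "W \<in> borel_measurable P"
  and le: "!!A. A \<in> sets F ==> (\<integral>\<^sup>+om. indicator A om * W om \<partial>P) <= c * emeasure P A"
  and Z: "Z \<in> borel_measurable F"
 shows "(\<integral>\<^sup>+om. Z om * W om \<partial>P) <= c * (\<integral>\<^sup>+om. Z om \<partial>P)"
 using Z
proof (induction rule: borel_measurable_induct)
 case (cong f g)
 have "space F = space P" using sub by (simp add: subalgebra_def)
 then have "(\<integral>\<^sup>+om. f om * W om \<partial>P) = (\<integral>\<^sup>+om. g om * W om \<partial>P)" "(\<integral>\<^sup>+om. f om \<partial>P) = (\<integral>\<^sup>+om. g om \<partial>P)"
  using cong by (auto intro!: nn_integral_cong)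
 then show ?case using cong by simp
next
 case (set A)
 then have "A \<in> sets P" using sub by (auto simp: subalgebra_def)
 then show ?case using le[OF set] by simp
next
 case (mult u k)
 have u: "u \<in> borel_measurable P" by (rule measurable_from_subalg[OF sub]) fact
 have "(\<integral>\<^sup>+om. k * u om * W om \<partial>P) = k * (\<integral>\<^sup>+om. u om * W om \<partial>P)"
  unfolding mult.assoc by (rule nn_integral_cmult) (use u W in simp)
 also have "... <= k * (c * (\<integral>\<^sup>+om. u om \<partial>P))" using mult by (intro mult_left_mono) auto
 also have "... = c * (\<integral>\<^sup>+om. k * u om \<partial>P)" using u by (simp add: nn_integral_cmult mult_ac)
 finally show ?case .
next
 case (add u v)
 have uv: "u \<in> borel_measurable P" "v \<in> borel_measurable P"
  by (rule measurable_from_subalg[OF sub]; fact)+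
 have "(\<integral>\<^sup>+om. (v om + u om) * W om \<partial>P) = (\<integral>\<^sup>+om. v om * W om \<partial>P) + (\<integral>\<^sup>+om. u om * W om \<partial>P)"
  unfolding distrib_right by (rule nn_integral_add) (use uv W in simp_all)
 also have "... <= c * (\<integral>\<^sup>+om. v om \<partial>P) + c * (\<integral>\<^sup>+om. u om \<partial>P)" using add by (intro add_mono) auto
 also have "... = c * (\<integral>\<^sup>+om. v om + u om \<partial>P)" using uv by (simp add: nn_integral_add distrib_left)
 finally show ?case .
next
 case (seq U)
 have U: "U i \<in> borel_measurable P" for i by (rule measurable_from_subalg[OF sub]) (use seq in auto)
 have inc: "incseq (%i om. U i om * W om)"
  using seq(3) by (auto simp: incseq_def le_fun_def intro!: mult_right_mono)
 have "(\<integral>\<^sup>+om. (SUP i. U i) om * W om \<partial>P) = (\<integral>\<^sup>+om. (SUP i. U i om * W om) \<partial>P)"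
  by (intro nn_integral_cong) (simp add: image_comp SUP_mult_right_ennreal)
 also have "... = (SUP i. \<integral>\<^sup>+om. U i om * W om \<partial>P)"
  by (rule nn_integral_monotone_convergence_SUP[OF inc]) (use U W in simp)
 also have "... <= c * (\<integral>\<^sup>+om. (SUP i. U i) om \<partial>P)"
 proof (rule SUP_least)
  fix i
  have "(\<integral>\<^sup>+om. U i om * W om \<partial>P) <= c * (\<integral>\<^sup>+om. U i om \<partial>P)" by (rule seq)
  also have "... <= c * (\<integral>\<^sup>+om. (SUP i. U i) om \<partial>P)"
   by (intro mult_left_mono nn_integral_mono) (auto simp: image_comp intro: SUP_upper)
  finally show "(\<integral>\<^sup>+om. U i om * W om \<partial>P) <= c * (\<integral>\<^sup>+om. (SUP i. U i) om \<partial>P)" .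
 qed
 finally show ?case .
qed

text \<open>The summand depends only on the rank of \<open>s\<close> in \<open>U\<close>, and the
  ranks are \<open>0, ..., card U - 1\<close>.\<close>

lemma sum_card_below:
 fixes U :: "real set" and f :: "nat => real"
 assumes "finite U"
 shows "(\<Sum>s\<in>U. f (card (U Int {..<s}))) = (\<Sum>i<card U. f i)"
 using assms
proof (induction rule: finite_linorder_max_induct)
 case (insert b A)
 have 1: "insert b A Int {..<b} = A" using insert(2) by auto
 have 2: "insert b A Int {..<s} = A Int {..<s}" if "s \<in> A" for s using insert(2) that by force
 have "b \<notin> A" using insert(2) by auto
 then show ?case using insert by (simp add: 1 2)
qed simp

lemma lcontI_eventually:
 assumes "!!s. 0 < s ==> s <= 1 ==> \<forall>\<^sub>F r in at_left s. K r = K s"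
 shows "lcont K"
 unfolding lcont_def using assms by (auto intro: tendsto_eventually)

lemma finite_eventually_left:
 fixes S :: "real set"
 assumes "finite S"
 shows "\<forall>\<^sub>F r in at_left s. S Int {..<r} = S Int {..<s}" "\<forall>\<^sub>F r in at_left s. S Int {..r} = S Int {..<s}"
proof -
 have "\<forall>\<^sub>F r in at_left s. (\<forall>q\<in>S Int {..<s}. q < r)"
  using assms by (auto simp: eventually_ball_finite_distrib intro!: eventually_at_leftI[of _ s])
 moreover have "\<forall>\<^sub>F r in at_left s. r < s" by (simp add: eventually_at_filter)
 ultimately have "\<forall>\<^sub>F r in at_left s. (\<forall>q\<in>S Int {..<s}. q < r) & r < s" by eventually_elim auto
 then have "\<forall>\<^sub>F r in at_left s. S Int {..<r} = S Int {..<s} & S Int {..r} = S Int {..<s}"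
 proof eventually_elim
  case (elim r)
  have "(q < s \<longleftrightarrow> q < r) & (q < s \<longleftrightarrow> q <= r)" if "q \<in> S" for q
  proof -
   have "q < s ==> q < r" using elim that by auto
   then show ?thesis using elim by (cases "q < s") auto
  qed
  then show ?case by auto
 qed
 then show "\<forall>\<^sub>F r in at_left s. S Int {..<r} = S Int {..<s}" "\<forall>\<^sub>F r in at_left s. S Int {..r} = S Int {..<s}"
  by (simp_all add: eventually_conj_iff)
qed

text \<open>The stochastic estimates are carried out for this structure: finitely many jump times
  per site, disjoint between sites, adapted counts, and a conditional intensity of at most
  \<open>lam\<close>, in the integrated form \<open>cnt_le\<close>. The pathwise properties are
  demanded for every sample point; exceptional sets are removed when the model is
  interpreted.\<close>

locale jump_process = prob_space P for P :: "'a measure" +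
 fixes Fl :: "real => 'a measure" and X :: "'x set" and S :: "'x => 'a => real set" and lam :: real
 assumes sub: "!!t. 0 <= t ==> subalgebra P (Fl t)"
  and Fmono: "!!s t. 0 <= s ==> s <= t ==> sets (Fl s) \<subseteq> sets (Fl t)"
  and finX: "finite X" and lam: "0 <= lam"
  and finS: "!!x om. x \<in> X ==> om \<in> space P ==> finite (S x om)"
  and S01: "!!x om. x \<in> X ==> om \<in> space P ==> S x om \<subseteq> {0<..1}"
  and disj: "!!x y om. x \<in> X ==> y \<in> X ==> x ~= y ==> om \<in> space P ==> S x om Int S y om = {}"
  and cnt_meas: "!!x t. x \<in> X ==> 0 <= t ==> t <= 1 ==> (%om. real (card (S x om Int {..t}))) \<in> borel_measurable (Fl t)"
  and cnt_le: "!!x s t A. x \<in> X ==> 0 <= s ==> s <= t ==> t <= 1 ==> A \<in> sets (Fl s) ==>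
   (\<integral>\<^sup>+om. indicator A om * ennreal (real (card (S x om Int {..t})) - real (card (S x om Int {..s}))) \<partial>P)
    <= ennreal (lam * (t - s)) * emeasure P A"
begin

lemma spF: "0 <= t ==> space (Fl t) = space P" using sub by (simp add: subalgebra_def)

lemma mF: "0 <= t ==> f \<in> borel_measurable (Fl t) ==> f \<in> borel_measurable P"
 by (rule measurable_from_subalg[OF sub])

lemma mFF: "0 <= s ==> s <= t ==> f \<in> borel_measurable (Fl s) ==> f \<in> borel_measurable (Fl t)"
 by (rule measurable_from_subalg[of "Fl t" "Fl s"]) (use Fmono[of s t] spF[of s] spF[of t] in \<open>auto simp: subalgebra_def\<close>)

definition N :: "'a => nat" where "N om = (\<Sum>x\<in>X. card (S x om))"

text \<open>Counting strictly before \<open>s\<close> makes \<open>cl\<close> left-continuous and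
  blind to a jump at \<open>s\<close> itself; evaluated at a jump time it is the rank of that
  jump.\<close>

definition cl :: "real => 'a => nat" where "cl s om = (\<Sum>x\<in>X. card (S x om Int {..<s}))"

lemma card_mono_cnt: "x \<in> X ==> om \<in> space P ==> s <= t ==> card (S x om Int {..s}) <= card (S x om Int {..t})"
 using finS by (intro card_mono) auto

text \<open>Dominated convergence along sequences increasing to \<open>s\<close>. The deterministic
  function of \<open>s\<close> so obtained then falls under the Riemann sum lemmas.\<close>

lemma expect_lcont:
 assumes K: "!!s. 0 <= s ==> s <= 1 ==> K s \<in> borel_measurable P"
  and lc: "!!om. om \<in> space P ==> lcont (%s. K s om)"
  and D: "!!s om. 0 <= s ==> s <= 1 ==> om \<in> space P ==> \<bar>K s om\<bar> <= D om" and iD: "integrable P D"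
 shows "!!s. 0 <= s ==> s <= 1 ==> integrable P (K s)"
  and "lcont (%s. \<integral>om. K s om \<partial>P)"
  and "!!s. 0 <= s ==> s <= 1 ==> \<bar>\<integral>om. K s om \<partial>P\<bar> <= (\<integral>om. D om \<partial>P)"
proof -
 show i: "integrable P (K s)" if "0 <= s" "s <= 1" for s
  by (rule Bochner_Integration.integrable_bound[OF iD K]) (use that D in \<open>force intro!: AE_I2\<close>)+
 show "\<bar>\<integral>om. K s om \<partial>P\<bar> <= (\<integral>om. D om \<partial>P)" if "0 <= s" "s <= 1" for s
  by (rule order.trans[OF integral_abs_bound integral_mono[OF integrable_abs[OF i[OF that]] iD]]) (use that D in auto)
 show "lcont (%s. \<integral>om. K s om \<partial>P)"
  unfolding lcont_def
 proof (intro allI impI)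
  fix s :: real assume s: "0 < s & s <= 1"
  show "((%r. \<integral>om. K r om \<partial>P) \<longlongrightarrow> (\<integral>om. K s om \<partial>P)) (at_left s)"
  proof (rule tendsto_at_left_sequentially[of 0])
   fix r :: "nat => real" assume r: "!!n. r n < s" "!!n. 0 < r n" "incseq r" "r \<longlonglongrightarrow> s"
   have at: "filterlim r (at_left s) sequentially"
    using r by (auto simp: filterlim_at intro!: always_eventually)
   show "(%n. \<integral>om. K (r n) om \<partial>P) \<longlonglongrightarrow> (\<integral>om. K s om \<partial>P)"
   proof (rule integral_dominated_convergence[OF _ _ iD])
    show "K s \<in> borel_measurable P" "K (r n) \<in> borel_measurable P" for n
     using s r(1,2)[of n] by (auto intro!: K)
    show "AE om in P. (%n. K (r n) om) \<longlonglongrightarrow> K s om"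
    proof (rule AE_I2)
     fix om assume "om \<in> space P"
     then have "((%u. K u om) \<longlongrightarrow> K s om) (at_left s)" using lc s by (auto simp: lcont_def)
     then show "(%n. K (r n) om) \<longlonglongrightarrow> K s om" by (rule filterlim_compose[OF _ at])
    qed
    show "AE om in P. norm (K (r n) om) <= D om" for n
     using s r(1,2)[of n] by (auto intro!: AE_I2 D)
   qed
  qed (use s in auto)
 qed
qed

text \<open>On one cell \<open>K\<close> is frozen at the left end and is known there, so
  \<open>cnt_le\<close> extends from indicators to this weight. The sum over the cells is a Riemann
  sum for the right side, and Fatou's lemma passes to the limit on the left, where integrability of
  the jump sum is not yet known.\<close>

lemma jump_sum_le:
 assumes x: "x \<in> X" and t: "0 < t" "t <= 1"
  and K: "!!s. 0 <= s ==> s <= 1 ==> K s \<in> borel_measurable (Fl s)"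
  and lc: "!!om. om \<in> space P ==> lcont (%s. K s om)"
  and nonneg: "!!s om. 0 <= s ==> s <= 1 ==> om \<in> space P ==> 0 <= K s om"
  and D: "!!s om. 0 <= s ==> s <= 1 ==> om \<in> space P ==> K s om <= D om" and iD: "integrable P D"
 shows "(\<integral>\<^sup>+om. ennreal (\<Sum>s\<in>S x om Int {..t}. K s om) \<partial>P) <= ennreal (lam * (LBINT s:{0..t}. (\<integral>om. K s om \<partial>P)))"
proof -
 define k where "k s = (\<integral>om. K s om \<partial>P)" for s
 define V where "V om u = real (card (S x om Int {..u}))" for om u
 have KP: "K s \<in> borel_measurable P" if "0 <= s" "s <= 1" for s using mF[OF that(1) K[OF that]] .
 have D': "\<bar>K s om\<bar> <= D om" if "0 <= s" "s <= 1" "om \<in> space P" for s om using D[OF that] nonneg[OF that] by simp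
 have E: "!!s. 0 <= s ==> s <= 1 ==> integrable P (K s)" "lcont k"
  "!!s. 0 <= s ==> s <= 1 ==> \<bar>k s\<bar> <= (\<integral>om. D om \<partial>P)"
  unfolding k_def by (rule expect_lcont[where K=K and D=D]; (assumption | rule KP lc D' iD)+)+
 define g where "g n i = real i * t / real n" for n i :: nat
 have g: "0 <= g n i" "g n i <= g n (Suc i)" "g n (Suc i) <= t" if "i < n" for n i
 proof -
  have "real (Suc i) * t <= real n * t" using that t by (intro mult_right_mono) auto
  then show "g n (Suc i) <= t" using that by (simp add: g_def pos_divide_le_eq mult.commute)
  show "0 <= g n i" "g n i <= g n (Suc i)" using that t by (auto simp: g_def divide_right_mono mult_right_mono)
 qed
 have step: "(\<integral>\<^sup>+om. ennreal (lsum n t (%s. K s om) (V om)) \<partial>P) <= ennreal (lam * lsum n t k (%u. u))"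
  if n: "n \<ge> 1" for n
 proof -
  have nn: "0 <= V om (g n (Suc i)) - V om (g n i)" if "i < n" "om \<in> space P" for i om
   using card_mono_cnt[OF x that(2) g(2)[OF that(1)]] by (simp add: V_def)
  have Vm: "(%om. V om (g n i)) \<in> borel_measurable P" if "i <= n" for i
  proof -
   have "g n i <= t" "0 <= g n i" using that t n by (auto simp: g_def field_simps)
   then show ?thesis unfolding V_def using t by (intro mF[OF _ cnt_meas[OF x]]) linarith+
  qed
  have "(\<integral>\<^sup>+om. ennreal (lsum n t (%s. K s om) (V om)) \<partial>P)
    = (\<integral>\<^sup>+om. (\<Sum>i<n. ennreal (K (g n i) om) * ennreal (V om (g n (Suc i)) - V om (g n i))) \<partial>P)"
  proof (rule nn_integral_cong)
   fix om assume om: "om \<in> space P"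
   have "0 <= K (g n i) om" if "i < n" for i using nonneg[OF g(1)[OF that] _ om] g[OF that] t by linarith
   note K0 = this
   have P: "0 <= K (g n i) om * (V om (g n (Suc i)) - V om (g n i))" if "i < n" for i
    by (intro mult_nonneg_nonneg nn[OF that om] K0[OF that])
   have "ennreal (lsum n t (%s. K s om) (V om)) = (\<Sum>i<n. ennreal (K (g n i) om * (V om (g n (Suc i)) - V om (g n i))))"
    unfolding lsum_def g_def[symmetric] by (rule sum_ennreal[symmetric]) (use P in auto)
   also have "... = (\<Sum>i<n. ennreal (K (g n i) om) * ennreal (V om (g n (Suc i)) - V om (g n i)))"
    by (intro sum.cong refl ennreal_mult K0 nn[OF _ om]) auto
   finally show "ennreal (lsum n t (%s. K s om) (V om)) = (\<Sum>i<n. ennreal (K (g n i) om) * ennreal (V om (g n (Suc i)) - V om (g n i)))" .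
  qed
  also have "... = (\<Sum>i<n. \<integral>\<^sup>+om. ennreal (K (g n i) om) * ennreal (V om (g n (Suc i)) - V om (g n i)) \<partial>P)"
  proof (rule nn_integral_sum)
   fix i assume "i \<in> {..<n}"
   then have i: "i < n" by simp
   have "K (g n i) \<in> borel_measurable P" using g[OF i] t by (intro KP) auto
   then show "(%om. ennreal (K (g n i) om) * ennreal (V om (g n (Suc i)) - V om (g n i))) \<in> borel_measurable P"
    using Vm[of i] Vm[of "Suc i"] i by simp
  qed
  also have "... <= (\<Sum>i<n. ennreal (lam * (g n (Suc i) - g n i)) * (\<integral>\<^sup>+om. ennreal (K (g n i) om) \<partial>P))"
  proof (rule sum_mono)
   fix i assume "i \<in> {..<n}"
   then have i: "i < n" by simp
   have g1: "g n i <= 1" "g n (Suc i) <= 1" using g[OF i] t by auto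
   show "(\<integral>\<^sup>+om. ennreal (K (g n i) om) * ennreal (V om (g n (Suc i)) - V om (g n i)) \<partial>P)
    <= ennreal (lam * (g n (Suc i) - g n i)) * (\<integral>\<^sup>+om. ennreal (K (g n i) om) \<partial>P)"
   proof (rule nn_integral_subalgebra_bound[OF sub[OF g(1)[OF i]]])
    show "(%om. ennreal (V om (g n (Suc i)) - V om (g n i))) \<in> borel_measurable P"
     using Vm[of i] Vm[of "Suc i"] i by simp
    show "(%om. ennreal (K (g n i) om)) \<in> borel_measurable (Fl (g n i))"
     using K[OF g(1)[OF i] g1(1)] by simp
    show "(\<integral>\<^sup>+om. indicator A om * ennreal (V om (g n (Suc i)) - V om (g n i)) \<partial>P) <= ennreal (lam * (g n (Suc i) - g n i)) * emeasure P A"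
     if "A \<in> sets (Fl (g n i))" for A
     unfolding V_def by (rule cnt_le[OF x g(1)[OF i] g(2)[OF i] g1(2) that])
   qed
  qed
  also have "... = (\<Sum>i<n. ennreal (lam * (k (g n i) * (g n (Suc i) - g n i))))"
  proof (rule sum.cong[OF refl])
   fix i assume "i \<in> {..<n}"
   then have i: "i < n" by simp
   have g1: "g n i <= 1" "g n (Suc i) <= 1" using g[OF i] t by auto
   have "(\<integral>\<^sup>+om. ennreal (K (g n i) om) \<partial>P) = ennreal (k (g n i))"
    unfolding k_def by (rule nn_integral_eq_integral[OF E(1)[OF g(1)[OF i] g1(1)]]) (use nonneg[OF g(1)[OF i] g1(1)] in \<open>auto intro!: AE_I2\<close>)
   moreover have "0 <= k (g n i)" unfolding k_def using nonneg[OF g(1)[OF i] g1(1)] by (intro integral_nonneg_AE AE_I2)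
   ultimately show "ennreal (lam * (g n (Suc i) - g n i)) * (\<integral>\<^sup>+om. ennreal (K (g n i) om) \<partial>P) = ennreal (lam * (k (g n i) * (g n (Suc i) - g n i)))"
    using lam g[OF i] by (simp add: ennreal_mult[symmetric] mult_ac)
  qed
  also have "... = ennreal (lam * lsum n t k (%u. u))"
  proof -
   have "0 <= k (g n i) * (g n (Suc i) - g n i)" if i: "i < n" for i
    unfolding k_def using nonneg[OF g(1)[OF i]] g[OF i] t by (intro mult_nonneg_nonneg integral_nonneg_AE AE_I2) auto
   then show ?thesis using lam by (subst sum_ennreal) (auto simp: lsum_def g_def sum_distrib_left)
  qed
  finally show ?thesis .
 qed
 have lim1: "(%n. lsum n t (%s. K s om) (V om)) \<longlonglongrightarrow> (\<Sum>s\<in>S x om Int {..t}. K s om)" if "om \<in> space P" for om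
 proof -
  have "S x om \<subseteq> {0<..}" using S01[OF x that] by auto
  from lsum_jump_tendsto[OF lc[OF that] t finS[OF x that] this, of "%_. 1"] show ?thesis by (simp add: V_def[abs_def])
 qed
 have lim2: "(%n. lsum n t k (%u. u)) \<longlonglongrightarrow> (LBINT s:{0..t}. k s)"
 proof -
  have "(%n. lsum n t k (%u. LBINT s:{0..u}. 1)) \<longlonglongrightarrow> (LBINT s:{0..t}. k s * 1)"
   by (rule lsum_int_tendsto(1)[OF E(2) t set_integrable_const_Icc, where D="\<integral>om. D om \<partial>P"]) (use E(3) t in auto)
  moreover have "lsum n t k (%u. LBINT s:{0..u}. 1) = lsum n t k (%u. u)" for n
   unfolding lsum_def using t by (intro sum.cong refl arg_cong2[of _ _ _ _ "(*)"]) (auto simp: set_lebesgue_integral_def)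
  ultimately show ?thesis by simp
 qed
 have meas: "(%om. lsum (Suc n) t (%s. K s om) (V om)) \<in> borel_measurable P" for n
  unfolding lsum_def g_def[symmetric]
 proof (intro borel_measurable_sum borel_measurable_times borel_measurable_diff)
  fix i assume "i \<in> {..<Suc n}"
  then have i: "i < Suc n" by simp
  have g1: "0 <= g (Suc n) i" "0 <= g (Suc n) (Suc i)" "g (Suc n) i <= 1" "g (Suc n) (Suc i) <= 1" using g[OF i] t by auto
  show "K (g (Suc n) i) \<in> borel_measurable P" by (rule KP[OF g1(1,3)])
  show "(%om. V om (g (Suc n) i)) \<in> borel_measurable P"
   unfolding V_def by (rule mF[OF g1(1) cnt_meas[OF x g1(1,3)]])
  show "(%om. V om (g (Suc n) (Suc i))) \<in> borel_measurable P"
   unfolding V_def by (rule mF[OF g1(2) cnt_meas[OF x g1(2,4)]])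
 qed
 have lim3: "(%n. ennreal (lam * lsum (Suc n) t k (%u. u))) \<longlonglongrightarrow> ennreal (lam * (LBINT s:{0..t}. k s))"
  using LIMSEQ_Suc[OF lim2] by (intro tendsto_ennrealI tendsto_mult_left)
 have "(\<integral>\<^sup>+om. ennreal (\<Sum>s\<in>S x om Int {..t}. K s om) \<partial>P) = (\<integral>\<^sup>+om. liminf (%n. ennreal (lsum (Suc n) t (%s. K s om) (V om))) \<partial>P)"
  by (intro nn_integral_cong lim_imp_Liminf[symmetric] tendsto_ennrealI LIMSEQ_Suc[OF lim1]) auto
 also have "... <= liminf (%n. \<integral>\<^sup>+om. ennreal (lsum (Suc n) t (%s. K s om) (V om)) \<partial>P)"
  by (rule nn_integral_liminf) (use meas in simp)
 also have "... <= liminf (%n. ennreal (lam * lsum (Suc n) t k (%u. u)))"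
  by (intro Liminf_mono always_eventually allI step) simp
 also have "... = ennreal (lam * (LBINT s:{0..t}. k s))"
  by (rule lim_imp_Liminf[OF _ lim3]) simp
 finally show ?thesis by (simp add: k_def)
qed

lemma cl_adapted:
 assumes "0 <= s" "s <= 1" and x: "x \<in> X"
 shows "(%om. real (card (S x om Int {..<s}))) \<in> borel_measurable (Fl s)"
proof (cases "s = 0")
 case True
 have "(%om. real (card (S x om Int {..<s}))) \<in> borel_measurable (Fl s) \<longleftrightarrow> (%om. 0::real) \<in> borel_measurable (Fl s)"
 proof (rule measurable_cong)
  fix om assume "om \<in> space (Fl s)"
  then have "S x om Int {..<s} = {}" using S01[OF x] spF assms True by fastforce
  then show "real (card (S x om Int {..<s})) = 0" by simp
 qed
 then show ?thesis by simp
next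
 case False
 then have s: "0 < s" using assms by simp
 have at: "filterlim (%n. s - s / real (Suc n)) (at_left s) sequentially"
  unfolding filterlim_at
 proof (intro conjI)
  show "(%n. s - s / real (Suc n)) \<longlonglongrightarrow> s" by real_asymp
  show "\<forall>\<^sub>F n in sequentially. s - s / real (Suc n) \<in> {..<s} & s - s / real (Suc n) ~= s"
   using s by (intro always_eventually allI) auto
 qed
 show ?thesis
 proof (rule borel_measurable_LIMSEQ_real[where u="%n om. real (card (S x om Int {..s - s / real (Suc n)}))"])
  fix n
  have "0 <= s - s / real (Suc n)" "s - s / real (Suc n) <= s" using s by (auto simp: field_simps)
  then show "(%om. real (card (S x om Int {..s - s / real (Suc n)}))) \<in> borel_measurable (Fl s)"
   using assms by (intro mFF[OF _ _ cnt_meas[OF x]]) linarith+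
 next
  fix om assume "om \<in> space (Fl s)"
  then have "om \<in> space P" using spF assms by simp
  from finite_eventually_left(2)[OF finS[OF x this], of s]
  have "\<forall>\<^sub>F n in sequentially. S x om Int {..s - s / real (Suc n)} = S x om Int {..<s}"
   by (rule eventually_compose_filterlim[OF _ at])
  then show "(%n. real (card (S x om Int {..s - s / real (Suc n)}))) \<longlonglongrightarrow> real (card (S x om Int {..<s}))"
   by (rule tendsto_eventually[OF eventually_mono]) simp
 qed
qed

lemma cl_adapted': "0 <= s ==> s <= 1 ==> cl s \<in> measurable (Fl s) (count_space UNIV)"
proof -
 assume s: "0 <= s" "s <= 1"
 have "(%om. nat \<lfloor>\<Sum>x\<in>X. real (card (S x om Int {..<s}))\<rfloor>) \<in> measurable (Fl s) (count_space UNIV)"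
  using cl_adapted[OF s] by measurable
 moreover have "nat \<lfloor>\<Sum>x\<in>X. real (card (S x om Int {..<s}))\<rfloor> = cl s om" for om
  unfolding cl_def of_nat_sum[symmetric] floor_of_nat nat_int ..
 ultimately show ?thesis by simp
qed

section \<open>Moments of the total number of jumps\<close>

lemma N_measurable: "N \<in> measurable P (count_space UNIV)"
proof -
 have m: "(%om. real (card (S x om Int {..1}))) \<in> borel_measurable P" if "x \<in> X" for x
  by (rule mF[OF _ cnt_meas[OF that]]) auto
 have "(%om. nat \<lfloor>\<Sum>x\<in>X. real (card (S x om Int {..1}))\<rfloor>) \<in> measurable P (count_space UNIV)"
  using m by measurable
 moreover have "nat \<lfloor>\<Sum>x\<in>X. real (card (S x om Int {..1}))\<rfloor> = N om" if "om \<in> space P" for om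
 proof -
  have "S x om Int {..1} = S x om" if "x \<in> X" for x using S01[OF that \<open>om \<in> space P\<close>] by auto
  then show ?thesis unfolding of_nat_sum[symmetric] N_def floor_of_nat nat_int by simp
 qed
 ultimately show ?thesis by (rule measurable_cong[THEN iffD1, rotated])
qed

lemma cl_le: "om \<in> space P ==> cl s om <= N om"
 unfolding cl_def N_def using finS by (intro sum_mono card_mono) auto

lemma cl_lcont: "om \<in> space P ==> lcont (%s. f (cl s om))"
proof (rule lcontI_eventually)
 fix s :: real assume om: "om \<in> space P"
 have "\<forall>\<^sub>F r in at_left s. \<forall>x\<in>X. S x om Int {..<r} = S x om Int {..<s}"
  using finite_eventually_left(1)[OF finS[OF _ om]] finX by (simp add: eventually_ball_finite_distrib)
 then show "\<forall>\<^sub>F r in at_left s. f (cl r om) = f (cl s om)"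
 proof eventually_elim
  case (elim r)
  then have "cl r om = cl s om" unfolding cl_def by (intro sum.cong) simp_all
  then show ?case by simp
 qed
qed

text \<open>Jump times of different sites are disjoint, so all jumps can be ranked together and
  \<open>sum_card_below\<close> applies to their union.\<close>

lemma sum_cl:
 assumes om: "om \<in> space P"
 shows "(\<Sum>x\<in>X. \<Sum>s\<in>S x om. f (cl s om)) = (\<Sum>i<N om. f i :: real)"
proof -
 define U where "U = (\<Union>x\<in>X. S x om)"
 have "card (U Int {..<s}) = cl s om" for s
 proof -
  have "card (\<Union>x\<in>X. S x om Int {..<s}) = cl s om"
   unfolding cl_def by (rule card_UN_disjoint) (use finX finS[OF _ om] disj[OF _ _ _ om] in auto)
  moreover have "U Int {..<s} = (\<Union>x\<in>X. S x om Int {..<s})" by (auto simp: U_def)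
  ultimately show ?thesis by simp
 qed
 moreover have "card U = N om"
  unfolding U_def N_def by (rule card_UN_disjoint) (use finX finS[OF _ om] disj[OF _ _ _ om] in auto)
 moreover have "finite U" using finX finS[OF _ om] by (auto simp: U_def)
 moreover have "(\<Sum>s\<in>U. f (cl s om)) = (\<Sum>x\<in>X. \<Sum>s\<in>S x om. f (cl s om))"
  unfolding U_def by (rule sum.UNION_disjoint) (use finX finS[OF _ om] disj[OF _ _ _ om] in auto)
 ultimately show ?thesis using sum_card_below[of U f] by simp
qed

lemma binom_moment_min:
 "(\<integral>\<^sup>+om. ennreal (real (min (N om) R choose q)) \<partial>P) <= ennreal ((real (card X) * lam) ^ q)"
proof (induction q)
 case 0
 then show ?case by (simp add: emeasure_space_1)
next
 case (Suc q)
 define K where "K s om = real (min (cl s om) R choose q)" for s om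
 define B where "B om = real (min (N om) R choose q)" for om
 have Bm: "B \<in> borel_measurable P" unfolding B_def using N_measurable by measurable
 have KB: "K s om <= B om" if "om \<in> space P" for s om
  unfolding K_def B_def using cl_le[OF that, of s] by (intro of_nat_mono binomial_right_mono) auto
 have BR: "B om <= real (R choose q)" for om unfolding B_def by (intro of_nat_mono binomial_right_mono) auto
 have iB: "integrable P B"
  by (rule integrable_const_bound[of _ "real (R choose q)"]) (use BR Bm in \<open>auto simp: B_def\<close>)
 have Km: "K s \<in> borel_measurable (Fl s)" if "0 <= s" "s <= 1" for s
  unfolding K_def using cl_adapted'[OF that] by measurable
 have lc: "lcont (%s. K s om)" if "om \<in> space P" for om unfolding K_def by (rule cl_lcont[OF that])
 have EB: "ennreal (\<integral>om. B om \<partial>P) <= ennreal ((real (card X) * lam) ^ q)"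
  using Suc nn_integral_eq_integral[OF iB] unfolding B_def by simp
 then have EB': "(\<integral>om. B om \<partial>P) <= (real (card X) * lam) ^ q" using lam by (subst (asm) ennreal_le_iff) auto
 have one: "(\<integral>\<^sup>+om. ennreal (\<Sum>s\<in>S x om. K s om) \<partial>P) <= ennreal (lam * (real (card X) * lam) ^ q)" if x: "x \<in> X" for x
 proof -
  have "(\<integral>\<^sup>+om. ennreal (\<Sum>s\<in>S x om. K s om) \<partial>P) = (\<integral>\<^sup>+om. ennreal (\<Sum>s\<in>S x om Int {..1}. K s om) \<partial>P)"
  proof (intro nn_integral_cong)
   fix om assume "om \<in> space P"
   then have "S x om Int {..1} = S x om" using S01[OF x] by fastforce
   then show "ennreal (\<Sum>s\<in>S x om. K s om) = ennreal (\<Sum>s\<in>S x om Int {..1}. K s om)" by simp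
  qed
  also have "... <= ennreal (lam * (LBINT s:{0..1}. (\<integral>om. K s om \<partial>P)))"
   by (rule jump_sum_le[OF x zero_less_one order.refl Km lc _ KB iB]) (simp_all add: K_def)
  also have "... <= ennreal (lam * (real (card X) * lam) ^ q)"
  proof (intro ennreal_leI mult_left_mono lam)
   have KP: "K s \<in> borel_measurable P" if "0 <= s" "s <= 1" for s using mF[OF that(1) Km[OF that]] .
   have KB': "\<bar>K s om\<bar> <= B om" if "0 <= s" "s <= 1" "om \<in> space P" for s om
    using KB[OF that(3), of s] by (simp add: K_def)
   have E3: "!!s. 0 <= s ==> s <= 1 ==> \<bar>\<integral>om. K s om \<partial>P\<bar> <= (\<integral>om. B om \<partial>P)"
    and E2: "lcont (%s. \<integral>om. K s om \<partial>P)"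
    by (rule expect_lcont[where K=K and D=B]; (assumption | rule KP lc KB' iB)+)+
   have "(LBINT s:{0..1}. (\<integral>om. K s om \<partial>P)) <= (LBINT s:{0..1::real}. (\<integral>om. B om \<partial>P))"
   proof (rule set_integral_mono)
    show "set_integrable lborel {0..1} (%s. \<integral>om. K s om \<partial>P)"
     using lsum_int_tendsto(2)[OF E2 _ _ set_integrable_const_Icc[of 0 1 1], of "\<integral>om. B om \<partial>P"] E3 by simp
   qed (use E3 set_integrable_const_Icc in \<open>auto intro: order.trans[OF abs_ge_self]\<close>)
   also have "... = (\<integral>om. B om \<partial>P)" by (simp add: set_lebesgue_integral_def)
   finally show "(LBINT s:{0..1}. (\<integral>om. K s om \<partial>P)) <= (real (card X) * lam) ^ q" using EB' by simp
  qed
  finally show ?thesis .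
 qed
 have Sm: "(%om. \<Sum>s\<in>S x om. K s om) \<in> borel_measurable P" if x: "x \<in> X" for x
 proof (rule borel_measurable_LIMSEQ_real[where u="%n om. lsum (Suc n) 1 (%s. K s om) (%u. real (card (S x om Int {..u})))"])
  fix n show "(%om. lsum (Suc n) 1 (%s. K s om) (%u. real (card (S x om Int {..u})))) \<in> borel_measurable P"
   unfolding lsum_def
  proof (intro borel_measurable_sum borel_measurable_times borel_measurable_diff)
   fix i assume "i \<in> {..<Suc n}"
   then have "i < Suc n" by simp
   then have g1: "0 <= real i * 1 / real (Suc n)" "real i * 1 / real (Suc n) <= 1"
     "0 <= real (Suc i) * 1 / real (Suc n)" "real (Suc i) * 1 / real (Suc n) <= 1" by (auto simp: field_simps)
   show "K (real i * 1 / real (Suc n)) \<in> borel_measurable P" by (rule mF[OF g1(1) Km[OF g1(1,2)]])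
   show "(%om. real (card (S x om Int {..real i * 1 / real (Suc n)}))) \<in> borel_measurable P" by (rule mF[OF g1(1) cnt_meas[OF x g1(1,2)]])
   show "(%om. real (card (S x om Int {..real (Suc i) * 1 / real (Suc n)}))) \<in> borel_measurable P" by (rule mF[OF g1(3) cnt_meas[OF x g1(3,4)]])
  qed
 next
  fix om assume om: "om \<in> space P"
  have e: "S x om Int {..1} = S x om" "S x om \<subseteq> {0<..}" using S01[OF x om] by auto
  from LIMSEQ_Suc[OF lsum_jump_tendsto[OF lc[OF om] _ _ finS[OF x om] e(2), of 1 "%_. 1"]]
  show "(%n. lsum (Suc n) 1 (%s. K s om) (%u. real (card (S x om Int {..u})))) \<longlonglongrightarrow> (\<Sum>s\<in>S x om. K s om)"
   by (simp add: e)
 qed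
 have "(\<integral>\<^sup>+om. ennreal (real (min (N om) R choose Suc q)) \<partial>P) <= (\<integral>\<^sup>+om. (\<Sum>x\<in>X. ennreal (\<Sum>s\<in>S x om. K s om)) \<partial>P)"
 proof (rule nn_integral_mono)
  fix om assume om: "om \<in> space P"
  have bs: "(\<Sum>i<M. real (i choose q)) = real (M choose Suc q)" for M
   by (induction M) (auto simp: add.commute)
  have "real (min (N om) R choose Suc q) = (\<Sum>i<min (N om) R. real (min i R choose q))"
   unfolding bs[symmetric] by (rule sum.cong) auto
  also have "... <= (\<Sum>i<N om. real (min i R choose q))" by (rule sum_mono2) auto
  also have "... = (\<Sum>x\<in>X. \<Sum>s\<in>S x om. K s om)" unfolding K_def sum_cl[OF om, of "%i. real (min i R choose q)"] ..
  finally have "real (min (N om) R choose Suc q) <= (\<Sum>x\<in>X. \<Sum>s\<in>S x om. K s om)" .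
  then show "ennreal (real (min (N om) R choose Suc q)) <= (\<Sum>x\<in>X. ennreal (\<Sum>s\<in>S x om. K s om))"
   by (subst sum_ennreal) (auto intro!: ennreal_leI sum_nonneg simp: K_def)
 qed
 also have "... = (\<Sum>x\<in>X. \<integral>\<^sup>+om. ennreal (\<Sum>s\<in>S x om. K s om) \<partial>P)"
  by (rule nn_integral_sum) (use Sm in simp)
 also have "... <= (\<Sum>x\<in>X. ennreal (lam * (real (card X) * lam) ^ q))" by (intro sum_mono one)
 also have "... = ennreal ((real (card X) * lam) ^ Suc q)"
  using lam by (subst sum_ennreal) (auto simp: mult_ac)
 finally show ?case .
qed

lemma binom_moment:
 "(\<integral>\<^sup>+om. ennreal (real (N om choose q)) \<partial>P) <= ennreal ((real (card X) * lam) ^ q)"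
proof -
 have "(\<integral>\<^sup>+om. ennreal (real (N om choose q)) \<partial>P) = (\<integral>\<^sup>+om. liminf (%R. ennreal (real (min (N om) R choose q))) \<partial>P)"
 proof (intro nn_integral_cong lim_imp_Liminf[symmetric])
  fix om
  have "\<forall>\<^sub>F R in sequentially. ennreal (real (min (N om) R choose q)) = ennreal (real (N om choose q))"
   by (rule eventually_sequentiallyI[of "N om"]) auto
  then show "(%R. ennreal (real (min (N om) R choose q))) \<longlonglongrightarrow> ennreal (real (N om choose q))" by (rule tendsto_eventually)
 qed simp
 also have "... <= liminf (%R. \<integral>\<^sup>+om. ennreal (real (min (N om) R choose q)) \<partial>P)"
  by (rule nn_integral_liminf) (use N_measurable in measurable)
 also have "... <= liminf (%R. ennreal ((real (card X) * lam) ^ q))"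
  by (intro Liminf_mono always_eventually allI binom_moment_min)
 finally show ?thesis by (simp add: Liminf_const)
qed

text \<open>For \<open>q <= N\<close> the bound \<open>(N/q)^q <= N choose q\<close> compares powers
  with binomials; smaller values of \<open>N\<close> are covered by the constant
  \<open>q^q\<close>.\<close>

lemma N_pow_integrable: "integrable P (%om. (1 + real (N om)) ^ q)"
proof (rule Bochner_Integration.integrable_bound)
 show "integrable P (%om. 2 ^ q * (1 + (real q ^ q + real q ^ q * real (N om choose q))))"
 proof (intro integrable_mult_right Bochner_Integration.integrable_add integrable_const)
  show "integrable P (%om. real (N om choose q))"
  proof (rule integrableI_bounded)
   show "(%om. real (N om choose q)) \<in> borel_measurable P" using N_measurable by measurable
   show "(\<integral>\<^sup>+om. ennreal (norm (real (N om choose q))) \<partial>P) < \<infinity>"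
    using order.strict_trans1[OF binom_moment] by simp
  qed
 qed
 show "(%om. (1 + real (N om)) ^ q) \<in> borel_measurable P" using N_measurable by measurable
 show "AE om in P. norm ((1 + real (N om)) ^ q) <= norm (2 ^ q * (1 + (real q ^ q + real q ^ q * real (N om choose q))))"
 proof (rule AE_I2)
  fix om
  have 1: "real (N om) ^ q <= real q ^ q + real q ^ q * real (N om choose q)"
  proof (cases "q <= N om")
   case True
   have "real q ^ q * (real (N om) / real q) ^ q <= real q ^ q * real (N om choose q)"
    by (intro mult_left_mono binomial_ge_n_over_k_pow_k True) auto
   then show ?thesis by (cases "q = 0") (auto simp: power_divide intro: order.trans)
  next
   case False
   then have "real (N om) ^ q <= real q ^ q" by (intro power_mono) auto
   then show ?thesis by (simp add: add_increasing2)
  qed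
  have "(1 + real (N om)) ^ q <= (2 * max 1 (real (N om))) ^ q" by (intro power_mono) auto
  also have "... = 2 ^ q * max 1 (real (N om)) ^ q" by (simp add: power_mult_distrib)
  also have "... <= 2 ^ q * (1 + real (N om) ^ q)" by (intro mult_left_mono) (auto simp: max_def)
  also have "... <= 2 ^ q * (1 + (real q ^ q + real q ^ q * real (N om choose q)))" using 1 by (intro mult_left_mono) auto
  finally show "norm ((1 + real (N om)) ^ q) <= norm (2 ^ q * (1 + (real q ^ q + real q ^ q * real (N om choose q))))"
   by simp
 qed
qed

text \<open>The expected number of jumps in an interval shrinking to \<open>t\<close> from the left
  is at most \<open>lam\<close> times its length. This is what allows sums over
  \<open>{..<t}\<close> and \<open>{..t}\<close> to be exchanged almost surely.\<close>

lemma AE_no_jump: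
 assumes x: "x \<in> X" and t: "0 <= t" "t <= 1"
 shows "AE om in P. t \<notin> S x om"
proof (cases "t = 0")
 case True
 then show ?thesis using S01[OF x] by (intro AE_I2) fastforce
next
 case False
 then have t0: "0 < t" using t by simp
 define W where "W om = ennreal (real (card (S x om Int {..t})) - real (card (S x om Int {..<t})))" for om
 have Wm: "W \<in> borel_measurable P" unfolding W_def
  using mF[OF t(1) cnt_meas[OF x t]] mF[OF t(1) cl_adapted[OF t x]] by simp
 have "(\<integral>\<^sup>+om. W om \<partial>P) <= ennreal e" if e: "e > 0" for e
 proof -
  \<comment> \<open>Chosen so that \<open>lam * (t - s) <= e\<close>; the \<open>+ 1\<close> avoids
    division by 0 when \<open>lam = 0\<close>.\<close>
  define s where "s = max 0 (t - e / (lam + 1))"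
  have s: "0 <= s" "s < t" "lam * (t - s) <= e"
  proof -
   show "0 <= s" "s < t" using t0 e lam by (auto simp: s_def)
   have "lam * (t - s) <= (lam + 1) * (e / (lam + 1))" using lam by (intro mult_mono) (auto simp: s_def t less_imp_le[OF e])
   also have "... = e" using lam by simp
   finally show "lam * (t - s) <= e" .
  qed
  have "(\<integral>\<^sup>+om. W om \<partial>P) <= (\<integral>\<^sup>+om. indicator (space P) om * ennreal (real (card (S x om Int {..t})) - real (card (S x om Int {..s}))) \<partial>P)"
  proof (rule nn_integral_mono)
   fix om assume om: "om \<in> space P"
   have "card (S x om Int {..s}) <= card (S x om Int {..<t})" using finS[OF x om] s by (intro card_mono) auto
   then show "W om <= indicator (space P) om * ennreal (real (card (S x om Int {..t})) - real (card (S x om Int {..s})))"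
    using om by (auto simp: W_def intro!: ennreal_leI)
  qed
  also have "... <= ennreal (lam * (t - s)) * emeasure P (space P)"
   by (rule cnt_le[OF x s(1) less_imp_le[OF s(2)] t(2)]) (simp add: spF[OF s(1), symmetric])
  also have "... <= ennreal e" using s(3) by (simp add: emeasure_space_1 ennreal_leI)
  finally show ?thesis .
 qed
 note small = this
 have "(\<integral>\<^sup>+om. W om \<partial>P) <= 0"
 proof (rule ennreal_le_epsilon)
  fix e :: real assume "0 < e"
  then show "(\<integral>\<^sup>+om. W om \<partial>P) <= 0 + ennreal e" using small[of e] by simp
 qed
 then have "(\<integral>\<^sup>+om. W om \<partial>P) = 0" by simp
 then have "AE om in P. W om = 0" using Wm by (simp add: nn_integral_0_iff_AE)
 then show ?thesis
 proof (rule AE_mp[OF _ AE_I2], intro impI notI)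
  fix om assume om: "om \<in> space P" and W: "W om = 0" and tS: "t \<in> S x om"
  have "S x om Int {..t} = insert t (S x om Int {..<t})" using tS by auto
  then show False using W finS[OF x om] by (simp add: W_def)
 qed
qed

end

text \<open>Holds also for a non-integrable \<open>f\<close>, whose integral is 0 by
  convention.\<close>

lemma LBINT_abs_le:
 fixes f :: "real => real"
 assumes "a <= b" "!!s. s \<in> {a..b} ==> \<bar>f s\<bar> <= M"
 shows "\<bar>LBINT s:{a..b}. f s\<bar> <= M * (b - a)"
proof (cases "set_integrable lborel {a..b} f")
 case True
 have "\<bar>LBINT s:{a..b}. f s\<bar> <= (LBINT s:{a..b}. \<bar>f s\<bar>)"
  unfolding set_lebesgue_integral_def by (rule order.trans[OF integral_abs_bound]) (simp add: abs_mult)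
 also have "... <= (LBINT s:{a..b}. M)"
  by (rule set_integral_mono[OF set_integrable_abs[OF True] set_integrable_const_Icc]) (use assms in auto)
 also have "... = M * (b - a)" using assms(1) by (simp add: set_lebesgue_integral_def)
 finally show ?thesis .
next
 case False
 have "0 <= M" using assms(2)[of a] assms(1) by fastforce
 moreover have "(LBINT s:{a..b}. f s) = 0" using False
  unfolding set_lebesgue_integral_def set_integrable_def by (rule not_integrable_integral_eq)
 ultimately show ?thesis using assms(1) by simp
qed

lemma filterlim_left_seq:
 assumes "0 < (t::real)"
 shows "filterlim (%n. t - t / real (Suc n)) (at_left t) sequentially"
 unfolding filterlim_at
proof (intro conjI)
 show "(%n. t - t / real (Suc n)) \<longlonglongrightarrow> t" by real_asymp
 show "\<forall>\<^sub>F n in sequentially. t - t / real (Suc n) \<in> {..<t} & t - t / real (Suc n) ~= t"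
  using assms by (intro always_eventually allI) auto
qed

lemma grid_bounds:
 assumes "0 < (t::real)" "i < n"
 shows "0 <= real i * t / real n" "real i * t / real n <= real (Suc i) * t / real n" "real (Suc i) * t / real n <= t"
proof -
 have "real (Suc i) * t <= real n * t" using assms by (intro mult_right_mono) auto
 then show "real (Suc i) * t / real n <= t" using assms by (simp add: pos_divide_le_eq mult.commute)
 show "0 <= real i * t / real n" "real i * t / real n <= real (Suc i) * t / real n"
  using assms by (auto simp: divide_right_mono mult_right_mono)
qed

section \<open>Admissible integrands, jump heights and drifts\<close>

context jump_process begin

text \<open>\<open>N\<close> has moments of every order, so a measurable variable of this kind has
  them too.\<close>

definition poly_bounded :: "('a => real) => bool" where
 "poly_bounded f \<longleftrightarrow> (\<exists>c q. \<forall>om\<in>space P. \<bar>f om\<bar> <= c * (1 + real (N om)) ^ q)"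

lemma poly_boundedI: "(!!om. om \<in> space P ==> \<bar>f om\<bar> <= c * (1 + real (N om)) ^ q) ==> poly_bounded f"
 unfolding poly_bounded_def by blast

lemma poly_bounded_integrable:
 assumes "poly_bounded f" "f \<in> borel_measurable P"
 shows "integrable P f"
proof -
 obtain c q where "\<forall>om\<in>space P. \<bar>f om\<bar> <= c * (1 + real (N om)) ^ q"
  using assms(1) unfolding poly_bounded_def by blast
 then show ?thesis
  by (intro Bochner_Integration.integrable_bound[OF integrable_mult_right[OF N_pow_integrable] assms(2), of c q] AE_I2) force
qed

text \<open>Left-continuous adapted processes play the role of predictable ones. The polynomial
  bound in \<open>N\<close>, uniform in time, is stable under sums, products, powers and integration
  against jumps or drifts, so one definition settles the integrability of everything that
  follows.\<close>

definition nice :: "(real => 'a => real) => bool" where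
 "nice K \<longleftrightarrow> (\<forall>s. 0 <= s & s <= 1 --> K s \<in> borel_measurable (Fl s)) & (\<forall>om\<in>space P. lcont (%s. K s om))
  & (\<exists>c q. \<forall>s om. 0 <= s & s <= 1 --> om \<in> space P --> \<bar>K s om\<bar> <= c * (1 + real (N om)) ^ q)"

lemma niceI:
 assumes "!!s. 0 <= s ==> s <= 1 ==> K s \<in> borel_measurable (Fl s)"
  "!!om. om \<in> space P ==> lcont (%s. K s om)"
  "!!s om. 0 <= s ==> s <= 1 ==> om \<in> space P ==> \<bar>K s om\<bar> <= c * (1 + real (N om)) ^ q"
 shows "nice K"
 unfolding nice_def using assms by blast

lemma nice_adapted: "nice K ==> 0 <= s ==> s <= 1 ==> K s \<in> borel_measurable (Fl s)"
 by (simp add: nice_def)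

lemma nice_measurable: "nice K ==> 0 <= s ==> s <= 1 ==> K s \<in> borel_measurable P"
 by (rule mF[OF _ nice_adapted])

lemma nice_lcont: "nice K ==> om \<in> space P ==> lcont (%s. K s om)"
 by (simp add: nice_def)

lemma nice_bound:
 assumes "nice K"
 obtains c q where "0 <= c" "!!s om. 0 <= s ==> s <= 1 ==> om \<in> space P ==> \<bar>K s om\<bar> <= c * (1 + real (N om)) ^ q"
proof -
 obtain c q where *: "\<forall>s om. 0 <= s & s <= 1 --> om \<in> space P --> \<bar>K s om\<bar> <= c * (1 + real (N om)) ^ q"
  using assms unfolding nice_def by blast
 \<comment> \<open>A sample point is needed to see that the constant \<open>c\<close> of the bound
   is nonnegative.\<close>
 obtain om where "om \<in> space P" using not_empty by blast
 with * have "0 <= c * (1 + real (N om)) ^ q" by (meson abs_ge_zero order.trans zero_le_one order.refl)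
 then have "0 <= c" by (simp add: zero_le_mult_iff) (smt (verit) zero_less_power of_nat_0_le_iff)
 with * that show ?thesis by blast
qed

lemma nice_integrable: "nice K ==> 0 <= s ==> s <= 1 ==> integrable P (K s)"
proof -
 assume K: "nice K" and s: "0 <= s" "s <= 1"
 obtain c q where "0 <= c" "!!s om. 0 <= s ==> s <= 1 ==> om \<in> space P ==> \<bar>K s om\<bar> <= c * (1 + real (N om)) ^ q"
  using nice_bound[OF K] by blast
 with s show ?thesis by (intro poly_bounded_integrable[OF poly_boundedI nice_measurable[OF K s]]) blast
qed

lemma nice_expect:
 assumes "nice K"
 shows "lcont (%s. \<integral>om. K s om \<partial>P)" "\<exists>M. \<forall>s. 0 <= s & s <= 1 --> \<bar>\<integral>om. K s om \<partial>P\<bar> <= M"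
  and "t <= 1 ==> set_integrable lborel {0..t} (%s. \<integral>om. K s om \<partial>P)"
proof -
 obtain c q where c: "!!s om. 0 <= s ==> s <= 1 ==> om \<in> space P ==> \<bar>K s om\<bar> <= c * (1 + real (N om)) ^ q"
  using nice_bound[OF assms] by metis
 note iD = integrable_mult_right[OF N_pow_integrable, of c q]
 show lc: "lcont (%s. \<integral>om. K s om \<partial>P)"
  by (rule expect_lcont(2)[where K=K and D="%om. c * (1 + real (N om)) ^ q"]; (assumption | rule nice_measurable[OF assms] nice_lcont[OF assms] c iD)+)
 have b: "\<bar>\<integral>om. K s om \<partial>P\<bar> <= (\<integral>om. c * (1 + real (N om)) ^ q \<partial>P)" if "0 <= s" "s <= 1" for s
  by (rule expect_lcont(3)[where K=K and D="%om. c * (1 + real (N om)) ^ q"]; (assumption | rule nice_measurable[OF assms] nice_lcont[OF assms] c iD that)+)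
 then show "\<exists>M. \<forall>s. 0 <= s & s <= 1 --> \<bar>\<integral>om. K s om \<partial>P\<bar> <= M" by blast
 assume t: "t <= 1"
 have "set_integrable lborel {0..1} (%s. (\<integral>om. K s om \<partial>P) * 1)"
  by (rule lsum_int_tendsto(2)[OF lc zero_less_one order.refl set_integrable_const_Icc, where D="\<integral>om. c * (1 + real (N om)) ^ q \<partial>P"]) (rule b)
 then have "set_integrable lborel {0..1} (%s. (\<integral>om. K s om \<partial>P))" by simp
 then show "set_integrable lborel {0..t} (%s. \<integral>om. K s om \<partial>P)"
  by (rule set_integrable_subset) (use t in auto)
qed

lemma nice_const: "nice (%_ _. c)"
 by (rule niceI[where c="\<bar>c\<bar>" and q=0]) (auto simp: lcont_def)

lemma nice_add:
 assumes "nice K" "nice L"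
 shows "nice (%s om. K s om + L s om)"
proof -
 obtain c q where c: "0 <= c" "!!s om. 0 <= s ==> s <= 1 ==> om \<in> space P ==> \<bar>K s om\<bar> <= c * (1 + real (N om)) ^ q"
  using nice_bound[OF assms(1)] by blast
 obtain c' q' where c': "0 <= c'" "!!s om. 0 <= s ==> s <= 1 ==> om \<in> space P ==> \<bar>L s om\<bar> <= c' * (1 + real (N om)) ^ q'"
  using nice_bound[OF assms(2)] by blast
 show ?thesis
 proof (rule niceI[where c="c + c'" and q="q + q'"])
  fix s :: real and om assume s: "0 <= s" "s <= 1" "om \<in> space P"
  have "c * (1 + real (N om)) ^ q <= c * (1 + real (N om)) ^ (q + q')" "c' * (1 + real (N om)) ^ q' <= c' * (1 + real (N om)) ^ (q + q')"
   using c(1) c'(1) by (auto intro!: mult_left_mono power_increasing)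
  then show "\<bar>K s om + L s om\<bar> <= (c + c') * (1 + real (N om)) ^ (q + q')"
   using c(2)[OF s] c'(2)[OF s] by (simp add: distrib_right)
 next
  fix om assume "om \<in> space P"
  then show "lcont (%s. K s om + L s om)"
   using nice_lcont[OF assms(1)] nice_lcont[OF assms(2)] by (auto simp: lcont_def intro!: tendsto_add)
 qed (intro borel_measurable_add nice_adapted assms)
qed

lemma nice_mult:
 assumes "nice K" "nice L"
 shows "nice (%s om. K s om * L s om)"
proof -
 obtain c q where c: "0 <= c" "!!s om. 0 <= s ==> s <= 1 ==> om \<in> space P ==> \<bar>K s om\<bar> <= c * (1 + real (N om)) ^ q"
  using nice_bound[OF assms(1)] by blast
 obtain c' q' where c': "0 <= c'" "!!s om. 0 <= s ==> s <= 1 ==> om \<in> space P ==> \<bar>L s om\<bar> <= c' * (1 + real (N om)) ^ q'"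
  using nice_bound[OF assms(2)] by blast
 show ?thesis
 proof (rule niceI[where c="c * c'" and q="q + q'"])
  fix s :: real and om assume s: "0 <= s" "s <= 1" "om \<in> space P"
  have "\<bar>K s om\<bar> * \<bar>L s om\<bar> <= (c * (1 + real (N om)) ^ q) * (c' * (1 + real (N om)) ^ q')"
   using c(1) by (intro mult_mono c(2)[OF s] c'(2)[OF s]) auto
  then show "\<bar>K s om * L s om\<bar> <= (c * c') * (1 + real (N om)) ^ (q + q')"
   by (simp add: abs_mult power_add mult_ac)
 next
  fix om assume "om \<in> space P"
  then show "lcont (%s. K s om * L s om)"
   using nice_lcont[OF assms(1)] nice_lcont[OF assms(2)] by (auto simp: lcont_def intro!: tendsto_mult)
 qed (intro borel_measurable_times nice_adapted assms)
qed

lemma nice_sum: "finite I ==> (!!i. i \<in> I ==> nice (K i)) ==> nice (%s om. \<Sum>i\<in>I. K i s om)"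
 by (induction I rule: finite_induct) (auto intro: nice_const nice_add)

lemma nice_comp:
 assumes K: "nice K" and g: "continuous_on UNIV g" and gb: "!!x. \<bar>g x\<bar> <= c * (1 + \<bar>x\<bar>) ^ q"
 shows "nice (%s om. g (K s om))"
proof -
 obtain c' q' where c': "0 <= c'" "!!s om. 0 <= s ==> s <= 1 ==> om \<in> space P ==> \<bar>K s om\<bar> <= c' * (1 + real (N om)) ^ q'"
  using nice_bound[OF K] by blast
 have c0: "0 <= c" using gb[of 0] by simp
 show ?thesis
 proof (rule niceI[where c="c * (1 + c') ^ q" and q="q' * q"])
  fix s :: real assume "0 <= s" "s <= 1"
  then have "K s \<in> borel_measurable (Fl s)" by (rule nice_adapted[OF K])
  then show "(%om. g (K s om)) \<in> borel_measurable (Fl s)"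
   using borel_measurable_continuous_onI[OF g] by measurable
 next
  fix om assume "om \<in> space P"
  then show "lcont (%s. g (K s om))" using nice_lcont[OF K, of om] g
   unfolding lcont_def by (metis isCont_tendsto_compose continuous_on_eq_continuous_at open_UNIV UNIV_I)
 next
  fix s :: real and om assume s: "0 <= s" "s <= 1" "om \<in> space P"
  have p1: "1 <= (1 + real (N om)) ^ q'" by (simp add: one_le_power)
  have "\<bar>g (K s om)\<bar> <= c * (1 + \<bar>K s om\<bar>) ^ q" by (rule gb)
  also have "... <= c * ((1 + c') * (1 + real (N om)) ^ q') ^ q"
  proof (intro mult_left_mono power_mono c0)
   show "1 + \<bar>K s om\<bar> <= (1 + c') * (1 + real (N om)) ^ q'"
    using c'(2)[OF s] p1 unfolding distrib_right by linarith
  qed simp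
  also have "... = c * (1 + c') ^ q * (1 + real (N om)) ^ (q' * q)"
   by (simp add: power_mult_distrib power_mult)
  finally show "\<bar>g (K s om)\<bar> <= c * (1 + c') ^ q * (1 + real (N om)) ^ (q' * q)" .
 qed
qed

lemma nice_abs: "nice K ==> nice (%s om. \<bar>K s om\<bar>)"
 by (rule nice_comp[where c=1 and q=1]) (auto intro: continuous_intros)

text \<open>Turns a factor known at time \<open>t\<close> into an integrand: the strict inequality
  \<open>t < s\<close> is left-continuous in \<open>s\<close>, and \<open>Z\<close> is already known
  wherever the process differs from 0.\<close>

lemma nice_step:
 assumes t: "0 <= t" "t <= 1" and Z: "Z \<in> borel_measurable (Fl t)" and b: "poly_bounded Z"
 shows "nice (%s om. if t < s then Z om else 0)"
proof -
 obtain c q where c: "\<forall>om\<in>space P. \<bar>Z om\<bar> <= c * (1 + real (N om)) ^ q"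
  using b unfolding poly_bounded_def by blast
 show ?thesis
 proof (rule niceI[where c=c and q=q])
  fix s :: real assume s: "0 <= s" "s <= 1"
  show "(%om. if t < s then Z om else 0) \<in> borel_measurable (Fl s)"
   using mFF[OF t(1) _ Z, of s] by (cases "t < s") auto
 next
  fix om
  show "lcont (%s. if t < s then Z om else 0)"
  proof (rule lcontI_eventually)
   fix s :: real
   show "\<forall>\<^sub>F r in at_left s. (if t < r then Z om else 0) = (if t < s then Z om else 0)"
   proof (cases "t < s")
    case True
    then have "\<forall>\<^sub>F r in at_left s. r > t" by (rule eventually_at_left_field[THEN iffD2, OF exI, OF conjI]) auto
    then show ?thesis by eventually_elim (use True in simp)
   next
    case False
    have "\<forall>\<^sub>F r in at_left s. r < s" by (simp add: eventually_at_filter)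
    then show ?thesis by eventually_elim (use False in simp)
   qed
  qed
 next
  fix s :: real and om assume "om \<in> space P"
  moreover from this have "\<bar>Z om\<bar> <= c * (1 + real (N om)) ^ q" using c by blast
  ultimately show "\<bar>if t < s then Z om else 0\<bar> <= c * (1 + real (N om)) ^ q"
   by (auto intro: order.trans[OF abs_ge_zero])
 qed
qed

text \<open>The heights matter at random times only; adaptedness is therefore required of their
  accumulated sums.\<close>

definition mark :: "('x => real => 'a => real) => real => bool" where
 "mark \<xi> b \<longleftrightarrow> 0 <= b & (\<forall>x\<in>X. \<forall>om\<in>space P. \<forall>s\<in>S x om. \<bar>\<xi> x s om\<bar> <= b) \<and>
   (\<forall>x\<in>X. \<forall>t. 0 <= t & t <= 1 --> (%om. \<Sum>s\<in>S x om Int {..t}. \<xi> x s om) \<in> borel_measurable (Fl t))"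

definition drift :: "('x => real => 'a => real) => real => bool" where
 "drift rh b \<longleftrightarrow> 0 <= b & (\<forall>x\<in>X. \<forall>om\<in>space P. set_integrable lborel {0..1} (%s. rh x s om) & (\<forall>s\<in>{0..1}. \<bar>rh x s om\<bar> <= b)) \<and>
   (\<forall>x\<in>X. \<forall>t. 0 <= t & t <= 1 --> (%om. LBINT s:{0..t}. rh x s om) \<in> borel_measurable (Fl t))"

text \<open>This is the martingale property, on \<open>[0,1]\<close>, of the sum of the heights
  minus the integral of \<open>ze\<close>.\<close>

definition compensates :: "('x => real => 'a => real) => ('x => real => 'a => real) => bool" where
 "compensates ze \<xi> \<longleftrightarrow> (\<forall>x\<in>X. \<forall>s t A. 0 <= s & s <= t & t <= 1 & A \<in> sets (Fl s) -->
   (\<integral>om. indicator A om * (((\<Sum>r\<in>S x om Int {..t}. \<xi> x r om) - (LBINT r:{0..t}. ze x r om))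
    - ((\<Sum>r\<in>S x om Int {..s}. \<xi> x r om) - (LBINT r:{0..s}. ze x r om))) \<partial>P) = 0)"

lemma drift_integrable: "drift rh b ==> x \<in> X ==> om \<in> space P ==> t <= 1 ==> set_integrable lborel {0..t} (%s. rh x s om)"
 by (rule set_integrable_subset[of _ "{0..1}"]) (auto simp: drift_def)

lemma drift_bound: "drift rh b ==> x \<in> X ==> om \<in> space P ==> 0 <= s ==> s <= 1 ==> \<bar>rh x s om\<bar> <= b"
 by (simp add: drift_def)

lemma mark_bound: "mark \<xi> b ==> x \<in> X ==> om \<in> space P ==> s \<in> S x om ==> \<bar>\<xi> x s om\<bar> <= b"
 by (simp add: mark_def)

lemma S_pos: "x \<in> X ==> om \<in> space P ==> S x om \<subseteq> {0<..}"
 using S01 by fastforce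

lemma card_S_le: "x \<in> X ==> om \<in> space P ==> card (S x om Int A) <= N om"
proof -
 assume x: "x \<in> X" "om \<in> space P"
 have "card (S x om Int A) <= card (S x om)" using finS[OF x] by (intro card_mono) auto
 also have "... <= N om" unfolding N_def using finX x by (intro member_le_sum) auto
 finally show ?thesis .
qed

lemma jump_sum_bound:
 assumes x: "x \<in> X" and om: "om \<in> space P" and "0 <= M" "!!s. s \<in> S x om ==> \<bar>f s\<bar> <= M"
 shows "\<bar>\<Sum>s\<in>S x om Int A. f s\<bar> <= M * real (N om)"
proof -
 have "\<bar>\<Sum>s\<in>S x om Int A. f s\<bar> <= (\<Sum>s\<in>S x om Int A. M)"
  by (rule order.trans[OF sum_abs sum_mono]) (use assms in auto)
 also have "... <= M * real (N om)"
  using card_S_le[OF x om, of A] assms(3) by (simp add: mult.commute mult_left_mono)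
 finally show ?thesis .
qed

lemma lsum_measurable:
 assumes t: "0 < t" "t <= 1" and K: "nice K" and V: "!!u. 0 <= u ==> u <= t ==> (%om. V u om) \<in> borel_measurable (Fl u)"
 shows "(%om. lsum n t (%s. K s om) (%u. V u om)) \<in> borel_measurable (Fl t)"
 unfolding lsum_def
proof (intro borel_measurable_sum borel_measurable_times borel_measurable_diff)
 fix i assume "i \<in> {..<n}"
 then have g: "0 <= real i * t / real n" "real i * t / real n <= real (Suc i) * t / real n" "real (Suc i) * t / real n <= t"
  using grid_bounds[OF t(1), of i n] by auto
 have g': "real i * t / real n <= t" "real i * t / real n <= 1" "0 <= real (Suc i) * t / real n" using g t by linarith+
 show "K (real i * t / real n) \<in> borel_measurable (Fl t)" by (rule mFF[OF g(1) g'(1) nice_adapted[OF K g(1) g'(2)]])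
 show "(%om. V (real i * t / real n) om) \<in> borel_measurable (Fl t)" by (rule mFF[OF g(1) g'(1) V[OF g(1) g'(1)]])
 show "(%om. V (real (Suc i) * t / real n) om) \<in> borel_measurable (Fl t)" by (rule mFF[OF g'(3) g(3) V[OF g'(3) g(3)]])
qed

lemma jump_sum_closed_adapted:
 assumes x: "x \<in> X" and K: "nice K" and \<xi>: "mark \<xi> b" and t: "0 < t" "t <= 1"
 shows "(%om. \<Sum>s\<in>S x om Int {..t}. K s om * \<xi> x s om) \<in> borel_measurable (Fl t)"
proof (rule borel_measurable_LIMSEQ_real)
 show "(%om. lsum n t (%s. K s om) (%u. \<Sum>s\<in>S x om Int {..u}. \<xi> x s om)) \<in> borel_measurable (Fl t)" for n
  by (rule lsum_measurable[OF t K]) (use \<xi> x t in \<open>auto simp: mark_def\<close>)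
 fix om assume "om \<in> space (Fl t)"
 then have om: "om \<in> space P" using spF t by simp
 show "(%n. lsum n t (%s. K s om) (%u. \<Sum>s\<in>S x om Int {..u}. \<xi> x s om)) \<longlonglongrightarrow> (\<Sum>s\<in>S x om Int {..t}. K s om * \<xi> x s om)"
  by (rule lsum_jump_tendsto[OF nice_lcont[OF K om] t finS[OF x om] S_pos[OF x om]])
qed

text \<open>The sum over jumps costs one more power of \<open>N\<close>. An open sum over
  \<open>{..<t}\<close> is constant on some interval to the left of \<open>t\<close>, hence
  left-continuous, and so can serve again as an integrand.\<close>

lemma jump_int_nice:
 assumes x: "x \<in> X" and K: "nice K" and \<xi>: "mark \<xi> b"
 shows "nice (%t om. \<Sum>s\<in>S x om Int {..<t}. K s om * \<xi> x s om)"
proof -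
 obtain c q where c: "0 <= c" "!!s om. 0 <= s ==> s <= 1 ==> om \<in> space P ==> \<bar>K s om\<bar> <= c * (1 + real (N om)) ^ q"
  using nice_bound[OF K] by blast
 have b: "0 <= b" using \<xi> by (simp add: mark_def)
 show ?thesis
 proof (rule niceI[where c="c * b" and q="Suc q"])
  fix t :: real assume t: "0 <= t" "t <= 1"
  show "(%om. \<Sum>s\<in>S x om Int {..<t}. K s om * \<xi> x s om) \<in> borel_measurable (Fl t)"
  proof (cases "t = 0")
   case True
   have "S x om Int {..<t} = {}" if "om \<in> space P" for om using S_pos[OF x that] True by fastforce
   then have "(\<Sum>s\<in>S x om Int {..<t}. K s om * \<xi> x s om) = 0" if "om \<in> space (Fl t)" for om
    using that spF[OF t(1)] by simp
   then show ?thesis by (subst measurable_cong[where g="%_. 0"]) simp_all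
  next
   case False
   then have t0: "0 < t" using t by simp
   show ?thesis
   proof (rule borel_measurable_LIMSEQ_real)
    fix n
    \<comment> \<open>Shift by two: the point \<open>t - t/1 = 0\<close> must be skipped, as the
      closed sum is treated for positive times only.\<close>
    have "t / real (Suc (Suc n)) < t / 1" using t0 by (intro divide_strict_left_mono) auto
    then have "t / real (Suc (Suc n)) < t" by simp
    moreover have "0 <= t / real (Suc (Suc n))" using t0 by simp
    ultimately have u: "0 < t - t / real (Suc (Suc n))" "t - t / real (Suc (Suc n)) <= t" "t - t / real (Suc (Suc n)) <= 1"
     using t by linarith+
    show "(%om. \<Sum>s\<in>S x om Int {..t - t / real (Suc (Suc n))}. K s om * \<xi> x s om) \<in> borel_measurable (Fl t)"
     by (rule mFF[OF less_imp_le[OF u(1)] u(2) jump_sum_closed_adapted[OF x K \<xi> u(1,3)]])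
   next
    fix om assume "om \<in> space (Fl t)"
    then have "om \<in> space P" using spF[OF t(1)] by simp
    from finite_eventually_left(2)[OF finS[OF x this], of t]
    have "\<forall>\<^sub>F n in sequentially. S x om Int {..t - t / real (Suc n)} = S x om Int {..<t}"
     by (rule eventually_compose_filterlim[OF _ filterlim_left_seq[OF t0]])
    then have "(%n. \<Sum>s\<in>S x om Int {..t - t / real (Suc n)}. K s om * \<xi> x s om) \<longlonglongrightarrow> (\<Sum>s\<in>S x om Int {..<t}. K s om * \<xi> x s om)"
     by (rule tendsto_eventually[OF eventually_mono]) simp
    then show "(%n. \<Sum>s\<in>S x om Int {..t - t / real (Suc (Suc n))}. K s om * \<xi> x s om) \<longlonglongrightarrow> (\<Sum>s\<in>S x om Int {..<t}. K s om * \<xi> x s om)"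
     by (rule LIMSEQ_Suc)
   qed
  qed
 next
  fix om assume om: "om \<in> space P"
  show "lcont (%t. \<Sum>s\<in>S x om Int {..<t}. K s om * \<xi> x s om)"
   by (rule lcontI_eventually, rule eventually_mono[OF finite_eventually_left(1)[OF finS[OF x om]]]) simp
 next
  fix t :: real and om assume t: "0 <= t" "t <= 1" and om: "om \<in> space P"
  have 1: "\<bar>K s om * \<xi> x s om\<bar> <= c * (1 + real (N om)) ^ q * b" if "s \<in> S x om" for s
   using c(2)[of s om] om S01[OF x om] that mark_bound[OF \<xi> x om that] c(1) unfolding abs_mult
   by (intro mult_mono) auto
  have "\<bar>\<Sum>s\<in>S x om Int {..<t}. K s om * \<xi> x s om\<bar> <= c * (1 + real (N om)) ^ q * b * real (N om)"
   by (rule jump_sum_bound[OF x om _ 1]) (use b c in auto)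
  also have "... <= c * (1 + real (N om)) ^ q * b * (1 + real (N om))"
   using b c(1) by (intro mult_left_mono) auto
  finally show "\<bar>\<Sum>s\<in>S x om Int {..<t}. K s om * \<xi> x s om\<bar> <= c * b * (1 + real (N om)) ^ Suc q" by (simp add: mult_ac)
 qed
qed

lemma nice_drift_integrable:
 assumes x: "x \<in> X" and K: "nice K" and rh: "drift rh b" and om: "om \<in> space P" and t: "t <= 1"
 shows "set_integrable lborel {0..t} (%s. K s om * rh x s om)"
proof -
 obtain c q where c: "!!s om. 0 <= s ==> s <= 1 ==> om \<in> space P ==> \<bar>K s om\<bar> <= c * (1 + real (N om)) ^ q"
  using nice_bound[OF K] by metis
 have "set_integrable lborel {0..1} (%s. K s om * rh x s om)"
  by (rule lsum_int_tendsto(2)[OF nice_lcont[OF K om] zero_less_one order.refl drift_integrable[OF rh x om order.refl] c[OF _ _ om]])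
 then show ?thesis by (rule set_integrable_subset) (use t in auto)
qed

lemma drift_int_nice:
 assumes x: "x \<in> X" and K: "nice K" and rh: "drift rh b"
 shows "nice (%t om. LBINT s:{0..t}. K s om * rh x s om)"
proof -
 obtain c q where c: "0 <= c" "!!s om. 0 <= s ==> s <= 1 ==> om \<in> space P ==> \<bar>K s om\<bar> <= c * (1 + real (N om)) ^ q"
  using nice_bound[OF K] by blast
 have b: "0 <= b" using rh by (simp add: drift_def)
 have 1: "\<bar>K s om * rh x s om\<bar> <= c * (1 + real (N om)) ^ q * b" if "0 <= s" "s <= 1" "om \<in> space P" for s om
  using c(2)[OF that] drift_bound[OF rh x that(3,1,2)] c(1) unfolding abs_mult by (intro mult_mono) auto
 show ?thesis
 proof (rule niceI[where c="c * b" and q="q"])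
  fix t :: real assume t: "0 <= t" "t <= 1"
  show "(%om. LBINT s:{0..t}. K s om * rh x s om) \<in> borel_measurable (Fl t)"
  proof (cases "t = 0")
   case True
   have z: "(LBINT s:{0..t}. K s om * rh x s om) = 0" if "om \<in> space (Fl t)" for om
   proof -
    have "om \<in> space P" using that spF[OF t(1)] by simp
    then have "\<bar>LBINT s:{0..t}. K s om * rh x s om\<bar> <= c * (1 + real (N om)) ^ q * b * (t - 0)"
     using t by (intro LBINT_abs_le 1) auto
    then show ?thesis using True by simp
   qed
   then show ?thesis by (subst measurable_cong[where g="%_. 0"]) simp_all
  next
   case False
   then have t0: "0 < t" using t by simp
   show ?thesis
   proof (rule borel_measurable_LIMSEQ_real)
    show "(%om. lsum n t (%s. K s om) (%u. LBINT s:{0..u}. rh x s om)) \<in> borel_measurable (Fl t)" for n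
     by (rule lsum_measurable[OF t0 t(2) K]) (use rh x t in \<open>auto simp: drift_def\<close>)
    fix om assume "om \<in> space (Fl t)"
    then have om: "om \<in> space P" using spF[OF t(1)] by simp
    show "(%n. lsum n t (%s. K s om) (%u. LBINT s:{0..u}. rh x s om)) \<longlonglongrightarrow> (LBINT s:{0..t}. K s om * rh x s om)"
     by (rule lsum_int_tendsto(1)[OF nice_lcont[OF K om] t0 t(2) drift_integrable[OF rh x om t(2)] c(2)[OF _ _ om]]) (use t in auto)
   qed
  qed
 next
  fix om assume om: "om \<in> space P"
  define M where "M = c * (1 + real (N om)) ^ q * b"
  show "lcont (%t. LBINT s:{0..t}. K s om * rh x s om)"
   unfolding lcont_def
  proof (intro allI impI)
   fix t :: real assume t: "0 < t & t <= 1"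
   have "\<forall>\<^sub>F r in at_left t. dist (LBINT s:{0..r}. K s om * rh x s om) (LBINT s:{0..t}. K s om * rh x s om) <= M * (t - r)"
    unfolding eventually_at_left_field
   proof (intro exI[of _ 0] conjI allI impI)
    fix r assume r: "0 < r" "r < t"
    have "(LBINT s:{0..t}. K s om * rh x s om) = (LBINT s:{0..r}. K s om * rh x s om) + (LBINT s:{r..t}. K s om * rh x s om)"
     by (rule LBINT_split[OF nice_drift_integrable[OF x K rh om]]) (use r t in auto)
    moreover have "\<bar>LBINT s:{r..t}. K s om * rh x s om\<bar> <= M * (t - r)"
     unfolding M_def using r t by (intro LBINT_abs_le 1 om) auto
    ultimately show "dist (LBINT s:{0..r}. K s om * rh x s om) (LBINT s:{0..t}. K s om * rh x s om) <= M * (t - r)"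
     by (simp add: dist_real_def)
   qed (use t in simp)
   then have "\<forall>\<^sub>F r in at_left t. dist (LBINT s:{0..r}. K s om * rh x s om) (LBINT s:{0..t}. K s om * rh x s om) <= dist (M * (t - r)) 0"
    by eventually_elim (simp add: dist_real_def)
   moreover have "((%r. M * (t - r)) \<longlongrightarrow> M * (t - t)) (at_left t)" by (intro tendsto_intros)
   then have "((%r. M * (t - r)) \<longlongrightarrow> 0) (at_left t)" by simp
   ultimately show "((%t. LBINT s:{0..t}. K s om * rh x s om) \<longlongrightarrow> (LBINT s:{0..t}. K s om * rh x s om)) (at_left t)"
    by (rule metric_tendsto_imp_tendsto[rotated])
  qed
 next
  fix t :: real and om assume t: "0 <= t" "t <= 1" and om: "om \<in> space P"
  have "\<bar>LBINT s:{0..t}. K s om * rh x s om\<bar> <= c * (1 + real (N om)) ^ q * b * (t - 0)"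
   using t by (intro LBINT_abs_le 1 om) auto
  also have "... <= c * (1 + real (N om)) ^ q * b * 1" using b c(1) t by (intro mult_left_mono) auto
  finally show "\<bar>LBINT s:{0..t}. K s om * rh x s om\<bar> <= c * b * (1 + real (N om)) ^ q" by (simp add: mult_ac)
 qed
qed

lemma AE_sum_open_closed:
 assumes "x \<in> X" "0 <= t" "t <= 1"
 shows "AE om in P. (\<Sum>s\<in>S x om Int {..<t}. f s om) = (\<Sum>s\<in>S x om Int {..t}. f s om)"
 using AE_no_jump[OF assms]
proof eventually_elim
 case (elim om)
 have "s \<in> S x om & s < t \<longleftrightarrow> s \<in> S x om & s <= t" for s using elim by (cases "s = t") auto
 then have "S x om Int {..<t} = S x om Int {..t}" by auto
 then show ?case by simp
qed

text \<open>For grid sums the claim is \<open>mart_orth\<close> on each cell, with \<open>K\<close>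
  at the left end as weight. Dominated convergence uses a bound uniform in the grid, namely the
  bound of \<open>K\<close> times a linear function of \<open>N\<close>. The limit contains the
  closed sum over \<open>{..t}\<close>, which equals the open one almost surely.\<close>

lemma compensation:
 assumes x: "x \<in> X" and K: "nice K" and \<xi>: "mark \<xi> b" and ze: "drift ze b'" and comp: "compensates ze \<xi>"
  and t: "0 <= t" "t <= 1"
 shows "(\<integral>om. (\<Sum>s\<in>S x om Int {..<t}. K s om * \<xi> x s om) - (LBINT s:{0..t}. K s om * ze x s om) \<partial>P) = 0"
proof (cases "t = 0")
 case True
 have "(\<Sum>s\<in>S x om Int {..<t}. K s om * \<xi> x s om) - (LBINT s:{0..t}. K s om * ze x s om) = 0" if "om \<in> space P" for om
 proof -
  have "S x om Int {..<t} = {}" using S_pos[OF x that] True by fastforce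
  moreover have "\<bar>LBINT s:{0..t}. K s om * ze x s om\<bar> <= \<bar>K 0 om * ze x 0 om\<bar> * (t - 0)"
   by (rule LBINT_abs_le) (use True in auto)
  ultimately show ?thesis using True by simp
 qed
 then show ?thesis by (subst Bochner_Integration.integral_cong[OF refl]) auto
next
 case False
 then have t0: "0 < t" using t by simp
 obtain c q where c: "0 <= c" "!!s om. 0 <= s ==> s <= 1 ==> om \<in> space P ==> \<bar>K s om\<bar> <= c * (1 + real (N om)) ^ q"
  using nice_bound[OF K] by blast
 have b: "0 <= b" "0 <= b'" using \<xi> ze by (simp_all add: mark_def drift_def)
 define Y where "Y u om = (\<Sum>s\<in>S x om Int {..u}. \<xi> x s om) - (LBINT s:{0..u}. ze x s om)" for u om
 have Ym: "Y u \<in> borel_measurable (Fl u)" if "0 <= u" "u <= 1" for u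
  unfolding Y_def using \<xi> ze x that by (intro borel_measurable_diff) (auto simp: mark_def drift_def)
 have Yb: "\<bar>Y u om\<bar> <= (b + b') * (1 + real (N om))" if "0 <= u" "u <= 1" "om \<in> space P" for u om
 proof -
  have "\<bar>\<Sum>s\<in>S x om Int {..u}. \<xi> x s om\<bar> <= b * real (N om)"
   by (rule jump_sum_bound[OF x that(3) b(1) mark_bound[OF \<xi> x that(3)]])
  moreover have "\<bar>LBINT s:{0..u}. ze x s om\<bar> <= b' * (u - 0)"
   using that by (intro LBINT_abs_le drift_bound[OF ze x]) auto
  moreover have "b' * (u - 0) <= b' * 1" using b that by (intro mult_left_mono) auto
  moreover have "0 <= b' * real (N om)" using b by simp
  ultimately show ?thesis using b unfolding Y_def distrib_right distrib_left mult_1_right by linarith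
 qed
 have zero: "(\<integral>om. lsum n t (%s. K s om) (%u. Y u om) \<partial>P) = 0" for n
 proof -
  define g where "g i = real i * t / real n" for i
  have *: "integrable P (%om. K (g i) om * (Y (g (Suc i)) om - Y (g i) om)) \<and>
    (\<integral>om. K (g i) om * (Y (g (Suc i)) om - Y (g i) om) \<partial>P) = 0" if i: "i < n" for i
  proof -
   have g: "0 <= g i" "g i <= g (Suc i)" "0 <= g (Suc i)" "g i <= 1" "g (Suc i) <= 1"
    using grid_bounds[OF t0 i] t unfolding g_def by linarith+
   have mY: "(%om. Y (g (Suc i)) om - Y (g i) om) \<in> borel_measurable P"
    using mF[OF g(3) Ym[OF g(3,5)]] mF[OF g(1) Ym[OF g(1,4)]] by simp
   have Yd: "\<bar>Y (g (Suc i)) om - Y (g i) om\<bar> <= 2 * (b + b') * (1 + real (N om)) ^ 1" if "om \<in> space P" for om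
    using Yb[OF g(3,5) that] Yb[OF g(1,4) that] unfolding power_one_right mult.assoc by linarith
   have iY: "integrable P (%om. Y (g (Suc i)) om - Y (g i) om)"
    by (rule poly_bounded_integrable[OF poly_boundedI[OF Yd] mY])
   have iK: "integrable P (%om. K (g i) om * (Y (g (Suc i)) om - Y (g i) om))"
   proof (rule poly_bounded_integrable[OF poly_boundedI])
    fix om assume om: "om \<in> space P"
    have "\<bar>K (g i) om\<bar> * \<bar>Y (g (Suc i)) om - Y (g i) om\<bar> <= (c * (1 + real (N om)) ^ q) * (2 * (b + b') * (1 + real (N om)) ^ 1)"
     using c(1) by (intro mult_mono c(2)[OF g(1,4) om] Yd[OF om]) auto
    then show "\<bar>K (g i) om * (Y (g (Suc i)) om - Y (g i) om)\<bar> <= (c * 2 * (b + b')) * (1 + real (N om)) ^ Suc q"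
     by (simp add: abs_mult mult_ac)
   next
    show "(%om. K (g i) om * (Y (g (Suc i)) om - Y (g i) om)) \<in> borel_measurable P"
     by (intro borel_measurable_times mY nice_measurable[OF K g(1,4)])
   qed
   have "(\<integral>om. K (g i) om * (Y (g (Suc i)) om - Y (g i) om) \<partial>P) = 0"
   proof (rule mart_orth[OF prob_space_axioms sub[OF g(1)] iY _ nice_adapted[OF K g(1,4)] iK])
    fix A assume "A \<in> sets (Fl (g i))"
    then show "(\<integral>om. indicator A om * (Y (g (Suc i)) om - Y (g i) om) \<partial>P) = 0"
     using comp x g unfolding compensates_def Y_def by blast
   qed
   with iK show ?thesis by blast
  qed
  have "(\<integral>om. lsum n t (%s. K s om) (%u. Y u om) \<partial>P) = (\<Sum>i<n. \<integral>om. K (g i) om * (Y (g (Suc i)) om - Y (g i) om) \<partial>P)"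
   unfolding lsum_def g_def[symmetric] by (rule Bochner_Integration.integral_sum) (use * in auto)
  then show ?thesis using * by simp
 qed
 define R where "R om = (\<Sum>s\<in>S x om Int {..t}. K s om * \<xi> x s om) - (LBINT s:{0..t}. K s om * ze x s om)" for om
 have split: "lsum n t k (%u. V u - W u) = lsum n t k V - lsum n t k W" for n k V W
  by (simp add: lsum_def sum_subtractf[symmetric] algebra_simps)
 have Rm: "R \<in> borel_measurable P"
  unfolding R_def using mF[OF t(1) jump_sum_closed_adapted[OF x K \<xi> t0 t(2)]] nice_measurable[OF drift_int_nice[OF x K ze] t] by simp
 have "(%n. \<integral>om. lsum (Suc n) t (%s. K s om) (%u. Y u om) \<partial>P) \<longlonglongrightarrow> (\<integral>om. R om \<partial>P)"
 proof (rule integral_dominated_convergence[where w="%om. (c * (b + b')) * (1 + real (N om)) ^ Suc q"])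
  show "R \<in> borel_measurable P" by (rule Rm)
  show "(%om. lsum (Suc n) t (%s. K s om) (%u. Y u om)) \<in> borel_measurable P" for n
   by (rule mF[OF t(1) lsum_measurable[OF t0 t(2) K]]) (use t in \<open>auto intro: Ym\<close>)
  show "integrable P (%om. (c * (b + b')) * (1 + real (N om)) ^ Suc q)"
   by (rule integrable_mult_right[OF N_pow_integrable])
  show "AE om in P. (%n. lsum (Suc n) t (%s. K s om) (%u. Y u om)) \<longlonglongrightarrow> R om"
  proof (rule AE_I2)
   fix om assume om: "om \<in> space P"
   have "(%n. lsum n t (%s. K s om) (%u. Y u om)) \<longlonglongrightarrow> R om"
    unfolding Y_def R_def split
    by (intro tendsto_diff lsum_jump_tendsto[OF nice_lcont[OF K om] t0 t(2) finS[OF x om] S_pos[OF x om]]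
       lsum_int_tendsto(1)[OF nice_lcont[OF K om] t0 t(2) drift_integrable[OF ze x om t(2)] c(2)[OF _ _ om]])
      (use t in auto)
   then show "(%n. lsum (Suc n) t (%s. K s om) (%u. Y u om)) \<longlonglongrightarrow> R om" by (rule LIMSEQ_Suc)
  qed
  show "AE om in P. norm (lsum (Suc n) t (%s. K s om) (%u. Y u om)) <= (c * (b + b')) * (1 + real (N om)) ^ Suc q" for n
  proof (rule AE_I2)
   fix om assume om: "om \<in> space P"
   have n1: "1 <= Suc n" by simp
   define D where "D = c * (1 + real (N om)) ^ q"
   have D0: "0 <= D" using c by (simp add: D_def)
   have KD: "\<bar>K (la (Suc n) t s) om\<bar> <= D" if "0 < s" "s <= t" for s
    unfolding D_def using la_bounds[OF that n1] that t by (intro c(2) om) auto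
   have "\<bar>\<Sum>s\<in>S x om Int {..t}. K (la (Suc n) t s) om * \<xi> x s om\<bar> <= (\<Sum>s\<in>S x om Int {..t}. D * b)"
   proof (rule order.trans[OF sum_abs sum_mono])
    fix s assume s: "s \<in> S x om Int {..t}"
    then show "\<bar>K (la (Suc n) t s) om * \<xi> x s om\<bar> <= D * b"
     unfolding abs_mult using S_pos[OF x om] KD mark_bound[OF \<xi> x om] D0 by (intro mult_mono) auto
   qed
   also have "... <= D * b * real (N om)"
    using card_S_le[OF x om, of "{..t}"] D0 b by (simp add: mult.commute mult_left_mono)
   finally have 1: "\<bar>\<Sum>s\<in>S x om Int {..t}. K (la (Suc n) t s) om * \<xi> x s om\<bar> <= D * b * real (N om)" .
   have "\<bar>LBINT s:{0<..t}. K (la (Suc n) t s) om * ze x s om\<bar> = \<bar>LBINT s:{0..t}. indicator {0<..t} s * (K (la (Suc n) t s) om * ze x s om)\<bar>"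
    unfolding LBINT_ioc[symmetric] by (intro arg_cong[where f=abs] set_lebesgue_integral_cong) auto
   also have "... <= D * b' * (t - 0)"
   proof (rule LBINT_abs_le[OF t(1)])
    fix s assume s: "s \<in> {0..t}"
    show "\<bar>indicator {0<..t} s * (K (la (Suc n) t s) om * ze x s om)\<bar> <= D * b'"
    proof (cases "0 < s")
     case True
     then have "\<bar>K (la (Suc n) t s) om\<bar> * \<bar>ze x s om\<bar> <= D * b'"
      using s t KD drift_bound[OF ze x om] D0 by (intro mult_mono) auto
     then show ?thesis using True s by (simp add: abs_mult)
    qed (use D0 b in simp)
   qed
   also have "... <= D * b' * 1" using t D0 b by (intro mult_left_mono) auto
   finally have 2: "\<bar>LBINT s:{0..t}. K (la (Suc n) t s) om * ze x s om\<bar> <= D * b'" by (simp add: LBINT_ioc)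
   have "lsum (Suc n) t (%s. K s om) (%u. Y u om) = (\<Sum>s\<in>S x om Int {..t}. K (la (Suc n) t s) om * \<xi> x s om) - (LBINT s:{0..t}. K (la (Suc n) t s) om * ze x s om)"
    unfolding Y_def split
    by (simp only: lsum_jump[OF t0 n1 finS[OF x om] S_pos[OF x om]] lsum_int(1)[OF t0 n1 drift_integrable[OF ze x om t(2)]])
   then have "norm (lsum (Suc n) t (%s. K s om) (%u. Y u om)) <= D * b * real (N om) + D * b'"
    using 1 2 by simp
   also have "... <= D * (b + b') * (1 + real (N om))"
    using D0 b by (simp add: algebra_simps)
   also have "... = (c * (b + b')) * (1 + real (N om)) ^ Suc q" by (simp add: D_def mult_ac)
   finally show "norm (lsum (Suc n) t (%s. K s om) (%u. Y u om)) <= (c * (b + b')) * (1 + real (N om)) ^ Suc q" .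
  qed
 qed
 then have "(\<integral>om. R om \<partial>P) = 0" by (simp add: zero LIMSEQ_const_iff)
 moreover have "(\<integral>om. (\<Sum>s\<in>S x om Int {..<t}. K s om * \<xi> x s om) - (LBINT s:{0..t}. K s om * ze x s om) \<partial>P) = (\<integral>om. R om \<partial>P)"
 proof (rule integral_cong_AE[OF _ Rm])
  show "(%om. (\<Sum>s\<in>S x om Int {..<t}. K s om * \<xi> x s om) - (LBINT s:{0..t}. K s om * ze x s om)) \<in> borel_measurable P"
   using nice_measurable[OF jump_int_nice[OF x K \<xi>] t] nice_measurable[OF drift_int_nice[OF x K ze] t] by simp
  show "AE om in P. (\<Sum>s\<in>S x om Int {..<t}. K s om * \<xi> x s om) - (LBINT s:{0..t}. K s om * ze x s om) = R om"
   using AE_sum_open_closed[OF x t, of "%s om. K s om * \<xi> x s om"] by eventually_elim (simp add: R_def)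
 qed
 ultimately show ?thesis by simp
qed

lemma mark_one: "mark (%_ _ _. 1) 1"
 unfolding mark_def using cnt_meas by simp

lemma drift_one: "drift (%_ _ _. 1) 1"
 unfolding drift_def using set_integrable_const_Icc by auto

lemma nice_jump_expect_le:
 assumes x: "x \<in> X" and K: "nice K" and nonneg: "!!s om. 0 <= s ==> s <= 1 ==> om \<in> space P ==> 0 <= K s om"
  and t: "0 <= t" "t <= 1"
 shows "(\<integral>om. (\<Sum>s\<in>S x om Int {..<t}. K s om) \<partial>P) <= lam * (LBINT s:{0..t}. (\<integral>om. K s om \<partial>P))"
  and "integrable P (%om. \<Sum>s\<in>S x om Int {..<t}. K s om)"
proof -
 have n: "nice (%t om. \<Sum>s\<in>S x om Int {..<t}. K s om)" using jump_int_nice[OF x K mark_one] by simp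
 show I: "integrable P (%om. \<Sum>s\<in>S x om Int {..<t}. K s om)" by (rule nice_integrable[OF n t])
 have nn: "0 <= (LBINT s:{0..t}. (\<integral>om. K s om \<partial>P))"
  unfolding set_lebesgue_integral_def using nonneg t
  by (intro integral_nonneg_AE AE_I2) (auto simp: indicator_def intro!: integral_nonneg_AE AE_I2)
 show "(\<integral>om. (\<Sum>s\<in>S x om Int {..<t}. K s om) \<partial>P) <= lam * (LBINT s:{0..t}. (\<integral>om. K s om \<partial>P))"
 proof (cases "t = 0")
  case True
  have "(\<Sum>s\<in>S x om Int {..<t}. K s om) = 0" if "om \<in> space P" for om
  proof -
   have "S x om Int {..<t} = {}" using S_pos[OF x that] True by fastforce
   then show ?thesis by simp
  qed
  then have "(\<integral>om. (\<Sum>s\<in>S x om Int {..<t}. K s om) \<partial>P) = 0"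
   by (subst Bochner_Integration.integral_cong[OF refl]) auto
  then show ?thesis using nn lam by simp
 next
  case False
  then have t0: "0 < t" using t by simp
  obtain c q where c: "0 <= c" "!!s om. 0 <= s ==> s <= 1 ==> om \<in> space P ==> \<bar>K s om\<bar> <= c * (1 + real (N om)) ^ q"
   using nice_bound[OF K] by blast
  have c2: "K s om <= c * (1 + real (N om)) ^ q" if "0 <= s" "s <= 1" "om \<in> space P" for s om
   using c(2)[OF that] by simp
  have snn: "0 <= (\<Sum>s\<in>S x om Int A. K s om)" if "om \<in> space P" for om A
   using nonneg[OF _ _ that] S01[OF x that] by (intro sum_nonneg) fastforce
  have "ennreal (\<integral>om. (\<Sum>s\<in>S x om Int {..<t}. K s om) \<partial>P) = (\<integral>\<^sup>+om. ennreal (\<Sum>s\<in>S x om Int {..<t}. K s om) \<partial>P)"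
   by (rule nn_integral_eq_integral[OF I, symmetric]) (use snn in auto)
  also have "... <= (\<integral>\<^sup>+om. ennreal (\<Sum>s\<in>S x om Int {..t}. K s om) \<partial>P)"
  proof (rule nn_integral_mono, rule ennreal_leI, rule sum_mono2)
   fix om s assume om: "om \<in> space P"
   show "finite (S x om Int {..t})" using finS[OF x om] by simp
   assume "s \<in> S x om Int {..t} - S x om Int {..<t}"
   then show "0 <= K s om" using S01[OF x om] by (intro nonneg om) auto
  qed auto
  also have "... <= ennreal (lam * (LBINT s:{0..t}. (\<integral>om. K s om \<partial>P)))"
   by (rule jump_sum_le[OF x t0 t(2) nice_adapted[OF K] nice_lcont[OF K] nonneg c2 integrable_mult_right[OF N_pow_integrable]])
  finally show ?thesis using nn lam by (subst (asm) ennreal_le_iff) auto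
 qed
qed

text \<open>Both sides are limits of the same left Riemann sums, for which the interchange is that
  of a finite sum. This takes the place of Fubini's theorem and of joint measurability in time and
  sample point.\<close>

lemma nice_fubini:
 assumes x: "x \<in> X" and K: "nice K" and t: "0 <= t" "t <= 1"
 shows "(\<integral>om. (LBINT s:{0..t}. K s om) \<partial>P) = (LBINT s:{0..t}. (\<integral>om. K s om \<partial>P))"
  and "integrable P (%om. LBINT s:{0..t}. K s om)"
proof -
 have n: "nice (%t om. LBINT s:{0..t}. K s om)" using drift_int_nice[OF x K drift_one] by simp
 show "integrable P (%om. LBINT s:{0..t}. K s om)" by (rule nice_integrable[OF n t])
 show "(\<integral>om. (LBINT s:{0..t}. K s om) \<partial>P) = (LBINT s:{0..t}. (\<integral>om. K s om \<partial>P))"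
 proof (cases "t = 0")
  case True
  have "(LBINT s:{0..t}. f s) = 0" for f :: "real => real"
   using LBINT_abs_le[of 0 t f "\<bar>f 0\<bar>"] True by simp
  then show ?thesis by simp
 next
  case False
  then have t0: "0 < t" using t by simp
  obtain c q where c: "0 <= c" "!!s om. 0 <= s ==> s <= 1 ==> om \<in> space P ==> \<bar>K s om\<bar> <= c * (1 + real (N om)) ^ q"
   using nice_bound[OF K] by blast
  obtain M where M: "\<forall>s. 0 <= s & s <= 1 --> \<bar>\<integral>om. K s om \<partial>P\<bar> <= M" using nice_expect(2)[OF K] by blast
  have idl: "lsum n t k (%u. LBINT s:{0..u}. 1) = lsum n t k (%u. u)" for n k
   unfolding lsum_def using t0 by (intro sum.cong refl arg_cong2[of _ _ _ _ "(*)"]) (auto simp: set_lebesgue_integral_def)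
  have E: "(\<integral>om. lsum n t (%s. K s om) (%u. u) \<partial>P) = lsum n t (%s. \<integral>om. K s om \<partial>P) (%u. u)" for n
  proof -
   have i: "integrable P (K (real i * t / real n))" if "i < n" for i
    using grid_bounds[OF t0 that] t by (intro nice_integrable[OF K]) linarith+
   then show ?thesis unfolding lsum_def by (subst Bochner_Integration.integral_sum) auto
  qed
  have l1: "(%n. lsum n t (%s. \<integral>om. K s om \<partial>P) (%u. u)) \<longlonglongrightarrow> (LBINT s:{0..t}. (\<integral>om. K s om \<partial>P) * 1)"
   unfolding idl[symmetric]
   by (rule lsum_int_tendsto(1)[OF nice_expect(1)[OF K] t0 t(2) set_integrable_const_Icc, where D=M]) (use M t in auto)
  have "(%n. \<integral>om. lsum n t (%s. K s om) (%u. u) \<partial>P) \<longlonglongrightarrow> (\<integral>om. (LBINT s:{0..t}. K s om) \<partial>P)"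
  proof (rule integral_dominated_convergence[where w="%om. c * (1 + real (N om)) ^ q"])
   show "(%om. LBINT s:{0..t}. K s om) \<in> borel_measurable P" by (rule nice_measurable[OF n t])
   show "(%om. lsum n t (%s. K s om) (%u. u)) \<in> borel_measurable P" for n
    by (rule mF[OF t(1) lsum_measurable[OF t0 t(2) K]]) auto
   show "integrable P (%om. c * (1 + real (N om)) ^ q)" by (rule integrable_mult_right[OF N_pow_integrable])
   show "AE om in P. (%n. lsum n t (%s. K s om) (%u. u)) \<longlonglongrightarrow> (LBINT s:{0..t}. K s om)"
   proof (rule AE_I2)
    fix om assume om: "om \<in> space P"
    have "(%n. lsum n t (%s. K s om) (%u. u)) \<longlonglongrightarrow> (LBINT s:{0..t}. K s om * 1)"
     unfolding idl[symmetric]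
     by (rule lsum_int_tendsto(1)[OF nice_lcont[OF K om] t0 t(2) set_integrable_const_Icc c(2)[OF _ _ om]]) (use t in auto)
    then show "(%n. lsum n t (%s. K s om) (%u. u)) \<longlonglongrightarrow> (LBINT s:{0..t}. K s om)" by simp
   qed
   show "AE om in P. norm (lsum n t (%s. K s om) (%u. u)) <= c * (1 + real (N om)) ^ q" for n
   proof (rule AE_I2)
    fix om assume om: "om \<in> space P"
    define D where "D = c * (1 + real (N om)) ^ q"
    have D0: "0 <= D" using c by (simp add: D_def)
    have "\<bar>lsum n t (%s. K s om) (%u. u)\<bar> <= (\<Sum>i<n. D * (t / real n))"
     unfolding lsum_def
    proof (rule order.trans[OF sum_abs sum_mono])
     fix i assume "i \<in> {..<n}"
     then have i: "i < n" by simp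
     have "real (Suc i) * t / real n - real i * t / real n = t / real n"
      by (simp add: distrib_right add_divide_distrib)
     moreover have "\<bar>K (real i * t / real n) om\<bar> <= D"
      unfolding D_def using grid_bounds[OF t0 i] t by (intro c(2) om) linarith+
     ultimately show "\<bar>K (real i * t / real n) om * (real (Suc i) * t / real n - real i * t / real n)\<bar> <= D * (t / real n)"
      using t0 mult_right_mono[of "\<bar>K (real i * t / real n) om\<bar>" D "t / real n"] by (simp add: abs_mult del: of_nat_Suc)
    qed
    also have "... <= D" using t D0 by (cases "n = 0") (auto intro: mult_left_le)
    finally show "norm (lsum n t (%s. K s om) (%u. u)) <= c * (1 + real (N om)) ^ q" by (simp add: D_def)
   qed
  qed
  then show ?thesis using l1 unfolding E by (simp add: LIMSEQ_unique)
 qed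
qed

end

section \<open>A Rosenthal inequality\<close>

lemma continuous_on_max_powr: "0 < q ==> continuous_on UNIV (%x::real. max x 0 powr q)"
 by (rule continuous_on_powr') (auto intro!: continuous_intros)

lemma continuous_on_abs_powr: "0 < q ==> continuous_on UNIV (%x::real. \<bar>x\<bar> powr q)"
 by (rule continuous_on_powr') (auto intro!: continuous_intros)

text \<open>The derivative of \<open>\<bar>x\<bar> powr p\<close>, in one formula that is continuous
  through 0.\<close>

definition dpow :: "real => real => real" where
 "dpow p x = p * (max x 0 powr (p - 1) - max (- x) 0 powr (p - 1))"

lemma dpow_pos: "0 <= x ==> dpow p x = p * x powr (p - 1)"
 and dpow_neg: "x <= 0 ==> dpow p x = - p * (- x) powr (p - 1)"
 by (auto simp: dpow_def max_def)

lemma dpow_minus: "dpow p (- x) = - dpow p x"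
 by (simp add: dpow_def algebra_simps)

lemma abs_dpow: "0 <= p ==> \<bar>dpow p x\<bar> = p * \<bar>x\<bar> powr (p - 1)"
 by (cases "0 <= x") (auto simp: dpow_pos dpow_neg abs_mult)

lemma continuous_dpow: "1 < p ==> continuous_on UNIV (dpow p)"
 unfolding dpow_def
 by (intro continuous_intros continuous_on_max_powr
   continuous_on_compose2[OF continuous_on_max_powr, of "p - 1" UNIV "%x. - x"]) auto

lemma DERIV_abs_powr:
 assumes p: "1 < p"
 shows "((%x::real. \<bar>x\<bar> powr p) has_real_derivative dpow p x) (at x)"
proof -
 consider "x > 0" | "x < 0" | "x = 0" by linarith
 then show ?thesis
 proof cases
  case 1
  have "((%x. x powr p) has_real_derivative p * x powr (p - 1)) (at x)"
   by (rule has_real_derivative_powr[OF 1])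
  then have "((%x. \<bar>x\<bar> powr p) has_real_derivative p * x powr (p - 1)) (at x)"
   by (rule has_field_derivative_transform_within_open[where S="{0<..}"]) (use 1 in auto)
  then show ?thesis using 1 by (simp add: dpow_pos)
 next
  case 2
  have "((%x. (- x) powr p) has_real_derivative p * (- x) powr (p - 1) * (- 1)) (at x)"
   by (rule DERIV_chain'[where g="%x. x powr p"]) (use 2 in \<open>auto intro!: derivative_eq_intros has_real_derivative_powr\<close>)
  then have "((%x. \<bar>x\<bar> powr p) has_real_derivative p * (- x) powr (p - 1) * (- 1)) (at x)"
   by (rule has_field_derivative_transform_within_open[where S="{..<0}"]) (use 2 in auto)
  then show ?thesis using 2 by (simp add: dpow_neg)
 next
  case 3
  have "((%h::real. \<bar>h\<bar> powr (p - 1)) \<longlongrightarrow> \<bar>0\<bar> powr (p - 1)) (at 0)"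
   using continuous_on_abs_powr[of "p - 1"] p
   by (metis continuous_on_def UNIV_I diff_gt_0_iff_gt)
  then have l: "((%h::real. \<bar>h\<bar> powr (p - 1)) \<longlongrightarrow> 0) (at 0)" using p by simp
  have "((%h::real. \<bar>h\<bar> powr p / h) \<longlongrightarrow> 0) (at 0)"
  proof (rule metric_tendsto_imp_tendsto[OF l], rule always_eventually, rule allI)
   fix h :: real
   show "dist (\<bar>h\<bar> powr p / h) 0 <= dist (\<bar>h\<bar> powr (p - 1)) 0"
    by (cases "h = 0") (auto simp: dist_real_def abs_divide powr_diff)
  qed
  then show ?thesis using 3 p by (simp add: has_field_derivative_iff dpow_def)
 qed
qed

text \<open>The size of the second derivative of \<open>\<bar>x\<bar> powr p\<close>, up to a
  constant. The case \<open>p = 2\<close> is separate because \<open>0 powr 0 = 0\<close>, whereas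
  the value 1 is needed at \<open>x = 0\<close>.\<close>

definition psi :: "real => real => real" where
 "psi p x = (if p = 2 then 1 else \<bar>x\<bar> powr (p - 2))"

lemma psi_nonneg: "0 <= psi p x" by (simp add: psi_def)

lemma psi_minus: "psi p (- x) = psi p x" by (simp add: psi_def)

lemma continuous_psi: "2 <= p ==> continuous_on UNIV (psi p)"
 unfolding psi_def by (cases "p = 2") (auto intro: continuous_on_abs_powr)

lemma powr_le_power:
 assumes "0 <= a" "a <= real q"
 shows "\<bar>x\<bar> powr a <= (1 + \<bar>x\<bar>) ^ q"
proof -
 have "\<bar>x\<bar> powr a <= (1 + \<bar>x\<bar>) powr a" using assms by (intro powr_mono2) auto
 also have "... <= (1 + \<bar>x\<bar>) powr real q" using assms by (intro powr_mono) auto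
 finally show ?thesis by (simp add: powr_realpow)
qed

text \<open>The first two terms come from jumps that are large relative to \<open>x\<close>, the
  third from small ones.\<close>

definition taylor_const :: "real => real" where
 "taylor_const p = 3 powr p + p * 2 powr (p - 1) + p * (p - 1) * (3 / 2) powr (p - 2)"

lemma taylor_const_nonneg: "2 <= p ==> 0 <= taylor_const p"
 unfolding taylor_const_def by (intro add_nonneg_nonneg mult_nonneg_nonneg) auto

text \<open>In this regime \<open>\<bar>x + y\<bar>\<close> is at most
  \<open>3 * \<bar>y\<bar>\<close> and \<open>\<bar>x\<bar>\<close> at most
  \<open>2 * \<bar>y\<bar>\<close>, so each term is separately of order
  \<open>\<bar>y\<bar> powr p\<close>.\<close>

lemma power_jump_large:
 assumes p: "2 <= p" and xy: "\<bar>x\<bar> <= 2 * \<bar>y::real\<bar>"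
 shows "\<bar>x + y\<bar> powr p - \<bar>x\<bar> powr p - dpow p x * y <= (3 powr p + p * 2 powr (p - 1)) * \<bar>y\<bar> powr p"
proof -
 have "\<bar>x + y\<bar> powr p <= (3 * \<bar>y\<bar>) powr p" using xy p by (intro powr_mono2) auto
 then have 1: "\<bar>x + y\<bar> powr p <= 3 powr p * \<bar>y\<bar> powr p" by (simp add: powr_mult)
 have "- dpow p x * y <= \<bar>dpow p x\<bar> * \<bar>y\<bar>" by (simp add: abs_mult[symmetric])
 also have "... = p * \<bar>x\<bar> powr (p - 1) * \<bar>y\<bar>" using p by (simp add: abs_dpow)
 also have "... <= p * (2 * \<bar>y\<bar>) powr (p - 1) * \<bar>y\<bar>"
  using p xy by (intro mult_right_mono mult_left_mono powr_mono2) auto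
 also have "... = p * 2 powr (p - 1) * (\<bar>y\<bar> powr (p - 1) * \<bar>y\<bar> powr 1)" by (simp add: powr_mult)
 also have "... = p * 2 powr (p - 1) * \<bar>y\<bar> powr p" by (simp only: powr_add[symmetric]) simp
 finally have "- dpow p x * y <= p * 2 powr (p - 1) * \<bar>y\<bar> powr p" .
 with 1 show ?thesis using powr_ge_zero[of "\<bar>x\<bar>" p] unfolding distrib_right by linarith
qed

text \<open>A second-order Taylor estimate through two applications of the mean value theorem. Since
  \<open>2 * \<bar>y\<bar> < x\<close>, all intermediate points are positive and at most
  \<open>3/2 * x\<close>, and \<open>powr (p - 2)\<close> is monotone.\<close>

lemma power_jump_small:
 assumes p: "2 <= p" and x: "0 < x" and xy: "2 * \<bar>y::real\<bar> < x"
 shows "\<bar>x + y\<bar> powr p - \<bar>x\<bar> powr p - dpow p x * y <= p * (p - 1) * (3 / 2) powr (p - 2) * (psi p x * y\<^sup>2)"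
proof (cases "y = 0")
 case True
 then show ?thesis by simp
next
 case False
 have fd: "((%z. z powr p) has_real_derivative p * z powr (p - 1)) (at z)" if "z > 0" for z
  by (rule has_real_derivative_powr[OF that])
 have fd2: "((%z. p * z powr (p - 1)) has_real_derivative p * (p - 1) * z powr (p - 2)) (at z)" if "z > 0" for z
  using DERIV_cmult[OF has_real_derivative_powr[OF that, of "p - 1"], of p] by (simp add: mult.assoc)
 have mvt: "\<exists>z\<in>{min u v..max u v}. f v - f u = f' z * (v - u)"
  if "!!z. z > 0 ==> (f has_real_derivative f' z) (at z)" "u > 0" "v > 0" for f f' and u v :: real
 proof (cases u v rule: linorder_cases)
  case less
  then show ?thesis using MVT2[OF less, of f f'] that by (force simp: mult.commute)
 next
  case greater
  have "\<exists>z>v. z < u & f u - f v = (u - v) * f' z" by (rule MVT2[OF greater]) (use that in auto)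
  then obtain z where z: "z > v" "z < u" "f u - f v = (u - v) * f' z" by blast
  have "f v - f u = f' z * (v - u)" using z(3) by (simp add: algebra_simps)
  then show ?thesis using z by (intro bexI[of _ z]) auto
 qed auto
 have xy0: "x + y > 0" using xy by linarith
 obtain z where z: "z \<in> {min x (x + y)..max x (x + y)}" "(x + y) powr p - x powr p = p * z powr (p - 1) * y"
  using mvt[OF fd x xy0] by auto
 have z0: "z > 0" "\<bar>z - x\<bar> <= \<bar>y\<bar>" using z(1) x xy0 by (auto simp: min_def max_def split: if_splits)
 obtain w where w: "w \<in> {min x z..max x z}" "p * z powr (p - 1) - p * x powr (p - 1) = p * (p - 1) * w powr (p - 2) * (z - x)"
  using mvt[OF fd2 x z0(1)] by auto
 have w0: "w > 0" "w <= 3 / 2 * x" using w(1) x z0 xy by (auto simp: min_def max_def split: if_splits)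
 have "(x + y) powr p - x powr p - p * x powr (p - 1) * y = p * (p - 1) * w powr (p - 2) * ((z - x) * y)"
  using z(2) w(2) by (metis (no_types) left_diff_distrib mult.assoc)
 also have "... <= p * (p - 1) * w powr (p - 2) * (y * y)"
 proof (rule mult_left_mono)
  have "(z - x) * y <= \<bar>z - x\<bar> * \<bar>y\<bar>" by (simp add: abs_mult[symmetric])
  also have "... <= \<bar>y\<bar> * \<bar>y\<bar>" using z0 by (intro mult_right_mono) auto
  finally show "(z - x) * y <= y * y" by simp
 qed (use p in auto)
 also have "... <= p * (p - 1) * (3 / 2 * x) powr (p - 2) * (y * y)"
  using p w0 by (intro mult_right_mono mult_left_mono powr_mono2) auto
 also have "... = p * (p - 1) * (3 / 2) powr (p - 2) * (psi p x * y\<^sup>2)"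
 proof -
  have "psi p x = x powr (p - 2)" using x by (simp add: psi_def)
  moreover have "(3 / 2 * x) powr (p - 2) = (3 / 2) powr (p - 2) * x powr (p - 2)" by (rule powr_mult)
  ultimately show ?thesis by (simp only: power2_eq_square mult.assoc)
 qed
 finally show ?thesis using x xy0 by (simp add: dpow_pos)
qed

text \<open>In each regime one of the two terms on the right is enough; negative \<open>x\<close>
  reduces to positive \<open>x\<close> by reflecting both \<open>x\<close> and
  \<open>y\<close>.\<close>

lemma power_jump:
 assumes p: "2 <= p"
 shows "\<bar>x + y\<bar> powr p - \<bar>x\<bar> powr p - dpow p x * y <= taylor_const p * (psi p x * y\<^sup>2 + \<bar>y::real\<bar> powr p)"
proof -
 define a where "a = 3 powr p + p * 2 powr (p - 1)"
 define b where "b = p * (p - 1) * (3 / 2) powr (p - 2)"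
 have ab: "0 <= a" "0 <= b" "taylor_const p = a + b" using p unfolding a_def b_def taylor_const_def
  by (auto intro!: add_nonneg_nonneg mult_nonneg_nonneg)
 have nn: "0 <= psi p x * y\<^sup>2" "0 <= \<bar>y\<bar> powr p" using psi_nonneg by auto
 have "\<bar>x + y\<bar> powr p - \<bar>x\<bar> powr p - dpow p x * y <= a * \<bar>y\<bar> powr p \<or>
   \<bar>x + y\<bar> powr p - \<bar>x\<bar> powr p - dpow p x * y <= b * (psi p x * y\<^sup>2)"
 proof (cases "\<bar>x\<bar> <= 2 * \<bar>y\<bar>")
  case True
  then show ?thesis using power_jump_large[OF p True] by (simp add: a_def)
 next
  case False
  show ?thesis
  proof (cases "x > 0")
   case True
   then show ?thesis using power_jump_small[OF p True, of y] False by (simp add: b_def)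
  next
   case F: False
   then have "- x > 0" "2 * \<bar>- y\<bar> < - x" using False by auto
   from power_jump_small[OF p this] show ?thesis
    using abs_minus_cancel[of "x + y"] by (simp add: b_def dpow_minus psi_minus)
  qed
 qed
 moreover have "0 <= a * (psi p x * y\<^sup>2)" "0 <= b * \<bar>y\<bar> powr p" "0 <= a * \<bar>y\<bar> powr p" "0 <= b * (psi p x * y\<^sup>2)"
  using ab nn by (auto simp del: mult_nonneg_nonneg intro!: mult_nonneg_nonneg)
 ultimately show ?thesis unfolding ab distrib_left distrib_right by linarith
qed

text \<open>Young's inequality for \<open>r * x powr p\<close> and
  \<open>r powr (1 - p/k) * y powr p\<close> with weights \<open>(p-k)/p\<close> and
  \<open>k/p\<close>: the second power of \<open>r\<close> is the one that makes \<open>r\<close>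
  cancel in the product. The weights are then estimated by 1.\<close>

lemma young_weighted:
 assumes k: "0 < k" "k < p" and r: "0 < r" and xy: "0 <= x" "0 <= (y::real)"
 shows "x powr (p - k) * y powr k <= r * x powr p + r powr (1 - p / k) * y powr p"
proof (cases "x = 0 \<or> y = 0")
 case True
 then show ?thesis using k r by auto
next
 case False
 then have pos: "x > 0" "y > 0" using xy by auto
 define a b where "a = r * x powr p" and "b = r powr (1 - p / k) * y powr p"
 have ab: "0 < a" "0 < b" using pos r by (auto simp: a_def b_def)
 have p: "p > 0" using k by simp
 have "a powr ((p - k) / p) * b powr (k / p) <= (p - k) / p * a + k / p * b"
  by (rule Youngs_inequality_0) (use k p ab in \<open>auto simp: field_simps\<close>)
 also have "... <= 1 * a + 1 * b"
  using k p ab by (intro add_mono mult_right_mono) auto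
 also have "a powr ((p - k) / p) = r powr ((p - k) / p) * x powr (p - k)"
  unfolding a_def using r p pos by (simp add: powr_mult powr_powr)
 also have "b powr (k / p) = r powr ((1 - p / k) * (k / p)) * y powr k"
  unfolding b_def using r p k pos by (simp add: powr_mult powr_powr)
 also have "(1 - p / k) * (k / p) = - ((p - k) / p)" using k p by (simp add: field_simps)
 also have "r powr ((p - k) / p) * x powr (p - k) * (r powr (- ((p - k) / p)) * y powr k) = x powr (p - k) * y powr k"
  using r by (simp add: powr_minus)
 finally show ?thesis by (simp add: a_def b_def)
qed

lemma psi_young:
 assumes p: "2 <= p" and r: "0 < r"
 shows "psi p x * y\<^sup>2 <= r * \<bar>x\<bar> powr p + r powr (1 - p / 2) * \<bar>y\<bar> powr p"
proof (cases "p = 2")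
 case True
 then show ?thesis using r by (simp add: psi_def powr_numeral)
next
 case False
 then show ?thesis using young_weighted[of 2 p r "\<bar>x\<bar>" "\<bar>y\<bar>"] p r by (simp add: psi_def powr_numeral)
qed

text \<open>Taking \<open>r\<close> proportional to \<open>g powr k\<close> extracts
  \<open>g powr k\<close> and leaves a factor that does not depend on \<open>g\<close>. After
  integration over times and sites the total of \<open>g powr k\<close> is compared with
  \<open>G\<close>, and \<open>U\<close> survives with the small coefficient \<open>d\<close>. For
  \<open>g = 0\<close> the parameter \<open>r\<close> tends to 0.\<close>

lemma young_optimize:
 fixes k p Z U g d G :: real
 assumes k: "0 < k" and Z: "!!r. 0 < r ==> Z <= r * U + r powr (1 - p / k) * g powr p"
  and U: "0 <= U" and g: "0 <= g" and d: "0 < d" and G: "0 < G"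
 shows "Z <= g powr k * (d * U / G + d powr (1 - p / k) * G powr (p / k - 1))"
proof (cases "g = 0")
 case True
 have "Z <= 0 + e" if "e > 0" for e
 proof -
  have "0 < e / (U + 1)" using U that by simp
  then have "Z <= e / (U + 1) * U" using Z[of "e / (U + 1)"] True by simp
  also have "... <= e" using U that by (simp add: field_simps)
  finally show ?thesis by simp
 qed
 then have "Z <= 0" by (rule field_le_epsilon)
 then show ?thesis using True by simp
next
 case False
 then have g0: "g > 0" using g by simp
 define r where "r = d * g powr k / G"
 have r: "r > 0" using g0 d G by (simp add: r_def)
 have "r powr (1 - p / k) * g powr p = d powr (1 - p / k) * G powr (p / k - 1) * (g powr (k * (1 - p / k)) * g powr p)"
  unfolding r_def using d G g0 by (simp add: powr_mult powr_divide powr_powr powr_diff field_simps)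
 also have "g powr (k * (1 - p / k)) * g powr p = g powr k"
  unfolding powr_add[symmetric] using k by (simp add: algebra_simps)
 finally have "r powr (1 - p / k) * g powr p = g powr k * (d powr (1 - p / k) * G powr (p / k - 1))" by (simp add: mult_ac)
 moreover have "r * U = g powr k * (d * U / G)" by (simp add: r_def)
 ultimately show ?thesis using Z[OF r] by (simp add: distrib_left)
qed

text \<open>Summation by parts: from \<open>n\<close> to \<open>Suc n\<close> the right side grows
  by \<open>(s (Suc n) powr (p-1) - s n powr (p-1)) * \<bar>m (Suc n)\<bar>\<close>. This is 0
  unless a new maximum is attained, and then Young's inequality shows that it dominates the growth
  of the left side.\<close>

lemma doob_pathwise_sum:
 fixes m s :: "nat => real"
 assumes p: "2 <= p" and s: "!!i. s i = Max ((%j. \<bar>m j\<bar>) ` {..i})"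
 shows "(p - 1) / p * s n powr p <= s n powr (p - 1) * \<bar>m n\<bar> - (\<Sum>i<n. s i powr (p - 1) * (\<bar>m (Suc i)\<bar> - \<bar>m i\<bar>))"
proof (induction n)
 case 0
 have s0: "s 0 = \<bar>m 0\<bar>" by (simp add: s)
 have "(p - 1) / p * s 0 powr p <= 1 * s 0 powr p" using p by (intro mult_right_mono) auto
 also have "... = s 0 powr (p - 1) * s 0 powr 1" by (simp only: powr_add[symmetric]) simp
 finally show ?case by (simp add: s0)
next
 case (Suc n)
 have sS: "s (Suc n) = max \<bar>m (Suc n)\<bar> (s n)"
  by (simp add: s atMost_Suc)
 have sn: "0 <= s n" unfolding s by (rule order.trans[OF abs_ge_zero[of "m n"] Max_ge]) auto
 have "(p - 1) / p * (s (Suc n) powr p - s n powr p) <= (s (Suc n) powr (p - 1) - s n powr (p - 1)) * \<bar>m (Suc n)\<bar>"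
 proof (cases "\<bar>m (Suc n)\<bar> <= s n")
  case True
  then show ?thesis by (simp add: sS)
 next
  case False
  then have e: "s (Suc n) = \<bar>m (Suc n)\<bar>" by (simp add: sS)
  define a b where "a = s n" and "b = \<bar>m (Suc n)\<bar>"
  have ab: "0 <= a" "0 < b" using sn False by (auto simp: a_def b_def)
  have "a powr (p - 1) * b <= (a powr (p - 1)) powr (p / (p - 1)) / (p / (p - 1)) + b powr p / p"
   by (rule Youngs_inequality) (use p ab in \<open>auto simp: field_simps\<close>)
  also have "(a powr (p - 1)) powr (p / (p - 1)) = a powr p" using p by (simp add: powr_powr)
  finally have y: "a powr (p - 1) * b <= (p - 1) / p * a powr p + b powr p / p" by (simp add: mult.commute)
  have "b powr (p - 1) * b = b powr (p - 1) * b powr 1" using ab by simp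
  also have "... = b powr p" by (simp only: powr_add[symmetric]) simp
  finally have bb: "b powr (p - 1) * b = b powr p" .
  have "(p - 1) / p * (b powr p - a powr p) = b powr p - (b powr p / p + (p - 1) / p * a powr p)"
   using p by (simp add: field_simps)
  also have "... <= b powr p - a powr (p - 1) * b" using y by simp
  finally show ?thesis by (simp add: e a_def[symmetric] b_def[symmetric] left_diff_distrib bb)
 qed
 with Suc show ?case by (simp add: algebra_simps)
qed

text \<open>Prepares the inequality for expectations. Half of the left side absorbs
  \<open>s n powr (p-1) * \<bar>m n\<bar>\<close>, and \<open>sgn (m i)\<close>, a subgradient of
  the absolute value, replaces increments of \<open>\<bar>m\<bar>\<close> by increments of
  \<open>m\<close>, so that for a martingale the sum has mean 0.\<close>

lemma doob_pathwise:
 fixes m s :: "nat => real"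
 assumes p: "2 <= p" and s: "!!i. s i = Max ((%j. \<bar>m j\<bar>) ` {..i})"
 shows "(p - 1) / (2 * p) * s n powr p <= ((p - 1) / (2 * p)) powr (1 - p) * \<bar>m n\<bar> powr p
   - (\<Sum>i<n. s i powr (p - 1) * sgn (m i) * (m (Suc i) - m i))"
proof -
 define r where "r = (p - 1) / (2 * p)"
 have r: "r > 0" using p by (simp add: r_def)
 have sn: "0 <= s i" for i unfolding s by (rule order.trans[OF abs_ge_zero[of "m i"] Max_ge]) auto
 have "s n powr (p - 1) * \<bar>m n\<bar> powr 1 <= r * s n powr p + r powr (1 - p / 1) * \<bar>m n\<bar> powr p"
  by (rule young_weighted) (use p r sn in auto)
 then have 1: "s n powr (p - 1) * \<bar>m n\<bar> <= r * s n powr p + r powr (1 - p) * \<bar>m n\<bar> powr p" by simp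
 have 2: "(\<Sum>i<n. s i powr (p - 1) * sgn (m i) * (m (Suc i) - m i)) <= (\<Sum>i<n. s i powr (p - 1) * (\<bar>m (Suc i)\<bar> - \<bar>m i\<bar>))"
 proof (rule sum_mono)
  fix i
  have "sgn (m i) * (m (Suc i) - m i) <= \<bar>m (Suc i)\<bar> - \<bar>m i\<bar>" by (auto simp: sgn_if abs_if)
  then have "s i powr (p - 1) * (sgn (m i) * (m (Suc i) - m i)) <= s i powr (p - 1) * (\<bar>m (Suc i)\<bar> - \<bar>m i\<bar>)"
   by (rule mult_left_mono) simp
  then show "s i powr (p - 1) * sgn (m i) * (m (Suc i) - m i) <= s i powr (p - 1) * (\<bar>m (Suc i)\<bar> - \<bar>m i\<bar>)" by (simp add: mult.assoc)
 qed
 have "(p - 1) / p * s n powr p = r * s n powr p + r * s n powr p" using p by (simp add: r_def field_simps)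
 then show ?thesis using doob_pathwise_sum[OF p s, of n] 1 2 unfolding r_def[symmetric] by linarith
qed

lemma powr_add_tendsto:
 assumes "0 <= G" "0 < a"
 shows "(%n. (G + 1 / real (Suc n)) powr a) \<longlonglongrightarrow> G powr a"
proof -
 have "(%n. 1 / real (Suc n)) \<longlonglongrightarrow> 0" by real_asymp
 then have "(%n. G + 1 / real (Suc n)) \<longlonglongrightarrow> G + 0" by (intro tendsto_intros)
 then have "(%n. (G + 1 / real (Suc n)) powr a) \<longlonglongrightarrow> (G + 0) powr a"
  using assms by (intro tendsto_powr2) (auto intro!: always_eventually)
 then show ?thesis by simp
qed

section \<open>Moments of a compensated sum with drift\<close>

context jump_process begin

text \<open>The jump sum is open at \<open>t\<close>, so the martingale part is left-continuous and
  can be the integrand of a further level.\<close>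

definition msum :: "('x => real => 'a => real) => ('x => real => 'a => real) => ('x => real => 'a => real) => real => 'a => real" where
 "msum \<xi> ze H t om = (\<Sum>x\<in>X. (\<Sum>s\<in>S x om Int {..<t}. H x s om * \<xi> x s om) - (LBINT s:{0..t}. H x s om * ze x s om))"

definition dsum :: "('x => real => 'a => real) => ('x => real => 'a => real) => real => 'a => real" where
 "dsum rh H t om = (\<Sum>x\<in>X. LBINT s:{0..t}. H x s om * rh x s om)"

lemma nice_msum:
 assumes H: "!!x. x \<in> X ==> nice (H x)" and "mark \<xi> b" "drift ze b'"
 shows "nice (msum \<xi> ze H)"
proof -
 have "nice (%t om. (\<Sum>s\<in>S x om Int {..<t}. H x s om * \<xi> x s om) + (-1) * (LBINT s:{0..t}. H x s om * ze x s om))" if "x \<in> X" for x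
  by (intro nice_add nice_mult nice_const jump_int_nice[OF that H[OF that] assms(2)] drift_int_nice[OF that H[OF that] assms(3)])
 then have "nice (%t om. \<Sum>x\<in>X. (\<Sum>s\<in>S x om Int {..<t}. H x s om * \<xi> x s om) + (-1) * (LBINT s:{0..t}. H x s om * ze x s om))"
  by (intro nice_sum finX)
 then show ?thesis unfolding msum_def[abs_def] by simp
qed

lemma nice_dsum:
 assumes H: "!!x. x \<in> X ==> nice (H x)" and "drift rh b"
 shows "nice (dsum rh H)"
 unfolding dsum_def[abs_def] by (intro nice_sum finX drift_int_nice[OF _ H assms(2)])

lemma nice_dpow:
 assumes p: "2 <= p" and K: "nice K"
 shows "nice (%s om. dpow p (K s om))"
proof (rule nice_comp[OF K continuous_dpow, where c=p and q="nat \<lceil>p\<rceil>"])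
 fix x :: real
 have "p * \<bar>x\<bar> powr (p - 1) <= p * (1 + \<bar>x\<bar>) ^ nat \<lceil>p\<rceil>"
  using p by (intro mult_left_mono powr_le_power) linarith+
 then show "\<bar>dpow p x\<bar> <= p * (1 + \<bar>x\<bar>) ^ nat \<lceil>p\<rceil>" using p by (simp add: abs_dpow)
qed (use p in simp)

lemma nice_psi:
 assumes p: "2 <= p" and K: "nice K"
 shows "nice (%s om. psi p (K s om))"
proof (rule nice_comp[OF K continuous_psi, where c=1 and q="nat \<lceil>p\<rceil>"])
 fix x :: real
 have "\<bar>x\<bar> powr (p - 2) <= (1 + \<bar>x\<bar>) ^ nat \<lceil>p\<rceil>" using p by (intro powr_le_power) linarith+
 moreover have "1 <= (1 + \<bar>x\<bar>) ^ nat \<lceil>p\<rceil>" by (simp add: one_le_power)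
 ultimately show "\<bar>psi p x\<bar> <= 1 * (1 + \<bar>x\<bar>) ^ nat \<lceil>p\<rceil>" by (simp add: psi_def)
qed (use p in simp)

lemma nice_powr:
 assumes a: "0 < a" and K: "nice K"
 shows "nice (%s om. \<bar>K s om\<bar> powr a)"
proof (rule nice_comp[OF K continuous_on_abs_powr[OF a], where c=1 and q="nat \<lceil>a\<rceil>"])
 fix x :: real
 have "\<bar>x\<bar> powr a <= (1 + \<bar>x\<bar>) ^ nat \<lceil>a\<rceil>" using a by (intro powr_le_power) linarith+
 then show "\<bar>\<bar>x\<bar> powr a\<bar> <= 1 * (1 + \<bar>x\<bar>) ^ nat \<lceil>a\<rceil>" by simp
qed

text \<open>\<open>chain_jump\<close> for the union of the jump times of all sites and for the total
  drift density. Disjointness of the jump sets reduces the height \<open>v\<close> at each jump time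
  to a single term.\<close>

lemma chain_rule_pathwise:
 assumes p: "2 <= p" and H: "!!x. x \<in> X ==> nice (H x)" and \<xi>: "mark \<xi> b" and ze: "drift ze b'" and rh: "drift rh r"
  and t: "0 <= t" "t <= 1" and om: "om \<in> space P"
 defines "Z \<equiv> %s. msum \<xi> ze H s om + dsum rh H s om"
 shows "\<bar>Z t\<bar> powr p = (\<Sum>x\<in>X. (\<Sum>s\<in>S x om Int {..<t}. \<bar>Z s + H x s om * \<xi> x s om\<bar> powr p - \<bar>Z s\<bar> powr p)
   - (LBINT s:{0..t}. dpow p (Z s) * H x s om * ze x s om) + (LBINT s:{0..t}. dpow p (Z s) * H x s om * rh x s om))"
proof -
 define J where "J = (\<Union>x\<in>X. S x om)"
 define v where "v s = (\<Sum>x\<in>X. if s \<in> S x om then H x s om * \<xi> x s om else 0)" for s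
 define d where "d s = (\<Sum>x\<in>X. H x s om * rh x s om - H x s om * ze x s om)" for s
 have finJ: "finite J" using finX finS[OF _ om] by (auto simp: J_def)
 have J0: "J \<subseteq> {0<..}" using S_pos[OF _ om] by (auto simp: J_def)
 have v: "v s = H x s om * \<xi> x s om" if x: "x \<in> X" "s \<in> S x om" for x s
 proof -
  have "(\<Sum>y\<in>X. if s \<in> S y om then H y s om * \<xi> y s om else 0) = (\<Sum>y\<in>X. if y = x then H x s om * \<xi> x s om else 0)"
   by (rule sum.cong[OF refl]) (use disj[OF x(1) _ _ om] x in auto)
  then show ?thesis using x finX by (simp add: v_def)
 qed
 have sumJ: "(\<Sum>s\<in>J Int {..<u}. f s) = (\<Sum>x\<in>X. \<Sum>s\<in>S x om Int {..<u}. f s)" for f :: "real => real" and u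
 proof -
  have "J Int {..<u} = (\<Union>x\<in>X. S x om Int {..<u})" by (auto simp: J_def)
  then show ?thesis
  proof (simp only:, intro sum.UNION_disjoint ballI impI)
   fix i j assume "i \<in> X" "j \<in> X" "i ~= j"
   then show "(S i om Int {..<u}) Int (S j om Int {..<u}) = {}" using disj[OF _ _ _ om] by blast
  qed (use finX finS[OF _ om] in auto)
 qed
 have ize: "set_integrable lborel {0..u} (%s. H x s om * ze x s om)" and irh: "set_integrable lborel {0..u} (%s. H x s om * rh x s om)"
  if "x \<in> X" "u <= 1" for x u
  using nice_drift_integrable[OF that(1) H[OF that(1)] ze om that(2)] nice_drift_integrable[OF that(1) H[OF that(1)] rh om that(2)] .
 have id: "set_integrable lborel {0..1} d"
  unfolding d_def set_integrable_def scaleR_sum_right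
  by (rule Bochner_Integration.integrable_sum) (use set_integral_diff(1)[OF irh ize] in \<open>auto simp: set_integrable_def\<close>)
 have intd: "(LBINT s:{0..u}. d s) = (\<Sum>x\<in>X. (LBINT s:{0..u}. H x s om * rh x s om) - (LBINT s:{0..u}. H x s om * ze x s om))"
  if "u <= 1" for u
 proof -
  have "(LBINT s:{0..u}. d s) = (\<Sum>x\<in>X. LBINT s:{0..u}. H x s om * rh x s om - H x s om * ze x s om)"
   unfolding d_def set_lebesgue_integral_def scaleR_sum_right
   by (rule Bochner_Integration.integral_sum) (use set_integral_diff(1)[OF irh ize] that in \<open>auto simp: set_integrable_def\<close>)
  then show ?thesis using set_integral_diff(2)[OF irh ize] that by simp
 qed
 have "\<forall>x\<in>X. \<exists>B. \<forall>s\<in>{0..1}. \<bar>H x s om\<bar> <= B"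
 proof
  fix x assume x: "x \<in> X"
  obtain c q where "0 <= c" "!!s om. 0 <= s ==> s <= 1 ==> om \<in> space P ==> \<bar>H x s om\<bar> <= c * (1 + real (N om)) ^ q"
   using nice_bound[OF H[OF x]] by blast
  then have "\<forall>s\<in>{0..1}. \<bar>H x s om\<bar> <= c * (1 + real (N om)) ^ q" using om by simp
  then show "\<exists>B. \<forall>s\<in>{0..1}. \<bar>H x s om\<bar> <= B" by blast
 qed
 from bchoice[OF this] obtain B where "\<forall>x\<in>X. \<forall>s\<in>{0..1}. \<bar>H x s om\<bar> <= B x" ..
 then have B: "!!x s. x \<in> X ==> s \<in> {0..1} ==> \<bar>H x s om\<bar> <= B x" by blast
 have b0: "0 <= b'" "0 <= r" using ze rh by (simp_all add: drift_def)
 have bd: "\<bar>d s\<bar> <= (\<Sum>x\<in>X. B x * r + B x * b')" if s: "s \<in> {0..1}" for s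
  unfolding d_def
 proof (rule order.trans[OF sum_abs sum_mono])
  fix x assume x: "x \<in> X"
  have Bx: "0 <= B x" using B[OF x s] by linarith
  have "\<bar>H x s om * rh x s om\<bar> <= B x * r" "\<bar>H x s om * ze x s om\<bar> <= B x * b'"
   unfolding abs_mult using B[OF x s] drift_bound[OF rh x om] drift_bound[OF ze x om] s Bx by (auto intro!: mult_mono)
  then show "\<bar>H x s om * rh x s om - H x s om * ze x s om\<bar> <= B x * r + B x * b'" by linarith
 qed
 have Z: "Z u = (\<Sum>s\<in>J Int {..<u}. v s) + (LBINT s:{0..u}. d s)" if "u <= 1" for u
 proof -
  have "(\<Sum>s\<in>J Int {..<u}. v s) = (\<Sum>x\<in>X. \<Sum>s\<in>S x om Int {..<u}. H x s om * \<xi> x s om)"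
   unfolding sumJ by (intro sum.cong refl) (auto simp: v)
  then show ?thesis unfolding Z_def msum_def dsum_def intd[OF that] by (simp add: sum_subtractf sum.distrib)
 qed
 define Y where "Y u = (\<Sum>s\<in>J Int {..<u}. v s) + (LBINT s:{0..u}. d s)" for u
 have YZ: "Y u = Z u" if "u <= 1" for u using Z[OF that] by (simp add: Y_def)
 have cr: "\<bar>Y t\<bar> powr p - \<bar>0\<bar> powr p = (\<Sum>s\<in>J Int {..<t}. \<bar>Y s + v s\<bar> powr p - \<bar>Y s\<bar> powr p) + (LBINT s:{0..t}. dpow p (Y s) * d s)"
 proof -
  have p1: "1 < p" using p by simp
  show ?thesis
   using chain_jump[OF finJ J0 id bd DERIV_abs_powr[OF p1] continuous_dpow[OF p1] t, of v] unfolding Y_def by simp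
 qed
 have 1: "(\<Sum>s\<in>J Int {..<t}. \<bar>Y s + v s\<bar> powr p - \<bar>Y s\<bar> powr p) = (\<Sum>x\<in>X. \<Sum>s\<in>S x om Int {..<t}. \<bar>Z s + H x s om * \<xi> x s om\<bar> powr p - \<bar>Z s\<bar> powr p)"
  unfolding sumJ
 proof (intro sum.cong refl)
  fix x s assume "x \<in> X" "s \<in> S x om Int {..<t}"
  then show "\<bar>Y s + v s\<bar> powr p - \<bar>Y s\<bar> powr p = \<bar>Z s + H x s om * \<xi> x s om\<bar> powr p - \<bar>Z s\<bar> powr p"
   using t by (simp add: v YZ)
 qed
 have nZ: "nice (%s om. msum \<xi> ze H s om + dsum rh H s om)" by (intro nice_add nice_msum[OF H \<xi> ze] nice_dsum[OF H rh])
 have nK: "nice (%s om. dpow p (msum \<xi> ze H s om + dsum rh H s om) * H x s om)" if "x \<in> X" for x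
  by (rule nice_mult[OF nice_dpow[OF p nZ] H[OF that]])
 have jze: "set_integrable lborel {0..t} (%s. dpow p (Z s) * H x s om * ze x s om)"
  and jrh: "set_integrable lborel {0..t} (%s. dpow p (Z s) * H x s om * rh x s om)" if x: "x \<in> X" for x
  using nice_drift_integrable[OF x nK[OF x] ze om t(2)] nice_drift_integrable[OF x nK[OF x] rh om t(2)]
  unfolding Z_def .
 have 2: "(LBINT s:{0..t}. dpow p (Y s) * d s) = (\<Sum>x\<in>X. (LBINT s:{0..t}. dpow p (Z s) * H x s om * rh x s om) - (LBINT s:{0..t}. dpow p (Z s) * H x s om * ze x s om))"
 proof -
  have "(LBINT s:{0..t}. dpow p (Y s) * d s) = (LBINT s:{0..t}. (\<Sum>x\<in>X. dpow p (Z s) * H x s om * rh x s om - dpow p (Z s) * H x s om * ze x s om))"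
   by (rule set_lebesgue_integral_cong)
     (use t in \<open>auto simp: YZ d_def sum_distrib_left algebra_simps\<close>)
  also have "... = (\<Sum>x\<in>X. LBINT s:{0..t}. dpow p (Z s) * H x s om * rh x s om - dpow p (Z s) * H x s om * ze x s om)"
   unfolding set_lebesgue_integral_def scaleR_sum_right
   by (rule Bochner_Integration.integral_sum) (rule set_integral_diff(1)[OF jrh jze, unfolded set_integrable_def])
  also have "... = (\<Sum>x\<in>X. (LBINT s:{0..t}. dpow p (Z s) * H x s om * rh x s om) - (LBINT s:{0..t}. dpow p (Z s) * H x s om * ze x s om))"
   by (intro sum.cong refl set_integral_diff(2) jrh jze)
  finally show ?thesis .
 qed
 show ?thesis using cr p YZ[OF t(2)] unfolding 1 2 by (simp add: sum.distrib sum_subtractf)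
qed

text \<open>Expectation of the chain rule. The first-order part \<open>dpow p (Z s) * H\<close> of
  the jumps together with the integral against \<open>ze\<close> is again a compensated sum and has
  mean 0. The remainder is estimated by \<open>power_jump\<close> and charged to the intensity,
  while the drift \<open>rh\<close> contributes directly.\<close>

lemma moment_inequality:
 assumes p: "2 <= p" and H: "!!x. x \<in> X ==> nice (H x)" and \<xi>: "mark \<xi> b" and ze: "drift ze b'"
  and comp: "compensates ze \<xi>" and rh: "drift rh r" and t: "0 <= t" "t <= 1"
 defines "Z \<equiv> %s om. msum \<xi> ze H s om + dsum rh H s om"
 shows "(\<integral>om. \<bar>Z t om\<bar> powr p \<partial>P) <= (\<Sum>x\<in>X. lam * taylor_const p *
    (LBINT s:{0..t}. b\<^sup>2 * (\<integral>om. psi p (Z s om) * (H x s om)\<^sup>2 \<partial>P) + b powr p * (\<integral>om. \<bar>H x s om\<bar> powr p \<partial>P))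
   + r * p * (LBINT s:{0..t}. (\<integral>om. \<bar>Z s om\<bar> powr (p - 1) * \<bar>H x s om\<bar> \<partial>P)))"
proof -
 define C where "C = taylor_const p"
 have C: "0 <= C" using taylor_const_nonneg[OF p] by (simp add: C_def)
 have b: "0 <= b" "0 <= r" using \<xi> rh by (simp_all add: mark_def drift_def)
 have nZ: "nice Z" unfolding Z_def by (intro nice_add nice_msum[OF H \<xi> ze] nice_dsum[OF H rh])
 define K where "K x s om = dpow p (Z s om) * H x s om" for x s om
 define Q where "Q x s om = b\<^sup>2 * (psi p (Z s om) * (H x s om)\<^sup>2) + b powr p * \<bar>H x s om\<bar> powr p" for x s om
 define R where "R x s om = \<bar>Z s om\<bar> powr (p - 1) * \<bar>H x s om\<bar>" for x s om
 have nK: "nice (K x)" if "x \<in> X" for x unfolding K_def[abs_def] by (rule nice_mult[OF nice_dpow[OF p nZ] H[OF that]])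
 have nQ1: "nice (%s om. psi p (Z s om) * (H x s om)\<^sup>2)" and nQ2: "nice (%s om. \<bar>H x s om\<bar> powr p)" if "x \<in> X" for x
  using p unfolding power2_eq_square by (auto intro!: nice_mult nice_psi nZ nice_powr H[OF that])
 have nQ: "nice (Q x)" if "x \<in> X" for x
  unfolding Q_def[abs_def] by (intro nice_add nice_mult[OF nice_const] nQ1 nQ2 that)
 have nR: "nice (R x)" if "x \<in> X" for x
  unfolding R_def[abs_def] using p by (intro nice_mult nice_powr nice_abs nZ H[OF that]) auto
 have path: "\<bar>Z t om\<bar> powr p <= (\<Sum>x\<in>X. ((\<Sum>s\<in>S x om Int {..<t}. K x s om * \<xi> x s om) - (LBINT s:{0..t}. K x s om * ze x s om))
    + C * (\<Sum>s\<in>S x om Int {..<t}. Q x s om) + r * p * (LBINT s:{0..t}. R x s om))" if om: "om \<in> space P" for om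
 proof -
  have "\<bar>Z t om\<bar> powr p = (\<Sum>x\<in>X. (\<Sum>s\<in>S x om Int {..<t}. \<bar>Z s om + H x s om * \<xi> x s om\<bar> powr p - \<bar>Z s om\<bar> powr p)
   - (LBINT s:{0..t}. K x s om * ze x s om) + (LBINT s:{0..t}. K x s om * rh x s om))"
   using chain_rule_pathwise[OF p H \<xi> ze rh t om] unfolding Z_def K_def by simp
  also have "... <= (\<Sum>x\<in>X. ((\<Sum>s\<in>S x om Int {..<t}. K x s om * \<xi> x s om) - (LBINT s:{0..t}. K x s om * ze x s om))
    + C * (\<Sum>s\<in>S x om Int {..<t}. Q x s om) + r * p * (LBINT s:{0..t}. R x s om))"
  proof (rule sum_mono)
   fix x assume x: "x \<in> X"
   have 1: "(\<Sum>s\<in>S x om Int {..<t}. \<bar>Z s om + H x s om * \<xi> x s om\<bar> powr p - \<bar>Z s om\<bar> powr p)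
    <= (\<Sum>s\<in>S x om Int {..<t}. K x s om * \<xi> x s om + C * Q x s om)"
   proof (rule sum_mono)
    fix s assume s: "s \<in> S x om Int {..<t}"
    define y where "y = H x s om * \<xi> x s om"
    have y: "\<bar>y\<bar> <= b * \<bar>H x s om\<bar>" unfolding y_def abs_mult
     using mult_left_mono[OF mark_bound[OF \<xi> x om], of s "\<bar>H x s om\<bar>"] s by (simp add: mult.commute)
    have "\<bar>Z s om + y\<bar> powr p - \<bar>Z s om\<bar> powr p - dpow p (Z s om) * y <= C * (psi p (Z s om) * y\<^sup>2 + \<bar>y\<bar> powr p)"
     unfolding C_def by (rule power_jump[OF p])
    also have "... <= C * Q x s om"
    proof (rule mult_left_mono[OF _ C])
     have "y\<^sup>2 <= (b * \<bar>H x s om\<bar>)\<^sup>2" using y by (metis abs_ge_zero power_mono power2_abs)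
     then have "psi p (Z s om) * y\<^sup>2 <= psi p (Z s om) * (b * \<bar>H x s om\<bar>)\<^sup>2" by (rule mult_left_mono[OF _ psi_nonneg])
     moreover have "\<bar>y\<bar> powr p <= (b * \<bar>H x s om\<bar>) powr p" using y p by (intro powr_mono2) auto
     ultimately show "psi p (Z s om) * y\<^sup>2 + \<bar>y\<bar> powr p <= Q x s om"
      using b by (simp add: Q_def power_mult_distrib powr_mult mult_ac)
    qed
    finally show "\<bar>Z s om + H x s om * \<xi> x s om\<bar> powr p - \<bar>Z s om\<bar> powr p <= K x s om * \<xi> x s om + C * Q x s om"
     by (simp add: y_def K_def mult.assoc)
   qed
   have 2: "(LBINT s:{0..t}. K x s om * rh x s om) <= (LBINT s:{0..t}. r * p * R x s om)"
   proof (rule set_integral_mono)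
    show "set_integrable lborel {0..t} (%s. K x s om * rh x s om)" by (rule nice_drift_integrable[OF x nK[OF x] rh om t(2)])
    show "set_integrable lborel {0..t} (%s. r * p * R x s om)"
     using nice_drift_integrable[OF x nR[OF x] drift_one om t(2)] by simp
    fix s assume s: "s \<in> {0..t}"
    have "K x s om * rh x s om <= \<bar>K x s om\<bar> * \<bar>rh x s om\<bar>" by (simp add: abs_mult[symmetric])
    also have "... <= \<bar>K x s om\<bar> * r" using drift_bound[OF rh x om] s t by (intro mult_left_mono) auto
    also have "... = r * p * R x s om" using p by (simp add: K_def R_def abs_mult abs_dpow)
    finally show "K x s om * rh x s om <= r * p * R x s om" .
   qed
   show "(\<Sum>s\<in>S x om Int {..<t}. \<bar>Z s om + H x s om * \<xi> x s om\<bar> powr p - \<bar>Z s om\<bar> powr p)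
     - (LBINT s:{0..t}. K x s om * ze x s om) + (LBINT s:{0..t}. K x s om * rh x s om)
    <= ((\<Sum>s\<in>S x om Int {..<t}. K x s om * \<xi> x s om) - (LBINT s:{0..t}. K x s om * ze x s om))
    + C * (\<Sum>s\<in>S x om Int {..<t}. Q x s om) + r * p * (LBINT s:{0..t}. R x s om)"
    using 1 2 by (simp add: sum.distrib sum_distrib_left)
  qed
  finally show ?thesis .
 qed
 have Qnn: "0 <= Q x s om" for x s om unfolding Q_def using psi_nonneg by (intro add_nonneg_nonneg mult_nonneg_nonneg) auto
 have iA: "integrable P (%om. (\<Sum>s\<in>S x om Int {..<t}. K x s om * \<xi> x s om) - (LBINT s:{0..t}. K x s om * ze x s om))" if x: "x \<in> X" for x
  by (intro Bochner_Integration.integrable_diff nice_integrable[OF jump_int_nice[OF x nK[OF x] \<xi>] t] nice_integrable[OF drift_int_nice[OF x nK[OF x] ze] t])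
 have iB: "integrable P (%om. \<Sum>s\<in>S x om Int {..<t}. Q x s om)" and
  bB: "(\<integral>om. (\<Sum>s\<in>S x om Int {..<t}. Q x s om) \<partial>P) <= lam * (LBINT s:{0..t}. (\<integral>om. Q x s om \<partial>P))" if x: "x \<in> X" for x
  using nice_jump_expect_le[OF x nQ[OF x] Qnn t] by auto
 have iR: "integrable P (%om. LBINT s:{0..t}. R x s om)" and
  bR: "(\<integral>om. (LBINT s:{0..t}. R x s om) \<partial>P) = (LBINT s:{0..t}. (\<integral>om. R x s om \<partial>P))" if x: "x \<in> X" for x
  using nice_fubini[OF x nR[OF x] t] by auto
 have iall: "integrable P (%om. ((\<Sum>s\<in>S x om Int {..<t}. K x s om * \<xi> x s om) - (LBINT s:{0..t}. K x s om * ze x s om))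
    + C * (\<Sum>s\<in>S x om Int {..<t}. Q x s om) + r * p * (LBINT s:{0..t}. R x s om))" if x: "x \<in> X" for x
  by (intro Bochner_Integration.integrable_add integrable_mult_right iA[OF x] iB[OF x] iR[OF x])
 have "(\<integral>om. \<bar>Z t om\<bar> powr p \<partial>P) <= (\<integral>om. (\<Sum>x\<in>X. ((\<Sum>s\<in>S x om Int {..<t}. K x s om * \<xi> x s om) - (LBINT s:{0..t}. K x s om * ze x s om))
    + C * (\<Sum>s\<in>S x om Int {..<t}. Q x s om) + r * p * (LBINT s:{0..t}. R x s om)) \<partial>P)"
  by (rule integral_mono[OF nice_integrable[OF nice_powr[OF _ nZ] t] _ path]) (use p iall in \<open>auto intro: Bochner_Integration.integrable_sum\<close>)
 also have "... = (\<Sum>x\<in>X. \<integral>om. ((\<Sum>s\<in>S x om Int {..<t}. K x s om * \<xi> x s om) - (LBINT s:{0..t}. K x s om * ze x s om))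
    + C * (\<Sum>s\<in>S x om Int {..<t}. Q x s om) + r * p * (LBINT s:{0..t}. R x s om) \<partial>P)"
  by (rule Bochner_Integration.integral_sum[OF iall])
 also have "... <= (\<Sum>x\<in>X. lam * C * (LBINT s:{0..t}. b\<^sup>2 * (\<integral>om. psi p (Z s om) * (H x s om)\<^sup>2 \<partial>P) + b powr p * (\<integral>om. \<bar>H x s om\<bar> powr p \<partial>P))
   + r * p * (LBINT s:{0..t}. (\<integral>om. R x s om \<partial>P)))"
 proof (rule sum_mono)
  fix x assume x: "x \<in> X"
  have eQ: "(LBINT s:{0..t}. (\<integral>om. Q x s om \<partial>P)) = (LBINT s:{0..t}. b\<^sup>2 * (\<integral>om. psi p (Z s om) * (H x s om)\<^sup>2 \<partial>P) + b powr p * (\<integral>om. \<bar>H x s om\<bar> powr p \<partial>P))"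
  proof (rule set_lebesgue_integral_cong, simp, intro allI impI)
   fix s assume "s \<in> {0..t}"
   then have s: "0 <= s" "s <= 1" using t by auto
   show "(\<integral>om. Q x s om \<partial>P) = b\<^sup>2 * (\<integral>om. psi p (Z s om) * (H x s om)\<^sup>2 \<partial>P) + b powr p * (\<integral>om. \<bar>H x s om\<bar> powr p \<partial>P)"
    unfolding Q_def using nice_integrable[OF nQ1[OF x] s] nice_integrable[OF nQ2[OF x] s]
    by (subst Bochner_Integration.integral_add) auto
  qed
  have "(\<integral>om. ((\<Sum>s\<in>S x om Int {..<t}. K x s om * \<xi> x s om) - (LBINT s:{0..t}. K x s om * ze x s om))
    + C * (\<Sum>s\<in>S x om Int {..<t}. Q x s om) + r * p * (LBINT s:{0..t}. R x s om) \<partial>P)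
   = (\<integral>om. ((\<Sum>s\<in>S x om Int {..<t}. K x s om * \<xi> x s om) - (LBINT s:{0..t}. K x s om * ze x s om)) \<partial>P)
    + C * (\<integral>om. (\<Sum>s\<in>S x om Int {..<t}. Q x s om) \<partial>P) + r * p * (\<integral>om. (LBINT s:{0..t}. R x s om) \<partial>P)"
   using iA[OF x] iB[OF x] iR[OF x] by (simp add: Bochner_Integration.integral_add)
  also have "... = C * (\<integral>om. (\<Sum>s\<in>S x om Int {..<t}. Q x s om) \<partial>P) + r * p * (LBINT s:{0..t}. (\<integral>om. R x s om \<partial>P))"
   unfolding compensation[OF x nK[OF x] \<xi> ze comp t] bR[OF x] by simp
  also have "... <= C * (lam * (LBINT s:{0..t}. (\<integral>om. Q x s om \<partial>P))) + r * p * (LBINT s:{0..t}. (\<integral>om. R x s om \<partial>P))"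
   by (intro add_right_mono mult_left_mono[OF bB[OF x] C])
  finally show "(\<integral>om. ((\<Sum>s\<in>S x om Int {..<t}. K x s om * \<xi> x s om) - (LBINT s:{0..t}. K x s om * ze x s om))
    + C * (\<Sum>s\<in>S x om Int {..<t}. Q x s om) + r * p * (LBINT s:{0..t}. R x s om) \<partial>P)
   <= lam * C * (LBINT s:{0..t}. b\<^sup>2 * (\<integral>om. psi p (Z s om) * (H x s om)\<^sup>2 \<partial>P) + b powr p * (\<integral>om. \<bar>H x s om\<bar> powr p \<partial>P))
   + r * p * (LBINT s:{0..t}. (\<integral>om. R x s om \<partial>P))" by (simp add: eQ mult_ac)
 qed
 finally show ?thesis by (simp add: C_def R_def)
qed

end

lemma LBINT_mono_upper:
 fixes f :: "real => real"
 assumes f: "set_integrable lborel {0..T} f" and nn: "!!s. 0 <= s ==> s <= T ==> 0 <= f s" and t: "0 <= t" "t <= T"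
 shows "(LBINT s:{0..t}. f s) <= (LBINT s:{0..T}. f s)"
proof -
 have "0 <= (LBINT s:{t..T}. f s)"
  unfolding set_lebesgue_integral_def using nn t by (intro integral_nonneg_AE AE_I2) (auto simp: indicator_def)
 then show ?thesis using LBINT_split[OF f t] by simp
qed

lemma powr_mult_split: "0 < G ==> (d * U / G + c * G powr (a - 1)) * G = d * U + c * G powr (a::real)"
 by (simp add: distrib_right powr_diff)

text \<open>The value of \<open>d\<close> makes the absorbed coefficient \<open>(C + p) * d\<close>
  equal to 1/2; the outer factor 2 undoes that absorption.\<close>

definition ros_const :: "real => real" where
 "ros_const p = (let C = taylor_const p; d = 1 / (2 * (C + p)) in 2 * (C * d powr (1 - p / 2) + C + p * d powr (1 - p)))"

lemma ros_const_nonneg: "2 <= p ==> 0 <= ros_const p"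
 using taylor_const_nonneg[of p] by (auto simp: ros_const_def Let_def intro!: add_nonneg_nonneg mult_nonneg_nonneg)

context jump_process begin

text \<open>With \<open>U\<close> the supremum of the moments over \<open>[0,T]\<close>, Young's
  inequality turns each mixed moment of \<open>Z\<close> and \<open>H\<close> into a small multiple
  of \<open>U\<close> plus a term in \<open>g\<close> alone, and the multiple of \<open>U\<close> is
  absorbed on the left. The offset \<open>e\<close> keeps the normalizations \<open>G1\<close> and
  \<open>G2\<close> positive.\<close>

lemma rosenthal_eta:
 assumes p: "2 <= p" and H: "!!x. x \<in> X ==> nice (H x)" and \<xi>: "mark \<xi> b" and ze: "drift ze b'"
  and comp: "compensates ze \<xi>" and rh: "drift rh r" and T: "T <= 1"
  and g0: "!!x s. x \<in> X ==> 0 <= s ==> s <= T ==> 0 <= g x s"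
  and g: "!!x s. x \<in> X ==> 0 <= s ==> s < T ==> (\<integral>om. \<bar>H x s om\<bar> powr p \<partial>P) <= g x s powr p"
  and i1: "!!x. x \<in> X ==> set_integrable lborel {0..T} (%s. g x s)"
  and i2: "!!x. x \<in> X ==> set_integrable lborel {0..T} (%s. (g x s)\<^sup>2)"
  and ip: "!!x. x \<in> X ==> set_integrable lborel {0..T} (%s. g x s powr p)"
  and t: "0 <= t" "t <= T" and e: "0 < e"
 shows "(\<integral>om. \<bar>msum \<xi> ze H t om + dsum rh H t om\<bar> powr p \<partial>P) <= ros_const p *
   ((r * (\<Sum>x\<in>X. LBINT s:{0..T}. g x s) + e) powr p
  + (lam * b\<^sup>2 * (\<Sum>x\<in>X. LBINT s:{0..T}. (g x s)\<^sup>2) + e) powr (p / 2)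
  + lam * b powr p * (\<Sum>x\<in>X. LBINT s:{0..T}. g x s powr p))"
proof -
 define C where "C = taylor_const p"
 have C: "0 <= C" using taylor_const_nonneg[OF p] by (simp add: C_def)
 have b: "0 <= b" "0 <= r" using \<xi> rh by (simp_all add: mark_def drift_def)
 define d where "d = 1 / (2 * (C + p))"
 have d: "0 < d" "(C + p) * d = 1 / 2" using C p by (auto simp: d_def)
 define Z where "Z s om = msum \<xi> ze H s om + dsum rh H s om" for s om
 have nZ: "nice Z" unfolding Z_def[abs_def] by (intro nice_add nice_msum[OF H \<xi> ze] nice_dsum[OF H rh])
 have nQ1: "nice (%s om. psi p (Z s om) * (H x s om)\<^sup>2)" and nQ2: "nice (%s om. \<bar>H x s om\<bar> powr p)" and
  nR: "nice (%s om. \<bar>Z s om\<bar> powr (p - 1) * \<bar>H x s om\<bar>)" if "x \<in> X" for x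
  using p unfolding power2_eq_square by (auto intro!: nice_mult nice_psi nZ nice_powr nice_abs H[OF that])
 have nZp: "nice (%s om. \<bar>Z s om\<bar> powr p)" using p by (intro nice_powr nZ) auto
 define u where "u s = (\<integral>om. \<bar>Z s om\<bar> powr p \<partial>P)" for s
 have T0: "0 <= T" using t by simp
 define U where "U = Sup (u ` {0..T})"
 obtain M where M: "\<forall>s. 0 <= s & s <= 1 --> \<bar>\<integral>om. \<bar>Z s om\<bar> powr p \<partial>P\<bar> <= M" using nice_expect(2)[OF nZp] by blast
 \<comment> \<open>The absorption is legitimate only because \<open>U\<close> is a genuine supremum;
   boundedness comes from the polynomial bound in \<open>N\<close>.\<close>
 have bdd: "bdd_above (u ` {0..T})"
  by (rule bdd_aboveI[of _ M]) (use M T in \<open>force simp: u_def\<close>)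
 have uU: "u s <= U" if "0 <= s" "s <= T" for s unfolding U_def by (rule cSUP_upper[OF _ bdd]) (use that in auto)
 have u0: "0 <= u s" for s unfolding u_def by (intro integral_nonneg_AE AE_I2) auto
 have U0: "0 <= U" using u0[of 0] uU[of 0] T0 by simp
 define A1 A2 Ap where "A1 = (\<Sum>x\<in>X. LBINT s:{0..T}. g x s)" and "A2 = (\<Sum>x\<in>X. LBINT s:{0..T}. (g x s)\<^sup>2)"
  and "Ap = (\<Sum>x\<in>X. LBINT s:{0..T}. g x s powr p)"
 have A: "0 <= A1" "0 <= A2" "0 <= Ap"
  unfolding A1_def A2_def Ap_def set_lebesgue_integral_def using g0
  by (auto intro!: sum_nonneg integral_nonneg_AE AE_I2 simp: indicator_def)
 define G1 G2 where "G1 = r * A1 + e" and "G2 = lam * b\<^sup>2 * A2 + e"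
 have G: "0 < G1" "0 < G2" "r * A1 <= G1" "lam * b\<^sup>2 * A2 <= G2"
  unfolding G1_def G2_def using A b lam e by (auto intro!: add_nonneg_pos mult_nonneg_nonneg)
 define q1 where "q1 = d * U / G1 + d powr (1 - p / 1) * G1 powr (p / 1 - 1)"
 define q2 where "q2 = d * U / G2 + d powr (1 - p / 2) * G2 powr (p / 2 - 1)"
 have q: "0 <= q1" "0 <= q2" using U0 d G by (auto simp: q1_def q2_def)
 have e2: "(\<integral>om. psi p (Z s om) * (H x s om)\<^sup>2 \<partial>P) <= (g x s)\<^sup>2 * q2"
  and e1: "(\<integral>om. \<bar>Z s om\<bar> powr (p - 1) * \<bar>H x s om\<bar> \<partial>P) <= g x s * q1"
  if x: "x \<in> X" and s: "0 <= s" "s < T" for x s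
 proof -
  have s1: "s <= 1" using s T by simp
  note iZ = nice_integrable[OF nZp s(1) s1] and iH = nice_integrable[OF nQ2[OF x] s(1) s1]
  have up: "(\<integral>om. v * \<bar>Z s om\<bar> powr p + w * \<bar>H x s om\<bar> powr p \<partial>P) <= v * U + w * g x s powr p" if "0 <= v" "0 <= w" for v w
  proof -
   have "(\<integral>om. v * \<bar>Z s om\<bar> powr p + w * \<bar>H x s om\<bar> powr p \<partial>P) = v * u s + w * (\<integral>om. \<bar>H x s om\<bar> powr p \<partial>P)"
    using iZ iH by (subst Bochner_Integration.integral_add) (auto simp: u_def)
   also have "... <= v * U + w * g x s powr p"
    using that uU[of s] s g[OF x s] by (intro add_mono mult_left_mono) auto
   finally show ?thesis .
  qed
  have "(\<integral>om. psi p (Z s om) * (H x s om)\<^sup>2 \<partial>P) <= v * U + v powr (1 - p / 2) * g x s powr p" if "0 < v" for v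
   by (rule order.trans[OF integral_mono up[of v "v powr (1 - p / 2)"]])
     (use nice_integrable[OF nQ1[OF x] s(1) s1] iZ iH psi_young[OF p that] that in auto)
  from young_optimize[OF _ this U0 _ d(1) G(2)]
  have "(\<integral>om. psi p (Z s om) * (H x s om)\<^sup>2 \<partial>P) <= g x s powr 2 * q2"
   using g0[OF x s(1)] s unfolding q2_def by simp
  then show "(\<integral>om. psi p (Z s om) * (H x s om)\<^sup>2 \<partial>P) <= (g x s)\<^sup>2 * q2"
   using g0[OF x s(1)] s by (simp add: powr_numeral)
  have yw: "\<bar>Z s om\<bar> powr (p - 1) * \<bar>H x s om\<bar> <= v * \<bar>Z s om\<bar> powr p + v powr (1 - p / 1) * \<bar>H x s om\<bar> powr p" if "0 < v" for v om
   using young_weighted[of 1 p v "\<bar>Z s om\<bar>" "\<bar>H x s om\<bar>"] that p by simp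
  have "(\<integral>om. \<bar>Z s om\<bar> powr (p - 1) * \<bar>H x s om\<bar> \<partial>P) <= v * U + v powr (1 - p / 1) * g x s powr p" if "0 < v" for v
   by (rule order.trans[OF integral_mono up[of v "v powr (1 - p / 1)"]])
     (use nice_integrable[OF nR[OF x] s(1) s1] iZ iH yw[OF that] that in auto)
  from young_optimize[OF _ this U0 _ d(1) G(1)]
  show "(\<integral>om. \<bar>Z s om\<bar> powr (p - 1) * \<bar>H x s om\<bar> \<partial>P) <= g x s * q1"
   using g0[OF x s(1)] s unfolding q1_def by simp
 qed
 \<comment> \<open>What is left of the three contributions once the multiples of \<open>U\<close>
   have been split off.\<close>
 define K2 where "K2 = C * (d powr (1 - p / 2) * G2 powr (p / 2)) + C * (lam * b powr p * Ap) + p * (d powr (1 - p) * G1 powr p)"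
 have ut: "u t <= U / 2 + K2" if t: "0 <= t" "t <= T" for t
 proof -
  have t1: "t <= 1" using t T by simp
  have "u t <= (\<Sum>x\<in>X. lam * C * (LBINT s:{0..t}. b\<^sup>2 * (\<integral>om. psi p (Z s om) * (H x s om)\<^sup>2 \<partial>P) + b powr p * (\<integral>om. \<bar>H x s om\<bar> powr p \<partial>P))
    + r * p * (LBINT s:{0..t}. (\<integral>om. \<bar>Z s om\<bar> powr (p - 1) * \<bar>H x s om\<bar> \<partial>P)))"
   using moment_inequality[OF p H \<xi> ze comp rh t(1) t1] unfolding u_def Z_def C_def by simp
  also have "... <= (\<Sum>x\<in>X. lam * C * (b\<^sup>2 * q2 * (LBINT s:{0..T}. (g x s)\<^sup>2) + b powr p * (LBINT s:{0..T}. g x s powr p)) + r * p * (q1 * (LBINT s:{0..T}. g x s)))"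
  proof (rule sum_mono)
   fix x assume x: "x \<in> X"
   \<comment> \<open>Half-open intervals are used because the bound of the moments by
     \<open>g\<close> is assumed for \<open>s < T\<close> only.\<close>
   have sub: "set_integrable lborel {0..<t} f" if "set_integrable lborel {0..T} f" for f :: "real => real"
    by (rule set_integrable_subset[OF that]) (use t in auto)
   have sub1: "set_integrable lborel {0..<t} f" if "set_integrable lborel {0..t} f" for f :: "real => real"
    by (rule set_integrable_subset[OF that]) (use t in auto)
   have "(LBINT s:{0..<t}. b\<^sup>2 * (\<integral>om. psi p (Z s om) * (H x s om)\<^sup>2 \<partial>P) + b powr p * (\<integral>om. \<bar>H x s om\<bar> powr p \<partial>P))
     <= (LBINT s:{0..<t}. b\<^sup>2 * q2 * (g x s)\<^sup>2 + b powr p * g x s powr p)"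
   proof (rule set_integral_mono)
    show "set_integrable lborel {0..<t} (%s. b\<^sup>2 * (\<integral>om. psi p (Z s om) * (H x s om)\<^sup>2 \<partial>P) + b powr p * (\<integral>om. \<bar>H x s om\<bar> powr p \<partial>P))"
     by (intro sub1 set_integral_add(1) set_integrable_mult_right nice_expect(3)[OF nQ1[OF x] t1] nice_expect(3)[OF nQ2[OF x] t1])
    show "set_integrable lborel {0..<t} (%s. b\<^sup>2 * q2 * (g x s)\<^sup>2 + b powr p * g x s powr p)"
     by (intro sub set_integral_add(1) set_integrable_mult_right i2[OF x] ip[OF x])
    fix s assume "s \<in> {0..<t}"
    then have s: "0 <= s" "s < T" using t by auto
    have "b\<^sup>2 * (\<integral>om. psi p (Z s om) * (H x s om)\<^sup>2 \<partial>P) <= b\<^sup>2 * ((g x s)\<^sup>2 * q2)"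
     by (rule mult_left_mono[OF e2[OF x s]]) simp
    moreover have "b powr p * (\<integral>om. \<bar>H x s om\<bar> powr p \<partial>P) <= b powr p * g x s powr p"
     by (rule mult_left_mono[OF g[OF x s]]) simp
    ultimately show "b\<^sup>2 * (\<integral>om. psi p (Z s om) * (H x s om)\<^sup>2 \<partial>P) + b powr p * (\<integral>om. \<bar>H x s om\<bar> powr p \<partial>P)
     <= b\<^sup>2 * q2 * (g x s)\<^sup>2 + b powr p * g x s powr p" by (simp add: mult_ac)
   qed
   also have "... <= (LBINT s:{0..T}. b\<^sup>2 * q2 * (g x s)\<^sup>2 + b powr p * g x s powr p)"
    unfolding LBINT_ico by (rule LBINT_mono_upper)
     (use t q i2[OF x] ip[OF x] in \<open>auto intro!: set_integral_add(1) add_nonneg_nonneg mult_nonneg_nonneg\<close>)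
   also have "... = b\<^sup>2 * q2 * (LBINT s:{0..T}. (g x s)\<^sup>2) + b powr p * (LBINT s:{0..T}. g x s powr p)"
    using i2[OF x] ip[OF x] by (subst set_integral_add(2)) auto
   finally have 1: "(LBINT s:{0..t}. b\<^sup>2 * (\<integral>om. psi p (Z s om) * (H x s om)\<^sup>2 \<partial>P) + b powr p * (\<integral>om. \<bar>H x s om\<bar> powr p \<partial>P))
     <= b\<^sup>2 * q2 * (LBINT s:{0..T}. (g x s)\<^sup>2) + b powr p * (LBINT s:{0..T}. g x s powr p)" by (simp only: LBINT_ico)
   have "(LBINT s:{0..<t}. (\<integral>om. \<bar>Z s om\<bar> powr (p - 1) * \<bar>H x s om\<bar> \<partial>P)) <= (LBINT s:{0..<t}. q1 * g x s)"
   proof (rule set_integral_mono)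
    show "set_integrable lborel {0..<t} (%s. \<integral>om. \<bar>Z s om\<bar> powr (p - 1) * \<bar>H x s om\<bar> \<partial>P)"
     by (intro sub1 nice_expect(3)[OF nR[OF x] t1])
    show "set_integrable lborel {0..<t} (%s. q1 * g x s)" by (intro sub set_integrable_mult_right i1[OF x])
    fix s assume "s \<in> {0..<t}"
    then have s: "0 <= s" "s < T" using t by auto
    show "(\<integral>om. \<bar>Z s om\<bar> powr (p - 1) * \<bar>H x s om\<bar> \<partial>P) <= q1 * g x s" using e1[OF x s] by (simp add: mult.commute)
   qed
   also have "... <= (LBINT s:{0..T}. q1 * g x s)"
    unfolding LBINT_ico by (rule LBINT_mono_upper) (use t q i1[OF x] g0[OF x] in auto)
   also have "... = q1 * (LBINT s:{0..T}. g x s)" by simp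
   finally have 2: "(LBINT s:{0..t}. (\<integral>om. \<bar>Z s om\<bar> powr (p - 1) * \<bar>H x s om\<bar> \<partial>P)) <= q1 * (LBINT s:{0..T}. g x s)"
    by (simp only: LBINT_ico)
   show "lam * C * (LBINT s:{0..t}. b\<^sup>2 * (\<integral>om. psi p (Z s om) * (H x s om)\<^sup>2 \<partial>P) + b powr p * (\<integral>om. \<bar>H x s om\<bar> powr p \<partial>P))
     + r * p * (LBINT s:{0..t}. (\<integral>om. \<bar>Z s om\<bar> powr (p - 1) * \<bar>H x s om\<bar> \<partial>P))
    <= lam * C * (b\<^sup>2 * q2 * (LBINT s:{0..T}. (g x s)\<^sup>2) + b powr p * (LBINT s:{0..T}. g x s powr p)) + r * p * (q1 * (LBINT s:{0..T}. g x s))"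
    using lam C b p by (intro add_mono mult_left_mono 1 2) auto
  qed
  also have "... = C * (q2 * (lam * b\<^sup>2 * A2)) + C * (lam * b powr p * Ap) + p * (q1 * (r * A1))"
   unfolding A1_def A2_def Ap_def by (simp add: sum.distrib sum_distrib_left algebra_simps)
  also have "... <= C * (q2 * G2) + C * (lam * b powr p * Ap) + p * (q1 * G1)"
   using C p q G lam A b by (intro add_mono mult_left_mono order.refl) auto
  also have "... = (C + p) * d * U + K2"
   using powr_mult_split[OF G(2), of d U "d powr (1 - p / 2)" "p / 2"] powr_mult_split[OF G(1), of d U "d powr (1 - p)" p]
   unfolding q1_def q2_def K2_def by (simp add: algebra_simps)
  finally show ?thesis unfolding d(2) by simp
 qed
 have "Sup (u ` {0..T}) <= U / 2 + K2" by (rule cSUP_least) (use ut T0 in auto)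
 then have "U <= U / 2 + K2" by (simp only: U_def[symmetric])
 then have "u t <= 2 * K2" using uU[OF t] by linarith
 also have "2 * K2 <= ros_const p * (G1 powr p + G2 powr (p / 2) + lam * b powr p * Ap)"
 proof -
  define a1 a2 a3 where "a1 = p * d powr (1 - p)" and "a2 = C * d powr (1 - p / 2)" and "a3 = C"
  have a: "0 <= a1" "0 <= a2" "0 <= a3" using p C by (auto simp: a1_def a2_def a3_def)
  have rc: "ros_const p = 2 * (a2 + a3 + a1)" by (simp add: ros_const_def Let_def a1_def a2_def a3_def C_def d_def)
  define y1 y2 y3 where "y1 = G1 powr p" and "y2 = G2 powr (p / 2)" and "y3 = lam * b powr p * Ap"
  have y: "0 <= y1" "0 <= y2" "0 <= y3" using lam A by (auto simp: y1_def y2_def y3_def)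
  have "K2 = a2 * y2 + a3 * y3 + a1 * y1" by (simp add: K2_def a1_def a2_def a3_def y1_def y2_def y3_def)
  also have "... <= (a2 + a3 + a1) * (y1 + y2 + y3)"
  proof -
   have "0 <= a2 * y1" "0 <= a2 * y3" "0 <= a3 * y1" "0 <= a3 * y2" "0 <= a1 * y2" "0 <= a1 * y3"
    using a y by simp_all
   then show ?thesis by (simp add: algebra_simps)
  qed
  finally show ?thesis unfolding rc y1_def y2_def y3_def mult.assoc by linarith
 qed
 finally show ?thesis unfolding u_def Z_def G1_def G2_def A1_def A2_def Ap_def .
qed

text \<open>The offset in \<open>rosenthal_eta\<close> is sent to 0 along
  \<open>1 / real (Suc n)\<close>.\<close>

lemma rosenthal:
 assumes p: "2 <= p" and H: "!!x. x \<in> X ==> nice (H x)" and \<xi>: "mark \<xi> b" and ze: "drift ze b'"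
  and comp: "compensates ze \<xi>" and rh: "drift rh r" and T: "T <= 1"
  and g0: "!!x s. x \<in> X ==> 0 <= s ==> s <= T ==> 0 <= g x s"
  and g: "!!x s. x \<in> X ==> 0 <= s ==> s < T ==> (\<integral>om. \<bar>H x s om\<bar> powr p \<partial>P) <= g x s powr p"
  and i1: "!!x. x \<in> X ==> set_integrable lborel {0..T} (%s. g x s)"
  and i2: "!!x. x \<in> X ==> set_integrable lborel {0..T} (%s. (g x s)\<^sup>2)"
  and ip: "!!x. x \<in> X ==> set_integrable lborel {0..T} (%s. g x s powr p)"
  and t: "0 <= t" "t <= T"
 shows "(\<integral>om. \<bar>msum \<xi> ze H t om + dsum rh H t om\<bar> powr p \<partial>P) <= ros_const p *
   ((r * (\<Sum>x\<in>X. LBINT s:{0..T}. g x s)) powr p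
  + (lam * b\<^sup>2 * (\<Sum>x\<in>X. LBINT s:{0..T}. (g x s)\<^sup>2)) powr (p / 2)
  + lam * b powr p * (\<Sum>x\<in>X. LBINT s:{0..T}. g x s powr p))"
proof (rule LIMSEQ_le_const)
 define A1 A2 Ap where "A1 = (\<Sum>x\<in>X. LBINT s:{0..T}. g x s)" and "A2 = (\<Sum>x\<in>X. LBINT s:{0..T}. (g x s)\<^sup>2)"
  and "Ap = (\<Sum>x\<in>X. LBINT s:{0..T}. g x s powr p)"
 have A: "0 <= A1" "0 <= A2"
  unfolding A1_def A2_def set_lebesgue_integral_def using g0
  by (auto intro!: sum_nonneg integral_nonneg_AE AE_I2 simp: indicator_def)
 have b: "0 <= b" "0 <= r" using \<xi> rh by (simp_all add: mark_def drift_def)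
 show "(%n. ros_const p * ((r * A1 + 1 / real (Suc n)) powr p + (lam * b\<^sup>2 * A2 + 1 / real (Suc n)) powr (p / 2) + lam * b powr p * Ap))
  \<longlonglongrightarrow> ros_const p * ((r * (\<Sum>x\<in>X. LBINT s:{0..T}. g x s)) powr p
  + (lam * b\<^sup>2 * (\<Sum>x\<in>X. LBINT s:{0..T}. (g x s)\<^sup>2)) powr (p / 2)
  + lam * b powr p * (\<Sum>x\<in>X. LBINT s:{0..T}. g x s powr p))"
  unfolding A1_def[symmetric] A2_def[symmetric] Ap_def[symmetric]
  using A b lam p by (intro tendsto_mult_left tendsto_add tendsto_const powr_add_tendsto) auto
 have "(\<integral>om. \<bar>msum \<xi> ze H t om + dsum rh H t om\<bar> powr p \<partial>P) <= ros_const p * ((r * A1 + 1 / real (Suc n)) powr p + (lam * b\<^sup>2 * A2 + 1 / real (Suc n)) powr (p / 2) + lam * b powr p * Ap)" for n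
  unfolding A1_def A2_def Ap_def
  by (rule rosenthal_eta[OF p H \<xi> ze comp rh T g0 g i1 i2 ip t]) auto
 then show "\<exists>N. \<forall>n\<ge>N. (\<integral>om. \<bar>msum \<xi> ze H t om + dsum rh H t om\<bar> powr p \<partial>P)
   <= ros_const p * ((r * A1 + 1 / real (Suc n)) powr p + (lam * b\<^sup>2 * A2 + 1 / real (Suc n)) powr (p / 2) + lam * b powr p * Ap)" by blast
qed

end

section \<open>A maximal inequality\<close>

text \<open>The constant left by \<open>doob_pathwise\<close> after division by the coefficient of
  its left side.\<close>

definition doob_const :: "real => real" where
 "doob_const p = ((p - 1) / (2 * p)) powr (1 - p) / ((p - 1) / (2 * p))"

lemma doob_const_nonneg: "2 <= p ==> 0 <= doob_const p"
 by (simp add: doob_const_def)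

context jump_process begin

lemma msum_diff:
 assumes H: "!!x. x \<in> X ==> nice (H x)" and ze: "drift ze b'" and st: "0 <= s" "s <= t" "t <= 1" and om: "om \<in> space P"
 shows "msum \<xi> ze H t om - msum \<xi> ze H s om = (\<Sum>x\<in>X. (\<Sum>r\<in>S x om Int {s..<t}. H x r om * \<xi> x r om) - (LBINT r:{s..t}. H x r om * ze x r om))"
 unfolding msum_def sum_subtractf[symmetric]
proof (rule sum.cong[OF refl])
 fix x assume x: "x \<in> X"
 have un: "S x om Int {..<t} = (S x om Int {..<s}) \<union> (S x om Int {s..<t})"
  unfolding Int_Un_distrib[symmetric] using st(2) by (intro arg_cong2[of _ _ _ _ "(\<inter>)"]) auto
 have "(\<Sum>r\<in>S x om Int {..<t}. H x r om * \<xi> x r om) = (\<Sum>r\<in>S x om Int {..<s}. H x r om * \<xi> x r om) + (\<Sum>r\<in>S x om Int {s..<t}. H x r om * \<xi> x r om)"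
  unfolding un
 proof (rule sum.union_disjoint)
  show "S x om Int {..<s} Int (S x om Int {s..<t}) = {}" by auto
 qed (simp_all add: finS[OF x om])
 then show "(\<Sum>r\<in>S x om Int {..<t}. H x r om * \<xi> x r om) - (LBINT r:{0..t}. H x r om * ze x r om)
   - ((\<Sum>r\<in>S x om Int {..<s}. H x r om * \<xi> x r om) - (LBINT r:{0..s}. H x r om * ze x r om))
   = (\<Sum>r\<in>S x om Int {s..<t}. H x r om * \<xi> x r om) - (LBINT r:{s..t}. H x r om * ze x r om)"
  using LBINT_split[OF nice_drift_integrable[OF x H[OF x] ze om st(3)] st(1,2)] by simp
qed

text \<open>The product of \<open>W\<close> with an increment is again a compensated sum, whose
  integrand is switched on after \<open>s\<close>, so \<open>compensation\<close> applies. The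
  increment contains a possible jump at \<open>s\<close>, which the switched integrand omits; such a
  jump has probability 0.\<close>

lemma msum_orthogonal:
 assumes H: "!!x. x \<in> X ==> nice (H x)" and \<xi>: "mark \<xi> b" and ze: "drift ze b'"
  and comp: "compensates ze \<xi>" and st: "0 <= s" "s <= t" "t <= 1"
  and W: "W \<in> borel_measurable (Fl s)" and Wb: "poly_bounded W"
 shows "(\<integral>om. W om * (msum \<xi> ze H t om - msum \<xi> ze H s om) \<partial>P) = 0"
  and "integrable P (%om. W om * (msum \<xi> ze H t om - msum \<xi> ze H s om))"
proof -
 have s1: "s <= 1" and t0: "0 <= t" using st by simp_all
 define K where "K x r om = (if s < r then W om else 0) * H x r om" for x r om
 have nK: "nice (K x)" if "x \<in> X" for x
  unfolding K_def[abs_def] by (rule nice_mult[OF nice_step[OF st(1) s1 W Wb] H[OF that]])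
 have eq: "AE om in P. W om * (msum \<xi> ze H t om - msum \<xi> ze H s om) = msum \<xi> ze K t om"
 proof -
  have "AE om in P. \<forall>x\<in>X. s \<notin> S x om"
   using finX AE_no_jump[OF _ st(1) s1] by (simp add: AE_ball_countable countable_finite)
  then show ?thesis
  proof (rule AE_mp, intro AE_I2 impI)
   fix om assume om: "om \<in> space P" and ns: "\<forall>x\<in>X. s \<notin> S x om"
   have "W om * ((\<Sum>r\<in>S x om Int {s..<t}. H x r om * \<xi> x r om) - (LBINT r:{s..t}. H x r om * ze x r om))
     = (\<Sum>r\<in>S x om Int {..<t}. K x r om * \<xi> x r om) - (LBINT r:{0..t}. K x r om * ze x r om)" if x: "x \<in> X" for x
   proof -
    have 1: "(\<Sum>r\<in>S x om Int {..<t}. K x r om * \<xi> x r om) = (\<Sum>r\<in>S x om Int {s..<t}. W om * (H x r om * \<xi> x r om))"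
    proof (rule sum.mono_neutral_cong_right)
     show "finite (S x om Int {..<t})" using finS[OF x om] by simp
     show "S x om Int {s..<t} \<subseteq> S x om Int {..<t}" by auto
     show "\<forall>r\<in>S x om Int {..<t} - S x om Int {s..<t}. K x r om * \<xi> x r om = 0" by (auto simp: K_def)
     fix r assume r: "r \<in> S x om Int {s..<t}"
     then have "s < r" using ns x by (cases "r = s") auto
     then show "K x r om * \<xi> x r om = W om * (H x r om * \<xi> x r om)" by (simp add: K_def)
    qed
    have 2: "(LBINT r:{0..t}. K x r om * ze x r om) = (LBINT r:{s..t}. W om * (H x r om * ze x r om))"
    proof -
     have "(LBINT r:{0..t}. K x r om * ze x r om) = (LBINT r:{s<..t}. W om * (H x r om * ze x r om))"
      unfolding set_lebesgue_integral_def
      by (intro Bochner_Integration.integral_cong) (use st in \<open>auto simp: indicator_def K_def\<close>)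
     then show ?thesis by (simp only: LBINT_ioc)
    qed
    show ?thesis unfolding 1 2 by (simp add: sum_distrib_left right_diff_distrib)
   qed
   moreover have d: "msum \<xi> ze H t om - msum \<xi> ze H s om = (\<Sum>x\<in>X. (\<Sum>r\<in>S x om Int {s..<t}. H x r om * \<xi> x r om) - (LBINT r:{s..t}. H x r om * ze x r om))"
    by (rule msum_diff[OF H ze st om])
   ultimately show "W om * (msum \<xi> ze H t om - msum \<xi> ze H s om) = msum \<xi> ze K t om"
    unfolding d by (simp add: msum_def sum_distrib_left)
  qed
 qed
 have nM: "nice (msum \<xi> ze H)" by (rule nice_msum[OF H \<xi> ze])
 have m: "(%om. W om * (msum \<xi> ze H t om - msum \<xi> ze H s om)) \<in> borel_measurable P"
  by (intro borel_measurable_times borel_measurable_diff nice_measurable[OF nM] mF[OF st(1) W] st s1 t0)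
 have nMK: "nice (msum \<xi> ze K)" by (rule nice_msum[OF nK \<xi> ze])
 have "(\<integral>om. msum \<xi> ze K t om \<partial>P) = 0"
 proof -
  have i: "integrable P (%om. (\<Sum>r\<in>S x om Int {..<t}. K x r om * \<xi> x r om) - (LBINT r:{0..t}. K x r om * ze x r om))" if x: "x \<in> X" for x
   by (intro Bochner_Integration.integrable_diff nice_integrable[OF jump_int_nice[OF x nK[OF x] \<xi>] t0 st(3)]
     nice_integrable[OF drift_int_nice[OF x nK[OF x] ze] t0 st(3)])
  have "(\<integral>om. msum \<xi> ze K t om \<partial>P) = (\<Sum>x\<in>X. \<integral>om. (\<Sum>r\<in>S x om Int {..<t}. K x r om * \<xi> x r om) - (LBINT r:{0..t}. K x r om * ze x r om) \<partial>P)"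
   unfolding msum_def by (rule Bochner_Integration.integral_sum[OF i])
  also have "... = 0" by (rule sum.neutral) (use compensation[OF _ nK \<xi> ze comp t0 st(3)] in auto)
  finally show ?thesis .
 qed
 then show "(\<integral>om. W om * (msum \<xi> ze H t om - msum \<xi> ze H s om) \<partial>P) = 0"
  using integral_cong_AE[OF m nice_measurable[OF nMK t0 st(3)] eq] by simp
 show "integrable P (%om. W om * (msum \<xi> ze H t om - msum \<xi> ze H s om))"
  by (rule integrable_cong_AE_imp[OF nice_integrable[OF nMK t0 st(3)] m]) (use eq in \<open>rule AE_symmetric\<close>)
qed

lemma Max_abs_bounds:
 fixes f :: "nat => real"
 assumes "!!j. j <= i ==> \<bar>f j\<bar> <= B"
 shows "Max ((%j. \<bar>f j\<bar>) ` {..i}) <= B" "0 <= Max ((%j. \<bar>f j\<bar>) ` {..i})"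
proof -
 show "Max ((%j. \<bar>f j\<bar>) ` {..i}) <= B" using assms by (subst Max_le_iff) auto
 show "0 <= Max ((%j. \<bar>f j\<bar>) ` {..i})" by (rule order.trans[OF abs_ge_zero[of "f i"] Max_ge]) auto
qed

text \<open>The weight \<open>s powr (p-1) * sgn m\<close> at a grid time is known at that time, so
  the sum in \<open>doob_pathwise\<close> has mean 0 and only the terminal moment survives.\<close>

lemma doob_grid:
 assumes p: "2 <= p" and H: "!!x. x \<in> X ==> nice (H x)" and \<xi>: "mark \<xi> b" and ze: "drift ze b'"
  and comp: "compensates ze \<xi>" and T: "0 < T" "T <= 1" and n: "1 <= n"
 shows "(\<integral>\<^sup>+om. ennreal (Max ((%j. \<bar>msum \<xi> ze H (real j * T / real n) om\<bar>) ` {..n}) powr p) \<partial>P)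
   <= ennreal (doob_const p * (\<integral>om. \<bar>msum \<xi> ze H T om\<bar> powr p \<partial>P))"
proof -
 define g where "g i = real i * T / real n" for i
 define m where "m i om = msum \<xi> ze H (g i) om" for i om
 define s where "s i om = Max ((%j. \<bar>m j om\<bar>) ` {..i})" for i om
 have nM: "nice (msum \<xi> ze H)" by (rule nice_msum[OF H \<xi> ze])
 have g: "0 <= g i" "g i <= 1" if "i <= n" for i
 proof -
  show "0 <= g i" using T by (simp add: g_def)
  have "real i * T <= real n * 1" using that T by (intro mult_mono) auto
  then show "g i <= 1" using n by (simp add: g_def)
 qed
 have gm: "g i <= g j" if "i <= j" for i j using that T by (auto simp: g_def intro!: divide_right_mono mult_right_mono)
 have gn: "g n = T" using n by (simp add: g_def)
 obtain c q where c: "0 <= c" "!!s om. 0 <= s ==> s <= 1 ==> om \<in> space P ==> \<bar>msum \<xi> ze H s om\<bar> <= c * (1 + real (N om)) ^ q"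
  using nice_bound[OF nM] by blast
 have mb: "\<bar>m i om\<bar> <= c * (1 + real (N om)) ^ q" if "i <= n" "om \<in> space P" for i om
  unfolding m_def by (rule c(2)[OF g[OF that(1)] that(2)])
 have sb: "s i om <= c * (1 + real (N om)) ^ q" "0 <= s i om" if "i <= n" "om \<in> space P" for i om
 proof -
  have mi: "\<bar>m j om\<bar> <= c * (1 + real (N om)) ^ q" if "j <= i" for j
   by (rule mb) (use that \<open>i <= n\<close> \<open>om \<in> space P\<close> in auto)
  show "s i om <= c * (1 + real (N om)) ^ q" "0 <= s i om"
   unfolding s_def by (rule Max_abs_bounds[OF mi]; simp)+
 qed
 define W where "W i om = s i om powr (p - 1) * sgn (m i om)" for i om
 have smeas: "s i \<in> borel_measurable (Fl (g i))" if i: "i <= n" for i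
 proof -
  have "(%om. \<bar>m j om\<bar>) \<in> borel_measurable (Fl (g i))" if "j <= i" for j
  proof -
   have "j <= n" using that i by simp
   then have "m j \<in> borel_measurable (Fl (g i))"
    unfolding m_def using g that by (intro mFF[OF _ gm nice_adapted[OF nM]]) auto
   then show ?thesis by simp
  qed
  then show ?thesis unfolding s_def[abs_def] by (intro borel_measurable_Max) auto
 qed
 have Wm: "W i \<in> borel_measurable (Fl (g i))" if "i <= n" for i
 proof -
  have "m i \<in> borel_measurable (Fl (g i))" unfolding m_def by (rule nice_adapted[OF nM g[OF that]])
  then show ?thesis unfolding W_def[abs_def] using smeas[OF that] by measurable
 qed
 have Wp: "poly_bounded (W i)" if i: "i <= n" for i
 proof (rule poly_boundedI)
  fix om assume om: "om \<in> space P"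
  have p1: "1 <= (1 + real (N om)) ^ q" by (simp add: one_le_power)
  have "\<bar>W i om\<bar> <= s i om powr (p - 1) * 1" unfolding W_def abs_mult by (intro mult_mono) (auto simp: sgn_if)
  also have "... <= (1 + \<bar>s i om\<bar>) ^ nat \<lceil>p\<rceil>" using powr_le_power[of "p - 1" "nat \<lceil>p\<rceil>" "s i om"] p sb[OF i om] by simp linarith
  also have "... <= ((1 + c) * (1 + real (N om)) ^ q) ^ nat \<lceil>p\<rceil>"
  proof (rule power_mono)
   show "1 + \<bar>s i om\<bar> <= (1 + c) * (1 + real (N om)) ^ q"
    using sb[OF i om] p1 unfolding distrib_right by linarith
  qed simp
  also have "... = (1 + c) ^ nat \<lceil>p\<rceil> * (1 + real (N om)) ^ (q * nat \<lceil>p\<rceil>)" by (simp add: power_mult_distrib power_mult)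
  finally show "\<bar>W i om\<bar> <= (1 + c) ^ nat \<lceil>p\<rceil> * (1 + real (N om)) ^ (q * nat \<lceil>p\<rceil>)" .
 qed
 define r where "r = (p - 1) / (2 * p)"
 have r: "0 < r" using p by (simp add: r_def)
 have orth: "(\<integral>om. W i om * (m (Suc i) om - m i om) \<partial>P) = 0" and iorth: "integrable P (%om. W i om * (m (Suc i) om - m i om))" if i: "i < n" for i
 proof -
  have i': "i <= n" "Suc i <= n" using i by auto
  show "(\<integral>om. W i om * (m (Suc i) om - m i om) \<partial>P) = 0" "integrable P (%om. W i om * (m (Suc i) om - m i om))"
   unfolding m_def using msum_orthogonal[OF H \<xi> ze comp g(1)[OF i'(1)] gm g(2)[OF i'(2)] Wm[OF i'(1)] Wp[OF i'(1)]] by auto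
 qed
 have nMp: "nice (%s om. \<bar>msum \<xi> ze H s om\<bar> powr p)" using p by (intro nice_powr nM) auto
 have im: "integrable P (%om. \<bar>m n om\<bar> powr p)"
  using nice_integrable[OF nMp g[OF order.refl]] unfolding m_def .
 define V where "V om = (r powr (1 - p) * \<bar>m n om\<bar> powr p - (\<Sum>i<n. W i om * (m (Suc i) om - m i om))) / r" for om
 have isum: "integrable P (%om. \<Sum>i<n. W i om * (m (Suc i) om - m i om))"
  by (rule Bochner_Integration.integrable_sum) (use iorth in auto)
 have iV: "integrable P V" unfolding V_def
  by (intro integrable_divide_zero Bochner_Integration.integrable_diff integrable_mult_right im isum)
 have sV: "s n om powr p <= V om" for om
 proof -
  have "r * s n om powr p <= r powr (1 - p) * \<bar>m n om\<bar> powr p - (\<Sum>i<n. s i om powr (p - 1) * sgn (m i om) * (m (Suc i) om - m i om))"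
   unfolding r_def by (rule doob_pathwise[OF p]) (simp add: s_def)
  then show ?thesis using r by (simp add: V_def W_def pos_le_divide_eq mult.commute)
 qed
 have EV: "(\<integral>om. V om \<partial>P) = doob_const p * (\<integral>om. \<bar>m n om\<bar> powr p \<partial>P)"
 proof -
  have "(\<integral>om. V om \<partial>P) = (r powr (1 - p) * (\<integral>om. \<bar>m n om\<bar> powr p \<partial>P) - (\<integral>om. (\<Sum>i<n. W i om * (m (Suc i) om - m i om)) \<partial>P)) / r"
   unfolding V_def using im isum by simp
  also have "(\<integral>om. (\<Sum>i<n. W i om * (m (Suc i) om - m i om)) \<partial>P) = (\<Sum>i<n. \<integral>om. W i om * (m (Suc i) om - m i om) \<partial>P)"
   by (rule Bochner_Integration.integral_sum) (use iorth in auto)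
  also have "... = 0" using orth by simp
  finally show ?thesis by (simp add: doob_const_def r_def)
 qed
 have "(\<integral>\<^sup>+om. ennreal (s n om powr p) \<partial>P) <= (\<integral>\<^sup>+om. ennreal (V om) \<partial>P)"
  by (intro nn_integral_mono ennreal_leI sV)
 also have "... = ennreal (\<integral>om. V om \<partial>P)"
  by (rule nn_integral_eq_integral[OF iV]) (use sV order.trans[OF powr_ge_zero] in blast)
 finally show ?thesis unfolding EV s_def m_def g_def[symmetric] gn .
qed

text \<open>Dyadic grids are nested, so the maxima increase and monotone convergence applies;
  left-continuity reaches all other times. The result is a measurable majorant \<open>V\<close>,
  which avoids the question of measurability of an uncountable supremum.\<close>

lemma doob_sup:
 assumes p: "2 <= p" and H: "!!x. x \<in> X ==> nice (H x)" and \<xi>: "mark \<xi> b" and ze: "drift ze b'"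
  and comp: "compensates ze \<xi>" and T: "0 < T" "T <= 1"
 obtains V where "V \<in> borel_measurable P"
  "!!om t. om \<in> space P ==> 0 <= t ==> t <= T ==> ennreal (\<bar>msum \<xi> ze H t om\<bar> powr p) <= V om"
  "(\<integral>\<^sup>+om. V om \<partial>P) <= ennreal (doob_const p * (\<integral>om. \<bar>msum \<xi> ze H T om\<bar> powr p \<partial>P))"
proof -
 define M where "M = msum \<xi> ze H"
 have nM: "nice M" unfolding M_def by (rule nice_msum[OF H \<xi> ze])
 define W where "W n om = ennreal (Max ((%j. \<bar>M (real j * T / real ((2::nat) ^ n)) om\<bar>) ` {..2 ^ n}) powr p)" for n :: nat and om
 have W: "ennreal (\<bar>M (real j * T / real ((2::nat) ^ n)) om\<bar> powr p) <= W n om" if "j <= 2 ^ n" for j n om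
  unfolding W_def using p that by (intro ennreal_leI powr_mono2 Max_ge) auto
 have inc: "incseq W"
 proof (rule incseq_SucI, rule le_funI)
  fix n om
  have "(%j. \<bar>M (real j * T / real ((2::nat) ^ n)) om\<bar>) ` {..2 ^ n} \<subseteq> (%j. \<bar>M (real j * T / real ((2::nat) ^ Suc n)) om\<bar>) ` {..2 ^ Suc n}"
  proof (rule image_subsetI)
   fix j :: nat assume j: "j \<in> {..2 ^ n}"
   have "real j * T / real ((2::nat) ^ n) = real (2 * j) * T / real ((2::nat) ^ Suc n)" by simp
   then show "\<bar>M (real j * T / real ((2::nat) ^ n)) om\<bar> \<in> (%j. \<bar>M (real j * T / real ((2::nat) ^ Suc n)) om\<bar>) ` {..2 ^ Suc n}"
    using j by (intro image_eqI[of _ _ "2 * j"]) (simp_all only: atMost_iff power_Suc mult_le_mono2)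
  qed
  then have "Max ((%j. \<bar>M (real j * T / real ((2::nat) ^ n)) om\<bar>) ` {..2 ^ n}) <= Max ((%j. \<bar>M (real j * T / real ((2::nat) ^ Suc n)) om\<bar>) ` {..2 ^ Suc n})"
   by (rule Max_mono) auto
  moreover have "0 <= Max ((%j. \<bar>M (real j * T / real ((2::nat) ^ n)) om\<bar>) ` {..2 ^ n})"
   by (rule order.trans[OF abs_ge_zero Max_ge[OF _ imageI[of 0]]]) simp_all
  ultimately show "W n om <= W (Suc n) om" unfolding W_def using p by (intro ennreal_leI powr_mono2) auto
 qed
 have Wm: "W n \<in> borel_measurable P" for n
 proof -
  have "(%om. \<bar>M (real j * T / real ((2::nat) ^ n)) om\<bar>) \<in> borel_measurable P" if "j <= 2 ^ n" for j :: nat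
  proof -
   have "real j <= real ((2::nat) ^ n)" using that by (simp only: of_nat_le_iff)
   then have "real j * T <= real ((2::nat) ^ n) * 1" using T by (intro mult_mono) auto
   then have "real j * T / real ((2::nat) ^ n) <= 1" by simp
   then have "M (real j * T / real ((2::nat) ^ n)) \<in> borel_measurable P"
    using T by (intro nice_measurable[OF nM]) auto
   then show ?thesis by simp
  qed
  then have "(%om. Max ((%j. \<bar>M (real j * T / real ((2::nat) ^ n)) om\<bar>) ` {..2 ^ n})) \<in> borel_measurable P"
   by (intro borel_measurable_Max) auto
  then show ?thesis unfolding W_def[abs_def] by measurable
 qed
 have W_sup: "ennreal (\<bar>M t om\<bar> powr p) <= (SUP n. W n om)" if om: "om \<in> space P" and t: "t \<in> {0..T}" for om t
  proof (cases "t = 0")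
   case True
   have "ennreal (\<bar>M (real 0 * T / real ((2::nat) ^ 0)) om\<bar> powr p) <= W 0 om" by (rule W) simp
   also have "... <= (SUP n. W n om)" by (rule SUP_upper) simp
   finally show ?thesis using True by simp
  next
   case False
   then have t0: "0 < t" "t <= T" using t by auto
   have "(%n. M (la n T t) om) \<longlonglongrightarrow> M t om"
    by (rule lcont_la[OF nice_lcont[OF nM om] t0 T(2)])
   moreover have "filterlim (%n. (2::nat) ^ n) sequentially sequentially"
    by (intro filterlim_subseq strict_monoI power_strict_increasing) auto
   ultimately have "(%n. M (la (2 ^ n) T t) om) \<longlonglongrightarrow> M t om" by (rule filterlim_compose)
   then have "(%n. \<bar>M (la (2 ^ n) T t) om\<bar> powr p) \<longlonglongrightarrow> \<bar>M t om\<bar> powr p"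
    using p by (intro tendsto_powr2 tendsto_rabs tendsto_const) (auto intro!: always_eventually)
   then have "(%n. ennreal (\<bar>M (la (2 ^ n) T t) om\<bar> powr p)) \<longlonglongrightarrow> ennreal (\<bar>M t om\<bar> powr p)"
    by (rule tendsto_ennrealI)
   then show ?thesis
   proof (rule LIMSEQ_le_const2, intro exI allI impI)
    fix n :: nat
    define j where "j = nat (\<lceil>real ((2::nat) ^ n) * t / T\<rceil> - 1)"
    have c1: "1 <= \<lceil>real ((2::nat) ^ n) * t / T\<rceil>" using t0 by simp
    have "real ((2::nat) ^ n) * t / T <= real ((2::nat) ^ n)" using t0 T by (simp add: field_simps)
    then have "\<lceil>real ((2::nat) ^ n) * t / T\<rceil> <= int (2 ^ n)" by (simp add: ceiling_le_iff)
    then have j: "j <= 2 ^ n" unfolding j_def by linarith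
    have "la (2 ^ n) T t = real j * T / real ((2::nat) ^ n)"
     using c1 by (simp add: la_def j_def mult.commute)
    then have "ennreal (\<bar>M (la (2 ^ n) T t) om\<bar> powr p) <= W n om" using W[OF j, of om] by simp
    also have "... <= (SUP n. W n om)" by (rule SUP_upper) simp
    finally show "ennreal (\<bar>M (la (2 ^ n) T t) om\<bar> powr p) <= (SUP n. W n om)" .
   qed
  qed
 have "(\<integral>\<^sup>+om. (SUP n. W n om) \<partial>P) = (SUP n. \<integral>\<^sup>+om. W n om \<partial>P)" by (rule nn_integral_monotone_convergence_SUP[OF inc Wm])
 also have "... <= ennreal (doob_const p * (\<integral>om. \<bar>M T om\<bar> powr p \<partial>P))"
  unfolding W_def M_def by (intro SUP_least doob_grid[OF p H \<xi> ze comp T]) auto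
 finally show thesis
  by (intro that[of "%om. SUP n. W n om"]) (use Wm W_sup in \<open>auto simp: M_def\<close>)
qed

end

section \<open>Iterated integrals\<close>

text \<open>Coordinates beyond \<open>m\<close> are pinned to \<open>base0\<close>, so
  \<open>box X 0\<close> is a single point.\<close>

definition box :: "site set => nat => tuple set" where
 "box X m = {w. (\<forall>i\<in>{1..m}. 0 <= fst (w i) & fst (w i) <= 1 & snd (w i) \<in> X) & (\<forall>i. i \<notin> {1..m} --> w i = base0)}"

text \<open>Sites are discrete and are held fixed along the sequence; only times converge.\<close>

definition tconv :: "(nat => tuple) => tuple => bool" where
 "tconv wn w \<longleftrightarrow> (\<forall>i. (\<forall>n. snd (wn n i) = snd (w i)) & (%n. fst (wn n i)) \<longlonglongrightarrow> fst (w i))"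

text \<open>The bound \<open>B\<close> is a parameter because limits of iterated integrals require
  one bound for a whole sequence of integrands.\<close>

definition gcont :: "site set => nat => real => (tuple => real) => bool" where
 "gcont X m B G \<longleftrightarrow> 0 <= B & (\<forall>w\<in>box X m. \<bar>G w\<bar> <= B) \<and>
   (\<forall>wn w. w \<in> box X m --> (\<forall>n. wn n \<in> box X m) --> tconv wn w --> (%n. G (wn n)) \<longlonglongrightarrow> G w)"

definition sect :: "nat => (tuple => real) => site => real => tuple => real" where
 "sect m G x s w = G (w(Suc m := (s, x)))"

lemma gcontD:
 assumes "gcont X m B G"
 shows "0 <= B" "w \<in> box X m ==> \<bar>G w\<bar> <= B"
  "w \<in> box X m ==> (!!n. wn n \<in> box X m) ==> tconv wn w ==> (%n. G (wn n)) \<longlonglongrightarrow> G w"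
 using assms unfolding gcont_def by simp_all

lemma box_upd:
 assumes "w \<in> box X m" "0 <= s" "s <= 1" "x \<in> X"
 shows "w(Suc m := (s, x)) \<in> box X (Suc m)"
 using assms by (auto simp: box_def)

lemma gcont_sect:
 assumes G: "gcont X (Suc m) B G" and s: "0 <= s" "s <= 1" "x \<in> X"
 shows "gcont X m B (sect m G x s)"
 unfolding gcont_def
proof (intro conjI ballI allI impI)
 show "0 <= B" by (rule gcontD(1)[OF G])
 show "\<bar>sect m G x s w\<bar> <= B" if "w \<in> box X m" for w
  unfolding sect_def by (rule gcontD(2)[OF G box_upd[OF that s]])
 fix wn w assume w: "w \<in> box X m" "\<forall>n. wn n \<in> box X m" "tconv wn w"
 have "tconv (%n. (wn n)(Suc m := (s, x))) (w(Suc m := (s, x)))" using w(3) by (auto simp: tconv_def)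
 then show "(%n. sect m G x s (wn n)) \<longlonglongrightarrow> sect m G x s w"
  unfolding sect_def by (intro gcontD(3)[OF G] box_upd[OF _ s] w(1) w(2)[rule_format])
qed

lemma sect_tendsto:
 assumes G: "gcont X (Suc m) B G" and s: "!!n. 0 <= sn n & sn n <= 1" "0 <= s" "s <= 1" "sn \<longlonglongrightarrow> s" "x \<in> X" and w: "w \<in> box X m"
 shows "(%n. sect m G x (sn n) w) \<longlonglongrightarrow> sect m G x s w"
proof -
 have "tconv (%n. w(Suc m := (sn n, x))) (w(Suc m := (s, x)))" using s by (auto simp: tconv_def)
 then show ?thesis unfolding sect_def
  by (intro gcontD(3)[OF G] box_upd[OF w]) (use s in auto)
qed

lemma sect_tendsto_seq:
 assumes "!!w. w \<in> box X (Suc m) ==> (%n. Gn n w) \<longlonglongrightarrow> G w" "0 <= s" "s <= 1" "x \<in> X" "w \<in> box X m"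
 shows "(%n. sect m (Gn n) x s w) \<longlonglongrightarrow> sect m G x s w"
 unfolding sect_def by (intro assms(1) box_upd assms)

text \<open>Each level has its own heights, compensator and drift, while all levels share the jump
  times.\<close>

locale iterated = jump_process P Fl X S lam
 for P :: "'a measure" and Fl and X :: "site set" and S and lam +
 fixes \<xi> ze rh :: "nat => site => real => 'a => real" and b r :: "nat => real" and b' :: "nat => real"
 assumes mk: "!!i. 1 <= i ==> mark (\<xi> i) (b i)" and dz: "!!i. 1 <= i ==> drift (ze i) (b' i)"
  and dr: "!!i. 1 <= i ==> drift (rh i) (r i)" and comp: "!!i. 1 <= i ==> compensates (ze i) (\<xi> i)"
begin

fun It :: "nat => (tuple => real) => real => 'a => real" where
 "It 0 G t om = G (%_. base0)"
| "It (Suc m) G t om =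
   msum (\<xi> (Suc m)) (ze (Suc m)) (%x s om. It m (sect m G x s) s om) t om
  + dsum (rh (Suc m)) (%x s om. It m (sect m G x s) s om) t om"

lemma bounds_nonneg: "1 <= i ==> 0 <= b i" "1 <= i ==> 0 <= b' i" "1 <= i ==> 0 <= r i"
 using mk dz dr by (auto simp: mark_def drift_def)

text \<open>A pathwise growth constant that depends on the number of sites. It serves the regularity
  of the iterated integrals; the moment bounds uniform in \<open>\<epsilon>\<close> are obtained
  separately.\<close>

fun Kc :: "nat => real" where
 "Kc 0 = 1"
| "Kc (Suc m) = real (card X) * (b (Suc m) + b' (Suc m) + r (Suc m)) * Kc m"

lemma Kc_nonneg: "0 <= Kc m"
 by (induction m) (auto intro!: mult_nonneg_nonneg add_nonneg_nonneg bounds_nonneg)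

text \<open>The times approach from below, so the open sums eventually run over exactly the jumps
  before \<open>t\<close>.\<close>

lemma tendsto_jump_sum:
 assumes x: "x \<in> X" and om: "om \<in> space P" and t: "!!n. tn n <= t" "tn \<longlonglongrightarrow> t"
  and f: "!!s. s \<in> S x om ==> (%n. f n s) \<longlonglongrightarrow> f' s"
 shows "(%n. \<Sum>s\<in>S x om Int {..<tn n}. f n s) \<longlonglongrightarrow> (\<Sum>s\<in>S x om Int {..<t}. f' s :: real)"
proof -
 have "\<forall>\<^sub>F n in sequentially. \<forall>s\<in>S x om Int {..<t}. s < tn n"
  using finS[OF x om] order_tendstoD(1)[OF t(2)] by (simp add: eventually_ball_finite_distrib)
 then have "\<forall>\<^sub>F n in sequentially. S x om Int {..<tn n} = S x om Int {..<t}"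
 proof eventually_elim
  case (elim n)
  then show ?case using t(1)[of n] by (auto intro: order.strict_trans2)
 qed
 then have ev: "\<forall>\<^sub>F n in sequentially. (\<Sum>s\<in>S x om Int {..<t}. f n s) = (\<Sum>s\<in>S x om Int {..<tn n}. f n s)"
  by eventually_elim simp
 have "(%n. \<Sum>s\<in>S x om Int {..<t}. f n s) \<longlonglongrightarrow> (\<Sum>s\<in>S x om Int {..<t}. f' s)"
  by (intro tendsto_sum f) auto
 then show ?thesis using ev by (rule Lim_transform_eventually)
qed

lemma tendsto_drift_int:
 fixes f :: "nat => real => real"
 assumes t: "!!n. 0 <= tn n & tn n <= t" "tn \<longlonglongrightarrow> t" "0 <= t" "t <= 1"
  and i: "!!n. set_integrable lborel {0..1} (f n)" and i': "set_integrable lborel {0..1} f'"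
  and f: "!!s. 0 <= s ==> s <= 1 ==> (%n. f n s) \<longlonglongrightarrow> f' s"
  and bd: "!!n s. 0 <= s ==> s <= 1 ==> \<bar>f n s\<bar> <= B"
 shows "(%n. LBINT s:{0..tn n}. f n s) \<longlonglongrightarrow> (LBINT s:{0..t}. f' s)"
 unfolding LBINT_ico[symmetric] unfolding set_lebesgue_integral_def
proof (rule integral_dominated_convergence[where w="%s. indicator {0..1} s * B"])
 have s1: "set_integrable lborel {0..<t} f'" by (rule set_integrable_subset[OF i']) (use t in auto)
 then show "(%s. indicator {0..<t} s *\<^sub>R f' s) \<in> borel_measurable lborel" by (auto simp: set_integrable_def)
 have "set_integrable lborel {0..<tn n} (f n)" for n by (rule set_integrable_subset[OF i]) (use t(1)[of n] t(4) in auto)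
 then show "(%s. indicator {0..<tn n} s *\<^sub>R f n s) \<in> borel_measurable lborel" for n by (auto simp: set_integrable_def)
 show "integrable lborel (%s. indicator {0..1::real} s * B)" using set_integrable_const_Icc[of 0 1 B] by (simp add: set_integrable_def)
 show "AE s in lborel. (%n. indicator {0..<tn n} s *\<^sub>R f n s) \<longlonglongrightarrow> indicator {0..<t} s *\<^sub>R f' s"
 proof (rule AE_I2)
  fix s :: real
  consider "s < 0" | "0 <= s" "s < t" | "t <= s" by linarith
  then show "(%n. indicator {0..<tn n} s *\<^sub>R f n s) \<longlonglongrightarrow> indicator {0..<t} s *\<^sub>R f' s"
  proof cases
   case 2
   have "\<forall>\<^sub>F n in sequentially. s < tn n" by (rule order_tendstoD(1)[OF t(2) 2(2)])
   then have "\<forall>\<^sub>F n in sequentially. f n s = indicator {0..<tn n} s *\<^sub>R f n s"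
    by eventually_elim (use 2 in simp)
   from Lim_transform_eventually[OF f this] show ?thesis using 2 t by simp
  next
   case 3
   have "indicator {0..<tn n} s = (0::real)" for n using t(1)[of n] 3 by simp
   then show ?thesis using 3 by simp
  qed simp
 qed
 show "AE s in lborel. norm (indicator {0..<tn n} s *\<^sub>R f n s) <= indicator {0..1} s * B" for n
 proof (rule AE_I2)
  fix s :: real
  have "0 <= B" using bd[of 0 n] by simp
  then show "norm (indicator {0..<tn n} s *\<^sub>R f n s) <= indicator {0..1} s * B"
   using bd[of s n] t(1)[of n] t(4) by (auto simp: indicator_def)
 qed
qed

text \<open>The four claims depend on each other. Niceness at level \<open>Suc m\<close> rests on
  the fourth claim at level \<open>m\<close>. There the time is both the upper limit and a frozen
  variable of the integrand, so left-continuity requires the joint convergence of the third claim,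
  whose dominated convergence uses the bound of the second.\<close>

lemma It_properties:
 shows "(\<forall>G B. gcont X m B G --> nice (It m G))
  & (\<forall>G B t om. gcont X m B G --> 0 <= t --> t <= 1 --> om \<in> space P --> \<bar>It m G t om\<bar> <= B * (Kc m * (1 + real (N om)) ^ m))
  & (\<forall>Gn G B tn t om. (\<forall>n. gcont X m B (Gn n)) --> gcont X m B G --> (\<forall>w\<in>box X m. (%n. Gn n w) \<longlonglongrightarrow> G w)
    --> (\<forall>n. 0 <= tn n & tn n <= t) --> tn \<longlonglongrightarrow> t --> 0 <= t --> t <= 1 --> om \<in> space P
    --> (%n. It m (Gn n) (tn n) om) \<longlonglongrightarrow> It m G t om)
  & (\<forall>G B x. gcont X (Suc m) B G --> x \<in> X --> nice (%s om. It m (sect m G x s) s om))"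
proof -
 \<comment> \<open>The passage from the first three claims to the fourth, isolated because it is
   used at level 0 and again in the induction step.\<close>
 have slice: "nice (%s om. It k (sect k G x s) s om)"
  if nice: "!!G B. gcont X k B G ==> nice (It k G)"
  and bound: "!!G B t om. gcont X k B G ==> 0 <= t ==> t <= 1 ==> om \<in> space P ==> \<bar>It k G t om\<bar> <= B * (Kc k * (1 + real (N om)) ^ k)"
  and conv: "!!Gn G B tn t om. (!!n. gcont X k B (Gn n)) ==> gcont X k B G ==> (!!w. w\<in>box X k ==> (%n. Gn n w) \<longlonglongrightarrow> G w)
    ==> (!!n. 0 <= tn n & tn n <= t) ==> tn \<longlonglongrightarrow> t ==> 0 <= t ==> t <= 1 ==> om \<in> space P
    ==> (%n. It k (Gn n) (tn n) om) \<longlonglongrightarrow> It k G t om"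
  and G: "gcont X (Suc k) B G" and x: "x \<in> X" for k G B x
 proof (rule niceI[where c="B * Kc k" and q=k])
  fix s :: real assume s: "0 <= s" "s <= 1"
  show "(%om. It k (sect k G x s) s om) \<in> borel_measurable (Fl s)"
   by (rule nice_adapted[OF nice[OF gcont_sect[OF G s x]] s])
  fix om assume "om \<in> space P"
  then show "\<bar>It k (sect k G x s) s om\<bar> <= B * Kc k * (1 + real (N om)) ^ k"
   using bound[OF gcont_sect[OF G s x] s] by (simp add: mult.assoc)
 next
  fix om assume om: "om \<in> space P"
  show "lcont (%s. It k (sect k G x s) s om)"
   unfolding lcont_def
  proof (intro allI impI)
   fix s :: real assume s: "0 < s & s <= 1"
   show "((%s. It k (sect k G x s) s om) \<longlongrightarrow> It k (sect k G x s) s om) (at_left s)"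
   proof (rule tendsto_at_left_sequentially[of 0])
    fix sn :: "nat => real" assume sn: "!!n. sn n < s" "!!n. 0 < sn n" "incseq sn" "sn \<longlonglongrightarrow> s"
    have sn1: "0 <= sn n & sn n <= 1" "0 <= sn n & sn n <= s" for n using sn(1,2)[of n] s by auto
    show "(%n. It k (sect k G x (sn n)) (sn n) om) \<longlonglongrightarrow> It k (sect k G x s) s om"
    proof (rule conv)
     show "gcont X k B (sect k G x (sn n))" for n using sn1(1)[of n] by (intro gcont_sect[OF G _ _ x]) auto
     show "gcont X k B (sect k G x s)" using s by (intro gcont_sect[OF G _ _ x]) auto
     show "(%n. sect k G x (sn n) w) \<longlonglongrightarrow> sect k G x s w" if "w \<in> box X k" for w
      using s by (intro sect_tendsto[OF G sn1(1) _ _ sn(4) x that]) auto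
    qed (use sn1 sn s om in auto)
   qed (use s in simp)
  qed
 qed
 show ?thesis
 proof (induction m)
  case 0
  have b0: "(%_. base0) \<in> box X 0" by (simp add: box_def)
  have "It 0 G = (%_ _. G (%_. base0))" for G by (intro ext) simp
  then have n0: "nice (It 0 G)" for G using nice_const[of "G (%_. base0)"] by simp
  have bd0: "\<bar>It 0 G t om\<bar> <= B * (Kc 0 * (1 + real (N om)) ^ 0)" if "gcont X 0 B G" for G B t om
   using that b0 by (simp add: gcont_def)
  have c0: "(%n. It 0 (Gn n) (tn n) om) \<longlonglongrightarrow> It 0 G t om" if "!!w. w\<in>box X 0 ==> (%n. Gn n w) \<longlonglongrightarrow> G w" for Gn :: "nat => tuple => real" and G tn t om
   using that[OF b0] by simp
  show ?case
  proof (intro conjI allI impI)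
   fix G B x assume "gcont X (Suc 0) B G" "x \<in> X"
   note G = this
   show "nice (%s om. It 0 (sect 0 G x s) s om)"
   proof (rule slice)
    fix Gn :: "nat => tuple => real" and G :: "tuple => real" and tn t om
    assume "!!w. w \<in> box X 0 ==> (%n. Gn n w) \<longlonglongrightarrow> G w"
    then show "(%n. It 0 (Gn n) (tn n) om) \<longlonglongrightarrow> It 0 G t om" by (rule c0)
   qed (rule n0, rule bd0, assumption, rule G, rule G)
  next
   fix Gn :: "nat => tuple => real" and G :: "tuple => real" and B t :: real and tn :: "nat => real" and om assume "\<forall>w\<in>box X 0. (%n. Gn n w) \<longlonglongrightarrow> G w"
   then show "(%n. It 0 (Gn n) (tn n) om) \<longlonglongrightarrow> It 0 G t om" by (intro c0) blast
  qed (rule n0, rule bd0)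
 next
  case (Suc m)
  note IH1 = Suc[THEN conjunct1, rule_format]
  note IH2 = Suc[THEN conjunct2, THEN conjunct1, rule_format]
  note IH3 = Suc[THEN conjunct2, THEN conjunct2, THEN conjunct1, rule_format]
  note sec = Suc[THEN conjunct2, THEN conjunct2, THEN conjunct2, rule_format]
  have conv: "(%n. It m (Gn n) (tn n) om) \<longlonglongrightarrow> It m G t om"
   if "!!n. gcont X m B (Gn n)" "gcont X m B G" "!!w. w\<in>box X m ==> (%n. Gn n w) \<longlonglongrightarrow> G w"
    "!!n. 0 <= tn n & tn n <= t" "tn \<longlonglongrightarrow> t" "0 <= t" "t <= 1" "om \<in> space P" for Gn G B tn t om
   by (rule IH3[where B=B]) (use that in auto)
  have bound: "\<bar>It m G t om\<bar> <= B * (Kc m * (1 + real (N om)) ^ m)"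
   if "gcont X m B G" "0 <= t" "t <= 1" "om \<in> space P" for G B t om by (rule IH2[OF that])
  have m1: "1 <= Suc m" by simp
  note mk' = mk[OF m1] and dz' = dz[OF m1] and dr' = dr[OF m1] and bn = bounds_nonneg[OF m1]
  have nice': "nice (It (Suc m) G)" if G: "gcont X (Suc m) B G" for G B
  proof -
   have "nice (%t om. msum (\<xi> (Suc m)) (ze (Suc m)) (%x s om. It m (sect m G x s) s om) t om
     + dsum (rh (Suc m)) (%x s om. It m (sect m G x s) s om) t om)"
    by (intro nice_add nice_msum[OF sec[OF G] mk' dz'] nice_dsum[OF sec[OF G] dr'])
   moreover have "It (Suc m) G = (%t om. msum (\<xi> (Suc m)) (ze (Suc m)) (%x s om. It m (sect m G x s) s om) t om
     + dsum (rh (Suc m)) (%x s om. It m (sect m G x s) s om) t om)" by (intro ext) simp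
   ultimately show ?thesis by simp
  qed
  have bound': "\<bar>It (Suc m) G t om\<bar> <= B * (Kc (Suc m) * (1 + real (N om)) ^ Suc m)"
   if G: "gcont X (Suc m) B G" and t: "0 <= t" "t <= 1" and om: "om \<in> space P" for G B t om
  proof -
   define Y where "Y = 1 + real (N om)"
   have Y: "1 <= Y" "real (N om) <= Y" by (simp_all add: Y_def)
   define D where "D = B * (Kc m * Y ^ m)"
   have D0: "0 <= D" using G Kc_nonneg Y by (auto simp: D_def gcont_def intro!: mult_nonneg_nonneg)
   have Hb: "\<bar>It m (sect m G x s) s om\<bar> <= D" if "0 <= s" "s <= 1" "x \<in> X" for x s
    unfolding D_def Y_def by (rule bound[OF gcont_sect[OF G that] that(1,2) om])
   have j: "\<bar>\<Sum>s\<in>S x om Int {..<t}. It m (sect m G x s) s om * \<xi> (Suc m) x s om\<bar> <= D * b (Suc m) * Y" if x: "x \<in> X" for x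
   proof -
    have "\<bar>\<Sum>s\<in>S x om Int {..<t}. It m (sect m G x s) s om * \<xi> (Suc m) x s om\<bar> <= D * b (Suc m) * real (N om)"
    proof (rule jump_sum_bound[OF x om])
     fix s assume s: "s \<in> S x om"
     then have "0 <= s" "s <= 1" using S01[OF x om] by auto
     then show "\<bar>It m (sect m G x s) s om * \<xi> (Suc m) x s om\<bar> <= D * b (Suc m)"
      unfolding abs_mult using Hb x mark_bound[OF mk' x om s] D0 by (intro mult_mono) auto
    qed (use D0 bn in simp)
    also have "... <= D * b (Suc m) * Y" using D0 bn Y by (intro mult_left_mono) auto
    finally show ?thesis .
   qed
   have d: "\<bar>LBINT s:{0..t}. It m (sect m G x s) s om * \<theta> x s om\<bar> <= D * e * Y"
    if x: "x \<in> X" and \<theta>: "drift \<theta> e" for x \<theta> e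
   proof -
    have e0: "0 <= e" using \<theta> by (simp add: drift_def)
    have "\<bar>LBINT s:{0..t}. It m (sect m G x s) s om * \<theta> x s om\<bar> <= D * e * (t - 0)"
    proof (rule LBINT_abs_le[OF t(1)])
     fix s assume "s \<in> {0..t}"
     then have s: "0 <= s" "s <= 1" using t by auto
     show "\<bar>It m (sect m G x s) s om * \<theta> x s om\<bar> <= D * e"
      unfolding abs_mult using Hb[OF s x] drift_bound[OF \<theta> x om s] D0 by (intro mult_mono) auto
    qed
    also have "... <= D * e * Y" using D0 e0 t Y by (intro mult_left_mono) auto
    finally show ?thesis .
   qed
   have "\<bar>It (Suc m) G t om\<bar> <= (\<Sum>x\<in>X. D * b (Suc m) * Y + D * b' (Suc m) * Y) + (\<Sum>x\<in>X. D * r (Suc m) * Y)"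
    unfolding It.simps msum_def dsum_def
   proof (intro order.trans[OF abs_triangle_ineq] add_mono order.trans[OF sum_abs] sum_mono)
    fix x assume x: "x \<in> X"
    show "\<bar>(\<Sum>s\<in>S x om Int {..<t}. It m (sect m G x s) s om * \<xi> (Suc m) x s om) - (LBINT s:{0..t}. It m (sect m G x s) s om * ze (Suc m) x s om)\<bar>
     <= D * b (Suc m) * Y + D * b' (Suc m) * Y"
     using j[OF x] d[OF x dz'] by linarith
    show "\<bar>LBINT s:{0..t}. It m (sect m G x s) s om * rh (Suc m) x s om\<bar> <= D * r (Suc m) * Y" by (rule d[OF x dr'])
   qed
   also have "... = B * (Kc (Suc m) * Y ^ Suc m)" by (simp add: D_def algebra_simps)
   finally show ?thesis by (simp add: Y_def)
  qed
  have conv': "(%n. It (Suc m) (Gn n) (tn n) om) \<longlonglongrightarrow> It (Suc m) G t om"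
   if Gn: "!!n. gcont X (Suc m) B (Gn n)" and G: "gcont X (Suc m) B G" and l: "!!w. w\<in>box X (Suc m) ==> (%n. Gn n w) \<longlonglongrightarrow> G w"
    and tn: "!!n. 0 <= tn n & tn n <= t" "tn \<longlonglongrightarrow> t" and t: "0 <= t" "t <= 1" and om: "om \<in> space P" for Gn G B tn t om
  proof -
   have Hc: "(%n. It m (sect m (Gn n) x s) s om) \<longlonglongrightarrow> It m (sect m G x s) s om" if x: "x \<in> X" and s: "0 <= s" "s <= 1" for x s
    by (rule conv[OF gcont_sect[OF Gn s x] gcont_sect[OF G s x] sect_tendsto_seq[OF l s x] _ _ s om]) (use s in auto)
   have di: "(%n. LBINT s:{0..tn n}. It m (sect m (Gn n) x s) s om * \<theta> x s om) \<longlonglongrightarrow> (LBINT s:{0..t}. It m (sect m G x s) s om * \<theta> x s om)"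
    if x: "x \<in> X" and \<theta>: "drift \<theta> e" for x \<theta> e
   proof (rule tendsto_drift_int[OF tn t])
    show "set_integrable lborel {0..1} (%s. It m (sect m (Gn n) x s) s om * \<theta> x s om)" for n
     by (rule nice_drift_integrable[OF x sec[OF Gn x] \<theta> om order.refl])
    show "set_integrable lborel {0..1} (%s. It m (sect m G x s) s om * \<theta> x s om)"
     by (rule nice_drift_integrable[OF x sec[OF G x] \<theta> om order.refl])
    show "(%n. It m (sect m (Gn n) x s) s om * \<theta> x s om) \<longlonglongrightarrow> It m (sect m G x s) s om * \<theta> x s om" if "0 <= s" "s <= 1" for s
     by (intro tendsto_mult Hc[OF x that] tendsto_const)
    show "\<bar>It m (sect m (Gn n) x s) s om * \<theta> x s om\<bar> <= (B * (Kc m * (1 + real (N om)) ^ m)) * e" if s: "0 <= s" "s <= 1" for n s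
     unfolding abs_mult
     by (intro mult_mono bound[OF gcont_sect[OF Gn s x] s om] drift_bound[OF \<theta> x om s] order.trans[OF abs_ge_zero bound[OF gcont_sect[OF Gn s x] s om]]) simp
   qed
   have ji: "(%n. \<Sum>s\<in>S x om Int {..<tn n}. It m (sect m (Gn n) x s) s om * \<xi> (Suc m) x s om) \<longlonglongrightarrow> (\<Sum>s\<in>S x om Int {..<t}. It m (sect m G x s) s om * \<xi> (Suc m) x s om)"
    if x: "x \<in> X" for x
   proof (rule tendsto_jump_sum[OF x om _ tn(2)])
    show "tn n <= t" for n using tn(1)[of n] by simp
    fix s assume "s \<in> S x om"
    then have "0 <= s" "s <= 1" using S01[OF x om] by auto
    then show "(%n. It m (sect m (Gn n) x s) s om * \<xi> (Suc m) x s om) \<longlonglongrightarrow> It m (sect m G x s) s om * \<xi> (Suc m) x s om"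
     by (intro tendsto_mult Hc[OF x] tendsto_const)
   qed
   show ?thesis unfolding It.simps msum_def dsum_def
    by (intro tendsto_add tendsto_sum tendsto_diff ji di[OF _ dz'] di[OF _ dr'])
  qed
  have sec': "nice (%s om. It (Suc m) (sect (Suc m) G x s) s om)" if "gcont X (Suc (Suc m)) B G" "x \<in> X" for G B x
  proof (rule slice)
   show "nice (It (Suc m) G)" if "gcont X (Suc m) B G" for G B by (rule nice'[OF that])
   show "\<bar>It (Suc m) G t om\<bar> <= B * (Kc (Suc m) * (1 + real (N om)) ^ Suc m)"
    if "gcont X (Suc m) B G" "0 <= t" "t <= 1" "om \<in> space P" for G B t om by (rule bound'[OF that])
   show "(%n. It (Suc m) (Gn n) (tn n) om) \<longlonglongrightarrow> It (Suc m) G t om"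
    if "!!n. gcont X (Suc m) B (Gn n)" "gcont X (Suc m) B G" "!!w. w\<in>box X (Suc m) ==> (%n. Gn n w) \<longlonglongrightarrow> G w"
     "!!n. 0 <= tn n & tn n <= t" "tn \<longlonglongrightarrow> t" "0 <= t" "t <= 1" "om \<in> space P" for Gn G B tn t om
    by (rule conv'[OF that])
  qed (rule that)+
  show ?case
  proof (intro conjI allI impI)
   fix Gn :: "nat => tuple => real" and G :: "tuple => real" and B t :: real and tn :: "nat => real" and om
   assume "\<forall>n. gcont X (Suc m) B (Gn n)" "gcont X (Suc m) B G" "\<forall>w\<in>box X (Suc m). (%n. Gn n w) \<longlonglongrightarrow> G w"
    "\<forall>n. 0 <= tn n & tn n <= t" "tn \<longlonglongrightarrow> t" "0 <= t" "t <= 1" "om \<in> space P"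
   then show "(%n. It (Suc m) (Gn n) (tn n) om) \<longlonglongrightarrow> It (Suc m) G t om"
    by (intro conv'[of B]) blast+
  qed (rule nice', assumption, rule bound', assumption+, rule sec', assumption+)
 qed
qed

lemma It_nice: "gcont X m B G ==> nice (It m G)"
 using It_properties[of m] by blast

lemma It_sect_nice: "gcont X (Suc m) B G ==> x \<in> X ==> nice (%s om. It m (sect m G x s) s om)"
 using It_properties[of m] by blast

end

section \<open>Mixed norms\<close>

lemma Lam_eq: "Lam N d = PiE_dflt {..<d} 0 (%_. {..<N})"
 by (auto simp: Lam_def PiE_dflt_def not_less)

lemma finite_Lam: "finite (Lam N d)"
 unfolding Lam_eq by (intro finite_PiE_dflt) auto

lemma card_Lam: "card (Lam N d) = N ^ d"
 unfolding Lam_eq by (subst card_PiE_dflt) auto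

lemma eps_card_Lam: "1 <= N ==> eps N ^ d * real (card (Lam N d)) = 1"
 by (simp add: card_Lam eps_def power_divide)

lemma eps_pos: "1 <= N ==> 0 < eps N"
 by (simp add: eps_def)

lemma Lam_nonempty: "1 <= N ==> (%_. 0) \<in> Lam N d"
 by (auto simp: Lam_def)

text \<open>This is \<open>a <= liminf an\<close>, within the reals. Continuity would be too much to
  ask: for the exponent \<open>EInf\<close> the norm cut at \<open>fst z < t\<close> can jump as
  \<open>t\<close> decreases to 0, where the cut leaves nothing.\<close>

definition lsc_seq :: "(nat => real) => real => bool" where
 "lsc_seq an a \<longleftrightarrow> (\<forall>e<a. \<forall>\<^sub>F n in sequentially. e < an n)"

lemma lsc_seq_sum:
 assumes "finite X" "!!x. x \<in> X ==> lsc_seq (%n. an n x) (a x)"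
 shows "lsc_seq (%n. \<Sum>x\<in>X. an n x) (\<Sum>x\<in>X. a x)"
 using assms
proof (induction X rule: finite_induct)
 case empty
 then show ?case by (simp add: lsc_seq_def)
next
 case (insert y X)
 show ?case unfolding lsc_seq_def
 proof (intro allI impI)
  fix e assume "e < (\<Sum>x\<in>insert y X. a x)"
  then have e: "e < a y + (\<Sum>x\<in>X. a x)" using insert by simp
  define d where "d = (a y + (\<Sum>x\<in>X. a x) - e) / 2"
  have d: "0 < d" using e by (simp add: d_def)
  have 1: "\<forall>\<^sub>F n in sequentially. a y - d < an n y" using insert(4)[of y] d by (simp add: lsc_seq_def)
  have 2: "\<forall>\<^sub>F n in sequentially. (\<Sum>x\<in>X. a x) - d < (\<Sum>x\<in>X. an n x)" using insert(3,4) d by (simp add: lsc_seq_def)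
  from 1 2 show "\<forall>\<^sub>F n in sequentially. e < (\<Sum>x\<in>insert y X. an n x)"
  proof eventually_elim
   case (elim n)
   have "e = a y - d + ((\<Sum>x\<in>X. a x) - d)" by (simp add: d_def field_simps)
   then show ?case using elim insert by simp
  qed
 qed
qed

lemma lsc_seq_cmult: "0 <= c ==> lsc_seq an a ==> lsc_seq (%n. c * an n) (c * a)"
 unfolding lsc_seq_def
proof (intro allI impI)
 fix e assume c: "0 <= c" and l: "\<forall>e<a. \<forall>\<^sub>F n in sequentially. e < an n" and e: "e < c * a"
 show "\<forall>\<^sub>F n in sequentially. e < c * an n"
 proof (cases "c = 0")
  case False
  then have c: "0 < c" using c by simp
  then have "e / c < a" using e by (simp add: pos_divide_less_eq mult.commute)
  then have "\<forall>\<^sub>F n in sequentially. e / c < an n" using l by blast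
  then show ?thesis by eventually_elim (use c in \<open>simp add: pos_divide_less_eq mult.commute\<close>)
 qed (use e in simp)
qed

lemma lsc_seq_square:
 assumes "!!n. 0 <= an n" "0 <= a" "lsc_seq an a"
 shows "lsc_seq (%n. (an n)\<^sup>2) (a\<^sup>2)"
 unfolding lsc_seq_def
proof (intro allI impI)
 fix e assume e: "e < a\<^sup>2"
 show "\<forall>\<^sub>F n in sequentially. e < (an n)\<^sup>2"
 proof (cases "e < 0")
  case True
  then show ?thesis by (intro always_eventually allI) (meson less_le_trans zero_le_power2)
 next
  case False
  then have "sqrt e < a" using e assms(2) by (simp add: real_less_lsqrt)
  then have "\<forall>\<^sub>F n in sequentially. sqrt e < an n" using assms(3) by (simp add: lsc_seq_def)
  then show ?thesis
  proof eventually_elim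
   case (elim n)
   have "(sqrt e)\<^sup>2 < (an n)\<^sup>2" by (rule power_strict_mono[OF elim]) (use False in auto)
   then show ?case using False by simp
  qed
 qed
qed

lemma lsc_seq_sqrt:
 assumes "!!n. 0 <= an n" "lsc_seq an a"
 shows "lsc_seq (%n. sqrt (an n)) (sqrt a)"
 unfolding lsc_seq_def
proof (intro allI impI)
 fix e assume e: "e < sqrt a"
 show "\<forall>\<^sub>F n in sequentially. e < sqrt (an n)"
 proof (cases "e < 0")
  case True
  then show ?thesis using assms(1) by (intro always_eventually allI) (meson less_le_trans real_sqrt_ge_zero)
 next
  case False
  then have "e\<^sup>2 < a" using e by (simp add: real_less_rsqrt not_less) (meson real_le_lsqrt not_le not_less order.strict_trans1 zero_le_power2 real_sqrt_gt_0_iff less_eq_real_def)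
  then have "\<forall>\<^sub>F n in sequentially. e\<^sup>2 < an n" using assms(2) by (simp add: lsc_seq_def)
  then show ?thesis by eventually_elim (rule real_less_rsqrt)
 qed
qed

text \<open>Fatou's lemma, applicable in \<open>ennreal\<close> because all functions are
  nonnegative.\<close>

lemma lsc_seq_integral:
 fixes f :: "real => real"
 assumes i: "!!n. set_integrable lborel {0..T} (fn n)" "set_integrable lborel {0..T} f"
  and nn: "!!n s. 0 <= s ==> s <= T ==> 0 <= fn n s" "!!s. 0 <= s ==> s <= T ==> 0 <= f s"
  and l: "!!s. 0 <= s ==> s <= T ==> lsc_seq (%n. fn n s) (f s)"
 shows "lsc_seq (%n. LBINT s:{0..T}. fn n s) (LBINT s:{0..T}. f s)"
 unfolding lsc_seq_def
proof (intro allI impI)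
 fix e assume e: "e < (LBINT s:{0..T}. f s)"
 have eq: "ennreal (LBINT s:{0..T}. g s) = (\<integral>\<^sup>+s. ennreal (indicator {0..T} s * g s) \<partial>lborel)"
  if "set_integrable lborel {0..T} g" "!!s. 0 <= s ==> s <= T ==> 0 <= g s" for g :: "real => real"
 proof -
  have "integrable lborel (%s. indicator {0..T} s * g s)" using that(1) by (simp add: set_integrable_def)
  then have "(\<integral>\<^sup>+s. ennreal (indicator {0..T} s * g s) \<partial>lborel) = ennreal (\<integral>s. indicator {0..T} s * g s \<partial>lborel)"
   by (rule nn_integral_eq_integral) (use that(2) in \<open>auto intro!: AE_I2 simp: indicator_def\<close>)
  then show ?thesis by (simp add: set_lebesgue_integral_def)
 qed
 have pos: "0 <= (LBINT s:{0..T}. fn n s)" for n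
  unfolding set_lebesgue_integral_def using nn(1) by (intro integral_nonneg_AE AE_I2) (auto simp: indicator_def)
 show "\<forall>\<^sub>F n in sequentially. e < (LBINT s:{0..T}. fn n s)"
 proof (cases "e < 0")
  case True
  then show ?thesis using pos by (intro always_eventually allI) (meson less_le_trans)
 next
  case False
  have eqn: "(\<integral>\<^sup>+s. ennreal (indicator {0..T} s * fn n s) \<partial>lborel) = ennreal (LBINT s:{0..T}. fn n s)" for n
   by (rule eq[OF i(1) nn(1), symmetric])
  have "ennreal (LBINT s:{0..T}. f s) = (\<integral>\<^sup>+s. ennreal (indicator {0..T} s * f s) \<partial>lborel)"
   by (rule eq[OF i(2) nn(2)])
  also have "... <= (\<integral>\<^sup>+s. liminf (%n. ennreal (indicator {0..T} s * fn n s)) \<partial>lborel)"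
  proof (rule nn_integral_mono)
   fix s
   show "ennreal (indicator {0..T} s * f s) <= liminf (%n. ennreal (indicator {0..T} s * fn n s))"
   proof (cases "s \<in> {0..T}")
    case True
    show ?thesis unfolding le_Liminf_iff
    proof (intro allI impI)
     fix y assume "y < ennreal (indicator {0..T} s * f s)"
     then have y: "y < ennreal (f s)" using True by simp
     then obtain r where r: "y = ennreal r" "0 <= r" by (cases y) auto
     then have "r < f s" using y by (simp add: ennreal_less_iff)
     then have "\<forall>\<^sub>F n in sequentially. r < fn n s" using l[of s] True by (simp add: lsc_seq_def)
     then show "\<forall>\<^sub>F n in sequentially. y < ennreal (indicator {0..T} s * fn n s)"
      by eventually_elim (use r True in \<open>simp add: ennreal_less_iff\<close>)
    qed
   qed simp
  qed
  also have "... <= liminf (%n. \<integral>\<^sup>+s. ennreal (indicator {0..T} s * fn n s) \<partial>lborel)"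
  proof (rule nn_integral_liminf)
   fix n
   have "(%s. indicator {0..T} s *\<^sub>R fn n s) \<in> borel_measurable lborel"
    by (rule borel_measurable_integrable[OF i(1)[unfolded set_integrable_def]])
   then show "(%s. ennreal (indicator {0..T} s * fn n s)) \<in> borel_measurable lborel" by simp
  qed
  also have "... = liminf (%n. ennreal (LBINT s:{0..T}. fn n s))" by (simp only: eqn)
  finally have le: "ennreal (LBINT s:{0..T}. f s) <= liminf (%n. ennreal (LBINT s:{0..T}. fn n s))" .
  have "ennreal e < ennreal (LBINT s:{0..T}. f s)" using e False by (simp add: ennreal_less_iff)
  then have "ennreal e < liminf (%n. ennreal (LBINT s:{0..T}. fn n s))" using le by (rule less_le_trans)
  then have "\<forall>\<^sub>F n in sequentially. ennreal e < ennreal (LBINT s:{0..T}. fn n s)" by (rule less_LiminfD)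
  then show ?thesis by eventually_elim (use False in \<open>simp add: ennreal_less_iff\<close>)
 qed
qed

text \<open>The underlying measure has mass \<open>T <= 1\<close>, because the lattice has volume 1
  by \<open>eps_card_Lam\<close>; hence each of the three norms is at most the supremum.\<close>

lemma lqnorm_bounds:
 assumes N: "1 <= N" and T: "0 <= T" "T <= 1" and f: "!!s x. 0 <= s ==> s <= T ==> x \<in> Lam N d ==> \<bar>f (s, x)\<bar> <= B"
 shows "0 <= lqnorm N d T q f" "lqnorm N d T q f <= B"
proof -
 note e = eps_pos[OF N]
 have B0: "0 <= B" using f[of 0 "%_. 0"] T Lam_nonempty[OF N] by (meson abs_ge_zero order.trans order.refl)
 have le: "(\<Sum>x\<in>Lam N d. LBINT s:{0..T}. h s x) <= real (card (Lam N d)) * D"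
  if "!!s x. 0 <= s ==> s <= T ==> x \<in> Lam N d ==> \<bar>h s x\<bar> <= D" "0 <= D" for h :: "real => site => real" and D
 proof -
  have "(LBINT s:{0..T}. h s x) <= D" if x: "x \<in> Lam N d" for x
  proof -
   have "\<bar>LBINT s:{0..T}. h s x\<bar> <= D * (T - 0)" by (rule LBINT_abs_le[OF T(1)]) (use that in \<open>auto simp: \<open>!!s x. 0 <= s ==> s <= T ==> x \<in> Lam N d ==> \<bar>h s x\<bar> <= D\<close>\<close>)
   also have "... <= D * 1" using T \<open>0 <= D\<close> by (intro mult_left_mono) auto
   finally show ?thesis by simp
  qed
  then have "(\<Sum>x\<in>Lam N d. LBINT s:{0..T}. h s x) <= (\<Sum>x\<in>Lam N d. D)" by (rule sum_mono)
  then show ?thesis by simp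
 qed
 have ge: "0 <= (\<Sum>x\<in>Lam N d. LBINT s:{0..T}. h s x)" if "!!s x. 0 <= h s x" for h :: "real => site => real"
  unfolding set_lebesgue_integral_def using that by (intro sum_nonneg integral_nonneg_AE AE_I2) simp
 have sc: "eps N ^ d * (real (card (Lam N d)) * D) = D" for D
  using eps_card_Lam[OF N, of d] by (simp add: mult.assoc[symmetric])
 have "0 <= lqnorm N d T q f & lqnorm N d T q f <= B"
 proof (cases q)
  case E1
  have "eps N ^ d * (\<Sum>x\<in>Lam N d. LBINT s:{0..T}. \<bar>f (s, x)\<bar>) <= eps N ^ d * (real (card (Lam N d)) * B)"
   by (intro mult_left_mono le) (use f B0 e in auto)
  then show ?thesis using ge[of "%s x. \<bar>f (s, x)\<bar>"] e E1 by (simp add: lqnorm_def sc)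
 next
  case E2
  have "eps N ^ d * (\<Sum>x\<in>Lam N d. LBINT s:{0..T}. (f (s, x))\<^sup>2) <= eps N ^ d * (real (card (Lam N d)) * B\<^sup>2)"
  proof (intro mult_left_mono le)
   fix s x assume "0 <= s" "s <= T" "x \<in> Lam N d"
   from f[OF this] show "\<bar>(f (s, x))\<^sup>2\<bar> <= B\<^sup>2" using B0 by (metis abs_power2 abs_ge_zero power2_abs power_mono)
  qed (use B0 e in auto)
  then have "sqrt (eps N ^ d * (\<Sum>x\<in>Lam N d. LBINT s:{0..T}. (f (s, x))\<^sup>2)) <= sqrt (B\<^sup>2)"
   unfolding sc by (rule real_sqrt_le_mono)
  then show ?thesis using ge[of "%s x. (f (s, x))\<^sup>2"] e E2 B0 by (simp add: lqnorm_def)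
 next
  case EInf
  have m: "\<bar>f (0, %_. 0)\<bar> \<in> {\<bar>f (s, x)\<bar> | s x. s \<in> {0..T} & x \<in> Lam N d}" using T Lam_nonempty[OF N, of d] by force
  have "Sup {\<bar>f (s, x)\<bar> | s x. s \<in> {0..T} & x \<in> Lam N d} <= B"
   by (rule cSup_least) (use m f in auto)
  moreover have "\<bar>f (0, %_. 0)\<bar> <= Sup {\<bar>f (s, x)\<bar> | s x. s \<in> {0..T} & x \<in> Lam N d}"
   by (rule cSup_upper[OF m]) (use f in \<open>auto intro!: bdd_aboveI[of _ B]\<close>)
  ultimately show ?thesis using EInf abs_ge_zero[of "f (0, %_. 0)"] by (simp add: lqnorm_def)
 qed
 then show "0 <= lqnorm N d T q f" "lqnorm N d T q f <= B" by auto
qed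

lemma lqnorm_abs: "lqnorm N d T q (%z. \<bar>f z\<bar>) = lqnorm N d T q f"
 by (cases q) (simp_all add: lqnorm_def)

lemma lqnorm_zero:
 assumes "1 <= N" "0 <= T" shows "lqnorm N d T q (%z. 0) = 0"
proof (cases q)
 case EInf
 have "{\<bar>0::real\<bar> | s x. s \<in> {0..T} & x \<in> Lam N d} = {0}" using assms Lam_nonempty[OF assms(1), of d] by force
 then show ?thesis using EInf by (simp add: lqnorm_def)
qed (simp_all add: lqnorm_def set_lebesgue_integral_def)

lemma lsc_seq_lqnorm:
 assumes N: "1 <= N" and T: "0 <= T" "T <= 1"
  and nn: "!!n s x. 0 <= s ==> s <= T ==> x \<in> Lam N d ==> 0 <= fn n (s, x) & fn n (s, x) <= B"
   "!!s x. 0 <= s ==> s <= T ==> x \<in> Lam N d ==> 0 <= f (s, x) & f (s, x) <= B"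
  and m: "!!n x. x \<in> Lam N d ==> (%s. indicator {0..T} s * fn n (s, x)) \<in> borel_measurable borel"
   "!!x. x \<in> Lam N d ==> (%s. indicator {0..T} s * f (s, x)) \<in> borel_measurable borel"
  and l: "!!s x. 0 <= s ==> s <= T ==> x \<in> Lam N d ==> lsc_seq (%n. fn n (s, x)) (f (s, x))"
 shows "lsc_seq (%n. lqnorm N d T q (fn n)) (lqnorm N d T q f)"
proof -
 note e = eps_pos[OF N]
 have int: "set_integrable lborel {0..T} (%s. h s)" if "(%s. indicator {0..T} s * h s) \<in> borel_measurable borel"
  "!!s. 0 <= s ==> s <= T ==> 0 <= h s & h s <= D" for h :: "real => real" and D
  unfolding set_integrable_def
 proof (rule Bochner_Integration.integrable_bound[where f="%s. indicator {0..T} s *\<^sub>R D"])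
  show "integrable lborel (%s. indicator {0..T} s *\<^sub>R D)" using set_integrable_const_Icc[of 0 T D] by (simp only: set_integrable_def)
  show "(%s. indicator {0..T} s *\<^sub>R h s) \<in> borel_measurable lborel" using that(1) by simp
  show "AE s in lborel. norm (indicator {0..T} s *\<^sub>R h s) <= norm (indicator {0..T} s *\<^sub>R D)"
   by (rule AE_I2) (use that(2) in \<open>force simp: indicator_def\<close>)
 qed
 have pos: "0 <= (\<Sum>x\<in>Lam N d. LBINT s:{0..T}. h s x)" if "!!s x. 0 <= h s x" for h :: "real => site => real"
  unfolding set_lebesgue_integral_def using that by (intro sum_nonneg integral_nonneg_AE AE_I2) simp
 show ?thesis
 proof (cases q)
  case E1
  have "lsc_seq (%n. LBINT s:{0..T}. \<bar>fn n (s, x)\<bar>) (LBINT s:{0..T}. \<bar>f (s, x)\<bar>)" if x: "x \<in> Lam N d" for x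
  proof (rule lsc_seq_integral)
   show "set_integrable lborel {0..T} (%s. \<bar>fn n (s, x)\<bar>)" for n
    by (rule set_integrable_abs[OF int[OF m(1)[OF x] nn(1)[OF _ _ x]]])
   show "set_integrable lborel {0..T} (%s. \<bar>f (s, x)\<bar>)"
    by (rule set_integrable_abs[OF int[OF m(2)[OF x] nn(2)[OF _ _ x]]])
   show "lsc_seq (%n. \<bar>fn n (s, x)\<bar>) \<bar>f (s, x)\<bar>" if "0 <= s" "s <= T" for s
    using l[OF that x] nn(1)[OF that x] nn(2)[OF that x] by simp
  qed auto
  then show ?thesis unfolding E1 lqnorm_def using e by (auto intro!: lsc_seq_cmult lsc_seq_sum finite_Lam)
 next
  case E2
  have sq: "0 <= h\<^sup>2 & h\<^sup>2 <= B\<^sup>2" if "0 <= h & h <= B" for h :: real using that by (auto intro: power_mono)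
  have msq: "(%s. indicator {0..T} s * (h s)\<^sup>2) \<in> borel_measurable borel" if "(%s. indicator {0..T} s * h s) \<in> borel_measurable borel" for h :: "real => real"
  proof -
   have "(%s. (indicator {0..T} s * h s)\<^sup>2) \<in> borel_measurable borel" using that by measurable
   then show ?thesis by (rule measurable_cong[THEN iffD1, rotated]) (simp add: indicator_def)
  qed
  have "lsc_seq (%n. LBINT s:{0..T}. (fn n (s, x))\<^sup>2) (LBINT s:{0..T}. (f (s, x))\<^sup>2)" if x: "x \<in> Lam N d" for x
  proof (rule lsc_seq_integral)
   show "set_integrable lborel {0..T} (%s. (fn n (s, x))\<^sup>2)" for n
    by (rule int[OF msq[OF m(1)[OF x]] sq[OF nn(1)[OF _ _ x]]])
   show "set_integrable lborel {0..T} (%s. (f (s, x))\<^sup>2)"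
    by (rule int[OF msq[OF m(2)[OF x]] sq[OF nn(2)[OF _ _ x]]])
   show "lsc_seq (%n. (fn n (s, x))\<^sup>2) ((f (s, x))\<^sup>2)" if "0 <= s" "s <= T" for s
    by (rule lsc_seq_square) (use l[OF that x] nn(1)[OF that x] nn(2)[OF that x] in auto)
  qed auto
  then have "lsc_seq (%n. eps N ^ d * (\<Sum>x\<in>Lam N d. LBINT s:{0..T}. (fn n (s, x))\<^sup>2)) (eps N ^ d * (\<Sum>x\<in>Lam N d. LBINT s:{0..T}. (f (s, x))\<^sup>2))"
   using e by (intro lsc_seq_cmult lsc_seq_sum finite_Lam) auto
  then show ?thesis unfolding E2 lqnorm_def expo.case
   by (intro lsc_seq_sqrt mult_nonneg_nonneg pos) (use e in auto)
 next
  case EInf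
  show ?thesis unfolding lsc_seq_def EInf lqnorm_def expo.case
  proof (intro allI impI)
   fix r assume r: "r < Sup {\<bar>f (s, x)\<bar> | s x. s \<in> {0..T} & x \<in> Lam N d}"
   have "\<bar>f (0, %_. 0)\<bar> \<in> {\<bar>f (s, x)\<bar> | s x. s \<in> {0..T} & x \<in> Lam N d}" using T Lam_nonempty[OF N, of d] by force
   then have "{\<bar>f (s, x)\<bar> | s x. s \<in> {0..T} & x \<in> Lam N d} ~= {}" by blast
   from less_cSupD[OF this r] obtain s x where sx: "s \<in> {0..T}" "x \<in> Lam N d" "r < \<bar>f (s, x)\<bar>" by blast
   then have s: "0 <= s" "s <= T" by auto
   have "r < f (s, x)" using sx nn(2)[OF s sx(2)] by simp
   then have "\<forall>\<^sub>F n in sequentially. r < fn n (s, x)" using l[OF s sx(2)] by (simp add: lsc_seq_def)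
   then show "\<forall>\<^sub>F n in sequentially. r < Sup {\<bar>fn n (s, x)\<bar> | s x. s \<in> {0..T} & x \<in> Lam N d}"
   proof eventually_elim
    case (elim n)
    have "\<bar>fn n (s, x)\<bar> <= Sup {\<bar>fn n (s, x)\<bar> | s x. s \<in> {0..T} & x \<in> Lam N d}"
    proof (rule cSup_upper)
     show "bdd_above {\<bar>fn n (s, x)\<bar> | s x. s \<in> {0..T} & x \<in> Lam N d}"
      by (rule bdd_aboveI[of _ B]) (use nn(1) in fastforce)
    qed (use sx in blast)
    then show ?case using elim by linarith
   qed
  qed
 qed
qed

text \<open>The mixed norm with an additional cutoff on the last time. \<open>mnorm\<close> keeps
  the ordering of times as an indicator inside the integrand; as a time parameter it gives a
  recursion of the same shape as \<open>It\<close>, starting with no variables.\<close>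

fun mn :: "nat => nat => real => (nat => expo) => nat => real => (tuple => real) => real" where
 "mn N d T pp 0 t H = \<bar>H (%_. base0)\<bar>"
| "mn N d T pp (Suc m) t H = lqnorm N d T (pp (Suc m))
   (%z. if fst z < t then mn N d T pp m (fst z) (sect m H (snd z) (fst z)) else 0)"

lemma mn_bounds:
 assumes N: "1 <= N" and T: "0 <= T" "T <= 1" and H: "gcont (Lam N d) m B H"
 shows "0 <= mn N d T pp m t H" "mn N d T pp m t H <= B"
proof -
 have "0 <= mn N d T pp m t H & mn N d T pp m t H <= B"
  using H
 proof (induction m arbitrary: H t)
  case 0
  have "(%_. base0) \<in> box (Lam N d) 0" by (simp add: box_def)
  then show ?case using gcontD(2)[OF 0] by simp
 next
  case (Suc m)
  have B0: "0 <= B" by (rule gcontD(1)[OF Suc.prems])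
  have "\<bar>if fst z < t then mn N d T pp m (fst z) (sect m H (snd z) (fst z)) else 0\<bar> <= B"
   if z: "z = (s, x)" "0 <= s" "s <= T" "x \<in> Lam N d" for z s x
   using Suc.IH[OF gcont_sect[OF Suc.prems z(2) _ z(4)], of s] B0 T z by simp
  then show ?case unfolding mn.simps using lqnorm_bounds[OF N T, of d _ B "pp (Suc m)"] by simp
 qed
 then show "0 <= mn N d T pp m t H" "mn N d T pp m t H <= B" by auto
qed

text \<open>Sublevel sets are closed in \<open>{0..T}\<close>. This route to measurability works
  also for the \<open>EInf\<close> norm, which is an uncountable supremum.\<close>

lemma lsc_measurable:
 fixes f :: "real => real"
 assumes nn: "!!s. 0 <= s ==> s <= T ==> 0 <= f s"
  and l: "!!sn s. (!!n. 0 <= sn n & sn n <= T) ==> sn \<longlonglongrightarrow> s ==> 0 <= s ==> s <= T ==> lsc_seq (%n. f (sn n)) (f s)"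
 shows "(%s. indicator {0..T} s * f s) \<in> borel_measurable borel"
proof (rule borel_measurable_iff_le[THEN iffD2], rule allI)
 fix a
 have "closed {s \<in> {0..T}. f s <= a}"
  unfolding closed_sequential_limits
 proof (intro allI impI, elim conjE)
  fix sn s assume sn: "\<forall>n. sn n \<in> {s \<in> {0..T}. f s <= a}" "sn \<longlonglongrightarrow> s"
  have s: "s \<in> {0..T}" by (rule closed_sequentially[OF closed_atLeastAtMost _ sn(2)]) (use sn(1) in auto)
  have "f s <= a"
  proof (rule ccontr)
   assume "\<not> f s <= a"
   moreover have "lsc_seq (%n. f (sn n)) (f s)"
    by (rule l[OF _ sn(2)]) (use sn(1) s in auto)
   ultimately have "\<forall>\<^sub>F n in sequentially. a < f (sn n)" unfolding lsc_seq_def by simp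
   from eventually_happens'[OF sequentially_bot this] obtain n where "a < f (sn n)" by blast
   moreover have "f (sn n) <= a" using sn(1) by blast
   ultimately show False by simp
  qed
  then show "s \<in> {s \<in> {0..T}. f s <= a}" using s by simp
 qed
 then have c: "{s \<in> {0..T}. f s <= a} \<in> sets borel" by simp
 have "{s \<in> space borel. indicator {0..T} s * f s <= a} = (if a < 0 then {} else {s \<in> {0..T}. f s <= a} \<union> - {0..T})"
 proof (intro set_eqI)
  fix s
  show "s \<in> {s \<in> space borel. indicator {0..T} s * f s <= a} \<longleftrightarrow> s \<in> (if a < 0 then {} else {s \<in> {0..T}. f s <= a} \<union> - {0..T})"
   using nn[of s] by (cases "s \<in> {0..T}") auto
 qed
 then show "{s \<in> space borel. indicator {0..T} s * f s <= a} \<in> sets borel" using c by simp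
qed

lemma mn_lsc:
 assumes N: "1 <= N" and T: "0 <= T" "T <= 1"
 shows "(!!n. gcont (Lam N d) m B (Hn n)) ==> gcont (Lam N d) m B H ==> (!!w. w \<in> box (Lam N d) m ==> (%n. Hn n w) \<longlonglongrightarrow> H w)
  ==> tn \<longlonglongrightarrow> t ==> lsc_seq (%n. mn N d T pp m (tn n) (Hn n)) (mn N d T pp m t H)"
proof (induction m arbitrary: Hn H tn t)
 case 0
 have "(%_. base0) \<in> box (Lam N d) 0" by (simp add: box_def)
 then have "(%n. \<bar>Hn n (%_. base0)\<bar>) \<longlonglongrightarrow> \<bar>H (%_. base0)\<bar>" by (intro tendsto_rabs 0)
 then show ?case by (auto simp: lsc_seq_def intro: order_tendstoD(1))
next
 case (Suc m)
 have meas: "(%s. indicator {0..T} s * (if fst (s, x) < u then mn N d T pp m (fst (s, x)) (sect m G (snd (s, x)) (fst (s, x))) else 0)) \<in> borel_measurable borel"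
  if G: "gcont (Lam N d) (Suc m) B G" and x: "x \<in> Lam N d" for G u x
 proof -
  have "(%s. indicator {0..T} s * mn N d T pp m s (sect m G x s)) \<in> borel_measurable borel"
  proof (rule lsc_measurable)
   show "0 <= mn N d T pp m s (sect m G x s)" if "0 <= s" "s <= T" for s
    using mn_bounds(1)[OF N T gcont_sect[OF G _ _ x]] that T by simp
   fix sn s assume sn: "!!n. 0 <= sn n & sn n <= T" "sn \<longlonglongrightarrow> s" "0 <= s" "s <= T"
   have sn1: "0 <= sn n & sn n <= 1" for n using sn(1)[of n] T by auto
   have s1: "s <= 1" using sn T by simp
   show "lsc_seq (%n. mn N d T pp m (sn n) (sect m G x (sn n))) (mn N d T pp m s (sect m G x s))"
   proof (rule Suc.IH)
    show "gcont (Lam N d) m B (sect m G x (sn n))" for n using sn1[of n] by (intro gcont_sect[OF G _ _ x]) auto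
    show "gcont (Lam N d) m B (sect m G x s)" by (rule gcont_sect[OF G sn(3) s1 x])
    show "(%n. sect m G x (sn n) w) \<longlonglongrightarrow> sect m G x s w" if "w \<in> box (Lam N d) m" for w
     by (rule sect_tendsto[OF G sn1 sn(3) s1 sn(2) x that])
   qed (rule sn(2))
  qed
  then have "(%s. (indicator {0..T} s * mn N d T pp m s (sect m G x s)) * indicator {..<u} s) \<in> borel_measurable borel"
   by measurable
  then show ?thesis by (rule measurable_cong[THEN iffD1, rotated]) (simp add: indicator_def)
 qed
 have bd: "0 <= (if fst (s, x) < u then mn N d T pp m (fst (s, x)) (sect m G (snd (s, x)) (fst (s, x))) else 0) \<and>
   (if fst (s, x) < u then mn N d T pp m (fst (s, x)) (sect m G (snd (s, x)) (fst (s, x))) else 0) <= B"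
  if G: "gcont (Lam N d) (Suc m) B G" and s: "0 <= s" "s <= T" and x: "x \<in> Lam N d" for G s u x
 proof -
  have "s <= 1" using s T by simp
  then show ?thesis using mn_bounds[OF N T gcont_sect[OF G s(1) _ x], of pp s] gcontD(1)[OF G] by simp
 qed
 show ?case unfolding mn.simps
 proof (rule lsc_seq_lqnorm[OF N T bd[OF Suc.prems(1)] bd[OF Suc.prems(2)] meas[OF Suc.prems(1)] meas[OF Suc.prems(2)]])
  fix s :: real and x assume s: "0 <= s" "s <= T" and x: "x \<in> Lam N d"
  have s1: "s <= 1" using s T by simp
  have l: "lsc_seq (%n. mn N d T pp m s (sect m (Hn n) x s)) (mn N d T pp m s (sect m H x s))"
   by (rule Suc.IH[OF gcont_sect[OF Suc.prems(1) s(1) s1 x] gcont_sect[OF Suc.prems(2) s(1) s1 x] sect_tendsto_seq[OF Suc.prems(3) s(1) s1 x]]) auto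
  show "lsc_seq (%n. if fst (s, x) < tn n then mn N d T pp m (fst (s, x)) (sect m (Hn n) (snd (s, x)) (fst (s, x))) else 0)
    (if fst (s, x) < t then mn N d T pp m (fst (s, x)) (sect m H (snd (s, x)) (fst (s, x))) else 0)"
  proof (cases "s < t")
   case True
   show ?thesis unfolding lsc_seq_def
   proof (intro allI impI)
    fix e assume e: "e < (if fst (s, x) < t then mn N d T pp m (fst (s, x)) (sect m H (snd (s, x)) (fst (s, x))) else 0)"
    have "\<forall>\<^sub>F n in sequentially. s < tn n" by (rule order_tendstoD(1)[OF Suc.prems(4) True])
    moreover have "\<forall>\<^sub>F n in sequentially. e < mn N d T pp m s (sect m (Hn n) x s)" using l e True by (simp add: lsc_seq_def)
    ultimately show "\<forall>\<^sub>F n in sequentially. e < (if fst (s, x) < tn n then mn N d T pp m (fst (s, x)) (sect m (Hn n) (snd (s, x)) (fst (s, x))) else 0)"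
     by eventually_elim simp
   qed
  next
   case False
   show ?thesis unfolding lsc_seq_def
   proof (intro allI impI always_eventually)
    fix e n assume "e < (if fst (s, x) < t then mn N d T pp m (fst (s, x)) (sect m H (snd (s, x)) (fst (s, x))) else 0)"
    then have "e < 0" using False by simp
    then show "e < (if fst (s, x) < tn n then mn N d T pp m (fst (s, x)) (sect m (Hn n) (snd (s, x)) (fst (s, x))) else 0)"
     by (rule less_le_trans[OF _ conjunct1[OF bd[OF Suc.prems(1) s x]]])
   qed
  qed
 qed auto
qed

lemma mn_sect_measurable:
 assumes N: "1 <= N" and T: "0 <= T" "T <= 1" and G: "gcont (Lam N d) (Suc m) B G" and x: "x \<in> Lam N d"
 shows "(%s. indicator {0..T} s * mn N d T pp m s (sect m G x s)) \<in> borel_measurable borel"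
proof (rule lsc_measurable)
 show "0 <= mn N d T pp m s (sect m G x s)" if "0 <= s" "s <= T" for s
  using mn_bounds(1)[OF N T gcont_sect[OF G _ _ x]] that T by simp
 fix sn s assume sn: "!!n. 0 <= sn n & sn n <= T" "sn \<longlonglongrightarrow> s" "0 <= s" "s <= T"
 have sn1: "0 <= sn n & sn n <= 1" for n using sn(1)[of n] T by auto
 have s1: "s <= 1" using sn T by simp
 show "lsc_seq (%n. mn N d T pp m (sn n) (sect m G x (sn n))) (mn N d T pp m s (sect m G x s))"
 proof (rule mn_lsc[OF N T])
  show "gcont (Lam N d) m B (sect m G x (sn n))" for n using sn1[of n] by (intro gcont_sect[OF G _ _ x]) auto
  show "gcont (Lam N d) m B (sect m G x s)" by (rule gcont_sect[OF G sn(3) s1 x])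
  show "(%n. sect m G x (sn n) w) \<longlonglongrightarrow> sect m G x s w" if "w \<in> box (Lam N d) m" for w
   by (rule sect_tendsto[OF G sn1 sn(3) s1 sn(2) x that])
 qed (rule sn(2))
qed

lemma mnorm_zero: "1 <= N ==> 0 <= T ==> mnorm N d T pp (Suc m) (%w. 0) = 0"
 by (induction m) (simp_all add: lqnorm_zero)

lemma base_upd: "(%i. if i = 1 then z else base0) = (%_. base0)(Suc 0 := z)"
 by (auto simp: fun_eq_iff)

lemma mn_eq_mnorm:
 assumes N: "1 <= N" and T: "0 <= T"
 shows "mn N d T pp (Suc m) u H = mnorm N d T pp (Suc m) (%w. H w * (if fst (w (Suc m)) < u then 1 else 0))"
proof (induction m arbitrary: u H)
 case 0
 have "mn N d T pp (Suc 0) u H = lqnorm N d T (pp 1) (%z. \<bar>H ((%_. base0)(Suc 0 := z)) * (if fst z < u then 1 else 0)\<bar>)"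
  by (simp add: sect_def if_distrib cong: if_cong)
 also have "... = mnorm N d T pp (Suc 0) (%w. H w * (if fst (w (Suc 0)) < u then 1 else 0))"
  unfolding lqnorm_abs mnorm.simps base_upd by simp
 finally show ?case .
next
 case (Suc m)
 have "(if fst z < u then mn N d T pp (Suc m) (fst z) (sect (Suc m) H (snd z) (fst z)) else 0)
   = mnorm N d T pp (Suc m) (%w. H (w(Suc (Suc m) := z)) * (if fst ((w(Suc (Suc m) := z)) (Suc (Suc m))) < u then 1 else 0) * (if fst z > fst (w (Suc m)) then 1 else 0))" for z
 proof (cases "fst z < u")
  case True
  then show ?thesis unfolding Suc by (simp add: sect_def)
 next
  case False
  then show ?thesis using mnorm_zero[OF N T, of d pp m] by simp
 qed
 then show ?case by (simp only: mn.simps(2)[of _ _ _ _ "Suc m"] mnorm.simps(3))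
qed

lemma mnorm_eq_lqnorm_mn:
 assumes N: "1 <= N" and T: "0 <= T"
 shows "mnorm N d T pp (Suc m) H = lqnorm N d T (pp (Suc m)) (%z. mn N d T pp m (fst z) (sect m H (snd z) (fst z)))"
proof (cases m)
 case 0
 have "mnorm N d T pp (Suc 0) H = lqnorm N d T (pp (Suc 0)) (%z. \<bar>H ((%_. base0)(Suc 0 := z))\<bar>)"
  unfolding lqnorm_abs mnorm.simps base_upd by simp
 then show ?thesis using 0 by (simp add: sect_def)
next
 case (Suc k)
 have "mn N d T pp (Suc k) (fst z) (sect (Suc k) H (snd z) (fst z)) = mnorm N d T pp (Suc k) (%w. H (w(Suc (Suc k) := z)) * (if fst z > fst (w (Suc k)) then 1 else 0))" for z
  unfolding mn_eq_mnorm[OF N T] by (simp add: sect_def)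
 then show ?thesis by (simp only: Suc mnorm.simps(3))
qed

text \<open>\<open>mnorm\<close> leaves the last time unrestricted. Cutting it at \<open>T\<close>
  affects only \<open>s = T\<close>, which is negligible for the integrals and can only lower the
  supremum.\<close>

lemma mn_le_mnorm:
 assumes N: "1 <= N" and T: "0 <= T" "T <= 1" and H: "gcont (Lam N d) (Suc m) B H"
 shows "mn N d T pp (Suc m) T H <= mnorm N d T pp (Suc m) H"
proof -
 define f where "f z = mn N d T pp m (fst z) (sect m H (snd z) (fst z))" for z
 have fb: "0 <= f (s, x) & f (s, x) <= B" if "0 <= s" "s <= T" "x \<in> Lam N d" for s x
  unfolding f_def using mn_bounds[OF N T gcont_sect[OF H that(1) _ that(3)]] that T by simp
 have ae: "(LBINT s:{0..T}. h s) = (LBINT s:{0..T}. g s)" if "!!s. s < T ==> h s = g s" for h g :: "real => real"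
  unfolding LBINT_ico[symmetric] by (rule set_lebesgue_integral_cong) (use that in auto)
 have "lqnorm N d T q (%z. if fst z < T then f z else 0) <= lqnorm N d T q f" for q
 proof (cases q)
  case E1
  have "(LBINT s:{0..T}. \<bar>if fst (s, x) < T then f (s, x) else 0\<bar>) = (LBINT s:{0..T}. \<bar>f (s, x)\<bar>)" for x by (rule ae) simp
  then show ?thesis by (simp add: E1 lqnorm_def)
 next
  case E2
  have "(LBINT s:{0..T}. (if fst (s, x) < T then f (s, x) else 0)\<^sup>2) = (LBINT s:{0..T}. (f (s, x))\<^sup>2)" for x by (rule ae) simp
  then show ?thesis by (simp add: E2 lqnorm_def)
 next
  case EInf
  have m0: "\<bar>if fst (0::real, %_::nat. 0::nat) < T then f (0, %_. 0) else 0\<bar> \<in> {\<bar>if fst (s, x) < T then f (s, x) else 0\<bar> | s x. s \<in> {0..T} & x \<in> Lam N d}"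
   using T Lam_nonempty[OF N, of d] by force
  have bdd: "bdd_above {\<bar>f (s, x)\<bar> | s x. s \<in> {0..T} & x \<in> Lam N d}" by (rule bdd_aboveI[of _ B]) (use fb in fastforce)
  have "Sup {\<bar>if fst (s, x) < T then f (s, x) else 0\<bar> | s x. s \<in> {0..T} & x \<in> Lam N d} <= Sup {\<bar>f (s, x)\<bar> | s x. s \<in> {0..T} & x \<in> Lam N d}"
  proof (rule cSup_least)
   fix y assume "y \<in> {\<bar>if fst (s, x) < T then f (s, x) else 0\<bar> | s x. s \<in> {0..T} & x \<in> Lam N d}"
   then obtain s x where sx: "s \<in> {0..T}" "x \<in> Lam N d" "y = \<bar>if fst (s, x) < T then f (s, x) else 0\<bar>" by blast
   have "y <= \<bar>f (s, x)\<bar>" using sx by simp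
   also have "... <= Sup {\<bar>f (s, x)\<bar> | s x. s \<in> {0..T} & x \<in> Lam N d}" by (rule cSup_upper[OF _ bdd]) (use sx in blast)
   finally show "y <= Sup {\<bar>f (s, x)\<bar> | s x. s \<in> {0..T} & x \<in> Lam N d}" .
  qed (use m0 in blast)
  then show ?thesis by (simp add: EInf lqnorm_def)
 qed
 from this[of "pp (Suc m)"] show ?thesis unfolding mnorm_eq_lqnorm_mn[OF N T(1)] mn.simps f_def .
qed

section \<open>Paths with jumps and quadratic variation\<close>

lemma cadlag_left_limit:
 assumes "cadlag f" "0 < s"
 shows "(f \<longlongrightarrow> Lim (at_left s) f) (at_left s)"
proof -
 obtain l where "(f \<longlongrightarrow> l) (at_left s)" using assms unfolding cadlag_def by (meson less_imp_le)
 then show ?thesis by (simp add: tendsto_Lim)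
qed

lemma jump_small:
 assumes f: "cadlag f" and us: "0 < s" "u < s" and b: "!!r. u < r ==> r <= s ==> \<bar>f r - v\<bar> <= e"
 shows "\<bar>jump f s\<bar> <= 2 * e"
proof -
 have ev: "\<forall>\<^sub>F r in at_left s. \<bar>f r - v\<bar> <= e"
  unfolding eventually_at_left_field using us b by (intro exI[of _ u]) auto
 have "((%r. \<bar>f r - v\<bar>) \<longlongrightarrow> \<bar>Lim (at_left s) f - v\<bar>) (at_left s)"
  by (intro tendsto_rabs tendsto_diff tendsto_const cadlag_left_limit[OF f us(1)])
 from tendsto_upperbound[OF this ev] have "\<bar>Lim (at_left s) f - v\<bar> <= e" by simp
 moreover have "\<bar>f s - v\<bar> <= e" using b[of s] us by simp
 ultimately show ?thesis using us by (simp add: jump_def)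
qed

text \<open>Near an accumulation point \<open>l\<close> of such times, \<open>f\<close> is nearly
  constant on either side by its one-sided limits, so large jumps close to \<open>l\<close> can
  occur only at \<open>l\<close> itself. Finiteness is vital since a sum over an infinite set is 0
  by convention.\<close>

lemma cadlag_finite_jumps:
 assumes f: "cadlag f" and a: "0 < a"
 shows "finite {s \<in> {0..1}. a <= \<bar>jump f s\<bar>}"
proof (rule ccontr)
 define T where "T = {s \<in> {0..1}. a <= \<bar>jump f s\<bar>}"
 assume "infinite {s \<in> {0..1}. a <= \<bar>jump f s\<bar>}"
 then have "infinite T" "T \<subseteq> {0..1}" by (auto simp: T_def)
 then obtain l where l: "l \<in> {0..1}" "l islimpt T"
  using compact_Icc[of 0 "1::real"] unfolding compact_eq_Bolzano_Weierstrass by meson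
 have "(f \<longlongrightarrow> f l) (at_right l)"
 proof -
  have "continuous (at l within {l..}) f" using f l by (simp add: cadlag_def)
  then have "(f \<longlongrightarrow> f l) (at l within {l..})" by (simp add: continuous_within)
  then show ?thesis by (rule tendsto_within_subset) auto
 qed
 then have "\<forall>\<^sub>F r in at_right l. dist (f r) (f l) < a / 4" using a by (intro tendstoD) auto
 then obtain u where u: "u > l" "!!r. l < r ==> r < u ==> \<bar>f r - f l\<bar> <= a / 4"
  unfolding eventually_at_right_field dist_real_def by (meson less_imp_le)
 have "\<exists>w<l. \<forall>s. w < s --> s < l --> s \<notin> T"
 proof (cases "l = 0")
  case True
  then show ?thesis by (intro exI[of _ "-1"]) (auto simp: T_def)
 next
  case False
  then have l0: "0 < l" using l by simp
  have "\<forall>\<^sub>F r in at_left l. dist (f r) (Lim (at_left l) f) < a / 4"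
   using cadlag_left_limit[OF f l0] a by (intro tendstoD) auto
  then obtain w where w: "w < l" "!!r. w < r ==> r < l ==> \<bar>f r - Lim (at_left l) f\<bar> <= a / 4"
   unfolding eventually_at_left_field dist_real_def by (meson less_imp_le)
  show ?thesis
  proof (intro exI[of _ w] conjI allI impI w(1) notI)
   fix s assume s: "w < s" "s < l" "s \<in> T"
   then have "s ~= 0" using a by (auto simp: T_def jump_def)
   then have "0 < s" using s by (auto simp: T_def)
   then have "\<bar>jump f s\<bar> <= 2 * (a / 4)" by (rule jump_small[OF f _ s(1), where v="Lim (at_left l) f"]) (use w s in auto)
   then show False using s a by (auto simp: T_def)
  qed
 qed
 then obtain w where w: "w < l" "!!s. w < s ==> s < l ==> s \<notin> T" by blast
 have "s \<notin> T" if "l < s" "s < u" for s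
 proof
  assume sT: "s \<in> T"
  have "0 < s" using l that by auto
  then have "\<bar>jump f s\<bar> <= 2 * (a / 4)" by (rule jump_small[OF f _ that(1), where v="f l"]) (use u that in auto)
  then show False using sT a by (auto simp: T_def)
 qed
 then have "\<not> (\<exists>s\<in>T. s ~= l & s \<in> {w<..<u})" using w(2) by (metis greaterThanLessThan_iff linorder_neqE_linordered_idom)
 moreover have "l \<in> {w<..<u}" using w(1) u(1) by simp
 then have "\<exists>s\<in>T. s \<in> {w<..<u} & s ~= l" using l(2) unfolding islimpt_def by (meson open_greaterThanLessThan)
 ultimately show False by blast
qed

lemma finite_gap:
 fixes J :: "real set"
 assumes "finite J"
 shows "\<exists>\<delta>>0. \<forall>s\<in>J. \<forall>s'\<in>J. s < s' --> \<delta> <= s' - s"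
proof -
 define D where "D = insert 1 ((%(s, s'). s' - s) ` {(s, s') \<in> J \<times> J. s < s'})"
 have "finite {(s, s') \<in> J \<times> J. s < s'}" by (rule finite_subset[of _ "J \<times> J"]) (use assms in auto)
 then have fin: "finite D" by (simp add: D_def)
 have "0 < Min D" using fin by (subst Min_gr_iff) (auto simp: D_def)
 moreover have "Min D <= s' - s" if "s \<in> J" "s' \<in> J" "s < s'" for s s'
  by (rule Min_le[OF fin]) (use that in \<open>force simp: D_def\<close>)
 ultimately show ?thesis by blast
qed

section \<open>Quadratic variation sums along uniform grids\<close>

definition qvar :: "nat => real => real => (real => real) => real" where
 "qvar n s t m = (\<Sum>i<n. (m (s + real (Suc i) * (t - s) / real n) - m (s + real i * (t - s) / real n))\<^sup>2)"

lemma grid_shift: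
 assumes "s <= (t::real)" "i < n"
 shows "s <= s + real i * (t - s) / real n" "s + real i * (t - s) / real n <= s + real (Suc i) * (t - s) / real n"
  "s + real (Suc i) * (t - s) / real n <= t"
  "(s + real (Suc i) * (t - s) / real n) - (s + real i * (t - s) / real n) = (t - s) / real n"
proof -
 have n: "0 < real n" using assms(2) by simp
 have "real (Suc i) * (t - s) <= real n * (t - s)" using assms by (intro mult_right_mono) auto
 then have "real (Suc i) * (t - s) / real n <= t - s" using n by (simp add: pos_divide_le_eq mult.commute)
 then show "s + real (Suc i) * (t - s) / real n <= t" by simp
 show "s <= s + real i * (t - s) / real n" using assms by simp
 show "(s + real (Suc i) * (t - s) / real n) - (s + real i * (t - s) / real n) = (t - s) / real n"
  by (simp add: distrib_right add_divide_distrib)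
 then show "s + real i * (t - s) / real n <= s + real (Suc i) * (t - s) / real n"
  using assms(1) n by (smt (verit) divide_nonneg_pos)
qed

lemma sum_grid:
 fixes \<xi> :: "real => real"
 assumes "finite J" "s <= t" "1 <= n"
 shows "(\<Sum>i<n. \<Sum>r\<in>J Int {s + real i * (t - s) / real n<..s + real (Suc i) * (t - s) / real n}. \<xi> r) = (\<Sum>r\<in>J Int {s<..t}. \<xi> r)"
proof -
 define g where "g i = s + real i * (t - s) / real n" for i
 have g: "g i <= g (Suc i)" "s <= g i" for i
 proof -
  have "real i * (t - s) / real n <= real (Suc i) * (t - s) / real n" using assms by (intro divide_right_mono mult_right_mono) auto
  then show "g i <= g (Suc i)" by (simp add: g_def)
  show "s <= g i" using assms by (simp add: g_def)
 qed
 have "(\<Sum>i<m. \<Sum>r\<in>J Int {g i<..g (Suc i)}. \<xi> r) = (\<Sum>r\<in>J Int {s<..g m}. \<xi> r)" for m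
 proof (induction m)
  case 0 then show ?case by (simp add: g_def)
 next
  case (Suc m)
  have "J Int {s<..g (Suc m)} = (J Int {s<..g m}) \<union> (J Int {g m<..g (Suc m)})" using g[of m] by auto
  moreover have "(\<Sum>r\<in>(J Int {s<..g m}) \<union> (J Int {g m<..g (Suc m)}). \<xi> r) = (\<Sum>r\<in>J Int {s<..g m}. \<xi> r) + (\<Sum>r\<in>J Int {g m<..g (Suc m)}. \<xi> r)"
   by (rule sum.union_disjoint) (use assms in auto)
  ultimately show ?case using Suc by simp
 qed
 from this[of n] show ?thesis using assms by (simp add: g_def)
qed

lemma qvar_split:
 fixes A B :: "nat => real"
 shows "(\<Sum>i<n. (A i - B i)\<^sup>2) = (\<Sum>i<n. (A i)\<^sup>2) - 2 * (\<Sum>i<n. A i * B i) + (\<Sum>i<n. (B i)\<^sup>2)"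
 by (simp add: power2_diff sum.distrib sum_subtractf sum_distrib_left mult.assoc algebra_simps)

text \<open>On a cell the increment is the jump part \<open>A\<close> minus the drift part
  \<open>D\<close>. Once the mesh is below the gap between jump times, a cell has at most one jump
  and the squares of \<open>A\<close> add up exactly; the mixed and drift terms are of order
  \<open>1/n\<close>. The second claim is the bound for later passages to the limit.\<close>

lemma qvar_tendsto:
 fixes \<xi> \<theta> :: "real => real"
 assumes J: "finite J" and st: "0 <= s" "s <= t" and \<theta>: "set_integrable lborel {0..t} \<theta>" "!!r. 0 <= r ==> r <= t ==> \<bar>\<theta> r\<bar> <= B"
  and m: "!!u. 0 <= u ==> u <= t ==> m u = (\<Sum>r\<in>J Int {..u}. \<xi> r) - (LBINT r:{0..u}. \<theta> r)"
 shows "(%n. qvar n s t m) \<longlonglongrightarrow> (\<Sum>r\<in>J Int {s<..t}. (\<xi> r)\<^sup>2)"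
  and "1 <= n ==> qvar n s t m <= ((\<Sum>r\<in>J Int {s<..t}. \<bar>\<xi> r\<bar>) + B * (t - s))\<^sup>2"
proof -
 define g where "g n i = s + real i * (t - s) / real n" for n i :: nat
 define A where "A n i = (\<Sum>r\<in>J Int {g n i<..g n (Suc i)}. \<xi> r)" for n i
 define D where "D n i = (LBINT r:{g n i..g n (Suc i)}. \<theta> r)" for n i
 have B0: "0 <= B" using \<theta>(2)[of 0] st by simp
 have g: "s <= g n i" "g n i <= g n (Suc i)" "g n (Suc i) <= t" "g n (Suc i) - g n i = (t - s) / real n" if "i < n" for n i
  using grid_shift[OF st(2) that] by (simp_all only: g_def)
 have inc: "m (g n (Suc i)) - m (g n i) = A n i - D n i" if i: "i < n" for n i
 proof -
  note gi = g[OF i]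
  have "J Int {..g n (Suc i)} = (J Int {..g n i}) \<union> (J Int {g n i<..g n (Suc i)})" using gi by auto
  moreover have "(\<Sum>r\<in>(J Int {..g n i}) \<union> (J Int {g n i<..g n (Suc i)}). \<xi> r) = (\<Sum>r\<in>J Int {..g n i}. \<xi> r) + A n i"
   unfolding A_def by (rule sum.union_disjoint) (use J in auto)
  moreover have "set_integrable lborel {0..g n (Suc i)} \<theta>" by (rule set_integrable_subset[OF \<theta>(1)]) (use gi in auto)
  from LBINT_split[OF this, of "g n i"] have "(LBINT r:{0..g n (Suc i)}. \<theta> r) = (LBINT r:{0..g n i}. \<theta> r) + D n i"
   using gi st by (simp add: D_def)
  moreover have "m (g n (Suc i)) = (\<Sum>r\<in>J Int {..g n (Suc i)}. \<xi> r) - (LBINT r:{0..g n (Suc i)}. \<theta> r)" "m (g n i) = (\<Sum>r\<in>J Int {..g n i}. \<xi> r) - (LBINT r:{0..g n i}. \<theta> r)"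
   using gi st by (auto intro!: m)
  ultimately show ?thesis by simp
 qed
 have Db: "\<bar>D n i\<bar> <= B * ((t - s) / real n)" if i: "i < n" for n i
 proof -
  have "\<bar>D n i\<bar> <= B * (g n (Suc i) - g n i)"
   unfolding D_def using g[OF i] st by (intro LBINT_abs_le \<theta>(2)) auto
  then show ?thesis using g(4)[OF i] by simp
 qed
 have sumA: "(\<Sum>i<n. \<bar>A n i\<bar>) <= (\<Sum>r\<in>J Int {s<..t}. \<bar>\<xi> r\<bar>)" if "1 <= n" for n
 proof -
  have "(\<Sum>i<n. \<bar>A n i\<bar>) <= (\<Sum>i<n. \<Sum>r\<in>J Int {g n i<..g n (Suc i)}. \<bar>\<xi> r\<bar>)"
   unfolding A_def by (intro sum_mono sum_abs)
  also have "... = (\<Sum>r\<in>J Int {s<..t}. \<bar>\<xi> r\<bar>)" unfolding g_def by (rule sum_grid[OF J st(2) that])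
  finally show ?thesis .
 qed
 have q: "qvar n s t m = (\<Sum>i<n. (A n i - D n i)\<^sup>2)" for n
  unfolding qvar_def g_def[symmetric] by (intro sum.cong refl) (simp add: inc)
 show "qvar n s t m <= ((\<Sum>r\<in>J Int {s<..t}. \<bar>\<xi> r\<bar>) + B * (t - s))\<^sup>2" if n: "1 <= n"
 proof -
  have sq: "(\<Sum>i<k. (x i)\<^sup>2) <= (\<Sum>i<k. x i)\<^sup>2" if "!!i. 0 <= x i" for x :: "nat => real" and k
  proof (induction k)
   case (Suc k)
   have "0 <= (\<Sum>i<k. x i) * x k" using that by (intro mult_nonneg_nonneg sum_nonneg)
   then show ?case using Suc by (simp add: power2_sum)
  qed simp
  have "qvar n s t m <= (\<Sum>i<n. \<bar>A n i - D n i\<bar>)\<^sup>2"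
   unfolding q using sq[of "%i. \<bar>A n i - D n i\<bar>" n] by simp
  also have "... <= ((\<Sum>r\<in>J Int {s<..t}. \<bar>\<xi> r\<bar>) + B * (t - s))\<^sup>2"
  proof (rule power_mono)
   have "(\<Sum>i<n. \<bar>A n i - D n i\<bar>) <= (\<Sum>i<n. \<bar>A n i\<bar> + \<bar>D n i\<bar>)" by (intro sum_mono) simp
   also have "... <= (\<Sum>r\<in>J Int {s<..t}. \<bar>\<xi> r\<bar>) + (\<Sum>i<n. B * ((t - s) / real n))"
    unfolding sum.distrib by (intro add_mono sumA[OF n] sum_mono Db) simp
   also have "... = (\<Sum>r\<in>J Int {s<..t}. \<bar>\<xi> r\<bar>) + B * (t - s)" using n by simp
   finally show "(\<Sum>i<n. \<bar>A n i - D n i\<bar>) <= (\<Sum>r\<in>J Int {s<..t}. \<bar>\<xi> r\<bar>) + B * (t - s)" .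
  qed (simp add: sum_nonneg)
  finally show ?thesis .
 qed
 obtain \<delta> where \<delta>: "\<delta> > 0" "\<forall>r\<in>J. \<forall>r'\<in>J. r < r' --> \<delta> <= r' - r" using finite_gap[OF J] by blast
 have l0: "(%n. c / real n) \<longlonglongrightarrow> 0" for c :: real by real_asymp
 have "\<forall>\<^sub>F n in sequentially. (t - s) / real n < \<delta>" by (rule order_tendstoD(2)[OF l0 \<delta>(1)])
 moreover have "\<forall>\<^sub>F n in sequentially. 1 <= n" by (rule eventually_ge_at_top)
 ultimately have evA: "\<forall>\<^sub>F n in sequentially. (\<Sum>r\<in>J Int {s<..t}. (\<xi> r)\<^sup>2) = (\<Sum>i<n. (A n i)\<^sup>2)"
 proof eventually_elim
  case (elim n)
  have "(A n i)\<^sup>2 = (\<Sum>r\<in>J Int {g n i<..g n (Suc i)}. (\<xi> r)\<^sup>2)" if i: "i < n" for i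
  proof -
   have "r = r'" if r: "r \<in> J Int {g n i<..g n (Suc i)}" "r' \<in> J Int {g n i<..g n (Suc i)}" for r r'
   proof (rule ccontr)
    assume "r ~= r'"
    then have "\<delta> <= \<bar>r - r'\<bar>" using \<delta>(2) r by (cases r r' rule: linorder_cases) auto
    moreover have "\<bar>r - r'\<bar> <= g n (Suc i) - g n i" using r by auto
    ultimately show False using elim g(4)[OF i] by simp
   qed
   then have "J Int {g n i<..g n (Suc i)} = {} \<or> (\<exists>r. J Int {g n i<..g n (Suc i)} = {r})" by blast
   then show ?thesis unfolding A_def by auto
  qed
  then have "(\<Sum>i<n. (A n i)\<^sup>2) = (\<Sum>i<n. \<Sum>r\<in>J Int {g n i<..g n (Suc i)}. (\<xi> r)\<^sup>2)" by simp
  also have "... = (\<Sum>r\<in>J Int {s<..t}. (\<xi> r)\<^sup>2)" unfolding g_def by (rule sum_grid[OF J st(2) elim(2)])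
  finally show ?case by simp
 qed
 have 1: "(%n. \<Sum>i<n. (A n i)\<^sup>2) \<longlonglongrightarrow> (\<Sum>r\<in>J Int {s<..t}. (\<xi> r)\<^sup>2)"
  by (rule Lim_transform_eventually[OF tendsto_const evA])
 have 2: "(%n. \<Sum>i<n. A n i * D n i) \<longlonglongrightarrow> 0"
 proof (rule tendsto_rabs_zero_cancel, rule tendsto_sandwich[OF _ _ tendsto_const l0[of "(\<Sum>r\<in>J Int {s<..t}. \<bar>\<xi> r\<bar>) * (B * (t - s))"]])
  show "\<forall>\<^sub>F n in sequentially. \<bar>\<Sum>i<n. A n i * D n i\<bar> <= (\<Sum>r\<in>J Int {s<..t}. \<bar>\<xi> r\<bar>) * (B * (t - s)) / real n"
   using eventually_ge_at_top[of 1]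
  proof eventually_elim
   case (elim n)
   have "\<bar>\<Sum>i<n. A n i * D n i\<bar> <= (\<Sum>i<n. \<bar>A n i\<bar> * (B * ((t - s) / real n)))"
   proof (rule order.trans[OF sum_abs sum_mono])
    fix i assume "i \<in> {..<n}"
    then show "\<bar>A n i * D n i\<bar> <= \<bar>A n i\<bar> * (B * ((t - s) / real n))"
     unfolding abs_mult by (intro mult_left_mono Db) auto
   qed
   also have "... = (\<Sum>i<n. \<bar>A n i\<bar>) * (B * ((t - s) / real n))" by (rule sum_distrib_right[symmetric])
   also have "... <= (\<Sum>r\<in>J Int {s<..t}. \<bar>\<xi> r\<bar>) * (B * ((t - s) / real n))"
    using B0 st by (intro mult_right_mono sumA elim) auto
   finally show ?case by simp
  qed
 qed auto
 have 3: "(%n. \<Sum>i<n. (D n i)\<^sup>2) \<longlonglongrightarrow> 0"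
 proof (rule tendsto_sandwich[OF _ _ tendsto_const l0[of "(B * (t - s))\<^sup>2"]])
  show "\<forall>\<^sub>F n in sequentially. 0 <= (\<Sum>i<n. (D n i)\<^sup>2)" by (simp add: sum_nonneg)
  show "\<forall>\<^sub>F n in sequentially. (\<Sum>i<n. (D n i)\<^sup>2) <= (B * (t - s))\<^sup>2 / real n"
   using eventually_ge_at_top[of 1]
  proof eventually_elim
   case (elim n)
   have "(\<Sum>i<n. (D n i)\<^sup>2) <= (\<Sum>i<n. (B * ((t - s) / real n))\<^sup>2)"
   proof (rule sum_mono)
    fix i assume "i \<in> {..<n}"
    then have "\<bar>D n i\<bar> <= B * ((t - s) / real n)" by (intro Db) auto
    then show "(D n i)\<^sup>2 <= (B * ((t - s) / real n))\<^sup>2" using power_mono[of "\<bar>D n i\<bar>" _ 2] by simp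
   qed
   also have "... = (B * (t - s))\<^sup>2 / real n" using elim by (simp add: power_divide power2_eq_square)
   finally show ?case .
  qed
 qed
 have "(%n. (\<Sum>i<n. (A n i)\<^sup>2) - 2 * (\<Sum>i<n. A n i * D n i) + (\<Sum>i<n. (D n i)\<^sup>2)) \<longlonglongrightarrow> (\<Sum>r\<in>J Int {s<..t}. (\<xi> r)\<^sup>2) - 2 * 0 + 0"
  by (intro tendsto_add tendsto_diff tendsto_mult tendsto_const 1 2 3)
 then show "(%n. qvar n s t m) \<longlonglongrightarrow> (\<Sum>r\<in>J Int {s<..t}. (\<xi> r)\<^sup>2)" unfolding q qvar_split by simp
qed

text \<open>Progressive measurability speaks of times in \<open>{0..t}\<close>; clamping by
  \<open>max 0 (min s t)\<close> gives a Borel function on the whole line that agrees there.\<close>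

lemma prog_path_measurable:
 assumes "prog_measurable Fl Y" "0 <= t" "om \<in> space (Fl t)"
 shows "(%s. indicator {0..t} s * Y s om) \<in> borel_measurable borel"
proof -
 have m: "(%(s, om). Y s om) \<in> borel_measurable (restrict_space borel {0..t} \<Otimes>\<^sub>M Fl t)"
  using assms by (simp add: prog_measurable_def)
 have cl: "(%s. max 0 (min s t)) \<in> measurable borel (restrict_space borel {0..t})"
  by (rule measurable_restrict_space2) (use assms in auto)
 have "(%s. (max 0 (min s t), om)) \<in> measurable borel (restrict_space borel {0..t} \<Otimes>\<^sub>M Fl t)"
  by (rule measurable_Pair[OF cl]) (use assms in simp)
 from measurable_compose[OF this m] have "(%s. Y (max 0 (min s t)) om) \<in> borel_measurable borel" by simp
 then have "(%s. indicator {0..t} s * Y (max 0 (min s t)) om) \<in> borel_measurable borel" by measurable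
 then show ?thesis by (rule measurable_cong[THEN iffD1, rotated]) (simp add: indicator_def max_def min_def)
qed

lemma prog_integral_measurable:
 assumes "prog_measurable Fl Y" "0 <= t"
 shows "(%om. LBINT s:{0..t}. Y s om) \<in> borel_measurable (Fl t)"
proof -
 have m: "(%(s, om). Y s om) \<in> borel_measurable (restrict_space borel {0..t} \<Otimes>\<^sub>M Fl t)"
  using assms by (simp add: prog_measurable_def)
 have cl: "(%s. max 0 (min s t)) \<in> measurable borel (restrict_space borel {0..t})"
  by (rule measurable_restrict_space2) (use assms in auto)
 have "(%z. (max 0 (min (snd z) t), fst z)) \<in> measurable (Fl t \<Otimes>\<^sub>M borel) (restrict_space borel {0..t} \<Otimes>\<^sub>M Fl t)"
  by (rule measurable_Pair[OF measurable_compose[OF measurable_snd cl] measurable_fst])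
 from measurable_compose[OF this m] have "(%z. Y (max 0 (min (snd z) t)) (fst z)) \<in> borel_measurable (Fl t \<Otimes>\<^sub>M borel)" by simp
 then have "(%z. indicator {0..t} (snd z) * Y (max 0 (min (snd z) t)) (fst z)) \<in> borel_measurable (Fl t \<Otimes>\<^sub>M borel)" by measurable
 then have "(%(om, s). indicator {0..t} s *\<^sub>R Y s om) \<in> borel_measurable (Fl t \<Otimes>\<^sub>M borel)"
  by (rule measurable_cong[THEN iffD1, rotated]) (auto simp: indicator_def max_def min_def)
 then have "(%(om, s). indicator {0..t} s *\<^sub>R Y s om) \<in> borel_measurable (Fl t \<Otimes>\<^sub>M lborel)"
  by (subst measurable_cong_sets[OF sets_pair_measure_cong[OF refl sets_lborel] refl])
 then show ?thesis unfolding set_lebesgue_integral_def by (rule lborel.borel_measurable_lebesgue_integral)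
qed

section \<open>The model as a jump process\<close>

locale spde_model =
 fixes d :: nat and k c Cb :: real and NN :: nat and P :: "'a measure" and Fl :: "real => 'a measure"
  and M :: "site => real => 'a => real" and Cc Ctt :: "real => site => 'a => real"
 assumes N1: "1 <= NN" and c0: "0 < c" and Cb0: "0 <= Cb" and mdl: "model d k c Cb NN P Fl M Cc Ctt"
begin

definition a :: real where "a = c * eps NN powr k"

lemma e0: "0 < eps NN" by (rule eps_pos[OF N1])

lemma a0: "0 < a" using c0 e0 by (simp add: a_def)

lemma mdl_parts:
 shows ps: "prob_space P" and "usual_filtration P Fl"
  and mdl_M: "\<forall>x\<in>Lam NN d. sq_int_cadlag_martingale P Fl (M x)"
  and mdl_A1: "\<forall>x\<in>Lam NN d. prog_measurable Fl (%s. Cc s x) \<and>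
     (AE om in P. \<forall>s\<ge>0. \<bar>Cc s x om\<bar> <= Cb) \<and>
     martingale P Fl (%t om. (M x t om)\<^sup>2 - eps NN powr (- real d) * (LBINT s:{0..t}. Cc s x om))"
  and mdl_A2: "\<forall>T. AE om in P. \<forall>s\<in>{0..T}. \<forall>x\<in>Lam NN d. \<forall>y\<in>Lam NN d.
     x ~= y --> \<not> (jump (%t. M x t om) s ~= 0 & jump (%t. M y t om) s ~= 0)"
  and mdl_A3: "\<forall>x\<in>Lam NN d. AE om in P. \<forall>t\<ge>0.
     jump (%t. M x t om) t ~= 0 --> \<bar>jump (%t. M x t om) t\<bar> = c * eps NN powr k"
  and mdl_A4: "\<forall>x\<in>Lam NN d. prog_measurable Fl (%s. Ctt s x) \<and>
     (AE om in P. \<forall>s\<ge>0. \<bar>Ctt s x om\<bar> <= Cb) \<and>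
     (AE om in P. \<forall>t\<ge>0. M x t om =
      (\<Sum>s\<in>jumps_in (%r. M x r om) {0..t}. jump (%r. M x r om) s)
      - eps NN powr (- k - real d) * (LBINT s:{0..t}. Ctt s x om))"
proof -
 note m = mdl[unfolded model_def]
 show "prob_space P" "usual_filtration P Fl" by (fact m[THEN conjunct1], fact m[THEN conjunct2, THEN conjunct1])
 show "\<forall>x\<in>Lam NN d. sq_int_cadlag_martingale P Fl (M x)" by (fact m[THEN conjunct2, THEN conjunct2, THEN conjunct1])
qed (fact mdl[unfolded model_def, THEN conjunct2, THEN conjunct2, THEN conjunct2, THEN conjunct2, THEN conjunct1], fact mdl[unfolded model_def, THEN conjunct2, THEN conjunct2, THEN conjunct2, THEN conjunct2, THEN conjunct2, THEN conjunct1], fact mdl[unfolded model_def, THEN conjunct2, THEN conjunct2, THEN conjunct2, THEN conjunct2, THEN conjunct2, THEN conjunct2, THEN conjunct1], fact mdl[unfolded model_def, THEN conjunct2, THEN conjunct2, THEN conjunct2, THEN conjunct2, THEN conjunct2, THEN conjunct2, THEN conjunct2])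

lemma filt: "filtration (space P) Fl" "0 <= t ==> subalgebra P (Fl t)" "Z \<in> null_sets P ==> A \<subseteq> Z ==> A \<in> sets (Fl 0)"
 using mdl_parts(2) unfolding usual_filtration_def by blast+

lemma Fl_mono: "s <= t ==> sets (Fl s) \<subseteq> sets (Fl t)"
 using filt(1) by (simp add: filtration_def)

lemma Fl_space: "0 <= t ==> space (Fl t) = space P" using filt(2)[of t] by (simp add: subalgebra_def)

lemma Fl_P: "0 <= t ==> A \<in> sets (Fl t) ==> A \<in> sets P" using filt(2)[of t] by (auto simp: subalgebra_def)

definition good :: "'a => bool" where
 "good om \<longleftrightarrow> (\<forall>s\<in>{0..1}. \<forall>x\<in>Lam NN d. \<forall>y\<in>Lam NN d. x ~= y --> \<not> (jump (%t. M x t om) s ~= 0 & jump (%t. M y t om) s ~= 0))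
  & (\<forall>x\<in>Lam NN d. \<forall>t\<ge>0. jump (%t. M x t om) t ~= 0 --> \<bar>jump (%t. M x t om) t\<bar> = c * eps NN powr k)
  & (\<forall>x\<in>Lam NN d. \<forall>s\<ge>0. \<bar>Cc s x om\<bar> <= Cb)
  & (\<forall>x\<in>Lam NN d. \<forall>s\<ge>0. \<bar>Ctt s x om\<bar> <= Cb)
  & (\<forall>x\<in>Lam NN d. \<forall>t\<ge>0. M x t om = (\<Sum>s\<in>jumps_in (%r. M x r om) {0..t}. jump (%r. M x r om) s)
      - eps NN powr (- k - real d) * (LBINT s:{0..t}. Ctt s x om))"

lemma AE_good: "AE om in P. good om"
proof -
 have 1: "AE om in P. \<forall>s\<in>{0..1}. \<forall>x\<in>Lam NN d. \<forall>y\<in>Lam NN d. x ~= y --> \<not> (jump (%t. M x t om) s ~= 0 & jump (%t. M y t om) s ~= 0)"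
  using mdl_A2 ..
 have fin: "AE om in P. \<forall>x\<in>Lam NN d. Q x om" if "\<forall>x\<in>Lam NN d. AE om in P. Q x om" for Q
  using that finite_Lam by (simp add: AE_finite_all)
 have 2: "AE om in P. \<forall>x\<in>Lam NN d. \<forall>t\<ge>0. jump (%t. M x t om) t ~= 0 --> \<bar>jump (%t. M x t om) t\<bar> = c * eps NN powr k"
  by (rule fin) (use mdl_A3 in blast)
 have 3: "AE om in P. \<forall>x\<in>Lam NN d. \<forall>s\<ge>0. \<bar>Cc s x om\<bar> <= Cb"
  by (rule fin) (use mdl_A1 in blast)
 have 4: "AE om in P. \<forall>x\<in>Lam NN d. \<forall>s\<ge>0. \<bar>Ctt s x om\<bar> <= Cb"
  by (rule fin) (use mdl_A4 in blast)
 have 5: "AE om in P. \<forall>x\<in>Lam NN d. \<forall>t\<ge>0. M x t om = (\<Sum>s\<in>jumps_in (%r. M x r om) {0..t}. jump (%r. M x r om) s)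
      - eps NN powr (- k - real d) * (LBINT s:{0..t}. Ctt s x om)"
  by (rule fin) (use mdl_A4 in blast)
 from 1 2 3 4 5 show ?thesis by eventually_elim (simp add: good_def)
qed

text \<open>The set of bad sample points need not be measurable, so a null set containing it is
  chosen. By completeness of the filtration this null set lies in \<open>Fl 0\<close>, and hence
  truncation to \<open>Om\<close> preserves adaptedness.\<close>

definition Om :: "'a set" where
 "Om = space P - (SOME Z. Z \<in> null_sets P & {om \<in> space P. \<not> good om} \<subseteq> Z)"

lemma Om: "0 <= t ==> Om \<in> sets (Fl t)" "om \<in> Om ==> good om" "om \<in> Om ==> om \<in> space P" "AE om in P. om \<in> Om"
proof -
 define Z where "Z = (SOME Z. Z \<in> null_sets P & {om \<in> space P. \<not> good om} \<subseteq> Z)"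
 have "\<exists>Z. Z \<in> null_sets P & {om \<in> space P. \<not> good om} \<subseteq> Z"
  using AE_good unfolding eventually_ae_filter by blast
 from someI_ex[OF this] have Z: "Z \<in> null_sets P" "{om \<in> space P. \<not> good om} \<subseteq> Z" unfolding Z_def by auto
 have O: "Om = space P - Z" by (simp add: Om_def Z_def)
 have "Z \<in> sets (Fl 0)" by (rule filt(3)[OF Z(1)]) simp
 then have "space (Fl 0) - Z \<in> sets (Fl 0)" by auto
 then have "Om \<in> sets (Fl 0)" by (simp add: O Fl_space)
 then show "0 <= t ==> Om \<in> sets (Fl t)" using Fl_mono[of 0 t] by blast
 show "om \<in> Om ==> good om" "om \<in> Om ==> om \<in> space P" using Z O by auto
 show "AE om in P. om \<in> Om" using AE_not_in[OF Z(1)] AE_space by eventually_elim (simp add: O)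
qed

text \<open>Off \<open>Om\<close> there are no jumps at all, so that finiteness and disjointness
  hold for every sample point.\<close>

definition SS :: "site => 'a => real set" where
 "SS x om = (if om \<in> Om then jumps_in (%r. M x r om) {0..1} else {})"

text \<open>Only \<open>w = 1\<close> and \<open>w = 2\<close> are used as driving heights.\<close>

definition jm :: "nat => site => real => 'a => real" where
 "jm w x s om = (jump (%r. M x r om) s) ^ w"

text \<open>The density of the compensator of \<open>jm w\<close>: by (A4) for the jumps themselves,
  by (A1) for their squares.\<close>

definition th :: "nat => site => real => 'a => real" where
 "th w x s om = (if om \<in> Om then (if w = 1 then eps NN powr (- k - real d) * Ctt s x om else eps NN powr (- real d) * Cc s x om) else 0)"

definition Bth :: "nat => real" where
 "Bth w = (if w = 1 then eps NN powr (- k - real d) * Cb else eps NN powr (- real d) * Cb)"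

text \<open>By (A1) squared jumps accumulate at a rate of at most
  \<open>eps NN powr (- real d) * Cb\<close>, and each of them equals
  \<open>a\<^sup>2\<close>.\<close>

definition lamb :: real where "lamb = eps NN powr (- real d) * Cb / a\<^sup>2"

lemma Bth0: "0 <= Bth w" using Cb0 by (simp add: Bth_def)

lemma lamb0: "0 <= lamb" using Cb0 by (simp add: lamb_def)

lemma cadlag_M: "x \<in> Lam NN d ==> om \<in> space P ==> cadlag (%t. M x t om)"
 using mdl_M by (simp add: sq_int_cadlag_martingale_def)

lemma SS_jump: "x \<in> Lam NN d ==> s \<in> SS x om ==> \<bar>jump (%r. M x r om) s\<bar> = a"
 using Om(2)[of om] by (auto simp: SS_def jumps_in_def good_def a_def split: if_splits)

lemma jm_SS:
 assumes "x \<in> Lam NN d" "s \<in> SS x om"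
 shows "\<bar>jm 1 x s om\<bar> = a" "(jm 1 x s om)\<^sup>2 = a\<^sup>2" "jm 2 x s om = a\<^sup>2"
proof -
 show 1: "\<bar>jm 1 x s om\<bar> = a" using SS_jump[OF assms] by (simp add: jm_def)
 have "(jm 1 x s om)\<^sup>2 = \<bar>jm 1 x s om\<bar>\<^sup>2" by simp
 then show 2: "(jm 1 x s om)\<^sup>2 = a\<^sup>2" unfolding 1 .
 have "jm 2 x s om = (jm 1 x s om)\<^sup>2" by (simp add: jm_def)
 then show "jm 2 x s om = a\<^sup>2" using 2 by simp
qed

lemma SS_finite: "x \<in> Lam NN d ==> finite (SS x om)"
proof (cases "om \<in> Om")
 case True
 assume x: "x \<in> Lam NN d"
 have "SS x om \<subseteq> {s \<in> {0..1}. a <= \<bar>jump (%r. M x r om) s\<bar>}"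
  using SS_jump[OF x] by (auto simp: SS_def jumps_in_def split: if_splits)
 then show ?thesis using cadlag_finite_jumps[OF cadlag_M[OF x Om(3)[OF True]] a0] finite_subset by blast
qed (simp add: SS_def)

lemma SS_01: "SS x om \<subseteq> {0<..1}"
 by (auto simp: SS_def jumps_in_def jump_def split: if_splits)

lemma SS_disj:
 assumes "x \<in> Lam NN d" "y \<in> Lam NN d" "x ~= y" shows "SS x om Int SS y om = {}"
proof (cases "om \<in> Om")
 case True
 have "False" if "s \<in> SS x om" "s \<in> SS y om" for s
 proof -
  have s: "s \<in> {0..1}" "jump (%t. M x t om) s ~= 0" "jump (%t. M y t om) s ~= 0"
   using that True by (auto simp: SS_def jumps_in_def)
  have "\<forall>s\<in>{0..1}. \<forall>x\<in>Lam NN d. \<forall>y\<in>Lam NN d. x ~= y --> \<not> (jump (%t. M x t om) s ~= 0 & jump (%t. M y t om) s ~= 0)"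
   using Om(2)[OF True] unfolding good_def by (rule conjunct1)
  then show False using s assms by blast
 qed
 then show ?thesis by blast
qed (simp add: SS_def)

lemma Cc_prog: "x \<in> Lam NN d ==> prog_measurable Fl (%s. Cc s x)"
 and Ctt_prog: "x \<in> Lam NN d ==> prog_measurable Fl (%s. Ctt s x)"
 using mdl_A1 mdl_A4 by blast+

lemma th_bound: "x \<in> Lam NN d ==> 0 <= s ==> \<bar>th w x s om\<bar> <= Bth w"
 using Om(2)[of om] e0 Cb0 by (auto simp: th_def Bth_def abs_mult good_def intro!: mult_left_mono)

lemma th_integrable:
 assumes x: "x \<in> Lam NN d" and om: "om \<in> space P" and t: "0 <= t"
 shows "set_integrable lborel {0..t} (%s. th w x s om)"
 unfolding set_integrable_def
proof (rule Bochner_Integration.integrable_bound[where f="%s. indicator {0..t} s *\<^sub>R Bth w"])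
 show "integrable lborel (%s. indicator {0..t} s *\<^sub>R Bth w)"
  using set_integrable_const_Icc[of 0 t "Bth w"] by (simp only: set_integrable_def)
 have w: "om \<in> space (Fl t)" using om t by (simp add: Fl_space)
 note m = prog_path_measurable[OF Cc_prog[OF x] t w] prog_path_measurable[OF Ctt_prog[OF x] t w]
 show "(%s. indicator {0..t} s *\<^sub>R th w x s om) \<in> borel_measurable lborel"
 proof -
  have e: "indicator {0..t} s *\<^sub>R th w x s om = (if om \<in> Om then (if w = 1 then eps NN powr (- k - real d) * (indicator {0..t} s * Ctt s x om)
    else eps NN powr (- real d) * (indicator {0..t} s * Cc s x om)) else 0)" for s
   by (cases "s \<in> {0..t}") (simp_all add: th_def)
  have "(%s. eps NN powr (- k - real d) * (indicator {0..t} s * Ctt s x om)) \<in> borel_measurable borel"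
   by (rule borel_measurable_times[OF borel_measurable_const m(2)])
  moreover have "(%s. eps NN powr (- real d) * (indicator {0..t} s * Cc s x om)) \<in> borel_measurable borel"
   by (rule borel_measurable_times[OF borel_measurable_const m(1)])
  ultimately show ?thesis unfolding e by (cases "om \<in> Om"; cases "w = 1") (simp_all only: if_True if_False refl borel_measurable_const measurable_lborel1 measurable_lborel2)
 qed
 show "AE s in lborel. norm (indicator {0..t} s *\<^sub>R th w x s om) <= norm (indicator {0..t} s *\<^sub>R Bth w)"
 proof (rule AE_I2)
  fix s show "norm (indicator {0..t} s *\<^sub>R th w x s om) <= norm (indicator {0..t} s *\<^sub>R Bth w)"
   using th_bound[OF x, of s w om] Bth0[of w] by (cases "s \<in> {0..t}") simp_all
 qed
qed

lemma th_adapted: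
 assumes x: "x \<in> Lam NN d" and t: "0 <= t"
 shows "(%om. LBINT s:{0..t}. th w x s om) \<in> borel_measurable (Fl t)"
proof -
 have "(%om. LBINT s:{0..t}. th w x s om) = (%om. if om \<in> Om then (if w = 1 then eps NN powr (- k - real d) * (LBINT s:{0..t}. Ctt s x om)
   else eps NN powr (- real d) * (LBINT s:{0..t}. Cc s x om)) else 0)"
 proof
  fix om
  show "(LBINT s:{0..t}. th w x s om) = (if om \<in> Om then (if w = 1 then eps NN powr (- k - real d) * (LBINT s:{0..t}. Ctt s x om)
   else eps NN powr (- real d) * (LBINT s:{0..t}. Cc s x om)) else 0)"
   by (cases "om \<in> Om"; cases "w = 1") (simp_all add: th_def)
 qed
 moreover have "(%om. if w = 1 then eps NN powr (- k - real d) * (LBINT s:{0..t}. Ctt s x om)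
   else eps NN powr (- real d) * (LBINT s:{0..t}. Cc s x om)) \<in> borel_measurable (Fl t)"
  using prog_integral_measurable[OF Cc_prog[OF x] t] prog_integral_measurable[OF Ctt_prog[OF x] t] by (cases "w = 1") simp_all
 moreover have "{om \<in> space (Fl t). om \<in> Om} \<in> sets (Fl t)"
 proof -
  have "{om \<in> space (Fl t). om \<in> Om} = Om" using Om(3) Fl_space[OF t] by auto
  then show ?thesis using Om(1)[OF t] by simp
 qed
 ultimately show ?thesis by (simp only:) (rule measurable_If, assumption, rule borel_measurable_const, assumption)
qed

lemma path_eq:
 assumes x: "x \<in> Lam NN d" and om: "om \<in> Om" and u: "0 <= u" "u <= 1"
 shows "M x u om = (\<Sum>s\<in>SS x om Int {..u}. jm 1 x s om) - (LBINT s:{0..u}. th 1 x s om)"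
proof -
 have "SS x om Int {..u} = jumps_in (%r. M x r om) {0..u}" using om u by (auto simp: SS_def jumps_in_def)
 moreover have "(LBINT s:{0..u}. th 1 x s om) = eps NN powr (- k - real d) * (LBINT s:{0..u}. Ctt s x om)"
  using om by (simp add: th_def)
 ultimately show ?thesis using Om(2)[OF om] x u by (simp add: good_def jm_def)
qed

section \<open>Squared increments and the intensity of the jumps\<close>

lemma M_facts:
 assumes x: "x \<in> Lam NN d"
 shows "0 <= t ==> M x t \<in> borel_measurable (Fl t)" "0 <= t ==> integrable P (M x t)" "0 <= t ==> integrable P (%om. (M x t om)\<^sup>2)"
proof -
 have "sq_int_cadlag_martingale P Fl (M x)" using mdl_M x by blast
 then show "0 <= t ==> M x t \<in> borel_measurable (Fl t)" "0 <= t ==> integrable P (M x t)" "0 <= t ==> integrable P (%om. (M x t om)\<^sup>2)"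
  unfolding sq_int_cadlag_martingale_def martingale_def adapted_def by blast+
qed

lemma martingale_diff:
 assumes "martingale P Fl Y" "0 <= s" "s <= t" "A \<in> sets (Fl s)"
 shows "(\<integral>om. indicator A om * (Y t om - Y s om) \<partial>P) = 0"
proof -
 have A: "A \<in> sets P" by (rule Fl_P[OF assms(2,4)])
 have i: "integrable P (%om. indicator A om * Y u om)" if "0 <= u" for u
  using integrable_mult_indicator[OF A, of "Y u"] assms(1) that by (simp add: martingale_def)
 have "(\<integral>om. indicator A om * Y t om \<partial>P) = (\<integral>om. indicator A om * Y s om \<partial>P)"
  using assms unfolding martingale_def set_lebesgue_integral_def by simp
 then show ?thesis using i[of s] i[of t] assms by (simp add: right_diff_distrib)
qed

lemma M_mart: "x \<in> Lam NN d ==> martingale P Fl (M x)"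
 using mdl_M by (simp add: sq_int_cadlag_martingale_def)

lemma th_int_integrable:
 assumes x: "x \<in> Lam NN d" and t: "0 <= t"
 shows "integrable P (%om. LBINT s:{0..t}. th w x s om)"
proof -
 interpret prob_space P by (rule ps)
 show ?thesis
 proof (rule integrable_const_bound[of _ "Bth w * t"])
  show "(%om. LBINT s:{0..t}. th w x s om) \<in> borel_measurable P" by (rule measurable_from_subalg[OF filt(2)[OF t] th_adapted[OF x t]])
  show "AE om in P. norm (LBINT s:{0..t}. th w x s om) <= Bth w * t"
   using LBINT_abs_le[OF t th_bound[OF x]] by (auto intro!: AE_I2)
 qed
qed

lemma square_increment:
 assumes x: "x \<in> Lam NN d" and s: "0 <= s" "s <= t" and A: "A \<in> sets (Fl s)"
 shows "(\<integral>om. indicator A om * ((M x t om)\<^sup>2 - (M x s om)\<^sup>2) \<partial>P)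
  = (\<integral>om. indicator A om * ((LBINT r:{0..t}. th 2 x r om) - (LBINT r:{0..s}. th 2 x r om)) \<partial>P)"
proof -
 have t: "0 <= t" using s by simp
 define Y where "Y u om = (M x u om)\<^sup>2 - eps NN powr (- real d) * (LBINT s:{0..u}. Cc s x om)" for u om
 have mY: "martingale P Fl Y" using mdl_A1 x unfolding Y_def[abs_def] by blast
 have AP: "A \<in> sets P" by (rule Fl_P[OF s(1) A])
 have iM: "integrable P (%om. indicator A om * ((M x t om)\<^sup>2 - (M x s om)\<^sup>2))"
  using integrable_mult_indicator[OF AP Bochner_Integration.integrable_diff[OF M_facts(3)[OF x t] M_facts(3)[OF x s(1)]]] by simp
 have iT: "integrable P (%om. indicator A om * ((LBINT r:{0..t}. th 2 x r om) - (LBINT r:{0..s}. th 2 x r om)))"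
  using integrable_mult_indicator[OF AP Bochner_Integration.integrable_diff[OF th_int_integrable[OF x t] th_int_integrable[OF x s(1)]]] by simp
 have eq: "AE om in P. indicator A om * (Y t om - Y s om) = indicator A om * ((M x t om)\<^sup>2 - (M x s om)\<^sup>2) - indicator A om * ((LBINT r:{0..t}. th 2 x r om) - (LBINT r:{0..s}. th 2 x r om))"
  using Om(4) by eventually_elim (simp add: Y_def th_def right_diff_distrib)
 have mm: "(%om. indicator A om * (Y t om - Y s om)) \<in> borel_measurable P"
  using mY s t AP unfolding martingale_def by (intro borel_measurable_times borel_measurable_diff) (auto simp: borel_measurable_integrable)
 have "0 = (\<integral>om. indicator A om * (Y t om - Y s om) \<partial>P)" by (rule martingale_diff[OF mY s A, symmetric])
 also have "... = (\<integral>om. indicator A om * ((M x t om)\<^sup>2 - (M x s om)\<^sup>2) - indicator A om * ((LBINT r:{0..t}. th 2 x r om) - (LBINT r:{0..s}. th 2 x r om)) \<partial>P)"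
  by (rule integral_cong_AE[OF mm _ eq]) (use iM iT in simp)
 also have "... = (\<integral>om. indicator A om * ((M x t om)\<^sup>2 - (M x s om)\<^sup>2) \<partial>P) - (\<integral>om. indicator A om * ((LBINT r:{0..t}. th 2 x r om) - (LBINT r:{0..s}. th 2 x r om)) \<partial>P)"
  by (rule Bochner_Integration.integral_diff[OF iM iT])
 finally show ?thesis by simp
qed

text \<open>The cross term \<open>M x u * (M x v - M x u)\<close> has mean 0 on \<open>A\<close>,
  because \<open>A\<close> and \<open>M x u\<close> are known at time \<open>u\<close>.\<close>

lemma increment_square:
 assumes x: "x \<in> Lam NN d" and s: "0 <= s" "s <= u" "u <= v" and A: "A \<in> sets (Fl s)"
 shows "integrable P (%om. indicator A om * (M x v om - M x u om)\<^sup>2)"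
  and "(\<integral>om. indicator A om * (M x v om - M x u om)\<^sup>2 \<partial>P) = (\<integral>om. indicator A om * ((M x v om)\<^sup>2 - (M x u om)\<^sup>2) \<partial>P)"
  and "integrable P (%om. indicator A om * ((M x v om)\<^sup>2 - (M x u om)\<^sup>2))"
proof -
 have u: "0 <= u" "0 <= v" using s by auto
 have Au: "A \<in> sets (Fl u)" using Fl_mono[OF s(2)] A by blast
 have AP: "A \<in> sets P" by (rule Fl_P[OF s(1) A])
 have m: "M x u \<in> borel_measurable P" "M x v \<in> borel_measurable P"
  using M_facts(2)[OF x] u by auto
 have i1: "integrable P (%om. 2 * ((M x u om)\<^sup>2 + (M x v om)\<^sup>2))"
  using M_facts(3)[OF x] u by auto
 have i2: "integrable P (%om. M x u om * (M x v om - M x u om))"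
 proof (rule Bochner_Integration.integrable_bound[OF i1])
  show "AE om in P. norm (M x u om * (M x v om - M x u om)) <= norm (2 * ((M x u om)\<^sup>2 + (M x v om)\<^sup>2))"
  proof (rule AE_I2)
   fix om
   have "\<bar>y * (z - y)\<bar> <= 2 * (y\<^sup>2 + z\<^sup>2)" for y z :: real
   proof -
    have a: "\<bar>y * z\<bar> <= y\<^sup>2 + z\<^sup>2" using sum_squares_bound[of "\<bar>y\<bar>" "\<bar>z\<bar>"] zero_le_power2[of y] zero_le_power2[of z] unfolding abs_mult power2_abs by linarith
    have "\<bar>y * (z - y)\<bar> <= \<bar>y * z\<bar> + y\<^sup>2" unfolding right_diff_distrib power2_eq_square using abs_triangle_ineq4[of "y * z" "y * y"] by simp
    also have "... <= (y\<^sup>2 + z\<^sup>2) + y\<^sup>2" by (rule add_right_mono[OF a])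
    also have "... <= 2 * (y\<^sup>2 + z\<^sup>2)" by simp
    finally show ?thesis .
   qed
   then show "norm (M x u om * (M x v om - M x u om)) <= norm (2 * ((M x u om)\<^sup>2 + (M x v om)\<^sup>2))" by simp
  qed
 qed (use m in measurable)
 have i3: "integrable P (%om. (indicator A om * M x u om) * (M x v om - M x u om))"
  using integrable_mult_indicator[OF AP i2] by (simp add: mult.assoc)
 have z: "(\<integral>om. (indicator A om * M x u om) * (M x v om - M x u om) \<partial>P) = 0"
 proof (rule mart_orth[OF ps filt(2)[OF u(1)] _ _ _ i3])
  show "integrable P (%om. M x v om - M x u om)" using M_facts(2)[OF x] u by simp
  show "(\<integral>om. indicator B om * (M x v om - M x u om) \<partial>P) = 0" if "B \<in> sets (Fl u)" for B
   by (rule martingale_diff[OF M_mart[OF x] u(1) s(3) that])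
  show "(%om. indicator A om * M x u om) \<in> borel_measurable (Fl u)" using M_facts(1)[OF x u(1)] Au by measurable
 qed
 show i4: "integrable P (%om. indicator A om * ((M x v om)\<^sup>2 - (M x u om)\<^sup>2))"
  using integrable_mult_indicator[OF AP Bochner_Integration.integrable_diff[OF M_facts(3)[OF x u(2)] M_facts(3)[OF x u(1)]]] by simp
 have eq: "indicator A om * (M x v om - M x u om)\<^sup>2 = indicator A om * ((M x v om)\<^sup>2 - (M x u om)\<^sup>2) - 2 * ((indicator A om * M x u om) * (M x v om - M x u om))" for om
  by (simp add: power2_eq_square algebra_simps)
 show "integrable P (%om. indicator A om * (M x v om - M x u om)\<^sup>2)"
  unfolding eq using i3 i4 by auto
 show "(\<integral>om. indicator A om * (M x v om - M x u om)\<^sup>2 \<partial>P) = (\<integral>om. indicator A om * ((M x v om)\<^sup>2 - (M x u om)\<^sup>2) \<partial>P)"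
  unfolding eq using i3 i4 z by (subst Bochner_Integration.integral_diff) auto
qed

text \<open>By orthogonality of increments the expected quadratic sum telescopes, so it equals the
  expected bracket for every \<open>n\<close> and not only in the limit.\<close>

lemma qvar_expect:
 assumes x: "x \<in> Lam NN d" and s: "0 <= s" "s <= t" and A: "A \<in> sets (Fl s)" and n: "1 <= n"
 shows "(\<integral>om. indicator A om * qvar n s t (%u. M x u om) \<partial>P)
   = (\<integral>om. indicator A om * ((LBINT r:{0..t}. th 2 x r om) - (LBINT r:{0..s}. th 2 x r om)) \<partial>P)"
  and "integrable P (%om. indicator A om * qvar n s t (%u. M x u om))"
proof -
 define g where "g i = s + real i * (t - s) / real n" for i :: nat
 have g: "s <= g i" "g i <= g (Suc i)" if "i < n" for i using grid_shift[OF s(2) that] by (simp_all only: g_def)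
 note I = increment_square[OF x s(1) g A]
 have q: "indicator A om * qvar n s t (%u. M x u om) = (\<Sum>i<n. indicator A om * (M x (g (Suc i)) om - M x (g i) om)\<^sup>2)" for om
  by (simp only: qvar_def g_def sum_distrib_left)
 show "integrable P (%om. indicator A om * qvar n s t (%u. M x u om))"
  unfolding q by (rule Bochner_Integration.integrable_sum) (rule I(1), auto)
 have "(\<integral>om. indicator A om * qvar n s t (%u. M x u om) \<partial>P) = (\<Sum>i<n. \<integral>om. indicator A om * (M x (g (Suc i)) om - M x (g i) om)\<^sup>2 \<partial>P)"
  unfolding q by (rule Bochner_Integration.integral_sum) (rule I(1), auto)
 also have "... = (\<Sum>i<n. \<integral>om. indicator A om * ((M x (g (Suc i)) om)\<^sup>2 - (M x (g i) om)\<^sup>2) \<partial>P)"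
  by (intro sum.cong refl I(2)) auto
 also have "... = (\<integral>om. (\<Sum>i<n. indicator A om * ((M x (g (Suc i)) om)\<^sup>2 - (M x (g i) om)\<^sup>2)) \<partial>P)"
  by (rule Bochner_Integration.integral_sum[symmetric]) (rule I(3), auto)
 also have "... = (\<integral>om. indicator A om * ((M x t om)\<^sup>2 - (M x s om)\<^sup>2) \<partial>P)"
 proof (intro Bochner_Integration.integral_cong refl)
  fix om
  have "(\<Sum>i<n. indicator A om * ((M x (g (Suc i)) om)\<^sup>2 - (M x (g i) om)\<^sup>2)) = indicator A om * ((M x (g n) om)\<^sup>2 - (M x (g 0) om)\<^sup>2)"
   unfolding sum_distrib_left[symmetric] sum_lessThan_telescope[of "%i. (M x (g i) om)\<^sup>2" n] ..
  moreover have "g n = t" "g 0 = s" using n by (simp_all add: g_def)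
  ultimately show "(\<Sum>i<n. indicator A om * ((M x (g (Suc i)) om)\<^sup>2 - (M x (g i) om)\<^sup>2)) = indicator A om * ((M x t om)\<^sup>2 - (M x s om)\<^sup>2)" by simp
 qed
 also have "... = (\<integral>om. indicator A om * ((LBINT r:{0..t}. th 2 x r om) - (LBINT r:{0..s}. th 2 x r om)) \<partial>P)"
  by (rule square_increment[OF x s A])
 finally show "(\<integral>om. indicator A om * qvar n s t (%u. M x u om) \<partial>P)
   = (\<integral>om. indicator A om * ((LBINT r:{0..t}. th 2 x r om) - (LBINT r:{0..s}. th 2 x r om)) \<partial>P)" .
qed

lemma qvar_path:
 assumes x: "x \<in> Lam NN d" and om: "om \<in> Om" and s: "0 <= s" "s <= t" "t <= 1"
 shows "(%n. qvar n s t (%u. M x u om)) \<longlonglongrightarrow> a\<^sup>2 * real (card (SS x om Int {s<..t}))"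
  and "1 <= n ==> qvar n s t (%u. M x u om) <= (a * real (card (SS x om Int {s<..t})) + Bth 1 * (t - s))\<^sup>2"
proof -
 have t: "0 <= t" using s by simp
 have sq: "(jm 1 x r om)\<^sup>2 = a\<^sup>2" "\<bar>jm 1 x r om\<bar> = a" if "r \<in> SS x om" for r
  using jm_SS[OF x that] by auto
 have p: "M x u om = (\<Sum>r\<in>SS x om Int {..u}. jm 1 x r om) - (LBINT r:{0..u}. th 1 x r om)" if "0 <= u" "u <= t" for u
  by (rule path_eq[OF x om]) (use that s in auto)
 note Q = qvar_tendsto[OF SS_finite[OF x] s(1,2) th_integrable[OF x Om(3)[OF om] t] th_bound[OF x] p]
 have "(%n. qvar n s t (%u. M x u om)) \<longlonglongrightarrow> (\<Sum>r\<in>SS x om Int {s<..t}. (jm 1 x r om)\<^sup>2)" by (rule Q(1))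
 also have "(\<Sum>r\<in>SS x om Int {s<..t}. (jm 1 x r om)\<^sup>2) = a\<^sup>2 * real (card (SS x om Int {s<..t}))"
  using sq by simp
 finally show "(%n. qvar n s t (%u. M x u om)) \<longlonglongrightarrow> a\<^sup>2 * real (card (SS x om Int {s<..t}))" .
 assume n: "1 <= n"
 have "qvar n s t (%u. M x u om) <= ((\<Sum>r\<in>SS x om Int {s<..t}. \<bar>jm 1 x r om\<bar>) + Bth 1 * (t - s))\<^sup>2" by (rule Q(2)) (use n in auto)
 also have "(\<Sum>r\<in>SS x om Int {s<..t}. \<bar>jm 1 x r om\<bar>) = a * real (card (SS x om Int {s<..t}))" using sq by simp
 finally show "qvar n s t (%u. M x u om) <= (a * real (card (SS x om Int {s<..t})) + Bth 1 * (t - s))\<^sup>2" .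
qed

lemma card_diff:
 assumes "x \<in> Lam NN d" "s <= t"
 shows "real (card (SS x om Int {..t})) - real (card (SS x om Int {..s})) = real (card (SS x om Int {s<..t}))"
proof -
 have "SS x om Int {..t} = (SS x om Int {..s}) \<union> (SS x om Int {s<..t})" using assms(2) by auto
 moreover have "card ((SS x om Int {..s}) \<union> (SS x om Int {s<..t})) = card (SS x om Int {..s}) + card (SS x om Int {s<..t})"
  by (rule card_Un_disjoint) (use SS_finite[OF assms(1)] in auto)
 ultimately show ?thesis by simp
qed

lemma qvar_nonneg: "0 <= qvar n s t m" by (simp add: qvar_def sum_nonneg)

lemma qvar_adapted:
 assumes x: "x \<in> Lam NN d" and s: "0 <= s" "s <= t"
 shows "(%om. qvar n s t (%u. M x u om)) \<in> borel_measurable (Fl t)"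
 unfolding qvar_def
proof (intro borel_measurable_sum borel_measurable_power borel_measurable_diff)
 fix i assume "i \<in> {..<n}"
 then have i: "i < n" by simp
 note g = grid_shift[OF s(2) i]
 have *: "M x u \<in> borel_measurable (Fl t)" if "0 <= u" "u <= t" for u
 proof -
  have "subalgebra (Fl t) (Fl u)" using Fl_mono[OF that(2)] Fl_space[OF that(1)] Fl_space[of t] that by (simp add: subalgebra_def)
  then show ?thesis by (rule measurable_from_subalg[OF _ M_facts(1)[OF x that(1)]])
 qed
 show "M x (s + real (Suc i) * (t - s) / real n) \<in> borel_measurable (Fl t)" using g s by (intro *) linarith+
 show "M x (s + real i * (t - s) / real n) \<in> borel_measurable (Fl t)" using g s by (intro *) linarith+
qed

text \<open>Jumps are counted through \<open>qvar\<close> divided by \<open>a\<^sup>2\<close>, a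
  limit of adapted quantities; the jump times themselves are never treated as random
  variables.\<close>

lemma card_adapted:
 assumes x: "x \<in> Lam NN d" and t: "0 <= t" "t <= 1"
 shows "(%om. real (card (SS x om Int {..t}))) \<in> borel_measurable (Fl t)"
proof (rule borel_measurable_LIMSEQ_real)
 show "(%om. indicator Om om * (qvar n 0 t (%u. M x u om) / a\<^sup>2)) \<in> borel_measurable (Fl t)" for n
  using qvar_adapted[OF x order.refl t(1), of n] Om(1)[OF t(1)] by measurable
 fix om
 show "(%n. indicator Om om * (qvar n 0 t (%u. M x u om) / a\<^sup>2)) \<longlonglongrightarrow> real (card (SS x om Int {..t}))"
 proof (cases "om \<in> Om")
  case True
  have "SS x om Int {0<..t} = SS x om Int {..t}" using SS_01[of x om] by auto
  then have "(%n. qvar n 0 t (%u. M x u om) / a\<^sup>2) \<longlonglongrightarrow> (a\<^sup>2 * real (card (SS x om Int {..t}))) / a\<^sup>2"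
   using qvar_path(1)[OF x True order.refl t] a0 by (intro tendsto_divide tendsto_const) auto
  then show ?thesis using True a0 by simp
 qed (simp add: SS_def)
qed

text \<open>Fatou's lemma for the quadratic sums, whose expectations are known exactly. Only an
  inequality can be claimed at this stage: a dominating function requires moments of the number of
  jumps, and these are derived from the present bound.\<close>

lemma card_le:
 assumes x: "x \<in> Lam NN d" and s: "0 <= s" "s <= t" "t <= 1" and A: "A \<in> sets (Fl s)"
 shows "(\<integral>\<^sup>+om. indicator A om * ennreal (real (card (SS x om Int {..t})) - real (card (SS x om Int {..s}))) \<partial>P)
    <= ennreal (lamb * (t - s)) * emeasure P A"
proof -
 interpret prob_space P by (rule ps)
 have t: "0 <= t" using s by simp
 have AP: "A \<in> sets P" by (rule Fl_P[OF s(1) A])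
 define q where "q n om = indicator A om * qvar (Suc n) s t (%u. M x u om) / a\<^sup>2" for n om
 have qm: "(%om. ennreal (q n om)) \<in> borel_measurable P" for n
  unfolding q_def using measurable_from_subalg[OF filt(2)[OF t] qvar_adapted[OF x s(1,2), of "Suc n"]] AP by measurable
 have iq: "integrable P (q n)" for n
  unfolding q_def using qvar_expect(2)[OF x s(1,2) A, of "Suc n"] by simp
 have Eq: "(\<integral>om. q n om \<partial>P) <= lamb * (t - s) * prob A" for n
 proof -
  have e1: "(\<integral>om. q n om \<partial>P) = (\<integral>om. indicator A om * ((LBINT r:{0..t}. th 2 x r om) - (LBINT r:{0..s}. th 2 x r om)) \<partial>P) / a\<^sup>2"
   unfolding q_def using qvar_expect(1)[OF x s(1,2) A, of "Suc n"] by simp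
  have "(\<integral>om. indicator A om * ((LBINT r:{0..t}. th 2 x r om) - (LBINT r:{0..s}. th 2 x r om)) \<partial>P) <= (\<integral>om. indicator A om * (Bth 2 * (t - s)) \<partial>P)"
  proof (rule integral_mono)
   show "integrable P (%om. indicator A om * ((LBINT r:{0..t}. th 2 x r om) - (LBINT r:{0..s}. th 2 x r om)))"
    using integrable_mult_indicator[OF AP Bochner_Integration.integrable_diff[OF th_int_integrable[OF x t] th_int_integrable[OF x s(1)]]] by simp
   show "integrable P (%om. indicator A om * (Bth 2 * (t - s)))"
    using AP by (simp add: integrable_indicator_iff emeasure_eq_measure)
   fix om assume om: "om \<in> space P"
   have "(LBINT r:{0..t}. th 2 x r om) - (LBINT r:{0..s}. th 2 x r om) = (LBINT r:{s..t}. th 2 x r om)"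
    using LBINT_split[OF th_integrable[OF x om t] s(1,2)] by simp
   also have "... <= Bth 2 * (t - s)"
   proof -
    have "\<bar>LBINT r:{s..t}. th 2 x r om\<bar> <= Bth 2 * (t - s)" by (rule LBINT_abs_le[OF s(2) th_bound[OF x]]) (use s in auto)
    then show ?thesis by simp
   qed
   finally show "indicator A om * ((LBINT r:{0..t}. th 2 x r om) - (LBINT r:{0..s}. th 2 x r om)) <= indicator A om * (Bth 2 * (t - s))"
    by (rule mult_left_mono) simp
  qed
  also have "(\<integral>om. indicator A om * (Bth 2 * (t - s)) \<partial>P) = prob A * (Bth 2 * (t - s))"
   using sets.sets_into_space[OF AP] by (simp add: Int_absorb1 Int_absorb2)
  finally have "(\<integral>om. q n om \<partial>P) <= prob A * (Bth 2 * (t - s)) / a\<^sup>2"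
   unfolding e1 by (rule divide_right_mono) simp
  also have "Bth 2 = lamb * a\<^sup>2" using a0 by (simp add: lamb_def Bth_def)
  also have "prob A * (lamb * a\<^sup>2 * (t - s)) / a\<^sup>2 = lamb * (t - s) * prob A" using a0 by (simp add: field_simps)
  finally show ?thesis .
 qed
 have "(\<integral>\<^sup>+om. indicator A om * ennreal (real (card (SS x om Int {..t})) - real (card (SS x om Int {..s}))) \<partial>P)
   = (\<integral>\<^sup>+om. liminf (%n. ennreal (q n om)) \<partial>P)"
 proof (rule nn_integral_cong_AE)
  show "AE om in P. indicator A om * ennreal (real (card (SS x om Int {..t})) - real (card (SS x om Int {..s}))) = liminf (%n. ennreal (q n om))"
   using Om(4)
  proof eventually_elim
   case (elim om)
   have "(%n. q n om) \<longlonglongrightarrow> indicator A om * (a\<^sup>2 * real (card (SS x om Int {s<..t}))) / a\<^sup>2"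
    unfolding q_def using a0 by (intro tendsto_divide tendsto_mult tendsto_const LIMSEQ_Suc[OF qvar_path(1)[OF x elim s]]) auto
   then have "(%n. q n om) \<longlonglongrightarrow> indicator A om * real (card (SS x om Int {s<..t}))" using a0 by simp
   then have "(%n. ennreal (q n om)) \<longlonglongrightarrow> ennreal (indicator A om * real (card (SS x om Int {s<..t})))" by (rule tendsto_ennrealI)
   then have "liminf (%n. ennreal (q n om)) = ennreal (indicator A om * real (card (SS x om Int {s<..t})))" by (rule lim_imp_Liminf[rotated]) simp
   then show ?case unfolding card_diff[OF x s(2)] by (simp add: indicator_def)
  qed
 qed
 also have "... <= liminf (%n. \<integral>\<^sup>+om. ennreal (q n om) \<partial>P)" by (rule nn_integral_liminf[OF qm])
 also have "... <= liminf (%n. ennreal (lamb * (t - s) * prob A))"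
 proof (intro Liminf_mono always_eventually allI)
  fix n
  have "(\<integral>\<^sup>+om. ennreal (q n om) \<partial>P) = ennreal (\<integral>om. q n om \<partial>P)"
   by (rule nn_integral_eq_integral[OF iq]) (auto simp: q_def qvar_nonneg)
  then show "(\<integral>\<^sup>+om. ennreal (q n om) \<partial>P) <= ennreal (lamb * (t - s) * prob A)" using Eq[of n] by (simp add: ennreal_leI)
 qed
 also have "... = ennreal (lamb * (t - s)) * emeasure P A"
  using lamb0 s by (simp add: Liminf_const emeasure_eq_measure ennreal_mult)
 finally show ?thesis .
qed

sublocale jump_process P Fl "Lam NN d" SS lamb
proof (intro jump_process.intro jump_process_axioms.intro)
 show "prob_space P" by (rule ps)
qed (use filt(2) Fl_mono finite_Lam lamb0 SS_finite SS_01 SS_disj card_adapted card_le in auto)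

text \<open>The accumulated jumps are \<open>M\<close> plus the integral of \<open>th 1\<close>,
  both adapted.\<close>

lemma mark_jm1: "mark (jm 1) a"
 unfolding mark_def
proof (intro conjI ballI allI impI)
 show "0 <= a" using a0 by simp
 show "\<bar>jm 1 x s om\<bar> <= a" if "x \<in> Lam NN d" "s \<in> SS x om" for x and s :: real and om using SS_jump[OF that] by (simp add: jm_def)
 fix x and t :: real assume x: "x \<in> Lam NN d" and "0 <= t & t <= 1"
 then have t: "0 <= t" "t <= 1" by auto
 have "(%om. indicator Om om * (M x t om + (LBINT s:{0..t}. th 1 x s om))) \<in> borel_measurable (Fl t)"
  using M_facts(1)[OF x t(1)] th_adapted[OF x t(1), of 1] Om(1)[OF t(1)] by measurable
 then show "(%om. \<Sum>s\<in>SS x om Int {..t}. jm 1 x s om) \<in> borel_measurable (Fl t)"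
  by (rule measurable_cong[THEN iffD1, rotated]) (use path_eq[OF x _ t] in \<open>auto simp: indicator_def SS_def\<close>)
qed

lemma sum_jm2: "x \<in> Lam NN d ==> (\<Sum>s\<in>SS x om Int A. jm 2 x s om) = a\<^sup>2 * real (card (SS x om Int A))"
proof -
 assume x: "x \<in> Lam NN d"
 have "jm 2 x s om = a\<^sup>2" if "s \<in> SS x om" for s by (rule jm_SS(3)[OF x that])
 then show ?thesis by simp
qed

lemma mark_jm2: "mark (jm 2) (a\<^sup>2)"
 unfolding mark_def
proof (intro conjI ballI allI impI)
 show "\<bar>jm 2 x s om\<bar> <= a\<^sup>2" if "x \<in> Lam NN d" "s \<in> SS x om" for x and s :: real and om
  using jm_SS(3)[OF that] by simp
 show "(%om. \<Sum>s\<in>SS x om Int {..t}. jm 2 x s om) \<in> borel_measurable (Fl t)" if "x \<in> Lam NN d" "0 <= t & t <= 1" for x and t :: real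
  unfolding sum_jm2[OF that(1)] using card_adapted[OF that(1)] that(2) by simp
qed simp

lemma drift_th: "drift (th w) (Bth w)"
 unfolding drift_def using Bth0 th_integrable th_bound th_adapted by auto

lemma compensates_th1: "compensates (th 1) (jm 1)"
 unfolding compensates_def
proof (intro ballI allI impI, elim conjE)
 fix x and s t :: real and A assume x: "x \<in> Lam NN d" and s: "0 <= s" "s <= t" "t <= 1" and A: "A \<in> sets (Fl s)"
 have t: "0 <= t" "s <= 1" using s by auto
 have AP: "A \<in> sets P" by (rule Fl_P[OF s(1) A])
 define Y where "Y u om = (\<Sum>r\<in>SS x om Int {..u}. jm 1 x r om) - (LBINT r:{0..u}. th 1 x r om)" for u om
 have Ym: "Y u \<in> borel_measurable P" if "0 <= u" "u <= 1" for u
 proof -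
  have "Y u \<in> borel_measurable (Fl u)" unfolding Y_def using mark_jm1 th_adapted[OF x that(1)] x that
   by (intro borel_measurable_diff) (auto simp: mark_def)
  then show ?thesis by (rule mF[OF that(1)])
 qed
 have "(\<integral>om. indicator A om * (Y t om - Y s om) \<partial>P) = (\<integral>om. indicator A om * (M x t om - M x s om) \<partial>P)"
 proof (rule integral_cong_AE)
  show "(%om. indicator A om * (Y t om - Y s om)) \<in> borel_measurable P" using Ym[OF t(1) s(3)] Ym[OF s(1) t(2)] AP by measurable
  show "(%om. indicator A om * (M x t om - M x s om)) \<in> borel_measurable P"
   using borel_measurable_integrable[OF M_facts(2)[OF x t(1)]] borel_measurable_integrable[OF M_facts(2)[OF x s(1)]] AP by measurable
  show "AE om in P. indicator A om * (Y t om - Y s om) = indicator A om * (M x t om - M x s om)"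
   using Om(4)
  proof eventually_elim
   case (elim om)
   show ?case unfolding path_eq[OF x elim t(1) s(3)] path_eq[OF x elim s(1) t(2)] Y_def ..
  qed
 qed
 also have "... = 0" by (rule martingale_diff[OF M_mart[OF x] s(1,2) A])
 finally show "(\<integral>om. indicator A om * ((\<Sum>r\<in>SS x om Int {..t}. jm 1 x r om) - (LBINT r:{0..t}. th 1 x r om)
   - ((\<Sum>r\<in>SS x om Int {..s}. jm 1 x r om) - (LBINT r:{0..s}. th 1 x r om))) \<partial>P) = 0" by (simp add: Y_def)
qed

text \<open>The inequality of \<open>card_le\<close> is upgraded to an identity: \<open>N\<close>
  now has all moments, and a multiple of the square of \<open>1 + N\<close> dominates the quadratic
  sums.\<close>

lemma compensates_th2: "compensates (th 2) (jm 2)"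
 unfolding compensates_def
proof (intro ballI allI impI, elim conjE)
 fix x and s t :: real and A assume x: "x \<in> Lam NN d" and s: "0 <= s" "s <= t" "t <= 1" and A: "A \<in> sets (Fl s)"
 have t: "0 <= t" "s <= 1" using s by auto
 have AP: "A \<in> sets P" by (rule Fl_P[OF s(1) A])
 define cd where "cd om = indicator A om * (a\<^sup>2 * real (card (SS x om Int {s<..t})))" for om
 define v where "v om = indicator A om * ((LBINT r:{0..t}. th 2 x r om) - (LBINT r:{0..s}. th 2 x r om))" for om
 have iv: "integrable P v" unfolding v_def
  using integrable_mult_indicator[OF AP Bochner_Integration.integrable_diff[OF th_int_integrable[OF x t(1)] th_int_integrable[OF x s(1)]]] by simp
 have cm: "cd \<in> borel_measurable P"
  unfolding cd_def card_diff[OF x s(2), symmetric]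
  using mF[OF t(1) card_adapted[OF x t(1) s(3)]] mF[OF s(1) card_adapted[OF x s(1) t(2)]] AP by measurable
 define K where "K = a + Bth 1"
 have w: "integrable P (%om. K\<^sup>2 * (1 + real (N om)) ^ 2)" by (rule integrable_mult_right[OF N_pow_integrable])
 have K0: "0 <= K" using a0 Bth0[of 1] by (simp add: K_def)
 have lim: "AE om in P. (%n. indicator A om * qvar (Suc n) s t (%u. M x u om)) \<longlonglongrightarrow> cd om"
  using Om(4) unfolding cd_def
  by eventually_elim (intro tendsto_mult tendsto_const LIMSEQ_Suc[OF qvar_path(1)[OF x _ s]])
 have bd: "AE om in P. norm (indicator A om * qvar (Suc n) s t (%u. M x u om)) <= K\<^sup>2 * (1 + real (N om)) ^ 2" for n
  using Om(4)
 proof eventually_elim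
  case (elim om)
  have "qvar (Suc n) s t (%u. M x u om) <= (a * real (card (SS x om Int {s<..t})) + Bth 1 * (t - s))\<^sup>2"
   by (rule qvar_path(2)[OF x elim s]) simp
  also have "... <= (K * (1 + real (N om)))\<^sup>2"
  proof (rule power_mono)
   have "a * real (card (SS x om Int {s<..t})) <= a * (1 + real (N om))"
    using card_S_le[OF x Om(3)[OF elim], of "{s<..t}"] a0 by (intro mult_left_mono) auto
   moreover have "Bth 1 * (t - s) <= Bth 1 * (1 + real (N om))" using Bth0 s by (intro mult_left_mono) auto
   ultimately show "a * real (card (SS x om Int {s<..t})) + Bth 1 * (t - s) <= K * (1 + real (N om))"
    by (simp add: K_def distrib_right)
  qed (use a0 Bth0 s in auto)
  finally show ?case using qvar_nonneg[of "Suc n" s t "%u. M x u om"] by (auto simp: indicator_def power_mult_distrib)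
 qed
 have "(%n. \<integral>om. indicator A om * qvar (Suc n) s t (%u. M x u om) \<partial>P) \<longlonglongrightarrow> (\<integral>om. cd om \<partial>P)"
  by (rule integral_dominated_convergence[OF cm borel_measurable_integrable[OF qvar_expect(2)[OF x s(1,2) A]] w lim bd]) simp
 moreover have "(\<integral>om. indicator A om * qvar (Suc n) s t (%u. M x u om) \<partial>P) = (\<integral>om. v om \<partial>P)" for n
  unfolding v_def by (rule qvar_expect(1)[OF x s(1,2) A]) simp
 ultimately have E: "(\<integral>om. cd om \<partial>P) = (\<integral>om. v om \<partial>P)" by (simp add: LIMSEQ_const_iff)
 have ic: "integrable P cd"
  by (rule integrable_dominated_convergence[OF cm borel_measurable_integrable[OF qvar_expect(2)[OF x s(1,2) A]] w lim bd]) simp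
 have "indicator A om * ((\<Sum>r\<in>SS x om Int {..t}. jm 2 x r om) - (LBINT r:{0..t}. th 2 x r om)
   - ((\<Sum>r\<in>SS x om Int {..s}. jm 2 x r om) - (LBINT r:{0..s}. th 2 x r om))) = cd om - v om" for om
  unfolding sum_jm2[OF x] cd_def v_def card_diff[OF x s(2), symmetric] by (simp add: algebra_simps)
 then have "(\<integral>om. indicator A om * ((\<Sum>r\<in>SS x om Int {..t}. jm 2 x r om) - (LBINT r:{0..t}. th 2 x r om)
   - ((\<Sum>r\<in>SS x om Int {..s}. jm 2 x r om) - (LBINT r:{0..s}. th 2 x r om))) \<partial>P) = (\<integral>om. cd om - v om \<partial>P)" by simp
 also have "... = 0" using E ic iv by simp
 finally show "(\<integral>om. indicator A om * ((\<Sum>r\<in>SS x om Int {..t}. jm 2 x r om) - (LBINT r:{0..t}. th 2 x r om)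
   - ((\<Sum>r\<in>SS x om Int {..s}. jm 2 x r om) - (LBINT r:{0..s}. th 2 x r om))) \<partial>P) = 0" .
qed

end

section \<open>Regularity of the integrand\<close>

text \<open>Times run up to 2 although the horizon is 1, so that difference quotients to the right
  of 1 are covered. The other coordinates are 0, which makes the set compact in the product
  topology.\<close>

definition cube :: "nat => (nat => real) set" where
 "cube n = {t. (\<forall>i\<in>{1..n}. 0 <= t i & t i <= 2) & (\<forall>i. i \<notin> {1..n} --> t i = 0)}"

lemma compact_cube: "compact (cube n)"
proof -
 have "cube n = PiE UNIV (%i. if i \<in> {1..n} then {0..2::real} else {0})"
  by (auto simp: cube_def PiE_iff split: if_splits)
 moreover have "compactin (product_topology (%_. euclidean) UNIV) (PiE UNIV (%i. if i \<in> {1..n} then {0..2::real} else {0}))"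
  unfolding compactin_PiE by auto
 ultimately show ?thesis by (simp add: euclidean_product_topology)
qed

lemma cube_nonneg: "cube n \<subseteq> {t. \<forall>i\<in>{1..n}. 0 <= t i}" by (auto simp: cube_def)

lemma cube_bounded:
 assumes "continuous_on {t. \<forall>i\<in>{1..n}. 0 <= t i} (f :: (nat => real) => real)"
 shows "\<exists>K\<ge>0. \<forall>t\<in>cube n. \<bar>f t\<bar> <= K"
proof -
 have "compact (f ` cube n)"
  by (rule compact_continuous_image[OF continuous_on_subset[OF assms cube_nonneg] compact_cube])
 then obtain K where "\<forall>x\<in>f ` cube n. norm x <= K" using compact_imp_bounded bounded_iff by blast
 then show ?thesis by (intro exI[of _ "max 0 K"]) (auto simp: le_max_iff_disj)
qed

text \<open>A continuous derivative is bounded on the compact cube, which gives a Lipschitz bound in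
  each single time.\<close>

lemma C1_time_bound:
 assumes F: "C1_time n F"
 shows "\<exists>K\<ge>0. (\<forall>t\<in>cube n. \<bar>F (timevec n z t)\<bar> <= K) \<and>
  (\<forall>a\<in>{1..n}. \<forall>t\<in>cube n. \<forall>s s'. 0 <= s --> s <= 2 --> 0 <= s' --> s' <= 2 -->
    \<bar>F (timevec n z (t(a := s))) - F (timevec n z (t(a := s')))\<bar> <= K * \<bar>s - s'\<bar>)"
proof -
 let ?Q = "{t. \<forall>i\<in>{1..n}. 0 <= (t i::real)}"
 obtain K0 where K0: "0 <= K0" "\<forall>t\<in>cube n. \<bar>F (timevec n z t)\<bar> <= K0"
  using cube_bounded[of n "%t. F (timevec n z t)"] F unfolding C1_time_def by blast
 have "\<exists>K\<ge>0. \<forall>t\<in>cube n. \<forall>s s'. 0 <= s --> s <= 2 --> 0 <= s' --> s' <= 2 -->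
    \<bar>F (timevec n z (t(a := s))) - F (timevec n z (t(a := s')))\<bar> <= K * \<bar>s - s'\<bar>" if a: "a \<in> {1..n}" for a
 proof -
  obtain D where D: "!!t. t \<in> ?Q ==> ((%s. F (timevec n z (t(a := s)))) has_real_derivative D t) (at (t a) within {0..})"
   "continuous_on ?Q D" using F a unfolding C1_time_def by blast
  obtain K where K: "0 <= K" "!!t. t \<in> cube n ==> \<bar>D t\<bar> <= K" using cube_bounded[OF D(2)] by blast
  have "\<bar>F (timevec n z (t(a := s))) - F (timevec n z (t(a := s')))\<bar> <= K * \<bar>s - s'\<bar>"
   if t: "t \<in> cube n" and s: "0 <= s" "s <= 2" "0 <= s'" "s' <= 2" for t and s s' :: real
  proof -
   have tu: "t(a := u) \<in> cube n" if "u \<in> {0..2}" for u using t a that by (auto simp: cube_def)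
   have "norm (F (timevec n z (t(a := s))) - F (timevec n z (t(a := s')))) <= K * norm (s - s')"
   proof (rule field_differentiable_bound[where S="{0..2}" and f'="%u. D (t(a := u))"])
    fix u :: real assume u: "u \<in> {0..2}"
    have "((%s. F (timevec n z ((t(a := u))(a := s)))) has_real_derivative D (t(a := u))) (at ((t(a := u)) a) within {0..})"
     by (rule D(1)) (use tu[OF u] cube_nonneg in blast)
    then have "((%s. F (timevec n z (t(a := s)))) has_real_derivative D (t(a := u))) (at u within {0..})" by simp
    then show "((%s. F (timevec n z (t(a := s)))) has_real_derivative D (t(a := u))) (at u within {0..2})"
     by (rule DERIV_subset) auto
    show "norm (D (t(a := u))) <= K" using K(2)[OF tu[OF u]] by simp
   qed (use s in auto)
   then show ?thesis by simp
  qed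
  with K(1) show ?thesis by blast
 qed
 then obtain Ka where Ka: "!!a. a \<in> {1..n} ==> 0 <= Ka a" "!!a t s s'. a \<in> {1..n} ==> t \<in> cube n ==> 0 <= s ==> s <= 2 ==> 0 <= s' ==> s' <= 2 ==>
    \<bar>F (timevec n z (t(a := s))) - F (timevec n z (t(a := s')))\<bar> <= Ka a * \<bar>s - s'\<bar>" by metis
 define K where "K = K0 + (\<Sum>a\<in>{1..n}. Ka a)"
 have S0: "0 <= (\<Sum>a\<in>{1..n}. Ka a)" by (rule sum_nonneg) (rule Ka(1))
 have KK: "Ka a <= K" if "a \<in> {1..n}" for a
  unfolding K_def using member_le_sum[of a "{1..n}" Ka] Ka(1) that K0(1) by force
 show ?thesis
 proof (intro exI[of _ K] conjI ballI allI impI)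
  show "0 <= K" unfolding K_def using K0(1) S0 by simp
  show "\<bar>F (timevec n z t)\<bar> <= K" if "t \<in> cube n" for t using K0(2)[rule_format, OF that] S0 unfolding K_def by linarith
  fix a t and s s' :: real assume h: "a \<in> {1..n}" "t \<in> cube n" "0 <= s" "s <= 2" "0 <= s'" "s' <= (2::real)"
  show "\<bar>F (timevec n z (t(a := s))) - F (timevec n z (t(a := s')))\<bar> <= K * \<bar>s - s'\<bar>"
   by (rule order.trans[OF Ka(2)[OF h] mult_right_mono[OF KK[OF h(1)]]]) simp
 qed
qed

text \<open>One variable of \<open>Fgs\<close> feeds all indices of its component, so a whole set of
  times moves together.\<close>

definition ov :: "(nat => real) => nat set => real => nat => real" where
 "ov t A s = (%i. if i \<in> A then s else t i)"

text \<open>The times in \<open>A\<close> are changed one after the other, each at the cost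
  \<open>K * \<bar>s - s'\<bar>\<close>.\<close>

lemma lipschitz_ov:
 fixes f :: "(nat => real) => real"
 assumes lip: "!!a t s s'. a \<in> {1..n} ==> t \<in> cube n ==> 0 <= s ==> s <= 2 ==> 0 <= s' ==> s' <= 2 ==> \<bar>f (t(a := s)) - f (t(a := s'))\<bar> <= K * \<bar>s - s'\<bar>"
  and s: "0 <= s" "s <= 2" "0 <= s'" "s' <= 2"
 shows "finite A ==> A \<subseteq> {1..n} ==> t \<in> cube n ==> \<bar>f (ov t A s) - f (ov t A s')\<bar> <= real (card A) * (K * \<bar>s - s'\<bar>)"
proof (induction A arbitrary: t rule: finite_induct)
 case empty
 then show ?case by (simp add: ov_def)
next
 case (insert a A)
 have a: "a \<in> {1..n}" and t1: "t(a := s) \<in> cube n" and t2: "ov t A s' \<in> cube n"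
  using insert.prems s by (auto simp: cube_def ov_def)
 have e1: "ov t (insert a A) s = ov (t(a := s)) A s" using insert.hyps by (auto simp: ov_def fun_eq_iff)
 have e2: "ov (t(a := s)) A s' = (ov t A s')(a := s)" "ov t (insert a A) s' = (ov t A s')(a := s')"
  using insert.hyps by (auto simp: ov_def fun_eq_iff)
 have "\<bar>f (ov (t(a := s)) A s) - f (ov (t(a := s)) A s')\<bar> <= real (card A) * (K * \<bar>s - s'\<bar>)"
  by (rule insert.IH[OF _ t1]) (use insert.prems in auto)
 moreover have "\<bar>f ((ov t A s')(a := s)) - f ((ov t A s')(a := s'))\<bar> <= K * \<bar>s - s'\<bar>"
  by (rule lip[OF a t2 s])
 moreover have "real (card (insert a A)) * (K * \<bar>s - s'\<bar>) = real (card A) * (K * \<bar>s - s'\<bar>) + K * \<bar>s - s'\<bar>"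
  using insert.hyps by (simp add: algebra_simps)
 ultimately show ?case unfolding e1 e2(2) using e2(1) by (smt (verit))
qed

text \<open>If no derivative exists, \<open>vector_derivative\<close> is one fixed arbitrary number; the bound covers that case.\<close>

lemma vector_derivative_bound:
 fixes f :: "real => real"
 assumes lip: "!!s s'. 0 <= s ==> s <= 2 ==> 0 <= s' ==> s' <= 2 ==> \<bar>f s - f s'\<bar> <= L * \<bar>s - s'\<bar>" and s0: "0 <= s0" "s0 <= 1"
 shows "\<bar>vector_derivative f (at s0 within {0..})\<bar> <= max L \<bar>SOME x. False\<bar>"
proof (cases "\<exists>D. (f has_vector_derivative D) (at s0 within {0..})")
 case False
 then have "vector_derivative f (at s0 within {0..}) = (SOME x. False)" by (simp add: vector_derivative_def)
 then show ?thesis by simp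
next
 case True
 then obtain D where "(f has_vector_derivative D) (at s0 within {0..})" by blast
 then have "(f has_vector_derivative vector_derivative f (at s0 within {0..})) (at s0 within {0..})"
  unfolding vector_derivative_def by (rule someI)
 then have t: "((%y. (f y - f s0) / (y - s0)) \<longlongrightarrow> vector_derivative f (at s0 within {0..})) (at s0 within {0..})"
  unfolding has_real_derivative_iff_has_vector_derivative[symmetric] has_field_derivative_iff .
 have "(at_right s0) <= at s0 within {0..}" by (rule at_le) (use s0 in auto)
 from tendsto_mono[OF this tendsto_rabs[OF t]]
 have lim: "((%y. \<bar>(f y - f s0) / (y - s0)\<bar>) \<longlongrightarrow> \<bar>vector_derivative f (at s0 within {0..})\<bar>) (at_right s0)" .
 have "\<forall>\<^sub>F y in at_right s0. y \<in> {s0<..<2}" by (rule eventually_at_right_real) (use s0 in simp)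
 then have "\<forall>\<^sub>F y in at_right s0. \<bar>(f y - f s0) / (y - s0)\<bar> <= L"
 proof eventually_elim
  case (elim y)
  then have "\<bar>f y - f s0\<bar> <= L * \<bar>y - s0\<bar>" using lip[of y s0] s0 by simp
  then show ?case using elim by (simp add: abs_divide divide_le_eq)
 qed
 then have "\<bar>vector_derivative f (at s0 within {0..})\<bar> <= L" by (rule tendsto_upperbound[OF lim]) simp
 then show ?thesis by simp
qed

definition comp_of :: "nat => (nat => nat set) => nat => nat" where
 "comp_of m sg i = (THE j. j \<in> {1..m} & i \<in> sg j)"

text \<open>Sites and times of the argument of \<open>F\<close> are separated because
  \<open>C1_time\<close> describes \<open>F\<close> for frozen sites; the site parts range over a
  finite set.\<close>

definition site_part :: "nat => nat => (nat => nat set) => tuple => tuple" where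
 "site_part n m sg w = (%i. if i \<in> {1..n} then (0, snd (w (comp_of m sg i))) else base0)"

definition time_part :: "nat => nat => (nat => nat set) => tuple => nat => real" where
 "time_part n m sg w = (%i. if i \<in> {1..n} then fst (w (comp_of m sg i)) else 0)"

lemma Fgs_timevec: "Fgs n m sg F w = F (timevec n (site_part n m sg w) (time_part n m sg w))"
 unfolding Fgs_def by (rule arg_cong[of _ _ F]) (auto simp: timevec_def site_part_def time_part_def comp_of_def)

definition tbox :: "site set => nat => real => tuple set" where
 "tbox X m T = {w. \<forall>j\<in>{1..m}. fst (w j) \<in> {0..T} & snd (w j) \<in> X}"

text \<open>There are finitely many configurations of sites, so the constants of
  \<open>C1_time_bound\<close> may be summed over them; the factor \<open>n\<close> accounts for the
  size of a component.\<close>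

lemma Fgs_regular:
 assumes F: "C1_time n F" and X: "finite X" and cm: "!!i. i \<in> {1..n} ==> comp_of m sg i \<in> {1..m}"
 obtains K where "0 <= K" "!!w. w \<in> tbox X m 2 ==> \<bar>Fgs n m sg F w\<bar> <= K"
  "!!w i s s'. w \<in> tbox X m 2 ==> 0 <= s ==> s <= 2 ==> 0 <= s' ==> s' <= 2 ==>
   \<bar>Fgs n m sg F (w(i := (s, snd (w i)))) - Fgs n m sg F (w(i := (s', snd (w i))))\<bar> <= K * \<bar>s - s'\<bar>"
proof -
 define Y where "Y = (%y i. if i \<in> {1..n} then (0::real, y i) else base0) ` PiE {1..n} (%_. X)"
 have fY: "finite Y" unfolding Y_def using X by (intro finite_imageI finite_PiE) auto
 have spY: "site_part n m sg w \<in> Y" if "w \<in> tbox X m 2" for w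
 proof -
  have "site_part n m sg w = (%i. if i \<in> {1..n} then (0, (restrict (%i. snd (w (comp_of m sg i))) {1..n}) i) else base0)"
   by (auto simp: site_part_def fun_eq_iff)
  moreover have "restrict (%i. snd (w (comp_of m sg i))) {1..n} \<in> PiE {1..n} (%_. X)"
   using that cm by (auto simp: tbox_def)
  ultimately show ?thesis unfolding Y_def by (rule image_eqI)
 qed
 have tpc: "time_part n m sg w \<in> cube n" if "w \<in> tbox X m 2" for w
  using that cm by (auto simp: tbox_def cube_def time_part_def)
 have "\<forall>y. \<exists>K\<ge>0. (\<forall>t\<in>cube n. \<bar>F (timevec n y t)\<bar> <= K) \<and>
  (\<forall>a\<in>{1..n}. \<forall>t\<in>cube n. \<forall>s s'. 0 <= s --> s <= 2 --> 0 <= s' --> s' <= 2 -->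
    \<bar>F (timevec n y (t(a := s))) - F (timevec n y (t(a := s')))\<bar> <= K * \<bar>s - s'\<bar>)"
  using C1_time_bound[OF F] by blast
 then obtain Ky where Ky: "!!y. 0 <= Ky y" "!!y t. t \<in> cube n ==> \<bar>F (timevec n y t)\<bar> <= Ky y"
  "!!y a t s s'. a \<in> {1..n} ==> t \<in> cube n ==> 0 <= s ==> s <= 2 ==> 0 <= s' ==> s' <= 2 ==>
    \<bar>F (timevec n y (t(a := s))) - F (timevec n y (t(a := s')))\<bar> <= Ky y * \<bar>s - s'\<bar>" by metis
 define K1 where "K1 = (\<Sum>y\<in>Y. Ky y)"
 have K1: "0 <= K1" "!!y. y \<in> Y ==> Ky y <= K1"
  unfolding K1_def using Ky(1) fY by (auto intro: sum_nonneg member_le_sum)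
 define K where "K = (1 + real n) * K1"
 have K: "0 <= K" "K1 <= K" "real n * K1 <= K" using K1(1) by (simp_all add: K_def algebra_simps)
 show ?thesis
 proof (rule that[OF K(1)])
  fix w assume w: "w \<in> tbox X m 2"
  show "\<bar>Fgs n m sg F w\<bar> <= K"
   unfolding Fgs_timevec using Ky(2)[OF tpc[OF w], of "site_part n m sg w"] K1(2)[OF spY[OF w]] K(2) by linarith
  fix i and s s' :: real assume s: "0 <= s" "s <= 2" "0 <= s'" "s' <= 2"
  define A where "A = {i' \<in> {1..n}. comp_of m sg i' = i}"
  have e: "Fgs n m sg F (w(i := (u, snd (w i)))) = F (timevec n (site_part n m sg w) (ov (time_part n m sg w) A u))" for u
  proof -
   have "site_part n m sg (w(i := (u, snd (w i)))) = site_part n m sg w"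
    "time_part n m sg (w(i := (u, snd (w i)))) = ov (time_part n m sg w) A u"
    by (auto simp: site_part_def time_part_def ov_def A_def fun_eq_iff)
   then show ?thesis by (simp add: Fgs_timevec)
  qed
  have "\<bar>F (timevec n (site_part n m sg w) (ov (time_part n m sg w) A s)) - F (timevec n (site_part n m sg w) (ov (time_part n m sg w) A s'))\<bar>
   <= real (card A) * (Ky (site_part n m sg w) * \<bar>s - s'\<bar>)"
   by (rule lipschitz_ov[OF _ s _ _ tpc[OF w], where f="%t. F (timevec n (site_part n m sg w) t)"])
    (use Ky(3) in \<open>auto simp: A_def\<close>)
  also have "... <= real n * (K1 * \<bar>s - s'\<bar>)"
  proof (intro mult_mono mult_right_mono K1(2) spY w)
   have "card A <= card {1..n}" by (rule card_mono) (auto simp: A_def)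
   then show "real (card A) <= real n" by simp
  qed (use Ky(1) K1(1) in auto)
  also have "... = (real n * K1) * \<bar>s - s'\<bar>" by simp
  also have "... <= K * \<bar>s - s'\<bar>" by (intro mult_right_mono K) simp
  finally show "\<bar>Fgs n m sg F (w(i := (s, snd (w i)))) - Fgs n m sg F (w(i := (s', snd (w i))))\<bar> <= K * \<bar>s - s'\<bar>"
   unfolding e .
 qed
qed

lemma tendsto_fun_iff: "((f :: 'b => nat => real) \<longlongrightarrow> l) F \<longleftrightarrow> (\<forall>i. ((%c. f c i) \<longlongrightarrow> l i) F)"
 using limitin_componentwise[of "%_. euclideanreal" "UNIV :: nat set" f l F]
 by (simp add: euclidean_product_topology limitin_canonical_iff)

text \<open>The site part does not change along \<open>tconv\<close>, so the claim is continuity of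
  \<open>F\<close> in the times, for the product topology.\<close>

lemma Fgs_gcont:
 assumes F: "C1_time n F" and X: "finite X" and cm: "!!i. i \<in> {1..n} ==> comp_of m sg i \<in> {1..m}"
 shows "\<exists>B. gcont X m B (Fgs n m sg F)"
proof -
 obtain K where K: "0 <= K" "!!w. w \<in> tbox X m 2 ==> \<bar>Fgs n m sg F w\<bar> <= K" using Fgs_regular[OF assms] by metis
 have "gcont X m K (Fgs n m sg F)"
  unfolding gcont_def
 proof (intro conjI ballI allI impI K(1))
  show "\<bar>Fgs n m sg F w\<bar> <= K" if "w \<in> box X m" for w by (rule K(2)) (use that in \<open>auto simp: box_def tbox_def\<close>)
  fix wn w assume w: "w \<in> box X m" "\<forall>l. wn l \<in> box X m" "tconv wn w"
  have sp: "site_part n m sg (wn l) = site_part n m sg w" for l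
   using w(3) by (auto simp: site_part_def tconv_def fun_eq_iff)
  have c: "continuous_on {t. \<forall>i\<in>{1..n}. 0 <= t i} (%t. F (timevec n (site_part n m sg w) t))"
   using F by (simp add: C1_time_def)
  have nn: "time_part n m sg v \<in> {t. \<forall>i\<in>{1..n}. 0 <= t i}" if "v \<in> box X m" for v
   using that cm by (auto simp: time_part_def box_def)
  have tt: "(%l. time_part n m sg (wn l)) \<longlonglongrightarrow> time_part n m sg w"
   unfolding tendsto_fun_iff using w(3) by (auto simp: time_part_def tconv_def)
  have "(%l. F (timevec n (site_part n m sg w) (time_part n m sg (wn l)))) \<longlonglongrightarrow> F (timevec n (site_part n m sg w) (time_part n m sg w))"
   by (rule continuous_on_tendsto_compose[OF c tt nn[OF w(1)]]) (use nn w(2) in auto)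
  then show "(%l. Fgs n m sg F (wn l)) \<longlonglongrightarrow> Fgs n m sg F w" by (simp add: Fgs_timevec sp)
 qed
 then show ?thesis ..
qed

section \<open>Mixed norms against C1 norms\<close>

lemma mn_bounded_by:
 assumes N: "1 <= N" and T: "0 <= T" "T <= 1" and B: "0 <= B"
 shows "(!!w. w \<in> tbox (Lam N d) m T ==> \<bar>H w\<bar> <= B) ==> 0 <= mn N d T pp m t H & mn N d T pp m t H <= B"
proof (induction m arbitrary: H t)
 case 0
 then show ?case by (simp add: tbox_def)
next
 case (Suc m)
 have "\<bar>if fst z < t then mn N d T pp m (fst z) (sect m H (snd z) (fst z)) else 0\<bar> <= B"
  if z: "z = (s, x)" "0 <= s" "s <= T" "x \<in> Lam N d" for z s x
 proof -
  have "\<bar>sect m H x s w\<bar> <= B" if "w \<in> tbox (Lam N d) m T" for w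
   unfolding sect_def by (rule Suc.prems) (use that z in \<open>auto simp: tbox_def\<close>)
  from Suc.IH[of "sect m H x s", OF this] show ?thesis using z B by simp
 qed
 then show ?case unfolding mn.simps using lqnorm_bounds[OF N T, of d _ B "pp (Suc m)"] by simp
qed

lemma mnorm_bounded_by:
 assumes N: "1 <= N" and T: "0 <= T" "T <= 1" and B: "0 <= B" and m: "1 <= m"
  and H: "!!w. w \<in> tbox (Lam N d) m T ==> \<bar>H w\<bar> <= B"
 shows "0 <= mnorm N d T pp m H" "mnorm N d T pp m H <= B"
proof -
 obtain k where k: "m = Suc k" using m by (cases m) auto
 have "\<bar>mn N d T pp k (fst z) (sect k H (snd z) (fst z))\<bar> <= B"
  if z: "z = (s, x)" "0 <= s" "s <= T" "x \<in> Lam N d" for z s x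
 proof -
  have "\<bar>sect k H x s w\<bar> <= B" if "w \<in> tbox (Lam N d) k T" for w
   unfolding sect_def by (rule H) (use that z k in \<open>auto simp: tbox_def\<close>)
  then have "0 <= mn N d T pp k s (sect k H x s) & mn N d T pp k s (sect k H x s) <= B"
   by (rule mn_bounded_by[OF N T B])
  then show ?thesis using z by simp
 qed
 then show "0 <= mnorm N d T pp m H" "mnorm N d T pp m H <= B"
  unfolding k mnorm_eq_lqnorm_mn[OF N T(1)] using lqnorm_bounds[OF N T, of d _ B "pp (Suc k)"] by simp_all
qed

text \<open>The first summand of \<open>c1norm\<close> is the supremum of the absolute value, which
  dominates every mixed norm. The second summand must be shown to be nonnegative, which needs a
  bound for the derivatives, as \<open>Sup\<close> of an unbounded set of reals is
  unspecified.\<close>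

lemma c1norm_ge_mnorm:
 assumes F: "C1_time n F" and cm: "!!i. i \<in> {1..n} ==> comp_of m sg i \<in> {1..m}" and N: "1 <= N" and T: "0 <= T" "T <= 1" and m: "1 <= m"
 shows "0 <= mnorm N d T pp m (Fgs n m sg F)" "i \<in> {1..m} ==> mnorm N d T pp m (Fgs n m sg F) <= c1norm N d T m i (Fgs n m sg F)"
proof -
 define G where "G = Fgs n m sg F"
 obtain K where K: "0 <= K" "!!w. w \<in> tbox (Lam N d) m 2 ==> \<bar>G w\<bar> <= K"
  "!!w i s s'. w \<in> tbox (Lam N d) m 2 ==> 0 <= s ==> s <= 2 ==> 0 <= s' ==> s' <= 2 ==>
   \<bar>G (w(i := (s, snd (w i)))) - G (w(i := (s', snd (w i))))\<bar> <= K * \<bar>s - s'\<bar>"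
  unfolding G_def using Fgs_regular[OF F finite_Lam cm] by metis
 have tb: "w \<in> tbox (Lam N d) m 2" if "w \<in> tbox (Lam N d) m T" for w using that T by (fastforce simp: tbox_def)
 define BT where "BT = Sup {\<bar>G z\<bar> | z. z \<in> tbox (Lam N d) m T}"
 have bdd: "bdd_above {\<bar>G z\<bar> | z. z \<in> tbox (Lam N d) m T}"
  by (rule bdd_aboveI[of _ K]) (use K(2) tb in auto)
 have BT: "\<bar>G w\<bar> <= BT" if "w \<in> tbox (Lam N d) m T" for w
  unfolding BT_def by (rule cSup_upper[OF _ bdd]) (use that in auto)
 have w0: "(%_. base0) \<in> tbox (Lam N d) m T" using Lam_nonempty[OF N, of d] T by (auto simp: tbox_def base0_def)
 have BT0: "0 <= BT" using BT[OF w0] by linarith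
 show "0 <= mnorm N d T pp m (Fgs n m sg F)" using mnorm_bounded_by(1)[OF N T BT0 m BT] by (simp add: G_def)
 have le: "mnorm N d T pp m G <= BT" by (rule mnorm_bounded_by(2)[OF N T BT0 m BT])
 assume i: "i \<in> {1..m}"
 define V where "V z = \<bar>vector_derivative (%s. G (z(i := (s, snd (z i))))) (at (fst (z i)) within {0..})\<bar>" for z
 have V: "V z <= max K \<bar>SOME x. False\<bar>" if z: "z \<in> tbox (Lam N d) m T" for z
  unfolding V_def by (rule vector_derivative_bound[OF K(3)[OF tb[OF z]]]) (use z[unfolded tbox_def, simplified, rule_format, of i] i T in auto)
 have "0 <= V (%_. base0)" by (simp add: V_def)
 also have "... <= Sup {V z | z. z \<in> tbox (Lam N d) m T}"
 proof (rule cSup_upper)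
  show "V (%_. base0) \<in> {V z | z. z \<in> tbox (Lam N d) m T}" using w0 by blast
  show "bdd_above {V z | z. z \<in> tbox (Lam N d) m T}"
   by (rule bdd_aboveI[of _ "max K \<bar>SOME x. False\<bar>"]) (use V in blast)
 qed
 finally have "BT <= c1norm N d T m i G"
  unfolding c1norm_def BT_def V_def by (simp add: tbox_def)
 with le show "mnorm N d T pp m (Fgs n m sg F) <= c1norm N d T m i (Fgs n m sg F)" by (simp add: G_def)
qed

text \<open>Counted from the largest element downwards, the exponents are
  \<open>0, ..., card I - 1\<close>.\<close>

lemma sum_rank_powers:
 fixes q :: real
 shows "finite I ==> (\<Sum>i\<in>I. q ^ card {j \<in> I. (i::nat) < j}) = (\<Sum>l<card I. q ^ l)"
proof (induction I rule: finite_linorder_min_induct)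
 case empty
 then show ?case by simp
next
 case (insert b A)
 have b: "b \<notin> A" using insert.hyps by auto
 have "{j \<in> insert b A. b < j} = A" using insert.hyps by auto
 moreover have "{j \<in> insert b A. i < j} = {j \<in> A. i < j}" if "i \<in> A" for i using insert.hyps that by auto
 ultimately have "(\<Sum>i\<in>insert b A. q ^ card {j \<in> insert b A. i < j}) = q ^ card A + (\<Sum>i\<in>A. q ^ card {j \<in> A. i < j})"
  using insert.hyps(1) b by simp
 then show ?case using insert b by simp
qed

text \<open>A geometric sum with ratio \<open>q = (p-1)/p\<close>, for which
  \<open>1 - q = 1/p\<close>. In this sense the right side of the theorem is homogeneous of degree 1
  in the integrand.\<close>

lemma beta_split:
 assumes p: "2 <= p" shows "beta p m sg pp + (\<Sum>i\<in>Iinf m sg pp 2. betai p m sg pp i) / p = 1"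
proof -
 define I q where "I = Iinf m sg pp 2" and "q = (p - 1) / p"
 have fI: "finite I" by (simp add: I_def Iinf_def)
 have q: "1 - q = 1 / p" "q ~= 1" using p by (simp_all add: q_def field_simps)
 have "betai p m sg pp i = q ^ card {j \<in> I. i < j}" if "i \<in> I" for i
 proof -
  have "Iinf m sg pp (i + 1) = {j \<in> I. i < j}" using that by (auto simp: I_def Iinf_def)
  then show ?thesis by (simp add: betai_def q_def)
 qed
 then have "(\<Sum>i\<in>I. betai p m sg pp i) = (\<Sum>l<card I. q ^ l)" using sum_rank_powers[OF fI, of q] by simp
 moreover have "(1 - q) * (\<Sum>l<card I. q ^ l) = 1 - q ^ card I" by (rule one_diff_power_eq[symmetric])
 moreover have "beta p m sg pp = q ^ card I" by (simp add: beta_def q_def I_def)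
 ultimately show ?thesis using q by (simp add: I_def)
qed

text \<open>\<open>x\<close> is written as \<open>x powr beta\<close> times a remaining power, and
  the factors of the latter are enlarged to the powers of \<open>c i\<close>. The factors
  \<open>e powr (- 1)\<close> are at least 1.\<close>

lemma le_mixed_norms:
 assumes p: "2 <= p" and x: "0 <= x" and e: "0 < e" "e <= 1" and c: "!!i. i \<in> Iinf m sg pp 2 ==> x <= c i"
 shows "x <= x powr beta p m sg pp * (\<Prod>i\<in>Iinf m sg pp 2. e powr (- 1) * c i powr betai p m sg pp i) powr (1 / p)"
proof (cases "x = 0")
 case True
 then show ?thesis by simp
next
 case False
 then have x0: "0 < x" using x by simp
 have b0: "0 <= betai p m sg pp i" for i using p by (simp add: betai_def)
 have "x powr (\<Sum>i\<in>Iinf m sg pp 2. betai p m sg pp i) = (\<Prod>i\<in>Iinf m sg pp 2. x powr betai p m sg pp i)"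
  using x0 by (intro powr_sum) (simp_all add: Iinf_def)
 also have "... <= (\<Prod>i\<in>Iinf m sg pp 2. e powr (- 1) * c i powr betai p m sg pp i)"
 proof (intro prod_mono conjI)
  fix i assume i: "i \<in> Iinf m sg pp 2"
  have "x powr betai p m sg pp i <= 1 * c i powr betai p m sg pp i" using powr_mono2[OF b0 x c[OF i]] by simp
  also have "... <= e powr (- 1) * c i powr betai p m sg pp i"
   using e by (intro mult_right_mono) (simp_all add: powr_minus one_le_inverse)
  finally show "x powr betai p m sg pp i <= e powr (- 1) * c i powr betai p m sg pp i" .
 qed simp
 finally have "(x powr (\<Sum>i\<in>Iinf m sg pp 2. betai p m sg pp i)) powr (1 / p)
   <= (\<Prod>i\<in>Iinf m sg pp 2. e powr (- 1) * c i powr betai p m sg pp i) powr (1 / p)"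
  using p by (intro powr_mono2) auto
 then have "x powr beta p m sg pp * x powr ((\<Sum>i\<in>Iinf m sg pp 2. betai p m sg pp i) / p)
   <= x powr beta p m sg pp * (\<Prod>i\<in>Iinf m sg pp 2. e powr (- 1) * c i powr betai p m sg pp i) powr (1 / p)"
  by (intro mult_left_mono) (simp_all add: powr_powr)
 moreover have "x powr beta p m sg pp * x powr ((\<Sum>i\<in>Iinf m sg pp 2. betai p m sg pp i) / p) = x"
  unfolding powr_add[symmetric] beta_split[OF p] using x0 by simp
 ultimately show ?thesis by simp
qed

section \<open>Labelled integrals as iterated integrals\<close>

context spde_model
begin

lemma mark_scale: "mark \<xi> B ==> 0 <= c' ==> mark (%x s om. c' * \<xi> x s om) (c' * B)"
 unfolding mark_def by (auto simp: abs_mult sum_distrib_left[symmetric] intro: mult_left_mono borel_measurable_times)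

lemma drift_scale: "drift rh B ==> 0 <= c' ==> drift (%x s om. c' * rh x s om) (c' * B)"
 unfolding drift_def by (auto simp: abs_mult intro: mult_left_mono borel_measurable_times)

lemma compensates_scale:
 assumes "compensates ze \<xi>" shows "compensates (%x s om. c' * ze x s om) (%x s om. c' * \<xi> x s om)"
 unfolding compensates_def
proof (intro ballI allI impI)
 fix x and s t :: real and A assume x: "x \<in> Lam NN d" and h: "0 <= s & s <= t & t <= 1 & A \<in> sets (Fl s)"
 define Y where "Y om = indicator A om * (((\<Sum>r\<in>SS x om Int {..t}. \<xi> x r om) - (LBINT r:{0..t}. ze x r om))
    - ((\<Sum>r\<in>SS x om Int {..s}. \<xi> x r om) - (LBINT r:{0..s}. ze x r om)))" for om
 have "(\<integral>om. Y om \<partial>P) = 0" using assms x h unfolding compensates_def Y_def by blast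
 then have "(\<integral>om. c' * Y om \<partial>P) = 0" by simp
 moreover have "indicator A om * (((\<Sum>r\<in>SS x om Int {..t}. c' * \<xi> x r om) - (LBINT r:{0..t}. c' * ze x r om))
    - ((\<Sum>r\<in>SS x om Int {..s}. c' * \<xi> x r om) - (LBINT r:{0..s}. c' * ze x r om))) = c' * Y om" for om
  unfolding Y_def by (simp add: sum_distrib_left[symmetric] algebra_simps)
 ultimately show "(\<integral>om. indicator A om * (((\<Sum>r\<in>SS x om Int {..t}. c' * \<xi> x r om) - (LBINT r:{0..t}. c' * ze x r om))
    - ((\<Sum>r\<in>SS x om Int {..s}. c' * \<xi> x r om) - (LBINT r:{0..s}. c' * ze x r om))) \<partial>P) = 0" by simp
qed

text \<open>The power of the jump that drives a level: an odd number of factors leaves the jump, an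
  even number its square. The labels other than \<open>NilL\<close> always involve the
  square.\<close>

definition wt :: "label => nat => nat" where "wt l j = (if l = NilL & odd j then 1 else 2)"

text \<open>The coefficient of the compensated part: the prefactor of the label, times the power of
  \<open>a\<close> that remains when the jump power is reduced to \<open>wt\<close>. A level
  labelled \<open>Nabla\<close> has no jump part.\<close>

definition cA :: "label => nat => real" where
 "cA l j = (case l of Nabla => 0
   | Diamond => eps NN powr ((real d + k) * (real j - 1)) * (eps NN ^ d * eps NN powr (- k))
   | NilL => eps NN ^ (j * d) * a ^ (j - wt l j))"

text \<open>For \<open>NilL\<close> with size at least 2 the integral is not compensated, so the
  compensator is added back with the coefficient of the jump part; for size 1 it belongs to the
  integral. For \<open>Nabla\<close> the second \<open>eps NN ^ d\<close> cancels the negative power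
  inside \<open>th 2\<close>.\<close>

definition cR :: "label => nat => real" where
 "cR l j = (case l of Nabla => eps NN powr ((real d + k) * (real j - 2)) * (eps NN ^ d * eps NN ^ d)
   | Diamond => 0 | NilL => (if j = 1 then 0 else cA l j))"

lemma cA_nonneg: "0 <= cA l j" using e0 a0 by (cases l) (simp_all add: cA_def)
lemma cR_nonneg: "0 <= cR l j" using e0 cA_nonneg[of NilL j] by (cases l) (simp_all add: cR_def)

definition lxi where "lxi sg L i x s om = cA (L i) (card (sg i)) * jm (wt (L i) (card (sg i))) x s om" for sg :: "nat => nat set" and L and i :: nat
definition lze where "lze sg L i x s om = cA (L i) (card (sg i)) * th (wt (L i) (card (sg i))) x s om" for sg :: "nat => nat set" and L and i :: nat
definition lrh where "lrh sg L i x s om = cR (L i) (card (sg i)) * th (wt (L i) (card (sg i))) x s om" for sg :: "nat => nat set" and L and i :: nat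
definition lb where "lb sg L i = cA (L i) (card (sg i)) * a ^ wt (L i) (card (sg i))" for sg :: "nat => nat set" and L and i :: nat
definition lbz where "lbz sg L i = cA (L i) (card (sg i)) * Bth (wt (L i) (card (sg i)))" for sg :: "nat => nat set" and L and i :: nat
definition lr where "lr sg L i = cR (L i) (card (sg i)) * Bth (wt (L i) (card (sg i)))" for sg :: "nat => nat set" and L and i :: nat

lemma wt_cases: "wt l j = 1 \<or> wt l j = 2" by (simp add: wt_def)

lemma mark_jm: "mark (jm (wt l j)) (a ^ wt l j)"
 using wt_cases[of l j] mark_jm1 mark_jm2 by auto

lemma compensates_th: "compensates (th (wt l j)) (jm (wt l j))"
 using wt_cases[of l j] compensates_th1 compensates_th2 by auto

lemma iterated_lev: "iterated P Fl (Lam NN d) SS lamb (lxi sg L) (lze sg L) (lrh sg L) (lb sg L) (lr sg L) (lbz sg L)"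
proof (rule iterated.intro, rule jump_process_axioms, rule iterated_axioms.intro)
 fix i :: nat
 show "mark (lxi sg L i) (lb sg L i)"
  unfolding lxi_def[abs_def] lb_def by (rule mark_scale[OF mark_jm cA_nonneg])
 show "drift (lze sg L i) (lbz sg L i)"
  unfolding lze_def[abs_def] lbz_def by (rule drift_scale[OF drift_th cA_nonneg])
 show "drift (lrh sg L i) (lr sg L i)"
  unfolding lrh_def[abs_def] lr_def by (rule drift_scale[OF drift_th cR_nonneg])
 show "compensates (lze sg L i) (lxi sg L i)"
  unfolding lze_def[abs_def] lxi_def[abs_def] by (rule compensates_scale[OF compensates_th])
qed

lemma SS_jumps: "om \<in> Om ==> t <= 1 ==> jumps_in (%r. M x r om) {0..<t} = SS x om Int {..<t}"
 by (auto simp: SS_def jumps_in_def)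

text \<open>Each pair of factors is replaced by \<open>a\<^sup>2\<close>.\<close>

lemma jump_pow:
 assumes "x \<in> Lam NN d" "s \<in> SS x om" and j: "1 <= j"
 shows "(jump (%r. M x r om) s) ^ j = a ^ (j - wt NilL j) * jm (wt NilL j) x s om"
proof (cases "odd j")
 case True
 then obtain i where i: "j = Suc (2 * i)" by (auto elim: oddE)
 have "(jump (%r. M x r om) s) ^ j = ((jm 1 x s om)\<^sup>2) ^ i * jm 1 x s om"
  by (simp add: i jm_def power_mult[symmetric] mult.commute)
 then show ?thesis unfolding jm_SS(2)[OF assms(1,2)] using i by (simp add: wt_def power_mult[symmetric])
next
 case False
 then obtain i where i: "j = 2 * i" by auto
 then obtain l where l: "i = Suc l" using j by (cases i) auto
 have "(jump (%r. M x r om) s) ^ j = ((jm 1 x s om)\<^sup>2) ^ l * (jm 1 x s om)\<^sup>2"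
  by (simp add: i l jm_def power_mult[symmetric] power_add[symmetric])
 then show ?thesis unfolding jm_SS(2)[OF assms(1,2)] jm_SS(3)[OF assms(1,2)] using i l
  by (simp add: wt_def jm_SS(3)[OF assms(1,2)] power_mult[symmetric])
qed

text \<open>Every label becomes a compensated sum plus a drift. For \<open>NilL\<close> with size at
  least 2 the two integrals against \<open>th\<close> cancel each other.\<close>

lemma lint_eq:
 assumes om: "om \<in> Om" and t: "t <= 1" and j: "1 <= j"
 shows "lint NN d k (%x r. M x r om) (%s x. Cc s x om) (%s x. Ctt s x om) l j H t =
  (\<Sum>x\<in>Lam NN d. (\<Sum>s\<in>SS x om Int {..<t}. H (s, x) * (cA l j * jm (wt l j) x s om)) - (LBINT s:{0..t}. H (s, x) * (cA l j * th (wt l j) x s om)))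
  + (\<Sum>x\<in>Lam NN d. LBINT s:{0..t}. H (s, x) * (cR l j * th (wt l j) x s om))"
proof -
 have J: "(\<Sum>s\<in>SS x om Int {..<t}. H (s, x) * (c' * f s)) = c' * (\<Sum>s\<in>SS x om Int {..<t}. H (s, x) * f s)" for c' x and f :: "real => real"
  by (simp add: sum_distrib_left mult_ac)
 have I: "(LBINT s:{0..t}. H (s, x) * (c' * f s)) = c' * (LBINT s:{0..t}. H (s, x) * f s)" for c' x and f :: "real => real"
  by (simp add: mult.left_commute)
 have th1: "(LBINT s:{0..t}. H (s, x) * th 1 x s om) = eps NN powr (- k - real d) * (LBINT s:{0..t}. H (s, x) * Ctt s x om)" for x
  unfolding I[symmetric] using om by (simp add: th_def)
 have th2: "(LBINT s:{0..t}. H (s, x) * th 2 x s om) = eps NN powr (- real d) * (LBINT s:{0..t}. H (s, x) * Cc s x om)" for x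
  unfolding I[symmetric] using om by (simp add: th_def)
 have ed: "eps NN ^ d * eps NN powr (- real d) = 1"
  using e0 by (simp add: powr_minus powr_realpow)
 show ?thesis
 proof (cases l)
  case Nabla
  have w: "wt Nabla j = 2" by (simp add: wt_def)
  have q: "(LBINT s:{0..t}. H (s, x) * Cc s x om) = eps NN ^ d * (LBINT s:{0..t}. H (s, x) * th 2 x s om)" for x
   unfolding th2 using ed by simp
  show ?thesis unfolding Nabla w J I
   by (simp add: lint_def intdz_def cA_def cR_def LBINT_ico sum_distrib_left mult.assoc q)
 next
  case Diamond
  have w: "wt Diamond j = 2" by (simp add: wt_def)
  show ?thesis unfolding Diamond w J I th2
   by (simp add: lint_def intMbar_def cA_def cR_def LBINT_ico SS_jumps[OF om t] jm_def sum_distrib_left right_diff_distrib mult.assoc)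
 next
  case NilL
  show ?thesis
  proof (cases "j = 1")
   case True
   have w: "wt NilL j = 1" by (simp add: wt_def True)
   show ?thesis unfolding NilL w J I th1
    by (simp add: lint_def intM_def cA_def cR_def LBINT_ico SS_jumps[OF om t] jm_def sum_distrib_left right_diff_distrib True wt_def)
  next
   case False
   have "(\<Sum>s\<in>SS x om Int {..<t}. H (s, x) * jump (%r. M x r om) s ^ j) = a ^ (j - wt NilL j) * (\<Sum>s\<in>SS x om Int {..<t}. H (s, x) * jm (wt NilL j) x s om)"
    if "x \<in> Lam NN d" for x
    unfolding J[symmetric] using jump_pow[OF that _ j] by (intro sum.cong) auto
   then show ?thesis unfolding NilL J I using False
    by (simp add: lint_def intMj_def cA_def cR_def LBINT_ico SS_jumps[OF om t] sum.distrib[symmetric] mult.assoc)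
  qed
 qed
qed

text \<open>The induction hypothesis identifies the inner integrals for all \<open>r < s\<close>,
  and left-continuity of \<open>It\<close> evaluates the left limit in \<open>Ilab\<close>. Time 0
  is exempt: there is no jump at 0, and a single point does not affect the integrals.\<close>

lemma Ilab_It:
 assumes om: "om \<in> Om" and G: "gcont (Lam NN d) (Suc m) B G" and t: "0 <= t" "t <= 1" and sg: "!!i. i \<in> {1..Suc m} ==> 1 <= card (sg i)"
 shows "Ilab NN d k (%x r. M x r om) (%s x. Cc s x om) (%s x. Ctt s x om) sg L (Suc m) G t
  = iterated.It (Lam NN d) SS (lxi sg L) (lze sg L) (lrh sg L) (Suc m) G t om"
proof -
 interpret iterated P Fl "Lam NN d" SS lamb "lxi sg L" "lze sg L" "lrh sg L" "lb sg L" "lr sg L" "lbz sg L"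
  by (rule iterated_lev)
 let ?I = "Ilab NN d k (%x r. M x r om) (%s x. Cc s x om) (%s x. Ctt s x om) sg L"
 show ?thesis using G t sg
 proof (induction m arbitrary: G t)
  case 0
  show ?case unfolding Ilab.simps base_upd It.simps
   using lint_eq[OF om 0(3), of "card (sg 1)"] 0(4)[of 1]
   by (simp add: msum_def dsum_def sect_def lxi_def lze_def lrh_def)
 next
  case (Suc m)
  define J where "J z = Lim (at_left (fst z)) (%r. ?I (Suc m) (%w. G (w(Suc (Suc m) := z))) r)" for z
  have J: "J (s, x) = It (Suc m) (sect (Suc m) G x s) s om" if s: "0 < s" "s <= 1" and x: "x \<in> Lam NN d" for s x
  proof -
   have gs: "gcont (Lam NN d) (Suc m) B (sect (Suc m) G x s)" by (rule gcont_sect[OF Suc.prems(1)]) (use s x in auto)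
   have "((%r. It (Suc m) (sect (Suc m) G x s) r om) \<longlongrightarrow> It (Suc m) (sect (Suc m) G x s) s om) (at_left s)"
    using nice_lcont[OF It_nice[OF gs] Om(3)[OF om]] s unfolding lcont_def by blast
   moreover have "\<forall>\<^sub>F r in at_left s. It (Suc m) (sect (Suc m) G x s) r om = ?I (Suc m) (sect (Suc m) G x s) r"
    using eventually_at_left_real[OF s(1)]
   proof eventually_elim
    case (elim r)
    have "?I (Suc m) (sect (Suc m) G x s) r = It (Suc m) (sect (Suc m) G x s) r om"
     by (rule Suc.IH[OF gs]) (use elim s Suc.prems(4) in auto)
    then show ?case by simp
   qed
   ultimately have "((%r. ?I (Suc m) (sect (Suc m) G x s) r) \<longlongrightarrow> It (Suc m) (sect (Suc m) G x s) s om) (at_left s)"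
    by (rule Lim_transform_eventually)
   then have "Lim (at_left s) (%r. ?I (Suc m) (sect (Suc m) G x s) r) = It (Suc m) (sect (Suc m) G x s) s om"
    by (rule tendsto_Lim[rotated]) simp
   moreover have "sect (Suc m) G x s = (%w. G (w(Suc (Suc m) := (s, x))))" by (simp add: sect_def fun_eq_iff)
   ultimately show ?thesis unfolding J_def by simp
  qed
  have D: "(LBINT s:{0..t}. J (s, x) * f s) = (LBINT s:{0..t}. It (Suc m) (sect (Suc m) G x s) s om * f s)"
   if x: "x \<in> Lam NN d" for x f
   unfolding LBINT_ioc[symmetric] by (rule set_lebesgue_integral_cong) (use J[OF _ _ x] Suc.prems(3) in auto)
  have S: "(\<Sum>s\<in>SS x om Int {..<t}. J (s, x) * f s) = (\<Sum>s\<in>SS x om Int {..<t}. It (Suc m) (sect (Suc m) G x s) s om * f s)"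
   if x: "x \<in> Lam NN d" for x f
   by (rule sum.cong[OF refl]) (use J[OF _ _ x] SS_01[of x om] in auto)
  have c1: "1 <= card (sg (Suc (Suc m)))" by (rule Suc.prems(4)) simp
  have "?I (Suc (Suc m)) G t = lint NN d k (%x r. M x r om) (%s x. Cc s x om) (%s x. Ctt s x om) (L (Suc (Suc m))) (card (sg (Suc (Suc m)))) J t"
   unfolding Ilab.simps J_def ..
  also have "... = It (Suc (Suc m)) G t om"
   unfolding lint_eq[OF om Suc.prems(3) c1] It.simps(2)[of "Suc m"] msum_def dsum_def
    lxi_def[of sg L "Suc (Suc m)"] lze_def[of sg L "Suc (Suc m)"] lrh_def[of sg L "Suc (Suc m)"]
   using D S by (simp del: It.simps)
  finally show ?case .
 qed
qed

end

section \<open>Moment bounds\<close>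

lemma set_integrable_bounded:
 assumes m: "(%s. indicator {0..T} s * f s) \<in> borel_measurable borel" and b: "!!s. 0 <= s ==> s <= T ==> \<bar>f s\<bar> <= B"
 shows "set_integrable lborel {0..T::real} (f :: real => real)"
 unfolding set_integrable_def
proof (rule Bochner_Integration.integrable_bound)
 show "integrable lborel (%s. indicator {0..T} s *\<^sub>R B)" using set_integrable_const_Icc[of 0 T B] by (simp add: set_integrable_def)
 show "(%s. indicator {0..T} s *\<^sub>R f s) \<in> borel_measurable lborel" using m by simp
 show "AE s in lborel. norm (indicator {0..T} s *\<^sub>R f s) <= norm (indicator {0..T} s *\<^sub>R B)"
 proof (rule AE_I2)
  fix s show "norm (indicator {0..T} s *\<^sub>R f s) <= norm (indicator {0..T} s *\<^sub>R B)"
   using b[of s] by (cases "s \<in> {0..T}") auto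
 qed
qed

lemma LBINT_cut:
 fixes f :: "real => real"
 assumes "!!s. t <= s ==> s <= T ==> f s = 0" "t <= T"
 shows "(LBINT s:{0..t}. f s) = (LBINT s:{0..T}. f s)"
proof -
 have "(LBINT s:{0..t}. f s) = (LBINT s:{0..<t}. f s)" by (rule LBINT_ico[symmetric])
 also have "... = (LBINT s:{0..T}. f s)"
  unfolding set_lebesgue_integral_def
  by (rule Bochner_Integration.integral_cong[OF refl]) (use assms in \<open>auto simp: indicator_def\<close>)
 finally show ?thesis .
qed

text \<open>The triangle inequality up to a factor \<open>card I\<close>, which only affects
  constants. For \<open>E2\<close> this factor allows the Cauchy-Schwarz inequality on the finite
  sum to replace Minkowski's inequality.\<close>

lemma lqnorm_sum:
 assumes N: "1 <= N" and T: "0 <= T" "T <= 1" and I: "finite I" and c: "!!i. i \<in> I ==> 0 <= c i"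
  and f: "!!i s x. i \<in> I ==> x \<in> Lam N d ==> 0 <= s ==> s <= T ==> 0 <= f i (s, x) & f i (s, x) <= B"
  and fm: "!!i x. i \<in> I ==> x \<in> Lam N d ==> (%s. indicator {0..T} s * f i (s, x)) \<in> borel_measurable borel"
 shows "lqnorm N d T q (%z. \<Sum>i\<in>I. c i * f i z) <= real (card I) * (\<Sum>i\<in>I. c i * lqnorm N d T q (f i))"
proof (cases "I = {}")
 case True
 then show ?thesis using lqnorm_zero[OF N T(1)] by simp
next
 case False
 note e = eps_pos[OF N]
 have n1: "1 <= real (card I)" using False I by (simp add: Suc_le_eq card_gt_0_iff)
 have lq0: "0 <= lqnorm N d T q (f i)" if "i \<in> I" for i q
  using lqnorm_bounds(1)[OF N T, of d "f i" B q] f[OF that] by (simp add: abs_of_nonneg)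
 have S0: "0 <= (\<Sum>i\<in>I. c i * lqnorm N d T q (f i))" for q by (intro sum_nonneg mult_nonneg_nonneg c lq0)
 have int: "set_integrable lborel {0..T} (%s. (f i (s, x)) ^ k)" if "i \<in> I" "x \<in> Lam N d" "k > 0" for i x k
 proof (rule set_integrable_bounded)
  have "(%s. (indicator {0..T} s * f i (s, x)) ^ k) \<in> borel_measurable borel" using fm[OF that(1,2)] by measurable
  moreover have "(indicator {0..T} s * f i (s, x)) ^ k = indicator {0..T} s * f i (s, x) ^ k" for s
   using that(3) by (simp add: indicator_def)
  ultimately show "(%s. indicator {0..T} s * f i (s, x) ^ k) \<in> borel_measurable borel" by simp
  show "\<bar>f i (s, x) ^ k\<bar> <= B ^ k" if "0 <= s" "s <= T" for s
   using f[OF \<open>i \<in> I\<close> \<open>x \<in> Lam N d\<close> that] by (simp add: power_mono)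
 qed
 show ?thesis
 proof (cases q)
  case E1
  have "lqnorm N d T E1 (%z. \<Sum>i\<in>I. c i * f i z) = eps N ^ d * (\<Sum>x\<in>Lam N d. \<Sum>i\<in>I. c i * (LBINT s:{0..T}. \<bar>f i (s, x)\<bar>))"
  proof -
   have "(LBINT s:{0..T}. \<bar>\<Sum>i\<in>I. c i * f i (s, x)\<bar>) = (\<Sum>i\<in>I. c i * (LBINT s:{0..T}. \<bar>f i (s, x)\<bar>))" if x: "x \<in> Lam N d" for x
   proof -
    have "(LBINT s:{0..T}. \<bar>\<Sum>i\<in>I. c i * f i (s, x)\<bar>) = (LBINT s:{0..T}. \<Sum>i\<in>I. c i * f i (s, x))"
     by (rule set_lebesgue_integral_cong) (use f x c in \<open>auto intro!: sum_nonneg abs_of_nonneg\<close>)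
    also have "... = (\<Sum>i\<in>I. LBINT s:{0..T}. c i * f i (s, x))"
     unfolding set_lebesgue_integral_def scaleR_sum_right
     by (rule Bochner_Integration.integral_sum) (use int[OF _ x, of _ 1] in \<open>auto simp: set_integrable_def mult.left_commute\<close>)
    also have "... = (\<Sum>i\<in>I. c i * (LBINT s:{0..T}. \<bar>f i (s, x)\<bar>))"
    proof (rule sum.cong[OF refl])
     fix i assume i: "i \<in> I"
     have "(LBINT s:{0..T}. f i (s, x)) = (LBINT s:{0..T}. \<bar>f i (s, x)\<bar>)"
      by (rule set_lebesgue_integral_cong) (use f[OF i x] in auto)
     then show "(LBINT s:{0..T}. c i * f i (s, x)) = c i * (LBINT s:{0..T}. \<bar>f i (s, x)\<bar>)" by simp
    qed
    finally show ?thesis .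
   qed
   then show ?thesis by (simp add: lqnorm_def)
  qed
  also have "... = (\<Sum>i\<in>I. c i * lqnorm N d T E1 (f i))"
   by (subst sum.swap) (simp add: lqnorm_def sum_distrib_left mult.left_commute)
  also have "... <= real (card I) * (\<Sum>i\<in>I. c i * lqnorm N d T E1 (f i))"
   using mult_right_mono[OF n1 S0[of E1]] by simp
  finally show ?thesis unfolding E1 .
 next
  case E2
  define A where "A i = lqnorm N d T E2 (f i)" for i
  have A: "(A i)\<^sup>2 = eps N ^ d * (\<Sum>x\<in>Lam N d. LBINT s:{0..T}. (f i (s, x))\<^sup>2)" for i
  proof -
   have "0 <= eps N ^ d * (\<Sum>x\<in>Lam N d. LBINT s:{0..T}. (f i (s, x))\<^sup>2)"
    unfolding set_lebesgue_integral_def using e by (intro mult_nonneg_nonneg sum_nonneg integral_nonneg_AE AE_I2) auto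
   then show ?thesis by (simp add: A_def lqnorm_def)
  qed
  have "(\<Sum>x\<in>Lam N d. LBINT s:{0..T}. (\<Sum>i\<in>I. c i * f i (s, x))\<^sup>2)
   <= (\<Sum>x\<in>Lam N d. \<Sum>i\<in>I. real (card I) * (c i)\<^sup>2 * (LBINT s:{0..T}. (f i (s, x))\<^sup>2))"
  proof (rule sum_mono)
   fix x assume x: "x \<in> Lam N d"
   have i2: "integrable lborel (%s. indicator {0..T} s *\<^sub>R (real (card I) * (c i)\<^sup>2 * (f i (s, x))\<^sup>2))" if "i \<in> I" for i
    using integrable_mult_right[OF int[OF that x, of 2, unfolded set_integrable_def], of "real (card I) * (c i)\<^sup>2"] by (simp add: mult_ac)
   have "(LBINT s:{0..T}. (\<Sum>i\<in>I. c i * f i (s, x))\<^sup>2) <= (LBINT s:{0..T}. \<Sum>i\<in>I. real (card I) * (c i)\<^sup>2 * (f i (s, x))\<^sup>2)"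
    unfolding set_lebesgue_integral_def
   proof (rule integral_mono_AE')
    show "integrable lborel (%s. indicator {0..T} s *\<^sub>R (\<Sum>i\<in>I. real (card I) * (c i)\<^sup>2 * (f i (s, x))\<^sup>2))"
     unfolding scaleR_sum_right by (rule Bochner_Integration.integrable_sum[OF i2])
    have "(\<Sum>i\<in>I. c i * f i (s, x))\<^sup>2 <= (\<Sum>i\<in>I. real (card I) * (c i)\<^sup>2 * (f i (s, x))\<^sup>2)" for s
     using sum_squared_le_sum_of_squares[of "%i. c i * f i (s, x)" I] by (simp add: power_mult_distrib sum_distrib_left mult_ac)
    then show "AE s in lborel. indicator {0..T} s *\<^sub>R (\<Sum>i\<in>I. c i * f i (s, x))\<^sup>2 <= indicator {0..T} s *\<^sub>R (\<Sum>i\<in>I. real (card I) * (c i)\<^sup>2 * (f i (s, x))\<^sup>2)"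
     by (intro AE_I2 scaleR_left_mono) auto
    show "AE s in lborel. 0 <= indicator {0..T} s *\<^sub>R (\<Sum>i\<in>I. real (card I) * (c i)\<^sup>2 * (f i (s, x))\<^sup>2)"
     by (intro AE_I2 scaleR_nonneg_nonneg sum_nonneg) auto
   qed
   also have "... = (\<Sum>i\<in>I. LBINT s:{0..T}. real (card I) * (c i)\<^sup>2 * (f i (s, x))\<^sup>2)"
    unfolding set_lebesgue_integral_def scaleR_sum_right by (rule Bochner_Integration.integral_sum[OF i2])
   finally show "(LBINT s:{0..T}. (\<Sum>i\<in>I. c i * f i (s, x))\<^sup>2) <= (\<Sum>i\<in>I. real (card I) * (c i)\<^sup>2 * (LBINT s:{0..T}. (f i (s, x))\<^sup>2))" by simp
  qed
  also have "... = (\<Sum>i\<in>I. real (card I) * (c i)\<^sup>2 * (\<Sum>x\<in>Lam N d. LBINT s:{0..T}. (f i (s, x))\<^sup>2))"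
   by (subst sum.swap) (simp add: sum_distrib_left)
  finally have "eps N ^ d * (\<Sum>x\<in>Lam N d. LBINT s:{0..T}. (\<Sum>i\<in>I. c i * f i (s, x))\<^sup>2)
   <= eps N ^ d * (\<Sum>i\<in>I. real (card I) * (c i)\<^sup>2 * (\<Sum>x\<in>Lam N d. LBINT s:{0..T}. (f i (s, x))\<^sup>2))"
   using e by (intro mult_left_mono) auto
  also have "... = real (card I) * (\<Sum>i\<in>I. (c i * A i)\<^sup>2)"
   unfolding power_mult_distrib A by (simp add: sum_distrib_left mult_ac)
  also have "... <= (real (card I))\<^sup>2 * (\<Sum>i\<in>I. c i * A i)\<^sup>2"
  proof (rule mult_mono)
   show "real (card I) <= (real (card I))\<^sup>2" using n1 by (simp add: power2_eq_square)
   have cA: "0 <= c i * A i" if "i \<in> I" for i using c[OF that] lq0[OF that] by (simp add: A_def)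
   have "L2_set (%i. c i * A i) I <= (\<Sum>i\<in>I. c i * A i)" by (rule L2_set_le_sum[OF cA])
   then have "(L2_set (%i. c i * A i) I)\<^sup>2 <= (\<Sum>i\<in>I. c i * A i)\<^sup>2" by (rule power_mono) (rule L2_set_nonneg)
   then show "(\<Sum>i\<in>I. (c i * A i)\<^sup>2) <= (\<Sum>i\<in>I. c i * A i)\<^sup>2" by (simp add: L2_set_def sum_nonneg)
  qed (auto intro: sum_nonneg)
  finally have "sqrt (eps N ^ d * (\<Sum>x\<in>Lam N d. LBINT s:{0..T}. (\<Sum>i\<in>I. c i * f i (s, x))\<^sup>2)) <= real (card I) * (\<Sum>i\<in>I. c i * A i)"
   unfolding power_mult_distrib[symmetric] using S0[of E2] by (intro real_le_lsqrt) (auto simp: A_def)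
  then show ?thesis unfolding E2 A_def by (simp add: lqnorm_def)
 next
  case EInf
  have bd: "f i (s, x) <= lqnorm N d T EInf (f i)" if "i \<in> I" "s \<in> {0..T}" "x \<in> Lam N d" for i s x
  proof -
   have "\<bar>f i (s, x)\<bar> <= Sup {\<bar>f i (s, x)\<bar> | s x. s \<in> {0..T} & x \<in> Lam N d}"
   proof (rule cSup_upper)
    show "bdd_above {\<bar>f i (s, x)\<bar> | s x. s \<in> {0..T} & x \<in> Lam N d}"
     by (rule bdd_aboveI[of _ B]) (use f[OF that(1)] in auto)
   qed (use that in auto)
   then show ?thesis by (simp add: lqnorm_def)
  qed
  have "lqnorm N d T EInf (%z. \<Sum>i\<in>I. c i * f i z) <= (\<Sum>i\<in>I. c i * lqnorm N d T EInf (f i))"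
   unfolding lqnorm_def[of _ _ _ _ "%z. \<Sum>i\<in>I. c i * f i z"] expo.case
  proof (rule cSup_least)
   show "{\<bar>\<Sum>i\<in>I. c i * f i (s, x)\<bar> |s x. s \<in> {0..T} & x \<in> Lam N d} ~= {}" using T Lam_nonempty[OF N] by auto
   fix v assume "v \<in> {\<bar>\<Sum>i\<in>I. c i * f i (s, x)\<bar> |s x. s \<in> {0..T} & x \<in> Lam N d}"
   then obtain s x where v: "v = \<bar>\<Sum>i\<in>I. c i * f i (s, x)\<bar>" and sx: "s \<in> {0..T}" "x \<in> Lam N d" by blast
   have "0 <= (\<Sum>i\<in>I. c i * f i (s, x))" using f sx c by (intro sum_nonneg mult_nonneg_nonneg) auto
   then have "v = (\<Sum>i\<in>I. c i * f i (s, x))" unfolding v by simp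
   also have "... <= (\<Sum>i\<in>I. c i * lqnorm N d T EInf (f i))" by (intro sum_mono mult_left_mono bd sx c)
   finally show "v <= (\<Sum>i\<in>I. c i * lqnorm N d T EInf (f i))" .
  qed
  also have "... <= real (card I) * (\<Sum>i\<in>I. c i * lqnorm N d T EInf (f i))"
   using mult_right_mono[OF n1 S0[of EInf]] by simp
  finally show ?thesis unfolding EInf .
 qed
qed

section \<open>Weights of exponents and sums over admissible exponent functions\<close>

lemma mn_cong: "(!!i. i \<in> {1..m} ==> pp i = pp' i) ==> mn N d T pp m t H = mn N d T pp' m t H"
proof (induction m arbitrary: t H)
 case (Suc m)
 have "mn N d T pp m u K = mn N d T pp' m u K" for u K by (rule Suc.IH) (use Suc.prems in auto)
 then show ?case using Suc.prems[of "Suc m"] by (simp cong: if_cong)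
qed simp

text \<open>The amount that an exponent subtracts from the component size in
  \<open>alpha\<close>.\<close>

definition wq :: "expo => real" where "wq q = (case q of E1 => 2 | E2 => 1 | EInf => 0)"

text \<open>The constraints of \<open>Padm\<close> at one single level, for label \<open>l\<close>
  and component size \<open>j\<close>.\<close>

definition Al :: "label => nat => expo set" where
 "Al l j = {q \<in> {E1, E2, EInf}. (q = E1 --> j ~= 1 & l ~= Diamond) & (l = Nabla --> q = E1)}"

lemma alpha_eq: "alpha d k m sg pp = (real d + k) * (\<Sum>i=1..m. real (card (sg i)) - wq (pp i))"
proof -
 have cnt: "real (card {i \<in> {1..m}. Q i}) = (\<Sum>i=1..m. if Q i then 1 else 0)" for Q
  by (simp add: sum.inter_filter[symmetric])
 have "wq (pp i) = 2 * (if pp i = E1 then 1 else 0) + (if pp i = E2 then 1 else 0)" for i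
  by (cases "pp i") (simp_all add: wq_def)
 then have "(\<Sum>i=1..m. wq (pp i)) = 2 * real (card {i \<in> {1..m}. pp i = E1}) + real (card {i \<in> {1..m}. pp i = E2})"
  unfolding cnt by (simp add: sum.distrib sum_distrib_left)
 then show ?thesis unfolding alpha_def by (simp add: sum_subtractf)
qed

lemma alpha_upd: "alpha d k (Suc m) sg (pp(Suc m := q)) = alpha d k m sg pp + (real d + k) * (real (card (sg (Suc m))) - wq q)"
proof -
 have "(\<Sum>i=1..m. real (card (sg i)) - wq ((pp(Suc m := q)) i)) = (\<Sum>i=1..m. real (card (sg i)) - wq (pp i))"
  by (rule sum.cong) auto
 then show ?thesis unfolding alpha_eq by (simp add: distrib_left)
qed

lemma finite_Padm: "finite (Padm m sg L)"
 unfolding Padm_def by (rule finite_subset[of _ "PiE {1..m} (%_. {E1, E2, EInf})"]) (auto intro: finite_PiE)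

lemma Padm_upd:
 assumes pp: "pp \<in> Padm m sg L" and q: "q \<in> Al (L (Suc m)) (card (sg (Suc m)))"
 shows "pp(Suc m := q) \<in> Padm (Suc m) sg L"
proof -
 have P: "pp \<in> PiE {1..m} (%_. {E1, E2, EInf})" "{i \<in> {1..m}. pp i = E1} Int GammaL m sg L = {}" "{i \<in> {1..m}. L i = Nabla} \<subseteq> {i \<in> {1..m}. pp i = E1}"
  using pp by (simp_all add: Padm_def)
 have q': "q \<in> {E1, E2, EInf}" "q = E1 --> card (sg (Suc m)) ~= 1 & L (Suc m) ~= Diamond" "L (Suc m) = Nabla --> q = E1"
  using q by (simp_all add: Al_def)
 have ins: "{1..Suc m} = insert (Suc m) {1..m}" by auto
 have "pp(Suc m := q) \<in> PiE {1..Suc m} (%_. {E1, E2, EInf})"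
  unfolding ins by (rule PiE_fun_upd[OF q'(1) P(1)])
 moreover have "(pp(Suc m := q)) i ~= E1" if i: "i \<in> {1..Suc m}" "i \<in> GammaL (Suc m) sg L" for i
 proof (cases "i = Suc m")
  case True
  then show ?thesis using q'(2) i by (auto simp: GammaL_def Gamma1_def)
 next
  case False
  then have "i \<in> {1..m}" "i \<in> GammaL m sg L" using i by (auto simp: GammaL_def Gamma1_def)
  then show ?thesis using P(2) False by auto
 qed
 moreover have "(pp(Suc m := q)) i = E1" if i: "i \<in> {1..Suc m}" "L i = Nabla" for i
 proof (cases "i = Suc m")
  case True
  then show ?thesis using q'(3) i by simp
 next
  case False
  then have "i \<in> {1..m}" using i by auto
  then show ?thesis using P(3) i False by auto
 qed
 ultimately show ?thesis unfolding Padm_def by blast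
qed

definition mbound :: "nat => nat => real => (nat => nat set) => (nat => label) => real => nat => real => (tuple => real) => real" where
 "mbound N d k sg L T m t G = (\<Sum>pp\<in>Padm m sg L. eps N powr alpha d k m sg pp * mn N d T pp m t G)"

lemma mbound_nonneg:
 assumes "1 <= N" "0 <= T" "T <= 1" "gcont (Lam N d) m B G" shows "0 <= mbound N d k sg L T m t G"
 unfolding mbound_def using mn_bounds(1)[OF assms] by (intro sum_nonneg mult_nonneg_nonneg) auto

text \<open>The norms of one level, applied to a sum over exponent functions of the lower levels,
  give one term for each pair of a new exponent \<open>q\<close> and an old function
  \<open>pp\<close>. The pairs are injected into the admissible functions on \<open>Suc m\<close>
  levels; interchanging norm and sum costs the factor \<open>card (Padm m sg L)\<close>.\<close>

lemma mbound_Suc: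
 assumes N: "1 <= N" and T: "0 <= T" "T <= 1" and G: "gcont (Lam N d) (Suc m) B G" and C: "0 <= C"
 shows "(\<Sum>q\<in>Al (L (Suc m)) (card (sg (Suc m))). eps N powr ((real d + k) * (real (card (sg (Suc m))) - wq q)) *
   lqnorm N d T q (%z. if fst z < t then C * mbound N d k sg L T m (fst z) (sect m G (snd z) (fst z)) else 0))
  <= C * real (card (Padm m sg L)) * mbound N d k sg L T (Suc m) t G"
proof -
 define A where "A = Al (L (Suc m)) (card (sg (Suc m)))"
 define f where "f pp z = (if fst z < t then mn N d T pp m (fst z) (sect m G (snd z) (fst z)) else 0)" for pp and z :: point
 have f: "0 <= f pp (s, x) & f pp (s, x) <= B" if "x \<in> Lam N d" "0 <= s" "s <= T" for pp s x
 proof -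
  have gs: "gcont (Lam N d) m B (sect m G x s)" by (rule gcont_sect[OF G]) (use that T in auto)
  show ?thesis using mn_bounds[OF N T gs] gcontD(1)[OF G] by (simp add: f_def)
 qed
 have fm: "(%s. indicator {0..T} s * f pp (s, x)) \<in> borel_measurable borel" if "x \<in> Lam N d" for pp x
 proof -
  have "(%s. indicator {..<t} s * (indicator {0..T} s * mn N d T pp m s (sect m G x s))) \<in> borel_measurable borel"
   using mn_sect_measurable[OF N T G that, of pp] by measurable
  then show ?thesis by (rule measurable_cong[THEN iffD1, rotated]) (simp add: f_def indicator_def)
 qed
 have fin: "finite (Padm m sg L)" "finite A" using finite_Padm by (auto simp: A_def Al_def)
 have lq: "lqnorm N d T q (%z. if fst z < t then C * mbound N d k sg L T m (fst z) (sect m G (snd z) (fst z)) else 0)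
  <= real (card (Padm m sg L)) * (\<Sum>pp\<in>Padm m sg L. C * eps N powr alpha d k m sg pp * lqnorm N d T q (f pp))" for q
 proof -
  have "(%z. if fst z < t then C * mbound N d k sg L T m (fst z) (sect m G (snd z) (fst z)) else 0)
   = (%z. \<Sum>pp\<in>Padm m sg L. C * eps N powr alpha d k m sg pp * f pp z)"
   by (auto simp: fun_eq_iff mbound_def f_def sum_distrib_left mult.assoc)
  then show ?thesis using lqnorm_sum[OF N T fin(1), of "%pp. C * eps N powr alpha d k m sg pp" d f B q] f fm C by simp
 qed
 \<comment> \<open>An admissible function is \<open>undefined\<close> outside \<open>{1..m}\<close>,
   so the updated function determines both \<open>q\<close> and \<open>pp\<close>.\<close>
 have inj: "inj_on (%(q, pp). pp(Suc m := q)) (A \<times> Padm m sg L)"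
 proof (rule inj_onI, clarsimp)
  fix q q' :: expo and pp pp' assume h: "pp \<in> Padm m sg L" "pp' \<in> Padm m sg L" "pp(Suc m := q) = pp'(Suc m := q')"
  have u: "pp (Suc m) = undefined" "pp' (Suc m) = undefined" using h(1,2) by (auto simp: Padm_def PiE_def extensional_def)
  have "q = q'" using fun_cong[OF h(3), of "Suc m"] by simp
  moreover have "pp i = pp' i" for i using fun_cong[OF h(3), of i] u by (cases "i = Suc m") auto
  ultimately show "q = q' & pp = pp'" by blast
 qed
 define W where "W pp = eps N powr alpha d k (Suc m) sg pp * mn N d T pp (Suc m) t G" for pp
 have W: "W (pp(Suc m := q)) = eps N powr ((real d + k) * (real (card (sg (Suc m))) - wq q)) * (eps N powr alpha d k m sg pp * lqnorm N d T q (f pp))" for pp q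
 proof -
  have "mn N d T (pp(Suc m := q)) m u K = mn N d T pp m u K" for u K by (rule mn_cong) auto
  then show ?thesis unfolding W_def alpha_upd by (simp add: powr_add f_def[abs_def] mult_ac cong: if_cong)
 qed
 have "(\<Sum>q\<in>A. eps N powr ((real d + k) * (real (card (sg (Suc m))) - wq q)) *
   lqnorm N d T q (%z. if fst z < t then C * mbound N d k sg L T m (fst z) (sect m G (snd z) (fst z)) else 0))
  <= (\<Sum>q\<in>A. eps N powr ((real d + k) * (real (card (sg (Suc m))) - wq q)) *
   (real (card (Padm m sg L)) * (\<Sum>pp\<in>Padm m sg L. C * eps N powr alpha d k m sg pp * lqnorm N d T q (f pp))))"
  by (intro sum_mono mult_left_mono lq) simp
 also have "... = C * real (card (Padm m sg L)) * (\<Sum>q\<in>A. \<Sum>pp\<in>Padm m sg L. W (pp(Suc m := q)))"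
  unfolding W by (simp add: sum_distrib_left mult_ac)
 also have "(\<Sum>q\<in>A. \<Sum>pp\<in>Padm m sg L. W (pp(Suc m := q))) = (\<Sum>pp\<in>(%(q, pp). pp(Suc m := q)) ` (A \<times> Padm m sg L). W pp)"
  unfolding sum.cartesian_product sum.reindex[OF inj] by (simp add: case_prod_unfold)
 also have "C * real (card (Padm m sg L)) * ... <= C * real (card (Padm m sg L)) * mbound N d k sg L T (Suc m) t G"
 proof (rule mult_left_mono)
  show "(\<Sum>pp\<in>(%(q, pp). pp(Suc m := q)) ` (A \<times> Padm m sg L). W pp) <= mbound N d k sg L T (Suc m) t G"
   unfolding mbound_def W_def[symmetric]
  proof (rule sum_mono2[OF finite_Padm])
   show "(%(q, pp). pp(Suc m := q)) ` (A \<times> Padm m sg L) \<subseteq> Padm (Suc m) sg L" using Padm_upd by (auto simp: A_def)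
   show "0 <= W pp" for pp unfolding W_def using mn_bounds(1)[OF N T G] by (intro mult_nonneg_nonneg) auto
  qed
 qed (use C in simp)
 finally show ?thesis unfolding A_def .
qed

text \<open>The 3 accounts for the three terms of the Rosenthal inequality, each estimated by the
  same p-th power; the root turns the moment constant into a norm constant.\<close>

definition kst :: "real => real" where "kst p = (3 * ros_const p) powr (1 / p)"

text \<open>Large enough for all labels at once: it covers the constants of the jump height, of its
  product with the root of the intensity, and of the drift. It is free of
  \<open>\<epsilon>\<close>.\<close>

definition klev :: "real => real => nat => real" where
 "klev c Cb j = (c ^ j + c\<^sup>2) * (1 + sqrt Cb / c) + Cb * (1 + c ^ (j - 2) + c ^ (j - 1))"

lemma klev_nonneg: "0 < c ==> 0 <= Cb ==> 0 <= klev c Cb j"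
 unfolding klev_def by (intro add_nonneg_nonneg mult_nonneg_nonneg) auto

fun cmom :: "real => real => real => (nat => nat set) => (nat => label) => nat => real" where
 "cmom p c Cb sg L 0 = 1"
| "cmom p c Cb sg L (Suc m) = kst p * klev c Cb (card (sg (Suc m))) * (cmom p c Cb sg L m * real (card (Padm m sg L)))"

lemma cmom_nonneg: "0 < c ==> 0 <= Cb ==> 0 <= cmom p c Cb sg L m"
 by (induction m) (auto simp: kst_def intro!: mult_nonneg_nonneg klev_nonneg)

section \<open>Scaling of the coefficients of one level\<close>

context spde_model
begin

lemma epow: "eps NN ^ n = eps NN powr real n" "a ^ n = c ^ n * eps NN powr (k * real n)"
 using e0 by (simp_all add: powr_realpow a_def power_mult_distrib powr_powr[symmetric])

text \<open>Lattice volume and jump size contribute \<open>d + k\<close> to the exponent of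
  \<open>\<epsilon>\<close> for each factor of the component; this is the weight of
  \<open>EInf\<close>.\<close>

lemma lb_le: "1 <= card (sg i) ==> lb sg L i <= (if L i = Nabla then 0 else (c ^ card (sg i) + c\<^sup>2) * eps NN powr ((real d + k) * real (card (sg i))))"
proof -
 assume j: "1 <= card (sg i)"
 define j where "j = card (sg i)"
 have wj: "wt NilL j <= j" using j unfolding j_def[symmetric] wt_def by (auto elim!: evenE)
 show ?thesis
 proof (cases "L i")
  case Nabla
  then show ?thesis by (simp add: lb_def cA_def)
 next
  case Diamond
  have "lb sg L i = c\<^sup>2 * (eps NN powr ((real d + k) * (real j - 1)) * (eps NN powr real d * eps NN powr (- k)) * eps NN powr (k * 2))"
   using Diamond unfolding lb_def j_def[symmetric] cA_def wt_def epow by simp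
  also have "... = c\<^sup>2 * eps NN powr ((real d + k) * real j)"
   unfolding powr_add[symmetric] by (simp add: algebra_simps)
  also have "... <= (c ^ j + c\<^sup>2) * eps NN powr ((real d + k) * real j)" using c0 by (intro mult_right_mono) auto
  finally show ?thesis using Diamond by (simp add: j_def)
 next
  case NilL
  have "lb sg L i = eps NN ^ (j * d) * a ^ j"
   using NilL wj unfolding lb_def j_def[symmetric] by (simp add: cA_def mult.assoc power_add[symmetric])
  also have "... = c ^ j * (eps NN powr real (j * d) * eps NN powr (k * real j))" unfolding epow by simp
  also have "... = c ^ j * eps NN powr ((real d + k) * real j)"
   unfolding powr_add[symmetric] by (simp add: algebra_simps)
  also have "... <= (c ^ j + c\<^sup>2) * eps NN powr ((real d + k) * real j)" by (intro mult_right_mono) auto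
  finally show ?thesis using NilL by (simp add: j_def)
 qed
qed

text \<open>The factor \<open>eps NN powr (- real d)\<close> turns a plain sum over sites into the
  normalized norm. Whenever there is a drift, the exponent is that of \<open>E1\<close>; the three
  summands of the constant belong to \<open>Nabla\<close>, to even and to odd sizes.\<close>

lemma lr_le:
 assumes j: "1 <= card (sg i)"
 shows "lr sg L i * eps NN powr (- real d) <= (if L i = Diamond \<or> (L i = NilL & card (sg i) = 1) then 0 else
   (Cb * (1 + c ^ (card (sg i) - 2) + c ^ (card (sg i) - 1))) * eps NN powr ((real d + k) * (real (card (sg i)) - 2)))"
proof -
 define j where "j = card (sg i)"
 have j1: "1 <= j" using j by (simp add: j_def)
 define E where "E = eps NN powr ((real d + k) * (real j - 2))"
 have le: "Cb * z * E <= (Cb * (1 + c ^ (j - 2) + c ^ (j - 1))) * E" if "z <= 1 + c ^ (j - 2) + c ^ (j - 1)" for z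
  using that Cb0 by (intro mult_right_mono mult_left_mono) (auto simp: E_def)
 have p: "0 <= c ^ n" for n using c0 by simp
 have g: "lr sg L i * eps NN powr (- real d) <= (Cb * (1 + c ^ (j - 2) + c ^ (j - 1))) * E" if "L i ~= Diamond" "\<not> (L i = NilL & j = 1)"
 proof (cases "L i")
  case Nabla
  have "lr sg L i * eps NN powr (- real d) = Cb * (eps NN powr ((real d + k) * (real j - 2)) * (eps NN powr real d * eps NN powr real d) * eps NN powr (- real d) * eps NN powr (- real d))"
   using Nabla unfolding lr_def j_def[symmetric] cR_def wt_def epow Bth_def by simp
  also have "... = Cb * 1 * E" unfolding powr_add[symmetric] E_def by (simp add: algebra_simps)
  also have "... <= (Cb * (1 + c ^ (j - 2) + c ^ (j - 1))) * E" using p[of "j - 2"] p[of "j - 1"] by (intro le) simp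
  finally show ?thesis .
 next
  case Diamond
  then show ?thesis using that by simp
 next
  case NilL
  then have j2: "2 <= j" using that j1 by simp
  show ?thesis
  proof (cases "odd j")
   case True
   have "lr sg L i * eps NN powr (- real d) = Cb * c ^ (j - 1) * (eps NN powr real (j * d) * eps NN powr (k * real (j - 1)) * eps NN powr (- k - real d) * eps NN powr (- real d))"
    using NilL True j2 unfolding lr_def j_def[symmetric] cR_def cA_def wt_def epow Bth_def by simp
   also have "... = Cb * c ^ (j - 1) * E" unfolding powr_add[symmetric] E_def using j2 by (simp add: algebra_simps of_nat_diff)
   also have "... <= (Cb * (1 + c ^ (j - 2) + c ^ (j - 1))) * E" using p[of "j - 2"] by (intro le) simp
   finally show ?thesis .
  next
   case False
   have "lr sg L i * eps NN powr (- real d) = Cb * c ^ (j - 2) * (eps NN powr real (j * d) * eps NN powr (k * real (j - 2)) * eps NN powr (- real d) * eps NN powr (- real d))"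
    using NilL False j2 unfolding lr_def j_def[symmetric] cR_def cA_def wt_def epow Bth_def by simp
   also have "... = Cb * c ^ (j - 2) * E" unfolding powr_add[symmetric] E_def using j2 by (simp add: algebra_simps of_nat_diff)
   also have "... <= (Cb * (1 + c ^ (j - 2) + c ^ (j - 1))) * E" using p[of "j - 1"] by (intro le) simp
   finally show ?thesis .
  qed
 qed
 show ?thesis
 proof (cases "L i = Diamond \<or> (L i = NilL & card (sg i) = 1)")
  case True
  then have "lr sg L i = 0" by (auto simp: lr_def cR_def)
  with True show ?thesis by simp
 next
  case False
  then show ?thesis using g by (auto simp: j_def E_def)
 qed
qed

text \<open>The intensity per normalized volume is of order \<open>\<epsilon>^(-2(d+k))\<close>, and
  its root is the ratio of the weights of \<open>E2\<close> and \<open>EInf\<close>.\<close>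

lemma sqrt_lamb: "sqrt (lamb * eps NN powr (- real d)) = sqrt Cb / c * eps NN powr (- (real d + k))"
proof -
 have "lamb * eps NN powr (- real d) = Cb / c\<^sup>2 * (eps NN powr (- (real d + k)))\<^sup>2"
 proof -
  have "a\<^sup>2 = c\<^sup>2 * eps NN powr (k * 2)" using epow(2)[of 2] by simp
  moreover have "(eps NN powr (- (real d + k)))\<^sup>2 * eps NN powr (k * 2) = eps NN powr (- real d) * eps NN powr (- real d)"
   unfolding power2_eq_square powr_add[symmetric] by (simp add: algebra_simps)
  ultimately show ?thesis unfolding lamb_def using c0 e0 by (simp add: field_simps)
 qed
 then show ?thesis using c0 by (simp add: real_sqrt_mult real_sqrt_divide)
qed

text \<open>A coefficient vanishes whenever its exponent is not admissible: there is no drift for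
  \<open>Diamond\<close> or for \<open>NilL\<close> with size 1, and no jump part for
  \<open>Nabla\<close>. The hypothesis on odd sizes excludes \<open>Nabla\<close> for size 1, where
  no exponent would be admissible.\<close>

lemma level_coeffs:
 assumes j: "1 <= card (sg i)" and odd: "odd (card (sg i)) ==> L i = NilL" and A: "!!q. 0 <= A q"
 shows "lr sg L i * eps NN powr (- real d) * A E1 + lb sg L i * sqrt (lamb * eps NN powr (- real d)) * A E2 + lb sg L i * A EInf
  <= klev c Cb (card (sg i)) * (\<Sum>q\<in>Al (L i) (card (sg i)). eps NN powr ((real d + k) * (real (card (sg i)) - wq q)) * A q)"
proof -
 define j where "j = card (sg i)"
 define e where "e q = eps NN powr ((real d + k) * (real j - wq q))" for q
 define X where "X = Al (L i) j"
 have K: "(c ^ j + c\<^sup>2) * (sqrt Cb / c) <= klev c Cb j" "c ^ j + c\<^sup>2 <= klev c Cb j" "Cb * (1 + c ^ (j - 2) + c ^ (j - 1)) <= klev c Cb j"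
 proof -
  have "0 <= (c ^ j + c\<^sup>2) * (sqrt Cb / c)" "0 <= c ^ j + c\<^sup>2" "0 <= Cb * (1 + c ^ (j - 2) + c ^ (j - 1))"
   using c0 Cb0 by (auto intro!: mult_nonneg_nonneg add_nonneg_nonneg divide_nonneg_nonneg)
  then show "(c ^ j + c\<^sup>2) * (sqrt Cb / c) <= klev c Cb j" "c ^ j + c\<^sup>2 <= klev c Cb j" "Cb * (1 + c ^ (j - 2) + c ^ (j - 1)) <= klev c Cb j"
   unfolding klev_def distrib_left[of "c ^ j + c\<^sup>2"] by simp_all
 qed
 have K0: "0 <= klev c Cb j" by (rule klev_nonneg[OF c0 Cb0])
 have eA: "0 <= e q * A q" for q using A by (simp add: e_def)
 have 1: "lr sg L i * eps NN powr (- real d) * A E1 <= (if E1 \<in> X then klev c Cb j * (e E1 * A E1) else 0)"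
 proof (cases "E1 \<in> X")
  case True
  have "lr sg L i * eps NN powr (- real d) <= (Cb * (1 + c ^ (j - 2) + c ^ (j - 1))) * e E1"
   using lr_le[where sg=sg and i=i and L=L, OF j] True by (auto simp: X_def Al_def j_def e_def wq_def)
  also have "... <= klev c Cb j * e E1" by (intro mult_right_mono K) (simp add: e_def)
  finally show ?thesis using True A[of E1] mult_right_mono[of "lr sg L i * eps NN powr (- real d)" "klev c Cb j * e E1" "A E1"] by (simp add: mult.assoc)
 next
  case False
  then have "L i = Diamond \<or> (L i = NilL & card (sg i) = 1)" using odd by (auto simp: X_def Al_def j_def)
  then have "lr sg L i = 0" by (auto simp: lr_def cR_def)
  then show ?thesis using False by simp
 qed
 have lb: "lb sg L i <= (c ^ j + c\<^sup>2) * e EInf" "lb sg L i = 0 \<or> (E2 \<in> X & EInf \<in> X)"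
  using lb_le[where sg=sg and i=i and L=L, OF j] j c0 by (auto simp: j_def e_def wq_def X_def Al_def lb_def cA_def split: if_splits label.splits) 
 have 2: "lb sg L i * sqrt (lamb * eps NN powr (- real d)) * A E2 <= (if E2 \<in> X then klev c Cb j * (e E2 * A E2) else 0)"
 proof (cases "lb sg L i = 0")
  case True
  then show ?thesis using K0 eA[of E2] by simp
 next
  case False
  have "lb sg L i * sqrt (lamb * eps NN powr (- real d)) <= (c ^ j + c\<^sup>2) * e EInf * sqrt (lamb * eps NN powr (- real d))"
   using lamb0 by (intro mult_right_mono lb) simp
  also have "... = (c ^ j + c\<^sup>2) * (sqrt Cb / c) * (e EInf * eps NN powr (- (real d + k)))" unfolding sqrt_lamb by simp
  also have "e EInf * eps NN powr (- (real d + k)) = e E2" unfolding e_def powr_add[symmetric] by (simp add: wq_def algebra_simps)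
  also have "(c ^ j + c\<^sup>2) * (sqrt Cb / c) * e E2 <= klev c Cb j * e E2" by (intro mult_right_mono K) (simp add: e_def)
  finally show ?thesis using False lb(2) A[of E2] mult_right_mono[of "lb sg L i * sqrt (lamb * eps NN powr (- real d))" "klev c Cb j * e E2" "A E2"] by (simp add: mult.assoc)
 qed
 have 3: "lb sg L i * A EInf <= (if EInf \<in> X then klev c Cb j * (e EInf * A EInf) else 0)"
 proof (cases "lb sg L i = 0")
  case True
  then show ?thesis using K0 eA[of EInf] by simp
 next
  case False
  have "lb sg L i <= klev c Cb j * e EInf" by (rule order.trans[OF lb(1) mult_right_mono[OF K(2)]]) (simp add: e_def)
  then show ?thesis using False lb(2) A[of EInf] mult_right_mono[of "lb sg L i" "klev c Cb j * e EInf" "A EInf"] by (simp add: mult.assoc)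
 qed
 have "(\<Sum>q\<in>X. e q * A q) = (\<Sum>q\<in>{E1, E2, EInf}. if q \<in> X then e q * A q else 0)"
  by (rule sum.mono_neutral_cong_left) (auto simp: X_def Al_def)
 then have "klev c Cb j * (\<Sum>q\<in>X. e q * A q) = (if E1 \<in> X then klev c Cb j * (e E1 * A E1) else 0) + (if E2 \<in> X then klev c Cb j * (e E2 * A E2) else 0) + (if EInf \<in> X then klev c Cb j * (e EInf * A EInf) else 0)"
  by (simp add: distrib_left)
 with 1 2 3 show ?thesis unfolding j_def[symmetric] X_def[symmetric] e_def[symmetric] by linarith
qed

text \<open>Rosenthal's inequality in terms of \<open>lqnorm\<close>. Since \<open>g\<close>
  vanishes from \<open>t\<close> on, integrals up to \<open>t\<close> are norms over
  \<open>[0,T]\<close>. The p-th power term is interpolated between the \<open>EInf\<close> and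
  \<open>E2\<close> norms, giving \<open>Y2^2 * Y3^(p-2)\<close>, so that no further exponent
  appears.\<close>

lemma step_moment:
 assumes p: "2 <= p" and H: "!!x. x \<in> Lam NN d ==> nice (H x)" and \<xi>: "mark \<xi> b" and ze: "drift ze b'"
  and comp: "compensates ze \<xi>" and rh: "drift rh r" and T: "0 <= T" "T <= 1" and t: "0 <= t" "t <= T"
  and g: "!!x s. x \<in> Lam NN d ==> 0 <= s ==> s <= T ==> 0 <= g (s, x) & g (s, x) <= B"
  and gE: "!!x s. x \<in> Lam NN d ==> 0 <= s ==> s < t ==> (\<integral>om. \<bar>H x s om\<bar> powr p \<partial>P) <= g (s, x) powr p"
  and gz: "!!x s. x \<in> Lam NN d ==> t <= s ==> g (s, x) = 0"
  and gm: "!!x. x \<in> Lam NN d ==> (%s. indicator {0..T} s * g (s, x)) \<in> borel_measurable borel"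
 shows "(\<integral>om. \<bar>msum \<xi> ze H t om + dsum rh H t om\<bar> powr p \<partial>P) \<le>
  (kst p * (r * eps NN powr (- real d) * lqnorm NN d T E1 g + b * sqrt (lamb * eps NN powr (- real d)) * lqnorm NN d T E2 g + b * lqnorm NN d T EInf g)) powr p"
proof -
 define A where "A q = lqnorm NN d T q g" for q
 define S1 where "S1 = (\<Sum>x\<in>Lam NN d. LBINT s:{0..t}. g (s, x))"
 define S2 where "S2 = (\<Sum>x\<in>Lam NN d. LBINT s:{0..t}. (g (s, x))\<^sup>2)"
 define Sp where "Sp = (\<Sum>x\<in>Lam NN d. LBINT s:{0..t}. g (s, x) powr p)"
 have b0: "0 <= b" "0 <= r" using \<xi> rh by (simp_all add: mark_def drift_def)
 have A0: "0 <= A q" for q unfolding A_def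
  using lqnorm_bounds(1)[OF N1 T, of d g B q] g by (simp add: abs_of_nonneg)
 have gi: "set_integrable lborel {0..t} (%s. g (s, x))" "set_integrable lborel {0..t} (%s. (g (s, x))\<^sup>2)"
  "set_integrable lborel {0..t} (%s. g (s, x) powr p)" if x: "x \<in> Lam NN d" for x
 proof -
  have "set_integrable lborel {0..T} (%s. g (s, x))"
   by (rule set_integrable_bounded[OF gm[OF x], of B]) (use g[OF x] in auto)
  then show "set_integrable lborel {0..t} (%s. g (s, x))" by (rule set_integrable_subset) (use t in auto)
  have "(%s. (indicator {0..T} s * g (s, x))\<^sup>2) \<in> borel_measurable borel" using gm[OF x] by measurable
  moreover have "(indicator {0..T} s * g (s, x))\<^sup>2 = indicator {0..T} s * (g (s, x))\<^sup>2" for s by (simp add: indicator_def)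
  ultimately have "set_integrable lborel {0..T} (%s. (g (s, x))\<^sup>2)"
   by (intro set_integrable_bounded[of _ _ "B\<^sup>2"]) (use g[OF x] in \<open>auto intro!: power_mono\<close>)
  then show "set_integrable lborel {0..t} (%s. (g (s, x))\<^sup>2)" by (rule set_integrable_subset) (use t in auto)
  have "(%s. (indicator {0..T} s * g (s, x)) powr p) \<in> borel_measurable borel" using gm[OF x] by measurable
  moreover have "(indicator {0..T} s * g (s, x)) powr p = indicator {0..T} s * g (s, x) powr p" for s by (simp add: indicator_def)
  ultimately have "set_integrable lborel {0..T} (%s. g (s, x) powr p)"
   by (intro set_integrable_bounded[of _ _ "B powr p"]) (use g[OF x] p in \<open>auto intro!: powr_mono2\<close>)
  then show "set_integrable lborel {0..t} (%s. g (s, x) powr p)" by (rule set_integrable_subset) (use t in auto)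
 qed
 have R: "(\<integral>om. \<bar>msum \<xi> ze H t om + dsum rh H t om\<bar> powr p \<partial>P) <= ros_const p * ((r * S1) powr p + (lamb * b\<^sup>2 * S2) powr (p / 2) + lamb * b powr p * Sp)"
  unfolding S1_def S2_def Sp_def
  by (rule rosenthal[OF p H \<xi> ze comp rh, where g="%x s. g (s, x)"]) (use g gE gi t T in auto)
 define u where "u = eps NN powr (- real d)"
 have u: "u * eps NN ^ d = 1" "0 < u" using e0 by (simp_all add: u_def powr_minus powr_realpow)
 have A1: "eps NN ^ d * S1 = A E1"
 proof -
  have "(LBINT s:{0..t}. g (s, x)) = (LBINT s:{0..T}. \<bar>g (s, x)\<bar>)" if x: "x \<in> Lam NN d" for x
  proof -
   have "(LBINT s:{0..t}. g (s, x)) = (LBINT s:{0..T}. g (s, x))" by (rule LBINT_cut) (use gz[OF x] t in auto)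
   also have "... = (LBINT s:{0..T}. \<bar>g (s, x)\<bar>)" by (rule set_lebesgue_integral_cong) (use g[OF x] in auto)
   finally show ?thesis .
  qed
  then show ?thesis by (simp add: S1_def A_def lqnorm_def)
 qed
 have S20: "0 <= S2" unfolding S2_def set_lebesgue_integral_def by (intro sum_nonneg integral_nonneg_AE AE_I2) simp
 have A2: "eps NN ^ d * S2 = (A E2)\<^sup>2"
 proof -
  have "(LBINT s:{0..t}. (g (s, x))\<^sup>2) = (LBINT s:{0..T}. (g (s, x))\<^sup>2)" if x: "x \<in> Lam NN d" for x
   by (rule LBINT_cut) (use gz[OF x] t in auto)
  then have "A E2 = sqrt (eps NN ^ d * S2)" by (simp add: S2_def A_def lqnorm_def)
  then show ?thesis using S20 e0 by simp
 qed
 have gA: "g (s, x) <= A EInf" if "x \<in> Lam NN d" "s \<in> {0..t}" for s x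
 proof -
  have "\<bar>g (s, x)\<bar> <= Sup {\<bar>g (s, x)\<bar> | s x. s \<in> {0..T} & x \<in> Lam NN d}"
  proof (rule cSup_upper)
   show "bdd_above {\<bar>g (s, x)\<bar> | s x. s \<in> {0..T} & x \<in> Lam NN d}" by (rule bdd_aboveI[of _ B]) (use g in auto)
   show "\<bar>g (s, x)\<bar> \<in> {\<bar>g (s, x)\<bar> | s x. s \<in> {0..T} & x \<in> Lam NN d}"
    using that t by (intro CollectI exI[of _ s] exI[of _ x]) auto
  qed
  then show ?thesis by (simp add: A_def lqnorm_def)
 qed
 have Sp: "Sp <= A EInf powr (p - 2) * S2"
  unfolding Sp_def S2_def sum_distrib_left
 proof (rule sum_mono)
  fix x assume x: "x \<in> Lam NN d"
  have "(LBINT s:{0..t}. g (s, x) powr p) <= (LBINT s:{0..t}. A EInf powr (p - 2) * (g (s, x))\<^sup>2)"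
  proof (rule set_integral_mono[OF gi(3)[OF x]])
   show "set_integrable lborel {0..t} (%s. A EInf powr (p - 2) * (g (s, x))\<^sup>2)" using gi(2)[OF x] by simp
   fix s assume s: "s \<in> {0..t}"
   show "g (s, x) powr p <= A EInf powr (p - 2) * (g (s, x))\<^sup>2"
   proof (cases "g (s, x) = 0")
    case False
    then have pos: "0 < g (s, x)" using g[OF x, of s] s t by auto
    then have "g (s, x) powr p = g (s, x) powr (p - 2) * (g (s, x))\<^sup>2"
     by (simp add: powr_diff)
    also have "... <= A EInf powr (p - 2) * (g (s, x))\<^sup>2"
     using p pos gA[OF x s] by (intro mult_right_mono powr_mono2) auto
    finally show ?thesis .
   qed simp
  qed
  then show "(LBINT s:{0..t}. g (s, x) powr p) <= A EInf powr (p - 2) * (LBINT s:{0..t}. (g (s, x))\<^sup>2)" by simp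
 qed
 define Y1 Y2 Y3 where "Y1 = r * u * A E1" and "Y2 = b * sqrt (lamb * u) * A E2" and "Y3 = b * A EInf"
 define Y where "Y = Y1 + Y2 + Y3"
 have Y0: "0 <= Y1" "0 <= Y2" "0 <= Y3"
  unfolding Y1_def Y2_def Y3_def using b0 A0 u lamb0 by (auto intro!: mult_nonneg_nonneg)
 have S1': "S1 = u * A E1" unfolding A1[symmetric] using u(1) by (simp add: mult.assoc[symmetric])
 have S2': "S2 = u * (A E2)\<^sup>2" unfolding A2[symmetric] using u(1) by (simp add: mult.assoc[symmetric])
 have y2: "lamb * b\<^sup>2 * S2 = Y2\<^sup>2"
  unfolding S2' Y2_def power_mult_distrib using lamb0 u by (simp add: mult_ac)
 have t1: "(r * S1) powr p <= Y powr p"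
  unfolding S1' using p Y0 by (intro powr_mono2) (auto simp: Y_def Y1_def mult.assoc)
 have t2: "(lamb * b\<^sup>2 * S2) powr (p / 2) <= Y powr p"
 proof -
  have "(Y2\<^sup>2) powr (p / 2) = Y2 powr p"
   using powr_powr[of Y2 2 "p / 2"] Y0(2) by simp
  also have "... <= Y powr p" using p Y0 by (intro powr_mono2) (auto simp: Y_def)
  finally show ?thesis unfolding y2 .
 qed
 have t3: "lamb * b powr p * Sp <= Y powr p"
 proof (cases "b = 0 \<or> Y = 0")
  case True
  then have "b = 0 \<or> (Y2 = 0 & Y3 = 0)" using Y0 by (auto simp: Y_def)
  then show ?thesis
  proof
   assume "Y2 = 0 & Y3 = 0"
   show ?thesis
   proof (cases "b = 0")
    case False
    then have "A EInf = 0" using \<open>Y2 = 0 & Y3 = 0\<close> by (simp add: Y3_def)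
    then have "Sp <= 0" using Sp by simp
    then have "lamb * b powr p * Sp <= 0" using lamb0 by (intro mult_nonneg_nonpos) auto
    then show ?thesis using powr_ge_zero[of Y p] by linarith
   qed simp
  qed simp
 next
  case False
  then have bp: "0 < b" "0 < Y" using b0 Y0 by (auto simp: Y_def)
  have "lamb * b powr p * Sp <= lamb * b powr p * (A EInf powr (p - 2) * S2)" using lamb0 by (intro mult_left_mono Sp) auto
  also have "lamb * b powr p * (A EInf powr (p - 2) * S2) = (lamb * b\<^sup>2 * S2) * (b powr (p - 2) * A EInf powr (p - 2))"
   using bp by (simp add: powr_diff)
  also have "... = Y2\<^sup>2 * Y3 powr (p - 2)" unfolding y2 Y3_def using b0 A0 by (simp add: powr_mult)
  also have "... <= Y\<^sup>2 * Y powr (p - 2)" using p Y0 by (intro mult_mono power_mono powr_mono2) (auto simp: Y_def)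
  also have "... = Y powr p" using bp by (simp add: powr_diff)
  finally show ?thesis .
 qed
 have R0: "0 <= ros_const p" by (rule ros_const_nonneg[OF p])
 note R
 also have "ros_const p * ((r * S1) powr p + (lamb * b\<^sup>2 * S2) powr (p / 2) + lamb * b powr p * Sp) <= ros_const p * (3 * Y powr p)"
  by (rule mult_left_mono[OF _ R0]) (use t1 t2 t3 in linarith)
 also have "... = (kst p * Y) powr p"
 proof -
  have "kst p powr p = 3 * ros_const p" unfolding kst_def using p R0 by (simp add: powr_powr)
  then show ?thesis using Y0 by (simp add: powr_mult Y_def kst_def)
 qed
 finally show ?thesis unfolding Y_def Y1_def Y2_def Y3_def u_def A_def .
qed

end

section \<open>Induction over the levels and the supremum in time\<close>

context spde_model
begin

text \<open>The inductive bound for the \<open>L^p\<close> norm of the inner integral, as a function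
  of the last point \<open>z\<close>. The cut at \<open>t\<close> matches the one in
  \<open>mn\<close>.\<close>

definition gcut :: "real => (nat => nat set) => (nat => label) => real => nat => real => (tuple => real) => point => real" where
 "gcut p sg L T m t G z = (if fst z < t then cmom p c Cb sg L m * mbound NN d k sg L T m (fst z) (sect m G (snd z) (fst z)) else 0)"

lemma gcut_facts:
 assumes T: "0 <= T" "T <= 1" and G: "gcont (Lam NN d) (Suc m) B G"
 shows "\<exists>B'. \<forall>x\<in>Lam NN d. \<forall>s. 0 <= s --> s <= T --> 0 <= gcut p sg L T m t G (s, x) & gcut p sg L T m t G (s, x) <= B'"
  and "x \<in> Lam NN d ==> (%s. indicator {0..T} s * gcut p sg L T m t G (s, x)) \<in> borel_measurable borel"
proof -
 have C: "0 <= cmom p c Cb sg L m" by (rule cmom_nonneg[OF c0 Cb0])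
 have B: "0 <= B" by (rule gcontD(1)[OF G])
 have S0: "0 <= (\<Sum>pp\<in>Padm m sg L. eps NN powr alpha d k m sg pp * B)" by (intro sum_nonneg mult_nonneg_nonneg B) simp
 show "\<exists>B'. \<forall>x\<in>Lam NN d. \<forall>s. 0 <= s --> s <= T --> 0 <= gcut p sg L T m t G (s, x) & gcut p sg L T m t G (s, x) <= B'"
 proof (intro exI ballI allI impI)
  fix x s assume x: "x \<in> Lam NN d" and s: "0 <= s" "s <= T"
  have gs: "gcont (Lam NN d) m B (sect m G x s)" by (rule gcont_sect[OF G]) (use s T x in auto)
  have "mbound NN d k sg L T m s (sect m G x s) <= (\<Sum>pp\<in>Padm m sg L. eps NN powr alpha d k m sg pp * B)"
   unfolding mbound_def by (intro sum_mono mult_left_mono mn_bounds(2)[OF N1 T gs]) simp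
  then show "0 <= gcut p sg L T m t G (s, x) & gcut p sg L T m t G (s, x) <= cmom p c Cb sg L m * (\<Sum>pp\<in>Padm m sg L. eps NN powr alpha d k m sg pp * B)"
   using C S0 mbound_nonneg[OF N1 T gs] by (auto simp: gcut_def intro!: mult_left_mono mult_nonneg_nonneg)
 qed
 assume x: "x \<in> Lam NN d"
 have "(%s. indicator {..<t} s * (cmom p c Cb sg L m * (\<Sum>pp\<in>Padm m sg L. eps NN powr alpha d k m sg pp * (indicator {0..T} s * mn NN d T pp m s (sect m G x s))))) \<in> borel_measurable borel"
  using mn_sect_measurable[OF N1 T G x] by measurable
 then show "(%s. indicator {0..T} s * gcut p sg L T m t G (s, x)) \<in> borel_measurable borel"
  by (rule measurable_cong[THEN iffD1, rotated]) (auto simp: gcut_def mbound_def indicator_def sum_distrib_left)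
qed

lemma level_bound:
 assumes T: "0 <= T" "T <= 1" and G: "gcont (Lam NN d) (Suc m) B G" and p: "2 <= p"
  and j: "1 <= card (sg (Suc m))" and odd: "odd (card (sg (Suc m))) ==> L (Suc m) = NilL"
  and A: "A = (%q. lqnorm NN d T q (gcut p sg L T m t G))"
 shows "0 <= A q" and "kst p * (lr sg L (Suc m) * eps NN powr (- real d) * A E1 + lb sg L (Suc m) * sqrt (lamb * eps NN powr (- real d)) * A E2 + lb sg L (Suc m) * A EInf)
  <= cmom p c Cb sg L (Suc m) * mbound NN d k sg L T (Suc m) t G"
proof -
 obtain B' where B': "\<forall>x\<in>Lam NN d. \<forall>s. 0 <= s --> s <= T --> 0 <= gcut p sg L T m t G (s, x) & gcut p sg L T m t G (s, x) <= B'"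
  using gcut_facts(1)[OF T G] by blast
 have A0: "0 <= A q" for q unfolding A by (rule lqnorm_bounds(1)[OF N1 T, of _ _ B']) (use B' in \<open>auto simp: abs_of_nonneg\<close>)
 then show "0 <= A q" .
 let ?j = "card (sg (Suc m))"
 have C: "0 <= cmom p c Cb sg L m" by (rule cmom_nonneg[OF c0 Cb0])
 have k0: "0 <= kst p" by (simp add: kst_def)
 have "lr sg L (Suc m) * eps NN powr (- real d) * A E1 + lb sg L (Suc m) * sqrt (lamb * eps NN powr (- real d)) * A E2 + lb sg L (Suc m) * A EInf
  <= klev c Cb ?j * (\<Sum>q\<in>Al (L (Suc m)) ?j. eps NN powr ((real d + k) * (real ?j - wq q)) * A q)"
  by (rule level_coeffs[where sg=sg and i="Suc m" and L=L and A=A, OF j odd A0])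
 also have "... <= klev c Cb ?j * (cmom p c Cb sg L m * real (card (Padm m sg L)) * mbound NN d k sg L T (Suc m) t G)"
  using mbound_Suc[OF N1 T G C, where k=k and L=L and sg=sg and t=t]
  by (intro mult_left_mono klev_nonneg[OF c0 Cb0]) (simp add: A gcut_def[abs_def])
 finally show "kst p * (lr sg L (Suc m) * eps NN powr (- real d) * A E1 + lb sg L (Suc m) * sqrt (lamb * eps NN powr (- real d)) * A E2 + lb sg L (Suc m) * A EInf)
  <= cmom p c Cb sg L (Suc m) * mbound NN d k sg L T (Suc m) t G"
  using mult_left_mono[OF _ k0] by (fastforce simp: mult.assoc)
qed

text \<open>Induction on the levels with \<open>G\<close> and \<open>t\<close> arbitrary, because
  the inner integral is needed for every section and up to every time \<open>s\<close>.\<close>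

lemma It_moment:
 assumes p: "2 <= p" and T: "0 <= T" "T <= 1"
 shows "(!!i. i \<in> {1..m} ==> 1 <= card (sg i)) ==> (!!i. i \<in> {1..m} ==> odd (card (sg i)) ==> L i = NilL) ==>
  gcont (Lam NN d) m B G ==> 0 <= t ==> t <= T ==>
  (\<integral>om. \<bar>iterated.It (Lam NN d) SS (lxi sg L) (lze sg L) (lrh sg L) m G t om\<bar> powr p \<partial>P) <= (cmom p c Cb sg L m * mbound NN d k sg L T m t G) powr p"
proof -
 interpret iterated P Fl "Lam NN d" SS lamb "lxi sg L" "lze sg L" "lrh sg L" "lb sg L" "lr sg L" "lbz sg L"
  by (rule iterated_lev)
 show "(!!i. i \<in> {1..m} ==> 1 <= card (sg i)) ==> (!!i. i \<in> {1..m} ==> odd (card (sg i)) ==> L i = NilL) ==>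
  gcont (Lam NN d) m B G ==> 0 <= t ==> t <= T ==> (\<integral>om. \<bar>It m G t om\<bar> powr p \<partial>P) <= (cmom p c Cb sg L m * mbound NN d k sg L T m t G) powr p"
 proof (induction m arbitrary: G t)
  case 0
  \<comment> \<open>With no variables there is a single exponent function, the one that is
    \<open>undefined\<close> everywhere, and its weight is 1.\<close>
  have "Padm 0 sg L = {%_. undefined}" by (auto simp: Padm_def)
  then have "mbound NN d k sg L T 0 t G = \<bar>G (%_. base0)\<bar>"
   using e0 by (simp add: mbound_def alpha_eq)
  then show ?case by (simp add: prob_space)
 next
  case (Suc m)
  note G = Suc.prems(3)
  have j: "1 <= card (sg (Suc m))" by (rule Suc.prems(1)) simp
  have odd: "odd (card (sg (Suc m))) ==> L (Suc m) = NilL" by (rule Suc.prems(2)) simp_all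
  obtain B' where B': "\<forall>x\<in>Lam NN d. \<forall>s. 0 <= s --> s <= T --> 0 <= gcut p sg L T m t G (s, x) & gcut p sg L T m t G (s, x) <= B'"
   using gcut_facts(1)[OF T G] by blast
  let ?g = "gcut p sg L T m t G"
  have "(\<integral>om. \<bar>It (Suc m) G t om\<bar> powr p \<partial>P) <= (kst p * (lr sg L (Suc m) * eps NN powr (- real d) * lqnorm NN d T E1 ?g
    + lb sg L (Suc m) * sqrt (lamb * eps NN powr (- real d)) * lqnorm NN d T E2 ?g + lb sg L (Suc m) * lqnorm NN d T EInf ?g)) powr p"
   unfolding It.simps(2)
  proof (rule step_moment[OF p _ mk dz comp dr T Suc.prems(4,5)])
   show "nice (%s om. It m (sect m G x s) s om)" if "x \<in> Lam NN d" for x by (rule It_sect_nice[OF G that])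
   show "(\<integral>om. \<bar>It m (sect m G x s) s om\<bar> powr p \<partial>P) <= ?g (s, x) powr p" if x: "x \<in> Lam NN d" and s: "0 <= s" "s < t" for x s
   proof -
    have "gcont (Lam NN d) m B (sect m G x s)" by (rule gcont_sect[OF G]) (use s T Suc.prems x in auto)
    from Suc.IH[OF _ _ this s(1)] Suc.prems s show ?thesis by (simp add: gcut_def)
   qed
   show "0 <= ?g (s, x) & ?g (s, x) <= B'" if "x \<in> Lam NN d" "0 <= s" "s <= T" for x s using B' that by blast
   show "?g (s, x) = 0" if "t <= s" for s x using that by (simp add: gcut_def)
   show "(%s. indicator {0..T} s * ?g (s, x)) \<in> borel_measurable borel" if "x \<in> Lam NN d" for x by (rule gcut_facts(2)[OF T G that])
  qed simp_all
  also have "... <= (cmom p c Cb sg L (Suc m) * mbound NN d k sg L T (Suc m) t G) powr p"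
  proof (rule powr_mono2)
   show "0 <= kst p * (lr sg L (Suc m) * eps NN powr (- real d) * lqnorm NN d T E1 ?g
    + lb sg L (Suc m) * sqrt (lamb * eps NN powr (- real d)) * lqnorm NN d T E2 ?g + lb sg L (Suc m) * lqnorm NN d T EInf ?g)"
    using level_bound(1)[where sg=sg and L=L and t=t, OF T G p j odd refl] bounds_nonneg(1,3)[of "Suc m"] lamb0
    by (intro mult_nonneg_nonneg add_nonneg_nonneg) (auto simp: kst_def)
  qed (use p level_bound(2)[where sg=sg and L=L and t=t, OF T G p j odd refl] in auto)
  finally show ?case .
 qed
qed

lemma add_powr_le:
 assumes "0 <= x" "0 <= y" "0 <= (q::real)" shows "(x + y) powr q <= 2 powr q * (x powr q + y powr q)"
proof -
 have "(x + y) powr q <= (2 * max x y) powr q" using assms by (intro powr_mono2) auto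
 also have "... = 2 powr q * max x y powr q" using assms by (simp add: powr_mult)
 also have "... <= 2 powr q * (x powr q + y powr q)" by (intro mult_left_mono) (auto simp: max_def)
 finally show ?thesis .
qed

text \<open>Only the outermost level has to cope with the supremum. Its martingale part is
  controlled by \<open>doob_sup\<close>, its drift part by the integral \<open>D\<close> of absolute
  values up to \<open>T\<close>, which does not depend on \<open>t\<close>. Each part is estimated
  with the other one set to 0, so both obey the bound \<open>Y\<close>.\<close>

lemma Ilab_sup_moment:
 assumes p: "2 <= p" and T: "0 <= T" "T <= 1" and sg: "!!i. i \<in> {1..Suc m} ==> 1 <= card (sg i)"
  and odd: "!!i. i \<in> {1..Suc m} ==> odd (card (sg i)) ==> L i = NilL" and G: "gcont (Lam NN d) (Suc m) B G"
 shows "(\<integral>\<^sup>+om. ennreal (\<bar>Sup {\<bar>Ilab NN d k (%x r. M x r om) (%s x. Cc s x om) (%s x. Ctt s x om) sg L (Suc m) G t\<bar> | t. t \<in> {0..T}}\<bar> powr p) \<partial>P)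
  <= ennreal (2 powr p * (doob_const p + 1) * (cmom p c Cb sg L (Suc m) * mbound NN d k sg L T (Suc m) T G) powr p)"
proof -
 interpret iterated P Fl "Lam NN d" SS lamb "lxi sg L" "lze sg L" "lrh sg L" "lb sg L" "lr sg L" "lbz sg L"
  by (rule iterated_lev)
 define H where "H x s om = It m (sect m G x s) s om" for x s om
 define \<xi> ze rh where "\<xi> = lxi sg L (Suc m)" and "ze = lze sg L (Suc m)" and "rh = lrh sg L (Suc m)"
 define b r where "b = lb sg L (Suc m)" and "r = lr sg L (Suc m)"
 define Y where "Y = cmom p c Cb sg L (Suc m) * mbound NN d k sg L T (Suc m) T G"
 let ?g = "gcut p sg L T m T G"
 define A where "A = (%q. lqnorm NN d T q ?g)"
 have nH: "nice (H x)" if "x \<in> Lam NN d" for x unfolding H_def[abs_def] by (rule It_sect_nice[OF G that])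
 have mk': "mark \<xi> b" and dz': "drift ze (lbz sg L (Suc m))" and dr': "drift rh r" and co': "compensates ze \<xi>"
  unfolding \<xi>_def ze_def rh_def b_def r_def by (simp_all add: mk dz dr comp)
 have j: "1 <= card (sg (Suc m))" and odd': "odd (card (sg (Suc m))) ==> L (Suc m) = NilL"
  using sg[of "Suc m"] odd[of "Suc m"] by auto
 have A0: "0 <= A q" for q by (rule level_bound(1)[where sg=sg and L=L and t=T, OF T G p j odd' A_def])
 have br: "0 <= b" "0 <= r" using bounds_nonneg[of "Suc m"] by (simp_all add: b_def r_def)
 obtain B' where B': "\<forall>x\<in>Lam NN d. \<forall>s. 0 <= s --> s <= T --> 0 <= ?g (s, x) & ?g (s, x) <= B'"
  using gcut_facts(1)[OF T G] by blast
 have gE: "(\<integral>om. \<bar>H x s om\<bar> powr p \<partial>P) <= ?g (s, x) powr p" if x: "x \<in> Lam NN d" and s: "0 <= s" "s < T" for x s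
 proof -
  have gs: "gcont (Lam NN d) m B (sect m G x s)" by (rule gcont_sect[OF G]) (use s T x in auto)
  have "(\<integral>om. \<bar>It m (sect m G x s) s om\<bar> powr p \<partial>P) <= (cmom p c Cb sg L m * mbound NN d k sg L T m s (sect m G x s)) powr p"
   by (rule It_moment[OF p T sg odd gs]) (use s in auto)
  then show ?thesis using s by (simp add: gcut_def H_def)
 qed
 \<comment> \<open>Stated for variable heights and drifts so that it serves both parts; only the
   absolute value of the integrand enters.\<close>
 have step: "(\<integral>om. \<bar>msum \<xi>' ze' H' T om + dsum rh' H' T om\<bar> powr p \<partial>P) <= Y powr p"
  if "!!x. x \<in> Lam NN d ==> nice (H' x)" "mark \<xi>' b1" "drift ze' b'" "compensates ze' \<xi>'" "drift rh' r1" "b1 <= b" "r1 <= r"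
   "!!x s om. \<bar>H' x s om\<bar> = \<bar>H x s om\<bar>" for \<xi>' ze' rh' H' b1 b' r1
 proof -
  have z: "0 <= b1" "0 <= r1" using that by (simp_all add: mark_def drift_def)
  have "(\<integral>om. \<bar>msum \<xi>' ze' H' T om + dsum rh' H' T om\<bar> powr p \<partial>P) <= (kst p * (r1 * eps NN powr (- real d) * A E1
    + b1 * sqrt (lamb * eps NN powr (- real d)) * A E2 + b1 * A EInf)) powr p"
   unfolding A_def
  proof (rule step_moment[OF p that(1) that(2,3,4,5) T T(1) order.refl])
   show "0 <= ?g (s, x) & ?g (s, x) <= B'" if "x \<in> Lam NN d" "0 <= s" "s <= T" for x s using B' that by blast
   show "(\<integral>om. \<bar>H' x s om\<bar> powr p \<partial>P) <= ?g (s, x) powr p" if "x \<in> Lam NN d" "0 <= s" "s < T" for x s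
    unfolding \<open>!!x s om. \<bar>H' x s om\<bar> = \<bar>H x s om\<bar>\<close> by (rule gE[OF that])
   show "?g (s, x) = 0" if "T <= s" for s x using that by (simp add: gcut_def)
   show "(%s. indicator {0..T} s * ?g (s, x)) \<in> borel_measurable borel" if "x \<in> Lam NN d" for x by (rule gcut_facts(2)[OF T G that])
  qed
  also have "... <= (kst p * (r * eps NN powr (- real d) * A E1 + b * sqrt (lamb * eps NN powr (- real d)) * A E2 + b * A EInf)) powr p"
   using p z A0 that(6,7) lamb0
   by (intro powr_mono2 mult_left_mono add_mono mult_right_mono mult_nonneg_nonneg add_nonneg_nonneg) (auto simp: kst_def)
  also have "... <= Y powr p"
  proof (rule powr_mono2)
   show "0 <= kst p * (r * eps NN powr (- real d) * A E1 + b * sqrt (lamb * eps NN powr (- real d)) * A E2 + b * A EInf)"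
    using A0 br lamb0 by (intro mult_nonneg_nonneg add_nonneg_nonneg) (auto simp: kst_def)
  qed (use p level_bound(2)[where sg=sg and L=L and t=T, OF T G p j odd' A_def] in \<open>auto simp: Y_def b_def r_def\<close>)
  finally show ?thesis .
 qed
 have z0: "drift (%_ _ _. 0) 0" "mark (%_ _ _. 0) 0" "compensates (%_ _ _. 0) (%_ _ _. 0)"
  by (simp_all add: drift_def mark_def compensates_def set_integrable_def)
 have zs: "dsum (%_ _ _. 0) K t om = 0" "msum (%_ _ _. 0) (%_ _ _. 0) K t om = 0" for K t om by (simp_all add: dsum_def msum_def)
 have rc: "drift (%_ _ _. r) r" using drift_scale[OF drift_one br(2)] by simp
 have m1: "(\<integral>om. \<bar>msum \<xi> ze H T om\<bar> powr p \<partial>P) <= Y powr p"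
  using step[OF nH mk' dz' co' z0(1)] br by (simp add: zs)
 define D where "D = dsum (%_ _ _. r) (%x s om. \<bar>H x s om\<bar>) T"
 have m2: "(\<integral>om. \<bar>D om\<bar> powr p \<partial>P) <= Y powr p"
  unfolding D_def using step[OF nice_abs[OF nH] z0(2,1,3) rc] br by (simp add: zs)
 have nD: "nice (dsum (%_ _ _. r) (%x s om. \<bar>H x s om\<bar>))" by (rule nice_dsum[OF nice_abs[OF nH] rc])
 have Dm: "D \<in> borel_measurable P" unfolding D_def by (rule nice_measurable[OF nD T])
 have iD: "integrable P (%om. \<bar>D om\<bar> powr p)" unfolding D_def using p by (intro nice_integrable[OF nice_powr[OF _ nD] T]) simp
 have d_le: "\<bar>dsum rh H t om\<bar> <= D om" if om: "om \<in> space P" and t: "0 <= t" "t <= T" for t om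
 proof -
  have "\<bar>LBINT s:{0..t}. H x s om * rh x s om\<bar> <= (LBINT s:{0..T}. \<bar>H x s om\<bar> * r)" if x: "x \<in> Lam NN d" for x
  proof -
   have i1: "set_integrable lborel {0..t} (%s. H x s om * rh x s om)" by (rule nice_drift_integrable[OF x nH[OF x] dr' om]) (use t T in auto)
   have i2: "set_integrable lborel {0..T} (%s. \<bar>H x s om\<bar> * r)" by (rule nice_drift_integrable[OF x nice_abs[OF nH[OF x]] rc om T(2)])
   have "\<bar>LBINT s:{0..t}. H x s om * rh x s om\<bar> <= (\<integral>s. \<bar>indicator {0..t} s *\<^sub>R (H x s om * rh x s om)\<bar> \<partial>lborel)"
    unfolding set_lebesgue_integral_def by (rule integral_abs_bound)
   also have "... <= (LBINT s:{0..T}. \<bar>H x s om\<bar> * r)"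
    unfolding set_lebesgue_integral_def
   proof (rule integral_mono)
    show "integrable lborel (%s. \<bar>indicator {0..t} s *\<^sub>R (H x s om * rh x s om)\<bar>)" using i1 by (auto simp: set_integrable_def)
    show "integrable lborel (%s. indicator {0..T} s *\<^sub>R (\<bar>H x s om\<bar> * r))" using i2 by (simp add: set_integrable_def)
    fix s :: real
    show "\<bar>indicator {0..t} s *\<^sub>R (H x s om * rh x s om)\<bar> <= indicator {0..T} s *\<^sub>R (\<bar>H x s om\<bar> * r)"
     using drift_bound[OF dr' x om, of s] t T br by (auto simp: indicator_def abs_mult intro!: mult_left_mono)
   qed
   finally show ?thesis .
  qed
  then show ?thesis unfolding dsum_def D_def by (intro order.trans[OF sum_abs] sum_mono)
 qed
 obtain V where V: "V \<in> borel_measurable P"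
  "!!om t. om \<in> space P ==> 0 <= t ==> t <= T ==> ennreal (\<bar>msum \<xi> ze H t om\<bar> powr p) <= V om"
  "(\<integral>\<^sup>+om. V om \<partial>P) <= ennreal (doob_const p * Y powr p)"
 \<comment> \<open>\<open>doob_sup\<close> asks for a positive horizon; at time 0 the martingale
   part is 0.\<close>
 proof (cases "T = 0")
  case True
  have "(SS x om Int {..<0}) = {}" for x om using SS_01[of x om] by auto
  moreover have "(LBINT s:{0::real}. f s) = 0" for f :: "real => real" using LBINT_ico[of 0 0 f] by (simp add: set_lebesgue_integral_def)
  ultimately have "msum \<xi> ze H 0 om = 0" for om by (simp add: msum_def)
  then show ?thesis using that[of "%_. 0"] True by (auto simp: order.antisym)
 next
  case False
  then have T0: "0 < T" using T by simp
  have "doob_const p * (\<integral>om. \<bar>msum \<xi> ze H T om\<bar> powr p \<partial>P) <= doob_const p * Y powr p"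
   by (rule mult_left_mono[OF m1 doob_const_nonneg[OF p]])
  then have le: "ennreal (doob_const p * (\<integral>om. \<bar>msum \<xi> ze H T om\<bar> powr p \<partial>P)) <= ennreal (doob_const p * Y powr p)"
   by (rule ennreal_leI)
  show ?thesis
  proof (rule doob_sup[OF p nH mk' dz' co' T0 T(2)])
   fix V assume V: "V \<in> borel_measurable P"
    "!!om t. om \<in> space P ==> 0 <= t ==> t <= T ==> ennreal (\<bar>msum \<xi> ze H t om\<bar> powr p) <= V om"
    "(\<integral>\<^sup>+om. V om \<partial>P) <= ennreal (doob_const p * (\<integral>om. \<bar>msum \<xi> ze H T om\<bar> powr p \<partial>P))"
   show thesis by (rule that[OF V(1,2) order.trans[OF V(3) le]])
  qed
 qed
 have main: "AE om in P. ennreal (\<bar>Sup {\<bar>Ilab NN d k (%x r. M x r om) (%s x. Cc s x om) (%s x. Ctt s x om) sg L (Suc m) G t\<bar> | t. t \<in> {0..T}}\<bar> powr p)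
   <= ennreal (2 powr p) * (V om + ennreal (\<bar>D om\<bar> powr p))"
  using Om(4)
 proof eventually_elim
  case (elim om)
  note om = Om(3)[OF elim]
  define Z where "Z = Sup {\<bar>Ilab NN d k (%x r. M x r om) (%s x. Cc s x om) (%s x. Ctt s x om) sg L (Suc m) G t\<bar> | t. t \<in> {0..T}}"
  have I: "Ilab NN d k (%x r. M x r om) (%s x. Cc s x om) (%s x. Ctt s x om) sg L (Suc m) G t = msum \<xi> ze H t om + dsum rh H t om"
   if "t \<in> {0..T}" for t
  proof -
   have "Ilab NN d k (%x r. M x r om) (%s x. Cc s x om) (%s x. Ctt s x om) sg L (Suc m) G t = It (Suc m) G t om"
    by (rule Ilab_It[OF elim G _ _ sg]) (use that T in auto)
   then show ?thesis by (simp add: \<xi>_def ze_def rh_def H_def[abs_def])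
  qed
  show ?case
  proof (cases "V om")
   case top
   then show ?thesis by (simp add: ennreal_mult_top)
  next
   case (real v)
   have D0: "0 <= D om" using d_le[OF om order.refl T(1)] by linarith
   define w where "w = v powr (1 / p) + D om"
   have le: "\<bar>Ilab NN d k (%x r. M x r om) (%s x. Cc s x om) (%s x. Ctt s x om) sg L (Suc m) G t\<bar> <= w" if t: "t \<in> {0..T}" for t
   proof -
    have "\<bar>msum \<xi> ze H t om\<bar> powr p <= v" using V(2)[OF om, of t] t real by (simp add: ennreal_le_iff)
    then have "(\<bar>msum \<xi> ze H t om\<bar> powr p) powr (1 / p) <= v powr (1 / p)" using p by (intro powr_mono2) auto
    then have "\<bar>msum \<xi> ze H t om\<bar> <= v powr (1 / p)" using p by (simp add: powr_powr)
    then show ?thesis unfolding I[OF t] w_def using d_le[OF om, of t] t by auto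
   qed
   have Zw: "Z <= w" unfolding Z_def by (rule cSup_least) (use le T in auto)
   \<comment> \<open>The supremum lies above the value at time 0 only because the set is bounded,
     which is known from \<open>w\<close>; this gives \<open>0 <= Z\<close>.\<close>
   have "\<bar>Ilab NN d k (%x r. M x r om) (%s x. Cc s x om) (%s x. Ctt s x om) sg L (Suc m) G 0\<bar> <= Z"
    unfolding Z_def
   proof (rule cSup_upper)
    show "bdd_above {\<bar>Ilab NN d k (%x r. M x r om) (%s x. Cc s x om) (%s x. Ctt s x om) sg L (Suc m) G t\<bar> | t. t \<in> {0..T}}"
     by (rule bdd_aboveI[of _ w]) (use le in blast)
   qed (use T in auto)
   then have "0 <= Z" by linarith
   then have "\<bar>Z\<bar> powr p <= w powr p" using Zw p by (intro powr_mono2) auto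
   also have "... <= 2 powr p * ((v powr (1 / p)) powr p + D om powr p)" unfolding w_def using D0 p by (intro add_powr_le) auto
   also have "(v powr (1 / p)) powr p = v" using p real by (simp add: powr_powr)
   also have "D om powr p = \<bar>D om\<bar> powr p" using D0 by simp
   finally have "ennreal (\<bar>Z\<bar> powr p) <= ennreal (2 powr p * (v + \<bar>D om\<bar> powr p))" by (rule ennreal_leI)
   also have "... = ennreal (2 powr p) * (V om + ennreal (\<bar>D om\<bar> powr p))" using real by (simp add: ennreal_mult)
   finally show ?thesis unfolding Z_def .
  qed
 qed
 have "(\<integral>\<^sup>+om. ennreal (\<bar>Sup {\<bar>Ilab NN d k (%x r. M x r om) (%s x. Cc s x om) (%s x. Ctt s x om) sg L (Suc m) G t\<bar> | t. t \<in> {0..T}}\<bar> powr p) \<partial>P)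
  <= (\<integral>\<^sup>+om. ennreal (2 powr p) * (V om + ennreal (\<bar>D om\<bar> powr p)) \<partial>P)" by (rule nn_integral_mono_AE[OF main])
 also have "... = ennreal (2 powr p) * ((\<integral>\<^sup>+om. V om \<partial>P) + (\<integral>\<^sup>+om. ennreal (\<bar>D om\<bar> powr p) \<partial>P))"
  using V(1) Dm by (simp add: nn_integral_cmult nn_integral_add)
 also have "(\<integral>\<^sup>+om. ennreal (\<bar>D om\<bar> powr p) \<partial>P) = ennreal (\<integral>om. \<bar>D om\<bar> powr p \<partial>P)" by (rule nn_integral_eq_integral[OF iD]) simp
 also have "ennreal (2 powr p) * ((\<integral>\<^sup>+om. V om \<partial>P) + ...) <= ennreal (2 powr p) * (ennreal (doob_const p * Y powr p) + ennreal (Y powr p))"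
  by (intro mult_left_mono add_mono V(3) ennreal_leI m2) simp
 also have "... = ennreal (2 powr p * (doob_const p + 1) * Y powr p)"
  using doob_const_nonneg[OF p] by (simp add: ennreal_plus[symmetric] ennreal_mult[symmetric] algebra_simps del: ennreal_plus)
 finally show ?thesis unfolding Y_def .
qed

end

lemma Ep_le:
 assumes p: "0 < p" and Q: "0 <= Q" and I: "(\<integral>\<^sup>+om. ennreal (\<bar>X om\<bar> powr p) \<partial>P) <= ennreal Q"
 shows "Ep P p X <= ennreal (Q powr (1 / p))"
proof -
 define J where "J = (\<integral>\<^sup>+om. ennreal (\<bar>X om\<bar> powr p) \<partial>P)"
 have J: "J <= ennreal Q" using I by (simp add: J_def)
 then have "J ~= \<infinity>" using ennreal_less_top[of Q] by (auto simp: top_unique)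
 moreover have "enn2real J <= Q" using enn2real_mono[OF J] Q by simp
 then have "enn2real J powr (1 / p) <= Q powr (1 / p)" using p by (intro powr_mono2) auto
 ultimately show ?thesis by (simp add: Ep_def J_def[symmetric] ennreal_leI)
qed

lemma comp_of_partition:
 assumes R: "equiv {1..n} R" and sg: "bij_betw sg {1..m} ({1..n} // R)"
 shows "i \<in> {1..n} ==> comp_of m sg i \<in> {1..m}" "j \<in> {1..m} ==> 1 <= card (sg j)"
proof -
 assume i: "i \<in> {1..n}"
 have "\<exists>!j. j \<in> {1..m} & i \<in> sg j"
 proof (rule ex_ex1I)
  have "R `` {i} \<in> sg ` {1..m}" unfolding bij_betw_imp_surj_on[OF sg] by (rule quotientI[OF i])
  moreover have "i \<in> R `` {i}" by (rule equiv_class_self[OF R i])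
  ultimately show "\<exists>j. j \<in> {1..m} & i \<in> sg j" by blast
  fix j j' assume j: "j \<in> {1..m} & i \<in> sg j" "j' \<in> {1..m} & i \<in> sg j'"
  have q: "sg j \<in> {1..n} // R" "sg j' \<in> {1..n} // R" using bij_betwE[OF sg] j by blast+
  have "sg j = sg j'" using quotient_disj[OF R q] j by blast
  then show "j = j'" using bij_betw_imp_inj_on[OF sg] j by (meson inj_onD)
 qed
 from theI'[OF this] show "comp_of m sg i \<in> {1..m}" by (simp add: comp_of_def)
next
 assume j: "j \<in> {1..m}"
 have q: "sg j \<in> {1..n} // R" using bij_betwE[OF sg] j by blast
 have "sg j ~= {}" by (rule in_quotient_imp_non_empty[OF R q])
 moreover have "finite (sg j)" by (rule finite_subset[OF in_quotient_imp_subset[OF R q]]) simp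
 ultimately show "1 <= card (sg j)" by (simp add: Suc_le_eq card_gt_0_iff)
qed

theorem theorem3p9:
  fixes d :: nat and k c Cb :: real
    and n m :: nat and R :: "(nat \<times> nat) set" and sg :: "nat \<Rightarrow> nat set"
    and L :: "nat \<Rightarrow> label" and p :: real
  assumes "1 \<le> d" and "k > - real d / 2" and "c > 0" and "Cb \<ge> 0"
    and "1 \<le> m" and "m \<le> n"
    and "equiv {1..n} R" and "card ({1..n} // R) = m"
    and "bij_betw sg {1..m} ({1..n} // R)"
    and "\<forall>i\<in>{1..m}. odd (card (sg i)) \<longrightarrow> L i = NilL"
    and "p \<ge> 2"
  shows "\<exists>(\<kappa> :: (nat \<Rightarrow> expo) \<Rightarrow> nat \<Rightarrow> real) (C :: real).
    (\<forall>pp i. \<kappa> pp i > 0) \<and>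
    (\<forall>N (P :: 'a measure) Fl M Cc Ctt (F :: tuple \<Rightarrow> real) T.
       N \<ge> 1 \<longrightarrow> model d k c Cb N P Fl M Cc Ctt \<longrightarrow> C1_time n F \<longrightarrow>
       T \<in> {0..1} \<longrightarrow>
       Ep P p (\<lambda>\<omega>. Sup {\<bar>Ilab N d k (\<lambda>x r. M x r \<omega>) (\<lambda>s x. Cc s x \<omega>) (\<lambda>s x. Ctt s x \<omega>)
                           sg L m (Fgs n m sg F) t\<bar> | t. t \<in> {0..T}})
       \<le> ennreal (C * (\<Sum>pp\<in>Padm m sg L.
            eps N powr alpha d k m sg pp
            * mnorm N d T pp m (Fgs n m sg F) powr beta p m sg pp
            * (\<Prod>i\<in>Iinf m sg pp 2.
                 eps N powr (- \<kappa> pp i) * c1norm N d T m i (Fgs n m sg F) powr betai p m sg pp i)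
              powr (1 / p))))"
proof -
 note cm = comp_of_partition(1)[OF assms(7,9)] and card1 = comp_of_partition(2)[OF assms(7,9)]
 note p = \<open>2 <= p\<close>
 obtain m' where m': "m = Suc m'" using \<open>1 <= m\<close> by (cases m) auto
 \<comment> \<open>\<open>2 powr p\<close> comes from splitting martingale and drift parts, and
   \<open>doob_const p + 1\<close> from their respective bounds. None of this depends on
   \<open>N\<close>, \<open>T\<close> or \<open>F\<close>.\<close>
 define K where "K = 2 powr p * (doob_const p + 1)"
 have K0: "0 <= K" using doob_const_nonneg[OF p] by (simp add: K_def)
 define C where "C = K powr (1 / p) * cmom p c Cb sg L m"
 have c_nonneg: "0 <= cmom p c Cb sg L m" by (rule cmom_nonneg[OF assms(3,4)])
 have C0: "0 <= C" using c_nonneg by (simp add: C_def)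
 have main: "Ep P p (%om. Sup {\<bar>Ilab N d k (%x r. M x r om) (%s x. Cc s x om) (%s x. Ctt s x om)
              sg L m (Fgs n m sg F) t\<bar> | t. t \<in> {0..T}})
    <= ennreal (C * (\<Sum>pp\<in>Padm m sg L.
      eps N powr alpha d k m sg pp
      * mnorm N d T pp m (Fgs n m sg F) powr beta p m sg pp
      * (\<Prod>i\<in>Iinf m sg pp 2.
         eps N powr (- 1) * c1norm N d T m i (Fgs n m sg F) powr betai p m sg pp i)
       powr (1 / p)))" (is "Ep P p ?X <= ennreal (C * (\<Sum>pp\<in>_. ?rhs pp))")
  if N: "1 <= N" and mdl: "model d k c Cb N P Fl M Cc Ctt" and F: "C1_time n F" and T: "0 <= T" "T <= 1"
  for N and P :: "'a measure" and Fl M Cc Ctt F T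
 proof -
  interpret spde_model d k c Cb N P Fl M Cc Ctt
   by (rule spde_model.intro) (use N mdl assms in auto)
  define G where "G = Fgs n m sg F"
  obtain B where G: "gcont (Lam N d) m B G" using Fgs_gcont[OF F finite_Lam cm] by (auto simp: G_def)
  define Y where "Y = mbound N d k sg L T m T G"
  have Y0: "0 <= Y" unfolding Y_def by (rule mbound_nonneg[OF N T G])
  have "(\<integral>\<^sup>+om. ennreal (\<bar>?X om\<bar> powr p) \<partial>P) <= ennreal (K * (cmom p c Cb sg L m * Y) powr p)"
   unfolding K_def Y_def G_def[symmetric] unfolding m'
  proof (rule Ilab_sup_moment[OF p T _ _ G[unfolded m']])
   show "1 <= card (sg i)" if "i \<in> {1..Suc m'}" for i using card1[of i] that m' by simp
   show "L i = NilL" if "i \<in> {1..Suc m'}" "odd (card (sg i))" for i using assms(10) that m' by blast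
  qed
  then have "Ep P p ?X <= ennreal ((K * (cmom p c Cb sg L m * Y) powr p) powr (1 / p))"
   by (intro Ep_le) (use p K0 in auto)
  also have "(K * (cmom p c Cb sg L m * Y) powr p) powr (1 / p) = C * Y"
   using p K0 c_nonneg Y0 by (simp add: powr_mult powr_powr C_def)
  also have "ennreal (C * Y) <= ennreal (C * (\<Sum>pp\<in>Padm m sg L. ?rhs pp))"
  proof (intro ennreal_leI mult_left_mono C0)
   show "Y <= (\<Sum>pp\<in>Padm m sg L. ?rhs pp)"
    unfolding Y_def mbound_def
   proof (rule sum_mono)
    fix pp
    \<comment> \<open>The moment bound contains the norm cut at \<open>T\<close>, the statement the
      uncut one.\<close>
    have "mn N d T pp m T G <= mnorm N d T pp m G" using mn_le_mnorm[OF N T, of d m' B G pp] G by (simp add: m')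
    also have "... <= mnorm N d T pp m G powr beta p m sg pp
      * (\<Prod>i\<in>Iinf m sg pp 2. eps N powr (- 1) * c1norm N d T m i G powr betai p m sg pp i) powr (1 / p)"
     unfolding G_def
    proof (rule le_mixed_norms[OF p c1norm_ge_mnorm(1)[OF F cm N T \<open>1 <= m\<close>] e0])
     show "eps N <= 1" using N by (simp add: eps_def)
     show "mnorm N d T pp m (Fgs n m sg F) <= c1norm N d T m i (Fgs n m sg F)" if "i \<in> Iinf m sg pp 2" for i
      by (rule c1norm_ge_mnorm(2)[OF F cm N T \<open>1 <= m\<close>]) (use that in \<open>auto simp: Iinf_def\<close>)
    qed
    finally show "eps N powr alpha d k m sg pp * mn N d T pp m T G <= ?rhs pp"
     unfolding G_def mult.assoc by (rule mult_left_mono) simp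
   qed
  qed
  finally show ?thesis .
 qed
 show ?thesis
 proof (rule exI[of _ "%_ _. 1"], rule exI[of _ C], intro conjI allI impI)
  show "(0::real) < 1" by simp
 qed (rule main, assumption+, simp_all)
qed

end
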